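(* Suppose $\mathcal{M}$ is a diffuse von Neumann algebra with a tracial state $\tau$. Suppose $\mathcal{N}$ is a diffuse von Neumann subalgebra of $\mathcal{M}$ and $u$ is a unitary element in $\mathcal{M}$ such that $\mathfrak{K}_2(\mathcal{N})=0$ and $\{\mathcal{N},u\}$ generates $\mathcal{M}$ as a von Neumann algebra. If there exist Haar unitary elements $v_1,v_2,\ldots$ and $w_1,w_2,\ldots$ in $\mathcal{N}$ such that $\|v_nu-uw_n\|_2\to0$, then $\mathfrak{K}_2(\mathcal{M})=0$. In particular, if there are Haar unitary elements $v,w$ in $\mathcal{N}$ such that $vu=uw$, then $\mathfrak{K}_2(\mathcal{M})=0$.
   Context: Tracial states are faithful and normal; a subalgebra carries the restricted trace. On $\mathcal{M}$, $\|x\|_2=\tau(x^*x)^{1/2}$. A unitary $u\in\mathcal{M}$ is a Haar unitary if $\tau(u^m)=0$ for all integers $m\ne0$. Let $\mathcal{M}_k(\mathbb{C})$ be the $k\times k$ complex matrices, $\tau_k=\frac1k Tr$, $\mathcal{U}(k)$ the unitary group, and $\|(A_1,\ldots,A_n)\|_2^2=\sum_j\tau_k(A_j^*A_j)$ on $\mathcal{M}_k(\mathbb{C})^n$; $\|\cdot\|$ is the operator norm. For $R,\epsilon>0$ and $m,k\in\mathbb{N}$, $\Gamma_R(x_1,\ldots,x_n;m,k,\epsilon)$ is the set of $(A_1,\ldots,A_n)\in\mathcal{M}_k(\mathbb{C})^n$ with $\|A_j\|\le R$ for all $j$ and $|\tau_k(A_{i_1}^{\eta_1}\cdots A_{i_q}^{\eta_q})-\tau(x_{i_1}^{\eta_1}\cdots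 x_{i_q}^{\eta_q})|<\epsilon$ for all $1\le q\le m$, $1\le i_1,\ldots,i_q\le n$, $\eta_1,\ldots,\eta_q\in\{1,*\}$. For $\omega>0$, the $\omega$-orbit-ball $\mathcal{U}(B_1,\ldots,B_n;\omega)$ is the set of $(A_1,\ldots,A_n)\in\mathcal{M}_k(\mathbb{C})^n$ for which there is $W\in\mathcal{U}(k)$ with $\|(A_1,\ldots,A_n)-(WB_1W^*,\ldots,WB_nW^* )\|_2<\omega$. The $\omega$-orbit covering number $\nu(\Gamma_R(x_1,\ldots,x_n;m,k,\epsilon),\omega)$ is the minimal number of $\omega$-orbit-balls with centers in $\Gamma_R(x_1,\ldots,x_n;m,k,\epsilon)$ that cover this set (by convention $\nu(\emptyset,\omega)=1$, so that the quantities below are $\ge0$ for $0<\omega<1$). Define $$\mathfrak{K}(x_1,\ldots,x_n;\omega,R)=\inf_{m\in\mathbb{N},\epsilon>0}\limsup_{k\to\infty}\frac{\log\nu(\Gamma_R(x_1,\ldots,x_n;m,k,\epsilon),\omega)}{-k^2\log\omega},$$ $\mathfrak{K}(x_1,\ldots,x_n;\omega)=\sup_{R>0}\mathfrak{K}(x_1,\ldots,x_n;\omega,R)$, and $\mathfrak{K}_2(x_1,\ldots,x_n)=\sup_{0<\omega<1}\mathfrak{K}(x_1,\ldots,x_n;\omega)$. For a finitely generated von Neumann algebra $\mathcal{M}$ with tracial state $\tau$, the upper free orbit-dimension $\mathfrak{K}_2(\mathcal{M})$ is the supremum of $\mathfrak{K}_2(x_1,\ldots,x_n)$ over all finite families $x_1,\ldots,x_n$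 that generate $\mathcal{M}$ as a von Neumann algebra. Since $\mathfrak{K}_2$ is defined only for finitely generated algebras, any algebra to which it is applied is understood to be finitely generated. *)

theory Defs
  imports "HOL-Analysis.Analysis" "Jordan_Normal_Form.Schur_Decomposition"
begin

section \<open>Complex Hilbert spaces and bounded operators\<close>

class scaleC =
  fixes scaleC :: "complex \<Rightarrow> 'a \<Rightarrow> 'a"  (infixr "*\<^sub>C" 75)

text \<open>
  Norm, topology and completeness are those of the underlying real Hilbert space, whose inner
  product is the real part of the complex one.  The complex inner product is linear in its first
  argument.
\<close>

class complex_hilbert = real_inner + complete_space + scaleC +
  fixes cinner :: "'a \<Rightarrow> 'a \<Rightarrow> complex"
  assumes scaleC_add_right: "c *\<^sub>C (x + y) = c *\<^sub>C x + c *\<^sub>C y"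
    and scaleC_add_left: "(c + d) *\<^sub>C x = c *\<^sub>C x + d *\<^sub>C x"
    and scaleC_scaleC: "c *\<^sub>C (d *\<^sub>C x) = (c * d) *\<^sub>C x"
    and scaleC_of_real: "complex_of_real r *\<^sub>C x = r *\<^sub>R x"
    and cinner_commute: "cinner x y = cnj (cinner y x)"
    and cinner_add_left: "cinner (x + y) z = cinner x z + cinner y z"
    and cinner_scaleC_left: "cinner (c *\<^sub>C x) y = c * cinner x y"
    and Re_cinner: "Re (cinner x y) = inner x y"

lemma cinner_scaleC_right:
  fixes x y :: "'a::complex_hilbert"
  shows "cinner x (c *\<^sub>C y) = cnj c * cinner x y"
  by (metis cinner_commute cinner_scaleC_left complex_cnj_mult)

lemma cinner_self:
  fixes x :: "'a::complex_hilbert"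
  shows "cinner x x = complex_of_real ((norm x)\<^sup>2)"
proof -
  have "Im (cinner x x) = 0"
    by (metis add.inverse_inverse cinner_commute cnj.sel(2) neg_equal_zero)
  moreover have "Re (cinner x x) = (norm x)\<^sup>2"
    by (simp add: Re_cinner power2_norm_eq_inner)
  ultimately show ?thesis
    by (simp add: complex_eq_iff)
qed

lemma norm_scaleC:
  fixes x :: "'a::complex_hilbert"
  shows "norm (c *\<^sub>C x) = cmod c * norm x"
proof -
  have "complex_of_real ((norm (c *\<^sub>C x))\<^sup>2) = (c * cnj c) * complex_of_real ((norm x)\<^sup>2)"
    by (simp only: cinner_self[symmetric] cinner_scaleC_left cinner_scaleC_right mult.assoc
        mult.left_commute)
  also have "\<dots> = complex_of_real ((cmod c * norm x)\<^sup>2)"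
    by (simp add: complex_norm_square[symmetric] power_mult_distrib)
  finally have "(norm (c *\<^sub>C x))\<^sup>2 = (cmod c * norm x)\<^sup>2"
    using of_real_eq_iff by blast
  then show ?thesis
    by (simp add: power2_eq_iff_nonneg)
qed

definition bounded_clinear :: "('a::complex_hilbert \<Rightarrow> 'a) \<Rightarrow> bool"
  where "bounded_clinear T \<longleftrightarrow> bounded_linear T \<and> (\<forall>c x. T (c *\<^sub>C x) = c *\<^sub>C T x)"

lemma scaleC_minus_right:
  fixes x :: "'a::complex_hilbert"
  shows "c *\<^sub>C (- x) = - (c *\<^sub>C x)"
  by (metis scaleC_add_right add_cancel_right_right eq_neg_iff_add_eq_0 add.right_inverse)

lemma scaleC_diff_right:
  fixes x y :: "'a::complex_hilbert"
  shows "c *\<^sub>C (x - y) = c *\<^sub>C x - c *\<^sub>C y"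
  by (simp only: diff_conv_add_uminus scaleC_add_right scaleC_minus_right)

lemma bounded_linear_scaleC: "bounded_linear (\<lambda>x::'a::complex_hilbert. c *\<^sub>C x)"
proof (rule bounded_linear_intro[where K = "cmod c"])
  fix x y :: 'a and r :: real
  show "c *\<^sub>C (x + y) = c *\<^sub>C x + c *\<^sub>C y"
    by (rule scaleC_add_right)
  show "c *\<^sub>C (r *\<^sub>R x) = r *\<^sub>R (c *\<^sub>C x)"
    by (simp only: scaleC_of_real[symmetric] scaleC_scaleC mult.commute)
  show "norm (c *\<^sub>C x) \<le> norm x * cmod c"
    by (simp add: norm_scaleC mult.commute)
qed

typedef (overloaded) 'a bop = "{T :: 'a::complex_hilbert \<Rightarrow> 'a. bounded_clinear T}"
  morphisms app Abs_bop
proof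
  have "(0::'a) = c *\<^sub>C 0" for c :: complex
    by (metis add_cancel_right_right scaleC_add_right)
  then show "(\<lambda>_. 0) \<in> {T :: 'a \<Rightarrow> 'a. bounded_clinear T}"
    by (simp add: bounded_clinear_def)
qed

setup_lifting type_definition_bop

instantiation bop :: (complex_hilbert) "{ring, monoid_mult, scaleC}"
begin

lift_definition zero_bop :: "'a bop" is "\<lambda>_. 0"
  by (metis (full_types) add_cancel_right_right bounded_clinear_def bounded_linear_zero
      scaleC_add_right)

lift_definition one_bop :: "'a bop" is "\<lambda>x. x"
  by (simp add: bounded_clinear_def)

lift_definition plus_bop :: "'a bop \<Rightarrow> 'a bop \<Rightarrow> 'a bop" is "\<lambda>S T x. S x + T x"
  by (simp add: bounded_clinear_def bounded_linear_add scaleC_add_right)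

lift_definition uminus_bop :: "'a bop \<Rightarrow> 'a bop" is "\<lambda>T x. - T x"
  by (simp add: bounded_clinear_def bounded_linear_minus scaleC_minus_right)

lift_definition minus_bop :: "'a bop \<Rightarrow> 'a bop \<Rightarrow> 'a bop" is "\<lambda>S T x. S x - T x"
  by (simp add: bounded_clinear_def bounded_linear_sub scaleC_diff_right)

lift_definition times_bop :: "'a bop \<Rightarrow> 'a bop \<Rightarrow> 'a bop" is "\<lambda>S T x. S (T x)"
  by (simp add: bounded_clinear_def bounded_linear_compose)

lift_definition scaleC_bop :: "complex \<Rightarrow> 'a bop \<Rightarrow> 'a bop" is "\<lambda>c T x. c *\<^sub>C T x"
  by (simp add: bounded_clinear_def scaleC_scaleC mult.commute
      bounded_linear_compose[OF bounded_linear_scaleC])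

instance
  by standard
    (transfer; simp add: fun_eq_iff bounded_clinear_def linear_simps add.assoc add.commute; fail)+

end

text \<open>The adjoint exists uniquely by the Riesz representation theorem.\<close>

definition adj :: "'a::complex_hilbert bop \<Rightarrow> 'a bop"
  where "adj T = (THE S. \<forall>x y. cinner (app T x) y = cinner x (app S y))"

definition unitary :: "'a::complex_hilbert bop \<Rightarrow> bool"
  where "unitary u \<longleftrightarrow> adj u * u = 1 \<and> u * adj u = 1"

definition projection :: "'a::complex_hilbert bop \<Rightarrow> bool"
  where "projection p \<longleftrightarrow> p * p = p \<and> adj p = p"


section \<open>Tracial von Neumann algebras\<close>

definition weak_operator_topology :: "'a::complex_hilbert bop topology"
  where "weak_operator_topology =
    topology_generated_by {{T. cinner (app T x) y \<in> U} | x y U. open U}"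

definition ultraweak_topology :: "'a::complex_hilbert bop topology"
  where "ultraweak_topology =
    topology_generated_by {{T. (\<Sum>i. cinner (app T (x i)) (y i)) \<in> U} | x y U.
      summable (\<lambda>i::nat. (norm (x i))\<^sup>2) \<and> summable (\<lambda>i. (norm (y i))\<^sup>2) \<and> open U}"

definition von_neumann_algebra :: "'a::complex_hilbert bop set \<Rightarrow> bool"
  where "von_neumann_algebra M \<longleftrightarrow>
    1 \<in> M \<and>
    (\<forall>a\<in>M. \<forall>b\<in>M. a + b \<in> M \<and> a * b \<in> M) \<and>
    (\<forall>c. \<forall>a\<in>M. c *\<^sub>C a \<in> M) \<and>
    (\<forall>a\<in>M. adj a \<in> M) \<and>
    closedin weak_operator_topology M"

definition vN_generated :: "'a::complex_hilbert bop set \<Rightarrow> 'a bop set"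
  where "vN_generated S = \<Inter>{A. von_neumann_algebra A \<and> S \<subseteq> A}"

definition finitely_generated :: "'a::complex_hilbert bop set \<Rightarrow> bool"
  where "finitely_generated M \<longleftrightarrow> (\<exists>xs. vN_generated (set xs) = M)"

definition minimal_projection :: "'a::complex_hilbert bop set \<Rightarrow> 'a bop \<Rightarrow> bool"
  where "minimal_projection M p \<longleftrightarrow>
    p \<in> M \<and> projection p \<and> p \<noteq> 0 \<and>
    (\<forall>q\<in>M. projection q \<and> p * q = q \<longrightarrow> q = 0 \<or> q = p)"

definition diffuse :: "'a::complex_hilbert bop set \<Rightarrow> bool"
  where "diffuse M \<longleftrightarrow> (\<nexists>p. minimal_projection M p)"

text \<open>A faithful normal tracial state; only the values of \<open>\<tau>\<close> on \<open>M\<close> matter.\<close>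

definition tracial_state :: "'a::complex_hilbert bop set \<Rightarrow> ('a bop \<Rightarrow> complex) \<Rightarrow> bool"
  where "tracial_state M \<tau> \<longleftrightarrow>
    (\<forall>a\<in>M. \<forall>b\<in>M. \<tau> (a + b) = \<tau> a + \<tau> b) \<and>
    (\<forall>c. \<forall>a\<in>M. \<tau> (c *\<^sub>C a) = c * \<tau> a) \<and>
    \<tau> 1 = 1 \<and>
    (\<forall>a\<in>M. \<tau> (adj a * a) \<in> \<real> \<and> 0 \<le> Re (\<tau> (adj a * a))) \<and>
    (\<forall>a\<in>M. \<forall>b\<in>M. \<tau> (a * b) = \<tau> (b * a)) \<and>
    (\<forall>a\<in>M. \<tau> (adj a * a) = 0 \<longrightarrow> a = 0) \<and>
    continuous_map (subtopology ultraweak_topology M) euclidean \<tau>"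

definition norm2 :: "('a::complex_hilbert bop \<Rightarrow> complex) \<Rightarrow> 'a bop \<Rightarrow> real"
  where "norm2 \<tau> x = sqrt (Re (\<tau> (adj x * x)))"

definition unitary_power :: "'a::complex_hilbert bop \<Rightarrow> int \<Rightarrow> 'a bop"
  where "unitary_power u m = (if 0 \<le> m then u ^ nat m else adj u ^ nat (- m))"

definition haar_unitary :: "('a::complex_hilbert bop \<Rightarrow> complex) \<Rightarrow> 'a bop \<Rightarrow> bool"
  where "haar_unitary \<tau> u \<longleftrightarrow> unitary u \<and> (\<forall>m::int. m \<noteq> 0 \<longrightarrow> \<tau> (unitary_power u m) = 0)"


section \<open>Matricial microstates\<close>

text \<open>
  Tuples are lists, indexed from 0.  A pair \<open>(i, s)\<close> in a word stands for the \<open>i\<close>-th entry of the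
  tuple, or for its adjoint if \<open>s\<close> holds.
\<close>

definition tau_mat :: "complex mat \<Rightarrow> complex"
  where "tau_mat A = (\<Sum>i<dim_row A. A $$ (i, i)) / of_nat (dim_row A)"

definition norm_cvec :: "complex vec \<Rightarrow> real"
  where "norm_cvec v = sqrt (\<Sum>i<dim_vec v. (cmod (v $ i))\<^sup>2)"

definition opnorm_mat :: "complex mat \<Rightarrow> real"
  where "opnorm_mat A =
    (SUP v\<in>{v \<in> carrier_vec (dim_col A). norm_cvec v \<le> 1}. norm_cvec (A *\<^sub>v v))"

definition unitary_mats :: "nat \<Rightarrow> complex mat set"
  where "unitary_mats k =
    {W \<in> carrier_mat k k. mat_adjoint W * W = 1\<^sub>m k \<and> W * mat_adjoint W = 1\<^sub>m k}"

definition mat_tuples :: "nat \<Rightarrow> nat \<Rightarrow> complex mat list set"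
  where "mat_tuples k n = {As. length As = n \<and> set As \<subseteq> carrier_mat k k}"

definition dist2_mats :: "complex mat list \<Rightarrow> complex mat list \<Rightarrow> real"
  where "dist2_mats As Bs =
    sqrt (\<Sum>j<length As. Re (tau_mat (mat_adjoint (As ! j - Bs ! j) * (As ! j - Bs ! j))))"

definition word_op :: "'a::complex_hilbert bop list \<Rightarrow> (nat \<times> bool) list \<Rightarrow> 'a bop"
  where "word_op xs w = prod_list (map (\<lambda>(i, s). if s then adj (xs ! i) else xs ! i) w)"

definition word_mat :: "nat \<Rightarrow> complex mat list \<Rightarrow> (nat \<times> bool) list \<Rightarrow> complex mat"
  where "word_mat k As w =
    foldr (\<lambda>(i, s) B. (if s then mat_adjoint (As ! i) else As ! i) * B) w (1\<^sub>m k)"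

definition microstates ::
  "('a::complex_hilbert bop \<Rightarrow> complex) \<Rightarrow> real \<Rightarrow> 'a bop list \<Rightarrow> nat \<Rightarrow> nat \<Rightarrow> real
    \<Rightarrow> complex mat list set"
  where "microstates \<tau> R xs m k \<epsilon> =
    {As \<in> mat_tuples k (length xs).
      (\<forall>A\<in>set As. opnorm_mat A \<le> R) \<and>
      (\<forall>w. 1 \<le> length w \<and> length w \<le> m \<and> (\<forall>(i, s)\<in>set w. i < length xs) \<longrightarrow>
        cmod (tau_mat (word_mat k As w) - \<tau> (word_op xs w)) < \<epsilon>)}"

definition orbit_ball :: "nat \<Rightarrow> complex mat list \<Rightarrow> real \<Rightarrow> complex mat list set"
  where "orbit_ball k Bs \<omega> =
    {As \<in> mat_tuples k (length Bs).
      \<exists>W\<in>unitary_mats k. dist2_mats As (map (\<lambda>B. W * B * mat_adjoint W) Bs) < \<omega>}"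

text \<open>
  Bounded sets of matrix tuples are totally bounded, so for \<open>\<omega> > 0\<close> the minimum below is taken over
  a nonempty set of natural numbers.
\<close>

definition orbit_covering_number :: "nat \<Rightarrow> complex mat list set \<Rightarrow> real \<Rightarrow> nat"
  where "orbit_covering_number k G \<omega> =
    (if G = {} then 1
     else LEAST N. \<exists>C. C \<subseteq> G \<and> finite C \<and> card C = N \<and> G \<subseteq> (\<Union>B\<in>C. orbit_ball k B \<omega>))"


section \<open>Upper free orbit-dimension\<close>

definition orbit_dim_at ::
  "('a::complex_hilbert bop \<Rightarrow> complex) \<Rightarrow> 'a bop list \<Rightarrow> real \<Rightarrow> real \<Rightarrow> ereal"
  where "orbit_dim_at \<tau> xs \<omega> R =
    (INF (m, \<epsilon>) \<in> UNIV \<times> {0<..}. limsup (\<lambda>k. ereal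
      (ln (real (orbit_covering_number k (microstates \<tau> R xs m k \<epsilon>) \<omega>))
        / (- ((real k)\<^sup>2 * ln \<omega>)))))"

definition upper_orbit_dim_tuple ::
  "('a::complex_hilbert bop \<Rightarrow> complex) \<Rightarrow> 'a bop list \<Rightarrow> ereal"
  where "upper_orbit_dim_tuple \<tau> xs =
    (SUP \<omega>\<in>{0<..<1}. SUP R\<in>{0<..}. orbit_dim_at \<tau> xs \<omega> R)"

definition upper_orbit_dim ::
  "'a::complex_hilbert bop set \<Rightarrow> ('a bop \<Rightarrow> complex) \<Rightarrow> ereal"
  where "upper_orbit_dim M \<tau> =
    (SUP xs\<in>{xs. xs \<noteq> [] \<and> vN_generated (set xs) = M}. upper_orbit_dim_tuple \<tau> xs)"

end

theory Submission
  imports Defs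
begin

text \<open>
  \<open>upper_orbit_dim N \<tau> = 0\<close> means that the covering numbers of the microstates of \<open>N\<close> grow like
  \<open>exp (o(k\<^sup>2))\<close>.  Let \<open>xs\<close> generate \<open>N\<close> and \<open>ys\<close> generate \<open>M\<close>.  Every microstate \<open>B\<close> of \<open>ys\<close>
  extends, with norm bounds, to a joint microstate of \<open>xs\<close>, \<open>u\<close> and \<open>ys\<close>, whose \<open>xs\<close>-part lies in one
  of \<open>exp (o(k\<^sup>2))\<close> orbit balls.  Once this ball is fixed, the matrix \<open>U\<close> for \<open>u\<close> is nearly a fixed
  point of \<open>E(x) = (1/K) (a\<^sub>0 x b\<^sub>0 + \<dots> + a\<^bsub>K-1\<^esub> x b\<^bsub>K-1\<^esub>)\<close>, where \<open>a\<^sub>t\<close> and \<open>b\<^sub>t\<close> are matrices for \<open>v\<^sup>t\<close>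
  and the adjoint of \<open>w\<^sup>t\<close>: indeed \<open>v u \<approx> u w\<close>.  The powers of a Haar unitary are orthonormal,
  so the squared Hilbert-Schmidt norm of \<open>E\<close> is about \<open>k\<^sup>2 / K\<close>; hence \<open>E\<close> maps the unit ball close
  to a subspace of dimension \<open>O(k\<^sup>2 / K)\<close>, and \<open>exp (O(k\<^sup>2 / K))\<close> small cells suffice for \<open>U\<close>.  As
  \<open>ys\<close> is approximated by polynomials in \<open>xs\<close> and \<open>u\<close>, this bounds the covering number for \<open>ys\<close>,
  and \<open>K\<close> is arbitrary.
\<close>

subsection \<open>Orthogonal approximation in Hilbert spaces\<close>

text \<open>Two obstacles shape the proof. Microstates of \<open>ys\<close> have an arbitrary radius
  \<open>R\<close>, and polynomials that approximate an element of \<open>M\<close> weakly have no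
  norm bound on matrices. Approximants of the auxiliary elements therefore pass through a cutoff, a
  polynomial form of (1 + t adj t)^-1 t, which has norm at most 1 on operators and on matrices of
  every size. Its inversion asks for small elements, whence the scaling to norm 1/8; the hypothesis
  on \<open>N\<close> is then used at radius 1. The second obstacle is the count of cells. The
  subspace has dimension of order k^2/K, and the mesh must shrink with the dimension; counting each
  coordinate separately would give k^2 log k in the exponent. Counting integer points by the sum of
  their absolute values avoids the logarithm. \<open>K\<close> is fixed before the Haar unitaries
  are picked. Hence approximate intertwining suffices, although the estimate for the error of the
  average grows like 8^K. The matrices are never corrected to unitaries: only operator bounds,
  traces of products and Hilbert-Schmidt distances enter.\<close>

lemma quadratic_nonneg_imp_linear_zero:
  fixes s q :: real
  assumes "\<And>r. 0 \<le> r * s + r\<^sup>2 * q"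
  shows "s = 0"
proof (rule ccontr)
  assume "s \<noteq> 0"
  have q0: "0 \<le> q" using assms[of 1] assms[of "-1"] by simp
  \<comment> \<open>The minimiser - s / (2 q) would need a separate case for \<open>q = 0\<close>;
    this point works for every \<open>q \<ge> 0\<close>.\<close>
  define r where "r = - s / (q + 1)"
  have "r * s + r\<^sup>2 * q = - (s\<^sup>2) * (1 / (q + 1) - q / (q + 1)\<^sup>2)"
    by (simp add: r_def power2_eq_square algebra_simps)
  also have "1 / (q + 1) - q / (q + 1)\<^sup>2 = 1 / (q + 1)\<^sup>2"
  proof -
    have "1 / (q + 1) = (q + 1) / (q + 1)\<^sup>2" using q0 by (simp add: power2_eq_square)
    then show ?thesis by (simp add: diff_divide_distrib[symmetric])
  qed
  finally have "r * s + r\<^sup>2 * q < 0" using \<open>s \<noteq> 0\<close> q0 by (simp add: mult_pos_pos)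
  then show False using assms[of r] by simp
qed

text \<open>The projection theorem in a finite direct sum of copies of the space, with tuples as
  plain functions. The parallelogram law makes a minimising sequence Cauchy in each component. As
  \<open>S\<close> need not be closed, the component of \<open>c\<close> along \<open>S\<close>
  occurs only through approximants.\<close>

lemma closest_tuple_orthogonal:
  fixes S :: "('i \<Rightarrow> 'b::{real_inner,complete_space}) set" and c :: "'i \<Rightarrow> 'b"
  assumes fin: "finite I" and ne: "S \<noteq> {}"
    and sub: "\<And>f g r. f \<in> S \<Longrightarrow> g \<in> S \<Longrightarrow> (\<lambda>i. f i + r *\<^sub>R g i) \<in> S"
  shows "\<exists>g. (\<forall>f\<in>S. (\<Sum>i\<in>I. inner (g i) (f i)) = 0) \<and>
    (\<forall>\<epsilon>>0. \<exists>f\<in>S. (\<Sum>i\<in>I. (norm (c i - f i - g i))\<^sup>2) < \<epsilon>)"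
proof -
  define J where "J f = (\<Sum>i\<in>I. (norm (c i - f i))\<^sup>2)" for f
  have J0: "0 \<le> J f" for f unfolding J_def by (simp add: sum_nonneg)
  define d where "d = Inf (J ` S)"
  have bdd: "bdd_below (J ` S)" using J0 by (meson bdd_belowI2)
  have dle: "d \<le> J f" if "f \<in> S" for f unfolding d_def using bdd that by (simp add: cInf_lower)
  have "\<exists>f\<in>S. J f < d + 1 / Suc n" for n
  proof -
    have "Inf (J ` S) < d + 1 / Suc n" unfolding d_def by simp
    then show ?thesis using cInf_less_iff[of "J ` S"] bdd ne by auto
  qed
  then obtain F where FS: "\<And>n. F n \<in> S" and FJ: "\<And>n. J (F n) < d + 1 / Suc n" by metis
  have para: "(\<Sum>i\<in>I. (norm (F n i - F m i))\<^sup>2) \<le> 2 / Suc n + 2 / Suc m" for n m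
  proof -
    \<comment> \<open>The midpoint of \<open>F n\<close> and \<open>F m\<close>, written so that
      \<open>sub\<close> applies twice.\<close>
    define h where "h i = F n i + (1/2) *\<^sub>R ((F m i + (-1) *\<^sub>R F n i))" for i
    have "(\<lambda>i. F m i + (-1) *\<^sub>R F n i) \<in> S" by (rule sub) (simp_all add: FS)
    then have hS: "h \<in> S" unfolding h_def by (intro sub FS)
    have "(norm (F n i - F m i))\<^sup>2 = 2 * (norm (c i - F n i))\<^sup>2
      + 2 * (norm (c i - F m i))\<^sup>2 - 4 * (norm (c i - h i))\<^sup>2" for i
      unfolding h_def power2_norm_eq_inner by (simp add: inner_simps inner_commute algebra_simps)
    then have "(\<Sum>i\<in>I. (norm (F n i - F m i))\<^sup>2) = 2 * J (F n) + 2 * J (F m) - 4 * J h"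
      unfolding J_def by (simp add: sum.distrib sum_subtractf sum_distrib_left)
    then show ?thesis using FJ[of n] FJ[of m] dle[OF hS] by (simp)
  qed
  have "Cauchy (\<lambda>n. F n i)" if "i \<in> I" for i
  proof (rule metric_CauchyI)
    fix e :: real assume "0 < e"
    then obtain M :: nat where M: "4 / e\<^sup>2 < M" using reals_Archimedean2 by blast
    show "\<exists>M. \<forall>m\<ge>M. \<forall>n\<ge>M. dist (F m i) (F n i) < e"
    proof (intro exI allI impI)
      fix m n assume mn: "M \<le> m" "M \<le> n"
      have Mpos: "0 < real M" using M \<open>0 < e\<close> by (smt (verit) divide_pos_pos zero_less_power)
      have "(norm (F m i - F n i))\<^sup>2 \<le> (\<Sum>i\<in>I. (norm (F m i - F n i))\<^sup>2)"
        using that fin by (intro member_le_sum) auto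
      also have "\<dots> \<le> 2 / Suc m + 2 / Suc n" by (rule para)
      also have "\<dots> \<le> 2 / M + 2 / M" using mn Mpos by (intro add_mono divide_left_mono) auto
      also have "\<dots> < e\<^sup>2" using M \<open>0 < e\<close> Mpos by (simp add: field_simps)
      finally show "dist (F m i) (F n i) < e" using \<open>0 < e\<close>
        by (simp add: dist_norm power_less_imp_less_base)
    qed
  qed
  then have "\<exists>z. i \<in> I \<longrightarrow> (\<lambda>n. F n i) \<longlonglongrightarrow> z" for i
    by (metis Cauchy_convergent_iff convergent_def)
  then obtain z where z: "\<And>i. i \<in> I \<Longrightarrow> (\<lambda>n. F n i) \<longlonglongrightarrow> z i" by metis
  define g where "g i = c i - z i" for i
  have inv: "(\<lambda>n. 1 / real (Suc n)) \<longlonglongrightarrow> 0" using LIMSEQ_inverse_real_of_nat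
    by (simp add: inverse_eq_divide)
  have JF: "(\<lambda>n. J (F n)) \<longlonglongrightarrow> d"
  proof (rule tendsto_sandwich[OF _ _ tendsto_const])
    show "\<forall>\<^sub>F n in sequentially. d \<le> J (F n)" using dle FS by auto
    show "\<forall>\<^sub>F n in sequentially. J (F n) \<le> d + 1 / Suc n" using FJ
      by (intro always_eventually allI less_imp_le)
    show "(\<lambda>n. d + 1 / real (Suc n)) \<longlonglongrightarrow> d" using tendsto_add[OF tendsto_const inv, of d] by simp
  qed
  moreover have JF2: "(\<lambda>n. J (F n)) \<longlonglongrightarrow> (\<Sum>i\<in>I. (norm (g i))\<^sup>2)"
    unfolding J_def g_def by (intro tendsto_intros z)
  ultimately have dg: "d = (\<Sum>i\<in>I. (norm (g i))\<^sup>2)" using LIMSEQ_unique by blast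
  show ?thesis
  proof (intro exI[of _ g] conjI ballI allI impI)
    fix f assume f: "f \<in> S"
    \<comment> \<open>First variation: minimality along the line through \<open>z\<close> in
      direction \<open>f\<close>, obtained as a limit since \<open>z\<close> itself may lie outside
      \<open>S\<close>.\<close>
    have "0 \<le> r * (2 * (\<Sum>i\<in>I. inner (g i) (f i))) + r\<^sup>2 * (\<Sum>i\<in>I. (norm (f i))\<^sup>2)" for r
    proof -
      have "(\<lambda>n. J (\<lambda>i. F n i + (-r) *\<^sub>R f i)) \<longlonglongrightarrow> (\<Sum>i\<in>I. (norm (c i - (z i + (-r) *\<^sub>R f i)))\<^sup>2)"
        unfolding J_def by (intro tendsto_intros z)
      moreover have "d \<le> J (\<lambda>i. F n i + (-r) *\<^sub>R f i)" for n by (intro dle sub FS f)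
      ultimately have "d \<le> (\<Sum>i\<in>I. (norm (c i - (z i + (-r) *\<^sub>R f i)))\<^sup>2)"
        by (meson LIMSEQ_le_const)
      also have "\<dots> = (\<Sum>i\<in>I. (norm (g i))\<^sup>2 + (r * (2 * inner (g i) (f i)) + r\<^sup>2 * (norm (f i))\<^sup>2))"
      proof (rule sum.cong[OF refl])
        fix i show "(norm (c i - (z i + (-r) *\<^sub>R f i)))\<^sup>2
          = (norm (g i))\<^sup>2 + (r * (2 * inner (g i) (f i)) + r\<^sup>2 * (norm (f i))\<^sup>2)"
          unfolding g_def power2_norm_eq_inner
            by (simp add: inner_simps inner_commute algebra_simps power2_eq_square)
      qed
      also have "\<dots>
         = d + (r * (2 * (\<Sum>i\<in>I. inner (g i) (f i))) + r\<^sup>2 * (\<Sum>i\<in>I. (norm (f i))\<^sup>2))"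
        unfolding dg by (simp add: sum.distrib sum_distrib_left)
      finally show ?thesis by simp
    qed
    from quadratic_nonneg_imp_linear_zero[OF this] show "(\<Sum>i\<in>I. inner (g i) (f i)) = 0" by simp
  next
    fix \<epsilon> :: real assume "0 < \<epsilon>"
    have "(\<lambda>n. (\<Sum>i\<in>I. (norm (c i - F n i - g i))\<^sup>2)) \<longlonglongrightarrow> (\<Sum>i\<in>I. (norm (c i - z i - g i))\<^sup>2)"
      by (intro tendsto_intros z)
    then have "(\<lambda>n. (\<Sum>i\<in>I. (norm (c i - F n i - g i))\<^sup>2)) \<longlonglongrightarrow> 0" by (simp add: g_def)
    then have "\<forall>\<^sub>F n in sequentially. (\<Sum>i\<in>I. (norm (c i - F n i - g i))\<^sup>2) < \<epsilon>"
      using \<open>0 < \<epsilon>\<close> by (simp add: order_tendstoD)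
    then show "\<exists>f\<in>S. (\<Sum>i\<in>I. (norm (c i - f i - g i))\<^sup>2) < \<epsilon>"
      using FS by (auto simp: eventually_sequentially)
  qed
qed

text \<open>Weak approximability makes the component of \<open>c\<close> orthogonal to \<open>S\<close> vanish.\<close>

lemma weak_imp_strong_approx:
  fixes S :: "('i \<Rightarrow> 'b::{real_inner,complete_space}) set" and c :: "'i \<Rightarrow> 'b"
  assumes fin: "finite I" and ne: "S \<noteq> {}"
    and sub: "\<And>f g r. f \<in> S \<Longrightarrow> g \<in> S \<Longrightarrow> (\<lambda>i. f i + r *\<^sub>R g i) \<in> S"
    and weak: "\<And>g \<epsilon>. 0 < \<epsilon> \<Longrightarrow> \<exists>f\<in>S. \<forall>i\<in>I. \<bar>inner (g i) (c i - f i)\<bar> < \<epsilon>"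
    and "0 < \<epsilon>"
  shows "\<exists>f\<in>S. (\<Sum>i\<in>I. (norm (c i - f i))\<^sup>2) < \<epsilon>"
proof -
  obtain g where g1: "\<And>f. f \<in> S \<Longrightarrow> (\<Sum>i\<in>I. inner (g i) (f i)) = 0"
    and g2: "\<And>\<epsilon>. 0 < \<epsilon> \<Longrightarrow> \<exists>f\<in>S. (\<Sum>i\<in>I. (norm (c i - f i - g i))\<^sup>2) < \<epsilon>"
    using closest_tuple_orthogonal[OF fin ne sub, where c = c] by metis
  \<comment> \<open>\<open>g\<close> annihilates \<open>S\<close>, so its pairing with
    \<open>c\<close> equals its pairing with \<open>c - f\<close>, which weak approximation makes
    small.\<close>
  have "\<bar>\<Sum>i\<in>I. inner (g i) (c i)\<bar> \<le> real (card I) * e" if "0 < e" for e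
  proof -
    obtain f where f: "f \<in> S" "\<forall>i\<in>I. \<bar>inner (g i) (c i - f i)\<bar> < e" using weak[OF \<open>0 < e\<close>] by blast
    have "(\<Sum>i\<in>I. inner (g i) (c i)) = (\<Sum>i\<in>I. inner (g i) (c i - f i))"
      using g1[OF f(1)] by (simp add: inner_diff_right sum_subtractf)
    also have "\<bar>\<dots>\<bar> \<le> (\<Sum>i\<in>I. e)"
      using f(2) by (intro order_trans[OF sum_abs] sum_mono) (auto intro: less_imp_le)
    finally show ?thesis by simp
  qed
  note small = this
  have gc: "(\<Sum>i\<in>I. inner (g i) (c i)) = 0"
  proof (rule ccontr)
    assume n: "(\<Sum>i\<in>I. inner (g i) (c i)) \<noteq> 0"
    define s where "s = \<bar>\<Sum>i\<in>I. inner (g i) (c i)\<bar>"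
    have "0 < s" using n by (simp add: s_def)
    have "s \<le> real (card I) * (s / (2 * (real (card I) + 1)))"
      unfolding s_def by (rule small) (use n in simp)
    also have "\<dots> < s" using \<open>0 < s\<close> by (simp add: field_simps add_nonneg_pos)
    finally show False by simp
  qed
  \<comment> \<open>By now \<open>g\<close> is orthogonal to \<open>c\<close> and to
    \<open>S\<close>, so Pythagoras bounds its norm by the approximation error.\<close>
  have gg: "(\<Sum>i\<in>I. (norm (g i))\<^sup>2) \<le> e" if "0 < e" for e
  proof -
    obtain f where f: "f \<in> S" "(\<Sum>i\<in>I. (norm (c i - f i - g i))\<^sup>2) < e" using g2[OF \<open>0 < e\<close>] by blast
    have "(\<Sum>i\<in>I. (norm (c i - f i - g i))\<^sup>2) =
      (\<Sum>i\<in>I. (norm (c i - f i))\<^sup>2 - 2 * (inner (g i) (c i) - inner (g i) (f i)) + (norm (g i))\<^sup>2)"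
      by (rule sum.cong) (simp_all add: power2_norm_eq_inner inner_simps inner_commute algebra_simps)
    also have "\<dots> = (\<Sum>i\<in>I. (norm (c i - f i))\<^sup>2) + (\<Sum>i\<in>I. (norm (g i))\<^sup>2)"
      using g1[OF f(1)] gc by (simp add: sum.distrib sum_subtractf flip: sum_distrib_left)
    finally show ?thesis using f(2) by (smt (verit) sum_nonneg zero_le_power2)
  qed
  have "(\<Sum>i\<in>I. (norm (g i))\<^sup>2) \<le> 0"
    using gg by (meson dense not_le)
  then have g0: "\<And>i. i \<in> I \<Longrightarrow> g i = 0"
    using fin by (metis (no_types, lifting) member_le_sum norm_eq_zero order_antisym zero_eq_power2 zero_le_power2 order_trans)
  obtain f where f: "f \<in> S" "(\<Sum>i\<in>I. (norm (c i - f i - g i))\<^sup>2) < \<epsilon>" using g2[OF \<open>0 < \<epsilon>\<close>] by blast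
  then show ?thesis using g0 by (auto intro!: bexI[of _ f])
qed

section \<open>The Riesz representation theorem\<close>

text \<open>Take the component \<open>y\<close>, orthogonal to the kernel, of a vector on which
  \<open>f\<close> is 1; then \<open>x - f x *\<^sub>R y\<close> lies in the kernel for every
  \<open>x\<close>. The projection for tuples is used with a one-point index set.\<close>

lemma riesz_real:
  fixes f :: "'b::{real_inner,complete_space} \<Rightarrow> real"
  assumes "bounded_linear f"
  shows "\<exists>y. \<forall>x. f x = inner x y"
proof (cases "\<forall>x. f x = 0")
  case True
  then show ?thesis by (auto intro: exI[of _ 0])
next
  case False
  interpret bounded_linear f by fact
  obtain c0 where c0: "f c0 \<noteq> 0" using False by blast
  define c where "c = (1 / f c0) *\<^sub>R c0"
  have fc: "f c = 1" using c0 by (simp add: c_def scale)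
  define S where "S = {(\<lambda>_::unit. a) | a. f a = 0}"
  have ne: "S \<noteq> {}" unfolding S_def using zero by blast
  have sub: "(\<lambda>i. h i + r *\<^sub>R g i) \<in> S" if "h \<in> S" "g \<in> S" for h g r
    using that unfolding S_def by (auto simp: add scale)
  obtain g where g1: "\<And>h. h \<in> S \<Longrightarrow> (\<Sum>i\<in>UNIV. inner (g i) (h i)) = 0"
    and g2: "\<And>\<epsilon>. 0 < \<epsilon> \<Longrightarrow> \<exists>h\<in>S. (\<Sum>i\<in>UNIV. (norm (c - h i - g i))\<^sup>2) < \<epsilon>"
    using closest_tuple_orthogonal[OF finite_class.finite_UNIV ne sub, where c = "\<lambda>_. c"] by metis
  define y where "y = g ()"
  have y1: "inner y a = 0" if "f a = 0" for a
    using g1[of "\<lambda>_. a"] that unfolding S_def by (auto simp: y_def UNIV_unit)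
  obtain K where K: "\<And>x. \<bar>f x\<bar> \<le> norm x * K" "0 < K" using pos_bounded by auto
  \<comment> \<open>\<open>y\<close> is a limit of vectors \<open>c - a\<close> with
    \<open>f a = 0\<close>, on which \<open>f\<close> is 1; continuity of \<open>f\<close> carries
    this over.\<close>
  have "f y = 1"
  proof (rule ccontr)
    assume n: "f y \<noteq> 1"
    define e where "e = \<bar>1 - f y\<bar> / K"
    have "0 < e" using n K by (simp add: e_def)
    then obtain h where "h \<in> S" "(\<Sum>i\<in>UNIV. (norm (c - h i - g i))\<^sup>2) < e\<^sup>2" using g2[of "e\<^sup>2"] by auto
    then obtain a where a: "f a = 0" "(norm (c - a - y))\<^sup>2 < e\<^sup>2"
      unfolding S_def by (auto simp: UNIV_unit y_def)
    have "norm (c - a - y) < e" using a(2) \<open>0 < e\<close> by (simp add: power_less_imp_less_base)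
    moreover have "\<bar>1 - f y\<bar> \<le> norm (c - a - y) * K" using K(1)[of "c - a - y"] a fc by (simp add: diff)
    ultimately show False unfolding e_def using K(2) by (simp add: field_simps)
  qed
  then have yy: "y \<noteq> 0" using zero by auto
  have "f x = inner x ((1 / inner y y) *\<^sub>R y)" for x
  proof -
    have "inner y (x - f x *\<^sub>R y) = 0" by (rule y1) (simp add: diff scale \<open>f y = 1\<close>)
    then have "inner x y = f x * inner y y" by (simp add: inner_simps inner_commute)
    then show ?thesis using yy by simp
  qed
  then show ?thesis by blast
qed

subsection \<open>Bounded operators and adjoints\<close>

lemma inner_scaleC_right: "inner (x::'a::complex_hilbert) (c *\<^sub>C y) = inner (cnj c *\<^sub>C x) y"
  by (metis Re_cinner cinner_scaleC_left cinner_scaleC_right)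

lemma cinner_eq_inner: "cinner (x::'a::complex_hilbert) y = Complex (inner x y) (inner x (\<i> *\<^sub>C y))"
  by (simp add: complex_eq_iff Re_cinner[symmetric] cinner_scaleC_right)

lemma cmod_cinner_le: "cmod (cinner (x::'a::complex_hilbert) y) \<le> norm x * norm y"
proof (cases "cinner x y = 0")
  case False
  define c where "c = cnj (cinner x y) / cmod (cinner x y)"
  have c: "cmod c = 1" using False by (simp add: c_def norm_divide)
  have "c * cinner x y = of_real (cmod (cinner x y))"
    using False by (simp add: c_def mult.commute[of "cnj _"] complex_norm_square[symmetric] power2_eq_square)
  then have "cmod (cinner x y) = Re (cinner (c *\<^sub>C x) y)" by (simp add: cinner_scaleC_left)
  also have "\<dots> \<le> norm (c *\<^sub>C x) * norm y" by (simp add: Re_cinner norm_cauchy_schwarz)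
  finally show ?thesis using c by (simp add: norm_scaleC)
qed simp

lemma cinner_add_right: "cinner (x::'a::complex_hilbert) (y + z) = cinner x y + cinner x z"
  by (metis cinner_commute cinner_add_left complex_cnj_add)

lemma cinner_minus_left: "cinner (- (x::'a::complex_hilbert)) y = - cinner x y"
  using cinner_add_left[of x "- x" y] cinner_add_left[of 0 0 y]
    by (simp add: eq_neg_iff_add_eq_0 add.commute)

lemma cinner_diff_left: "cinner ((x::'a::complex_hilbert) - z) y = cinner x y - cinner z y"
  by (simp only: diff_conv_add_uminus cinner_add_left cinner_minus_left)

lemma cinner_diff_right: "cinner y ((x::'a::complex_hilbert) - z) = cinner y x - cinner y z"
  by (metis cinner_commute cinner_diff_left complex_cnj_diff)

lemma scaleC_one [simp]: "1 *\<^sub>C (x::'a::complex_hilbert) = x"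
  using scaleC_of_real[of 1 x] by simp

lemma scaleC_zero_left [simp]: "0 *\<^sub>C (x::'a::complex_hilbert) = 0"
  using scaleC_of_real[of 0 x] by simp

lemma scaleC_zero_right [simp]: "c *\<^sub>C (0::'a::complex_hilbert) = 0"
  using scaleC_add_right[of c 0 0] by simp

lemma scaleC_minus1 [simp]: "(-1) *\<^sub>C (x::'a::complex_hilbert) = - x"
  using scaleC_of_real[of "-1" x] by simp

lemma bop_eqI: "(\<And>x. app S x = app T x) \<Longrightarrow> S = T"
  by (metis app_inverse ext)

lemmas app_simps [simp] = zero_bop.rep_eq one_bop.rep_eq plus_bop.rep_eq uminus_bop.rep_eq
  minus_bop.rep_eq times_bop.rep_eq scaleC_bop.rep_eq

lemma bounded_clinear_app: "bounded_clinear (app T)" using app[of T] by simp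

lemma bounded_linear_app: "bounded_linear (app T)"
  using bounded_clinear_app[of T] by (simp add: bounded_clinear_def)

lemma app_scaleC [simp]: "app T (c *\<^sub>C x) = c *\<^sub>C app T x"
  using bounded_clinear_app[of T] by (simp add: bounded_clinear_def)

lemma app_add [simp]: "app T (x + y) = app T x + app T y"
  by (simp add: bounded_linear_app linear_simps)

lemma app_diff [simp]: "app T (x - y) = app T x - app T y"
  by (simp add: bounded_linear_app linear_simps)

lemma app_zero [simp]: "app T 0 = 0"
  by (simp add: bounded_linear_app linear_simps)

text \<open>Operator norm bounds are kept as a predicate: they combine by rules, and no norm on
  \<open>bop\<close> has to be introduced.\<close>

definition opb :: "'a::complex_hilbert bop \<Rightarrow> real \<Rightarrow> bool"
  where "opb T K \<longleftrightarrow> 0 \<le> K \<and> (\<forall>x. norm (app T x) \<le> K * norm x)"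

lemma opbD: "opb T K \<Longrightarrow> norm (app T x) \<le> K * norm x" by (simp add: opb_def)

lemma opb_ex: "\<exists>K. opb T K"
  using bounded_linear.nonneg_bounded[OF bounded_linear_app[of T]] by (auto simp: opb_def mult.commute)

lemma opb_mono: "opb T K \<Longrightarrow> K \<le> L \<Longrightarrow> opb T L"
  unfolding opb_def by (meson mult_right_mono norm_ge_zero order_trans)

lemma opb_add: "opb S K \<Longrightarrow> opb T L \<Longrightarrow> opb (S + T) (K + L)"
  unfolding opb_def by (auto simp: distrib_right intro!: order_trans[OF norm_triangle_ineq] add_mono)

lemma opb_diff: "opb S K \<Longrightarrow> opb T L \<Longrightarrow> opb (S - T) (K + L)"
  unfolding opb_def by (auto simp: distrib_right intro!: order_trans[OF norm_triangle_ineq4] add_mono)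

lemma opb_mult: assumes "opb S K" "opb T L" shows "opb (S * T) (K * L)"
  unfolding opb_def
proof (intro conjI allI)
  show "0 \<le> K * L" using assms by (simp add: opb_def)
  fix x
  have "norm (app S (app T x)) \<le> K * norm (app T x)" using assms by (simp add: opb_def)
  also have "\<dots> \<le> K * (L * norm x)" using assms by (intro mult_left_mono) (auto simp: opb_def)
  finally show "norm (app (S * T) x) \<le> K * L * norm x" by (simp add: mult.assoc)
qed

lemma opb_scaleC: "opb T L \<Longrightarrow> opb (c *\<^sub>C T) (cmod c * L)"
  unfolding opb_def by (simp add: norm_scaleC mult.assoc mult_left_mono)

lemma opb_one: "opb 1 1" by (simp add: opb_def)

lemma opb_zero: "opb 0 0" by (simp add: opb_def)

text \<open>Riesz is applied to the real inner product only. Uniqueness of the representing vector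
  makes it complex linear in \<open>y\<close>, and \<open>cinner_eq_inner\<close> recovers the
  imaginary part.\<close>

lemma adjoint_exists: "\<exists>S. \<forall>x y. cinner (app T x) y = cinner x (app S y)"
proof -
  have "\<exists>z. \<forall>x. inner (app T x) y = inner x z" for y
    by (rule riesz_real) (intro bounded_linear_compose[OF bounded_linear_inner_left bounded_linear_app])
  then obtain g where g: "\<And>x y. inner (app T x) y = inner x (g y)" by metis
  have add: "g (x + y) = g x + g y" for x y
    by (subst vector_eq_ldot[symmetric]) (simp add: inner_add_right g[symmetric])
  have sc: "g (c *\<^sub>C x) = c *\<^sub>C g x" for c x
    by (subst vector_eq_ldot[symmetric]) (simp add: inner_scaleC_right g[symmetric])
  have sr: "g (r *\<^sub>R x) = r *\<^sub>R g x" for r x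
    using sc[of "complex_of_real r" x] by (simp add: scaleC_of_real)
  obtain K where K: "opb T K" using opb_ex by blast
  have bd: "norm (g x) \<le> norm x * K" for x
  proof (cases "g x = 0")
    case True then show ?thesis using K by (simp add: opb_def)
  next
    case False
    have "norm (g x) * norm (g x) = inner (app T (g x)) x"
      by (simp add: g power2_norm_eq_inner[symmetric] power2_eq_square)
    also have "\<dots> \<le> norm (app T (g x)) * norm x" by (rule norm_cauchy_schwarz)
    also have "\<dots> \<le> (K * norm (g x)) * norm x" by (intro mult_right_mono opbD K) simp
    finally have "norm (g x) * norm (g x) \<le> norm (g x) * (norm x * K)" by (simp add: mult_ac)
    then show ?thesis using False by simp
  qed
  have "bounded_linear g" by (rule bounded_linear_intro[OF add sr bd])
  then have "bounded_clinear g" using sc by (simp add: bounded_clinear_def)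
  then have ap: "app (Abs_bop g) = g" by (simp add: Abs_bop_inverse)
  have "cinner (app T x) y = cinner x (g y)" for x y
    by (simp add: cinner_eq_inner g sc)
  then show ?thesis using ap by metis
qed

lemma cinner_ext: "(\<And>x. cinner x y = cinner x z) \<Longrightarrow> y = (z::'a::complex_hilbert)"
  by (subst vector_eq_ldot[symmetric]) (simp flip: Re_cinner)

lemma adjoint_unique:
  assumes "\<And>x y. cinner (app T x) y = cinner x (app S y)" shows "adj T = S"
  unfolding adj_def
proof (rule the_equality)
  fix S' assume "\<forall>x y. cinner (app T x) y = cinner x (app S' y)"
  then show "S' = S" using assms by (intro bop_eqI cinner_ext) metis
qed (use assms in blast)

lemma cinner_adj: "cinner (app T x) y = cinner x (app (adj T) y)"
  using adjoint_exists[of T] adjoint_unique[of T] by metis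

lemma cinner_adj': "cinner (app (adj T) x) y = cinner x (app T y)"
  by (metis cinner_adj cinner_commute)

lemma inner_adj: "inner (app T x) y = inner x (app (adj T) y)"
  by (metis Re_cinner cinner_adj)

lemma adj_adj [simp]: "adj (adj T) = T"
  by (rule adjoint_unique) (simp add: cinner_adj')

lemma adj_mult [simp]: "adj (S * T) = adj T * adj S"
  by (rule adjoint_unique) (simp add: cinner_adj)

lemma adj_add [simp]: "adj (S + T) = adj S + adj T"
  by (rule adjoint_unique) (simp add: cinner_adj cinner_add_left cinner_add_right)

lemma adj_diff [simp]: "adj (S - T) = adj S - adj T"
  by (rule adjoint_unique) (simp add: cinner_adj cinner_diff_left cinner_diff_right)

lemma adj_scaleC [simp]: "adj (c *\<^sub>C T) = cnj c *\<^sub>C adj T"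
  by (rule adjoint_unique) (simp add: cinner_adj cinner_scaleC_left cinner_scaleC_right)

lemma adj_one [simp]: "adj 1 = 1"
  by (rule adjoint_unique) simp

lemma adj_zero [simp]: "adj 0 = 0"
  using adj_diff[of 0 0] by simp

lemma opb_adj: assumes K: "opb T K" shows "opb (adj T) K"
  unfolding opb_def
proof (intro conjI allI)
  show "0 \<le> K" using K by (simp add: opb_def)
  fix x
  show "norm (app (adj T) x) \<le> K * norm x"
  proof (cases "app (adj T) x = 0")
    case True then show ?thesis using K by (simp add: opb_def)
  next
    case False
    have "norm (app (adj T) x) * norm (app (adj T) x) = inner (app T (app (adj T) x)) x"
      by (simp add: inner_adj power2_norm_eq_inner[symmetric] power2_eq_square)
    also have "\<dots> \<le> norm (app T (app (adj T) x)) * norm x" by (rule norm_cauchy_schwarz)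
    also have "\<dots> \<le> (K * norm (app (adj T) x)) * norm x" by (intro mult_right_mono opbD K) simp
    finally have "norm (app (adj T) x) * norm (app (adj T) x) \<le> norm (app (adj T) x) * (K * norm x)"
      by (simp add: mult_ac)
    then show ?thesis using False by simp
  qed
qed

lemma scaleC_bop_simps [simp]:
  fixes S T :: "'a::complex_hilbert bop"
  shows "1 *\<^sub>C S = S" "0 *\<^sub>C S = 0" "c *\<^sub>C (d *\<^sub>C S) = (c * d) *\<^sub>C S"
    "(c *\<^sub>C S) * T = c *\<^sub>C (S * T)" "S * (c *\<^sub>C T) = c *\<^sub>C (S * T)" "(-1) *\<^sub>C S = - S"
  by (rule bop_eqI; simp add: scaleC_scaleC)+

lemma scaleC_bop_distrib:
  fixes S T :: "'a::complex_hilbert bop"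
  shows "c *\<^sub>C (S + T) = c *\<^sub>C S + c *\<^sub>C T" "(c + d) *\<^sub>C S = c *\<^sub>C S + d *\<^sub>C S"
    "c *\<^sub>C (S - T) = c *\<^sub>C S - c *\<^sub>C T"
  by (rule bop_eqI; simp add: scaleC_add_right scaleC_add_left scaleC_diff_right)+

lemma unitary_norm: assumes "unitary u" shows "norm (app u x) = norm x"
proof -
  have "(norm (app u x))\<^sup>2 = inner x (app (adj u * u) x)"
    by (simp add: power2_norm_eq_inner inner_adj)
  also have "\<dots> = (norm x)\<^sup>2" using assms by (simp only: unitary_def one_bop.rep_eq power2_norm_eq_inner)
  finally show ?thesis by (simp add: power2_eq_iff_nonneg)
qed

subsection \<open>Bounded strong-* convergence\<close>

text \<open>Strong-star convergence of a bounded net. The uniform bound makes multiplication jointly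
  continuous and lets normal functionals pass to the limit; convergence of the adjoints makes the
  star operation continuous.\<close>

definition bsot :: "'i filter \<Rightarrow> ('i \<Rightarrow> 'a::complex_hilbert bop) \<Rightarrow> 'a bop \<Rightarrow> bool"
  where "bsot F T T0 \<longleftrightarrow> (\<exists>K. \<forall>i. opb (T i) K) \<and>
    (\<forall>x. ((\<lambda>i. app (T i) x) \<longlongrightarrow> app T0 x) F) \<and>
    (\<forall>x. ((\<lambda>i. app (adj (T i)) x) \<longlongrightarrow> app (adj T0) x) F)"

lemma bsot_const: "bsot F (\<lambda>_. T) T"
  unfolding bsot_def using opb_ex by auto

lemma bsot_adj: "bsot F T T0 \<Longrightarrow> bsot F (\<lambda>i. adj (T i)) (adj T0)"
  unfolding bsot_def using opb_adj by auto

lemma bsot_add: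
  assumes "bsot F S S0" "bsot F T T0" shows "bsot F (\<lambda>i. S i + T i) (S0 + T0)"
proof -
  obtain K L where "\<And>i. opb (S i) K" "\<And>i. opb (T i) L"
    using assms unfolding bsot_def by blast
  then have "\<forall>i. opb (S i + T i) (K + L)" by (blast intro: opb_add)
  then show ?thesis using assms unfolding bsot_def by (auto intro!: tendsto_add)
qed

lemma bsot_scaleC:
  assumes "bsot F T T0" shows "bsot F (\<lambda>i. c *\<^sub>C T i) (c *\<^sub>C T0)"
proof -
  obtain K where "\<And>i. opb (T i) K" using assms unfolding bsot_def by blast
  then have "\<forall>i. opb (c *\<^sub>C T i) (cmod c * K)" by (blast intro: opb_scaleC)
  then show ?thesis using assms unfolding bsot_def
    by (auto intro!: bounded_linear.tendsto[OF bounded_linear_scaleC])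
qed

lemma bsot_diff:
  assumes "bsot F S S0" "bsot F T T0" shows "bsot F (\<lambda>i. S i - T i) (S0 - T0)"
proof -
  obtain K L where "\<And>i. opb (S i) K" "\<And>i. opb (T i) L"
    using assms unfolding bsot_def by blast
  then have "\<forall>i. opb (S i - T i) (K + L)" by (blast intro: opb_diff)
  then show ?thesis using assms unfolding bsot_def by (auto intro!: tendsto_diff)
qed

lemma tendsto_app_mult:
  assumes K: "\<And>i. opb (S i) K" and S: "((\<lambda>i. app (S i) (app T0 x)) \<longlongrightarrow> app S0 (app T0 x)) F"
    and T: "((\<lambda>i. app (T i) x) \<longlongrightarrow> app T0 x) F"
  shows "((\<lambda>i. app (S i * T i) x) \<longlongrightarrow> app (S0 * T0) x) F"
proof -
  have "((\<lambda>i. app (S i) (app (T i) x - app T0 x)) \<longlongrightarrow> 0) F"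
  proof (rule Lim_null_comparison)
    show "\<forall>\<^sub>F i in F. norm (app (S i) (app (T i) x - app T0 x)) \<le> K * norm (app (T i) x - app T0 x)"
      using K by (intro always_eventually allI opbD)
    have "((\<lambda>i. app (T i) x - app T0 x) \<longlongrightarrow> 0) F" using T by (simp add: LIM_zero)
    then show "((\<lambda>i. K * norm (app (T i) x - app T0 x)) \<longlongrightarrow> 0) F"
      by (intro tendsto_mult_right_zero tendsto_norm_zero)
  qed
  from tendsto_add[OF this S] show ?thesis by simp
qed

lemma bsot_mult:
  assumes "bsot F S S0" "bsot F T T0" shows "bsot F (\<lambda>i. S i * T i) (S0 * T0)"
proof -
  obtain K L where K: "\<And>i. opb (S i) K" and L: "\<And>i. opb (T i) L"
    using assms unfolding bsot_def by blast
  show ?thesis unfolding bsot_def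
  proof (intro conjI allI)
    show "\<exists>K. \<forall>i. opb (S i * T i) K" using opb_mult[OF K L] by blast
    show "((\<lambda>i. app (S i * T i) x) \<longlongrightarrow> app (S0 * T0) x) F" for x
      using assms by (intro tendsto_app_mult[OF K]) (auto simp: bsot_def)
    show "((\<lambda>i. app (adj (S i * T i)) x) \<longlongrightarrow> app (adj (S0 * T0)) x) F" for x
      unfolding adj_mult using assms
      by (intro tendsto_app_mult[OF opb_adj[OF L]]) (auto simp: bsot_def)
  qed
qed

lemma tendsto_cinner:
  fixes f g :: "'i \<Rightarrow> 'a::complex_hilbert"
  assumes "(f \<longlongrightarrow> a) F" "(g \<longlongrightarrow> b) F"
  shows "((\<lambda>i. cinner (f i) (g i)) \<longlongrightarrow> cinner a b) F"
  unfolding cinner_eq_inner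
  by (intro tendsto_Complex tendsto_inner assms bounded_linear.tendsto[OF bounded_linear_scaleC])

lemma openin_topology_generated_byE:
  assumes "openin (topology_generated_by S) U" "a \<in> U"
  shows "\<exists>\<F>. finite \<F> \<and> \<F> \<subseteq> S \<and> a \<in> \<Inter>\<F> \<and> \<Inter>\<F> \<subseteq> U"
  using openin_topology_generated_by[OF assms(1)] assms(2)
proof induction
  case (Int A B)
  from Int.prems have "a \<in> A" "a \<in> B" by auto
  obtain F where "finite F" "F \<subseteq> S" "a \<in> \<Inter>F" "\<Inter>F \<subseteq> A" using Int.IH(1)[OF \<open>a \<in> A\<close>] by (elim exE conjE)
  moreover obtain G where "finite G" "G \<subseteq> S" "a \<in> \<Inter>G" "\<Inter>G \<subseteq> B" using Int.IH(2)[OF \<open>a \<in> B\<close>]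
    by (elim exE conjE)
  ultimately show ?case by (intro exI[of _ "F \<union> G"]) auto
next
  case (UN K)
  then obtain k where "k \<in> K" "a \<in> k" by blast
  from UN.IH[OF this] obtain F where "finite F" "F \<subseteq> S" "a \<in> \<Inter>F" "\<Inter>F \<subseteq> k" by (elim exE conjE)
  then show ?case using \<open>k \<in> K\<close> by (intro exI[of _ F]) auto
next
  case (Basis s)
  then show ?case by (intro exI[of _ "{s}"]) auto
qed simp

text \<open>Bounded convergence implies ultraweak convergence: the series defining an ultraweak
  neighbourhood converges termwise and is dominated by \<open>K\<close> times the sum of two
  convergent series of squares, so Tannery's theorem applies.\<close>

lemma tendsto_trace_bsot:
  assumes tr: "tracial_state M \<tau>" and T: "\<And>i. T i \<in> M" and T0: "T0 \<in> M" and b: "bsot F T T0"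
  shows "((\<lambda>i. \<tau> (T i)) \<longlongrightarrow> \<tau> T0) F"
proof (cases "F = bot")
  case False
  show ?thesis
  proof (rule topological_tendstoI)
    fix V :: "complex set" assume V: "open V" "\<tau> T0 \<in> V"
    have cm: "continuous_map (subtopology ultraweak_topology M) euclidean \<tau>"
      using tr by (simp add: tracial_state_def)
    have tsp: "topspace ultraweak_topology = (UNIV::'a bop set)"
    proof -
      have "\<exists>x y U. (UNIV::'a bop set) = {T. (\<Sum>i. cinner (app T (x i)) (y i)) \<in> U} \<and>
        summable (\<lambda>i::nat. (norm (x i))\<^sup>2) \<and> summable (\<lambda>i. (norm (y i))\<^sup>2) \<and> open U"
        by (intro exI[of _ "\<lambda>_. 0"] exI[of _ UNIV]) auto
      then have "(UNIV::'a bop set) \<in> {{T. (\<Sum>i. cinner (app T (x i)) (y i)) \<in> U} | x y U.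
        summable (\<lambda>i::nat. (norm (x i))\<^sup>2) \<and> summable (\<lambda>i. (norm (y i))\<^sup>2) \<and> open U}" by simp
      then show ?thesis unfolding ultraweak_topology_def topology_generated_by_topspace
        by (rule top.extremum_uniqueI[OF Sup_upper])
    qed
    have "openin (subtopology ultraweak_topology M) {x \<in> topspace (subtopology ultraweak_topology M). \<tau> x \<in> V}"
      using openin_continuous_map_preimage[OF cm, of V] V(1) by simp
    then have "openin (subtopology ultraweak_topology M) {x \<in> M. \<tau> x \<in> V}" by (simp add: tsp)
    then obtain O' where O: "openin ultraweak_topology O'" "{x \<in> M. \<tau> x \<in> V} = O' \<inter> M"
      unfolding openin_subtopology by (elim exE conjE) (rule that)
    have "T0 \<in> O'" using O(2) V(2) T0 by auto
    from openin_topology_generated_byE[OF O(1)[unfolded ultraweak_topology_def] this]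
    obtain \<F> where F: "finite \<F>" "\<F> \<subseteq> {{T. (\<Sum>i. cinner (app T (x i)) (y i)) \<in> U} | x y U.
      summable (\<lambda>i::nat. (norm (x i))\<^sup>2) \<and> summable (\<lambda>i. (norm (y i))\<^sup>2) \<and> open U}"
      "T0 \<in> \<Inter>\<F>" "\<Inter>\<F> \<subseteq> O'" by (elim exE conjE) (rule that)
    have "\<forall>\<^sub>F i in F. T i \<in> B" if B: "B \<in> \<F>" for B
    proof -
      obtain x y U where xy: "B = {T. (\<Sum>i. cinner (app T (x i)) (y i)) \<in> U}"
        "summable (\<lambda>i::nat. (norm (x i))\<^sup>2)" "summable (\<lambda>i. (norm (y i))\<^sup>2)" "open U"
        using subsetD[OF F(2) B] unfolding mem_Collect_eq by (elim exE conjE) (rule that)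
      obtain K where K: "\<And>i. opb (T i) K" using b unfolding bsot_def by blast
      have K0: "0 \<le> K" using K by (simp add: opb_def)
      have lim: "((\<lambda>i. \<Sum>n. cinner (app (T i) (x n)) (y n)) \<longlongrightarrow> (\<Sum>n. cinner (app T0 (x n)) (y n))) F"
      proof (rule conjunct2[OF conjunct2[OF tannerys_theorem[where M = "\<lambda>n. K * ((norm (x n))\<^sup>2 + (norm (y n))\<^sup>2)"]]])
        show "((\<lambda>i. cinner (app (T i) (x n)) (y n)) \<longlongrightarrow> cinner (app T0 (x n)) (y n)) F" for n
          using b by (intro tendsto_cinner tendsto_const) (auto simp: bsot_def)
        have "cmod (cinner (app (T i) (x n)) (y n)) \<le> K * ((norm (x n))\<^sup>2 + (norm (y n))\<^sup>2)" for n i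
        proof -
          have "cmod (cinner (app (T i) (x n)) (y n)) \<le> norm (app (T i) (x n)) * norm (y n)"
            by (rule cmod_cinner_le)
          also have "\<dots> \<le> (K * norm (x n)) * norm (y n)" by (intro mult_right_mono opbD K) simp
          also have "\<dots> = K * (norm (x n) * norm (y n))" by simp
          also have "\<dots> \<le> K * ((norm (x n))\<^sup>2 + (norm (y n))\<^sup>2)"
          proof (intro mult_left_mono K0)
            have "2 * (norm (x n) * norm (y n)) \<le> (norm (x n))\<^sup>2 + (norm (y n))\<^sup>2"
              using sum_squares_bound[of "norm (x n)" "norm (y n)"] by (simp add: mult.assoc)
            then show "norm (x n) * norm (y n) \<le> (norm (x n))\<^sup>2 + (norm (y n))\<^sup>2"
              by (smt (verit) mult_nonneg_nonneg norm_ge_zero)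
          qed
          finally show ?thesis .
        qed
        then show "\<forall>\<^sub>F (n, i) in sequentially \<times>\<^sub>F F. cmod (cinner (app (T i) (x n)) (y n))
          \<le> K * ((norm (x n))\<^sup>2 + (norm (y n))\<^sup>2)"
          by (intro always_eventually) auto
        show "summable (\<lambda>n. K * ((norm (x n))\<^sup>2 + (norm (y n))\<^sup>2))"
          by (intro summable_mult summable_add xy)
        show "F \<noteq> bot" by fact
      qed
      have "(\<Sum>n. cinner (app T0 (x n)) (y n)) \<in> U" using F(3) B xy(1) by blast
      with lim xy(4) have "\<forall>\<^sub>F i in F. (\<Sum>n. cinner (app (T i) (x n)) (y n)) \<in> U"
        by (rule topological_tendstoD)
      then show ?thesis unfolding xy(1) by simp
    qed
    then have "\<forall>\<^sub>F i in F. \<forall>B\<in>\<F>. T i \<in> B" using F(1) by (simp add: eventually_ball_finite)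
    then show "\<forall>\<^sub>F i in F. \<tau> (T i) \<in> V"
    proof (rule eventually_mono)
      fix i assume "\<forall>B\<in>\<F>. T i \<in> B"
      then have "T i \<in> O' \<inter> M" using F(4) T by blast
      then show "\<tau> (T i) \<in> V" using O(2) by blast
    qed
  qed
qed simp

subsection \<open>A norm-decreasing polynomial cutoff\<close>

text \<open>An operator with its adjoint on a real inner product space. The instances are a bounded
  operator, and left multiplication by a matrix on \<open>fmat\<close>; the latter space is not
  complete, so completeness is not assumed. \<open>c\<close> bounds the square of the norm.\<close>

locale adjoint_pair =
  fixes T Ts :: "'v::real_inner \<Rightarrow> 'v" and c :: real
  assumes lin: "linear T" "linear Ts"
    and adj: "\<And>x y. inner (T x) y = inner x (Ts y)"
    and bnd: "\<And>x. (norm (T x))\<^sup>2 \<le> c * (norm x)\<^sup>2"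
    and c0: "0 \<le> c"
begin

text \<open>
  As \<open>1 + T Ts = (1 + c) (1 - D)\<close>, the polynomials \<open>g J\<close> in \<open>T Ts\<close> are the Neumann sums of the inverse
  of \<open>1 + T Ts\<close>.  The cutoff of \<open>T\<close> is \<open>g J T\<close>, of norm at most 1 for all \<open>c\<close> and \<open>J\<close>.  It takes the place of
  Kaplansky's density theorem, and bounds matrices and operators simultaneously.
\<close>

definition D where "D x = (1 / (1 + c)) *\<^sub>R (c *\<^sub>R x - T (Ts x))"

primrec g where
  "g 0 x = 0"
| "g (Suc J) x = (1 / (1 + c)) *\<^sub>R x + D (g J x)"

lemma lin_simps: "T (x + y) = T x + T y" "Ts (x + y) = Ts x + Ts y"
  "T (x - y) = T x - T y" "Ts (x - y) = Ts x - Ts y"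
  "T (r *\<^sub>R x) = r *\<^sub>R T x" "Ts (r *\<^sub>R x) = r *\<^sub>R Ts x" "T 0 = 0" "Ts 0 = 0"
  using lin by (simp_all add: linear_add linear_diff linear_scale linear_0)

lemma D_lin: "D (x + y) = D x + D y" "D (x - y) = D x - D y" "D (r *\<^sub>R x) = r *\<^sub>R D x" "D 0 = 0"
  unfolding D_def by (simp_all add: lin_simps algebra_simps)

lemma g_lin: "g J (x + y) = g J x + g J y" "g J (x - y) = g J x - g J y" "g J (r *\<^sub>R x) = r *\<^sub>R g J x"
  by (induction J) (simp_all add: D_lin scaleR_right_distrib scaleR_right_diff_distrib)

lemma inner_T_Ts: "inner (T (Ts x)) y = inner x (T (Ts y))"
  by (metis adj inner_commute)

lemma inner_T_Ts_self: "inner x (T (Ts x)) = inner (Ts x) (Ts x)"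
  by (metis adj inner_commute)

lemma D_self_adjoint: "inner (D x) y = inner x (D y)"
  unfolding D_def by (simp add: inner_simps inner_T_Ts)

lemma D_T_Ts: "x + T (Ts x) = (1 + c) *\<^sub>R (x - D x)"
proof -
  have "(1 + c) *\<^sub>R D x = c *\<^sub>R x - T (Ts x)" using c0 by (simp add: D_def)
  then show ?thesis by (simp add: scaleR_right_diff_distrib scaleR_add_left)
qed

text \<open>As \<open>0 \<le> T Ts \<le> c\<close>, the operator \<open>c - T Ts\<close> has norm at
  most \<open>c\<close>. The ratio c / (1 + c) is below 1, so the Neumann series converges
  geometrically.\<close>

lemma norm_D: "norm (D x) \<le> c / (1 + c) * norm x"
proof -
  have "(norm (c *\<^sub>R x - T (Ts x)))\<^sup>2 = (c * norm x)\<^sup>2 - 2 * c * (norm (Ts x))\<^sup>2 + (norm (T (Ts x)))\<^sup>2"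
    unfolding power_mult_distrib power2_norm_eq_inner using inner_T_Ts_self[of x]
    by (simp add: inner_simps inner_commute power2_eq_square algebra_simps)
  also have "\<dots> \<le> (c * norm x)\<^sup>2"
    using bnd[of "Ts x"] mult_nonneg_nonneg[OF c0 zero_le_power2[of "norm (Ts x)"]] by linarith
  finally have "norm (c *\<^sub>R x - T (Ts x)) \<le> c * norm x" using c0 by (simp add: power2_le_iff_abs_le)
  then show ?thesis unfolding D_def using c0 by (simp add: divide_right_mono)
qed

lemma norm_D_funpow: "norm ((D ^^ J) x) \<le> (c / (1 + c)) ^ J * norm x"
proof (induction J)
  case (Suc J)
  have "norm ((D ^^ Suc J) x) \<le> c / (1 + c) * norm ((D ^^ J) x)" using norm_D by simp
  also have "\<dots> \<le> c / (1 + c) * ((c / (1 + c)) ^ J * norm x)" using Suc c0 by (intro mult_left_mono) auto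
  finally show ?case by (simp add: mult.assoc)
qed simp

lemma norm_D_funpow_le: "norm ((D ^^ J) x) \<le> norm x"
proof -
  have "(c / (1 + c)) ^ J \<le> 1" using c0 by (intro power_le_one) auto
  then have "(c / (1 + c)) ^ J * norm x \<le> 1 * norm x" by (intro mult_right_mono) auto
  then show ?thesis using norm_D_funpow[of J x] by simp
qed

text \<open>The Neumann sum telescopes: \<open>g J\<close> inverts 1 + T Ts up to the remainder
  \<open>D ^^ J\<close>.\<close>

lemma H_g: "g J x + T (Ts (g J x)) = x - (D ^^ J) x"
proof (induction J)
  case 0 show ?case by (simp add: lin_simps)
next
  case (Suc J)
  have "g (Suc J) x + T (Ts (g (Suc J) x)) = (1 + c) *\<^sub>R (g (Suc J) x - D (g (Suc J) x))"
    by (rule D_T_Ts)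
  also have "\<dots> = x - D x + D ((1 + c) *\<^sub>R (g J x - D (g J x)))"
    using c0 by (simp add: D_lin scaleR_right_diff_distrib scaleR_add_right)
  also have "\<dots> = x - D x + D (x - (D ^^ J) x)" using D_T_Ts[of "g J x"] Suc by simp
  finally show ?case by (simp add: D_lin)
qed

lemma g_H: "g J (x + T (Ts x)) = x - (D ^^ J) x"
proof (induction J)
  case (Suc J)
  have "g (Suc J) (x + T (Ts x)) = (1 / (1 + c)) *\<^sub>R ((1 + c) *\<^sub>R (x - D x)) + D (x - (D ^^ J) x)"
    using Suc D_T_Ts[of x] by simp
  then show ?case using c0 by (simp add: D_lin)
qed simp

lemma norm_H_sq: "(norm (x + T (Ts x)))\<^sup>2 = (norm x)\<^sup>2 + 2 * (norm (Ts x))\<^sup>2 + (norm (T (Ts x)))\<^sup>2"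
  unfolding power2_norm_eq_inner using inner_T_Ts_self[of x] by (simp add: inner_simps inner_commute)

lemma norm_le_H: "norm x \<le> norm (x + T (Ts x))"
  by (rule power2_le_imp_le) (simp_all add: norm_H_sq)

text \<open>For a singular value t of \<open>T\<close> this is 2 t \<le> 1 + t^2; no spectral theory
  is used.\<close>

lemma norm_Ts_le_H: "2 * norm (Ts x) \<le> norm (x + T (Ts x))"
proof -
  have "(norm (Ts x))\<^sup>2 = inner (T (Ts x)) x" by (simp add: power2_norm_eq_inner adj)
  also have "\<dots> \<le> norm (T (Ts x)) * norm x" by (rule norm_cauchy_schwarz)
  finally have "2 * (norm (Ts x))\<^sup>2 \<le> 2 * norm x * norm (T (Ts x))" by (simp add: mult_ac)
  also have "\<dots> \<le> (norm x)\<^sup>2 + (norm (T (Ts x)))\<^sup>2" by (rule sum_squares_bound)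
  finally have "(2 * norm (Ts x))\<^sup>2 \<le> (norm (x + T (Ts x)))\<^sup>2"
    unfolding norm_H_sq power_mult_distrib by simp
  then show ?thesis by (rule power2_le_imp_le) simp
qed

lemma norm_H_g: "norm (g J x + T (Ts (g J x))) \<le> 2 * norm x"
  unfolding H_g using norm_triangle_ineq4[of x "(D ^^ J) x"] norm_D_funpow_le[of J x] by simp

lemma norm_g: "norm (g J x) \<le> 2 * norm x"
  by (rule order_trans[OF norm_le_H norm_H_g])

lemma norm_Ts_g: "norm (Ts (g J x)) \<le> norm x"
  using norm_Ts_le_H[of "g J x"] norm_H_g[of J x] by simp

lemma D_g: "D (g J x) = g J (D x)"
  by (induction J) (simp_all add: D_lin)

lemma g_self_adjoint: "inner (g J x) y = inner x (g J y)"
proof (induction J arbitrary: x y)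
  case (Suc J)
  then show ?case by (simp add: inner_simps D_self_adjoint D_g)
qed simp

text \<open>Dual to \<open>norm_Ts_g\<close>. The factor 2 lost to the remainder in
  \<open>norm_H_g\<close> is exactly regained from \<open>norm_Ts_le_H\<close>, which gives 1 for
  every \<open>J\<close> and \<open>c\<close>.\<close>

lemma norm_g_T: "norm (g J (T x)) \<le> norm x"
proof -
  have "(norm (g J (T x)))\<^sup>2 = inner x (Ts (g J (g J (T x))))"
    unfolding power2_norm_eq_inner by (simp only: g_self_adjoint adj)
  also have "\<dots> \<le> norm x * norm (Ts (g J (g J (T x))))" by (rule norm_cauchy_schwarz)
  also have "\<dots> \<le> norm x * norm (g J (T x))" by (intro mult_left_mono norm_Ts_g) simp
  finally have "norm (g J (T x)) * norm (g J (T x)) \<le> norm x * norm (g J (T x))"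
    by (simp add: power2_eq_square)
  then show ?thesis by (cases "norm (g J (T x)) = 0") auto
qed

text \<open>A resolvent identity: apply \<open>g J\<close> to the difference of \<open>T x\<close>
  and \<open>y + T (Ts y)\<close>. Only the values of \<open>T - z\<close> and
  \<open>Ts - zs\<close> at \<open>x\<close>, \<open>y\<close> and \<open>zs y\<close> enter, so
  closeness at finitely many vectors is enough; the last term vanishes as \<open>J\<close>
  grows.\<close>

lemma cutoff_error:
  assumes z: "z x = y + z (zs y)"
  shows "norm (g J (T x) - y) \<le> 2 * norm (T x - z x) + norm (Ts y - zs y)
    + 2 * norm (T (zs y) - z (zs y)) + (c / (1 + c)) ^ J * norm y"
proof -
  have "g J (T x) - y = g J (T x) - g J (y + T (Ts y)) - (D ^^ J) y" by (simp add: g_H)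
  also have "\<dots> = g J (T x - (y + T (Ts y))) - (D ^^ J) y" by (simp add: g_lin)
  also have "T x - (y + T (Ts y)) = (T x - z x) - T (Ts y - zs y) - (T (zs y) - z (zs y))"
    using z by (simp add: lin_simps algebra_simps)
  finally have eq: "g J (T x) - y = g J (T x - z x) - g J (T (Ts y - zs y)) - g J (T (zs y)
    - z (zs y)) - (D ^^ J) y"
    by (simp only: g_lin)
  have "norm (a - b - d - e) \<le> norm a + norm b + norm d + norm e" for a b d e :: 'v
    by (smt (verit) norm_triangle_ineq4)
  then have "norm (g J (T x) - y) \<le> norm (g J (T x - z x)) + norm (g J (T (Ts y - zs y)))
      + norm (g J (T (zs y) - z (zs y))) + norm ((D ^^ J) y)" unfolding eq .
  then show ?thesis using norm_g[of J "T x - z x"] norm_g[of J "T (zs y) - z (zs y)"]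
      norm_g_T[of J "Ts y - zs y"] norm_D_funpow[of J y] by linarith
qed

end

text \<open>The rule Ts f(T Ts) = f(Ts T) Ts for polynomials f; it makes the adjoint of a cutoff the
  cutoff of the adjoint.\<close>

lemma g_intertwine:
  assumes "adjoint_pair T Ts c" "adjoint_pair Ts T c"
  shows "Ts (adjoint_pair.g T Ts c J x) = adjoint_pair.g Ts T c J (Ts x)"
proof -
  interpret a: adjoint_pair T Ts c by fact
  interpret b: adjoint_pair Ts T c by fact
  have D: "Ts (a.D x) = b.D (Ts x)" for x unfolding a.D_def b.D_def by (simp add: a.lin_simps)
  show ?thesis by (induction J) (simp_all add: a.lin_simps D)
qed

subsection \<open>Star polynomials\<close>

datatype expr = Var nat | One | Add expr expr | Mul expr expr | Scal complex expr | Adj expr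

text \<open>Star and unit are arguments so that one expression can be evaluated both in operators
  and in \<open>k \<times> k\<close> matrices, whose unit \<open>idm k\<close> varies with the
  size.\<close>

primrec ev :: "('a::{ring,scaleC} \<Rightarrow> 'a) \<Rightarrow> 'a \<Rightarrow> (nat \<Rightarrow> 'a) \<Rightarrow> expr \<Rightarrow> 'a" where
  "ev st e1 X (Var i) = X i"
| "ev st e1 X One = e1"
| "ev st e1 X (Add e f) = ev st e1 X e + ev st e1 X f"
| "ev st e1 X (Mul e f) = ev st e1 X e * ev st e1 X f"
| "ev st e1 X (Scal c e) = c *\<^sub>C ev st e1 X e"
| "ev st e1 X (Adj e) = st (ev st e1 X e)"

primrec vars :: "expr \<Rightarrow> nat set" where
  "vars (Var i) = {i}"
| "vars One = {}"
| "vars (Add e f) = vars e \<union> vars f"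
| "vars (Mul e f) = vars e \<union> vars f"
| "vars (Scal c e) = vars e"
| "vars (Adj e) = vars e"

text \<open>A norm bound for the value at arguments of norm at most \<open>R\<close>. It is read off
  the expression alone and so holds for operators and for matrices of all sizes.\<close>

primrec ebd :: "real \<Rightarrow> expr \<Rightarrow> real" where
  "ebd R (Var i) = R"
| "ebd R One = 1"
| "ebd R (Add e f) = ebd R e + ebd R f"
| "ebd R (Mul e f) = ebd R e * ebd R f"
| "ebd R (Scal c e) = cmod c * ebd R e"
| "ebd R (Adj e) = ebd R e"

text \<open>The recursion for \<open>g J (T x)\<close> written as an expression in \<open>t\<close>
  and \<open>Adj t\<close>; for want of a zero expression it starts at
  \<open>Scal 0 t\<close>.\<close>

primrec cutE :: "real \<Rightarrow> expr \<Rightarrow> nat \<Rightarrow> expr" where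
  "cutE c t 0 = Scal 0 t"
| "cutE c t (Suc J) = Add (Scal (of_real (1 / (1 + c))) t)
    (Scal (of_real (1 / (1 + c))) (Add (Scal (of_real c) (cutE c t J))
      (Scal (-1) (Mul t (Mul (Adj t) (cutE c t J))))))"

definition cutoff :: "real \<Rightarrow> expr \<Rightarrow> nat \<Rightarrow> expr" where "cutoff R t J = cutE ((ebd R t)\<^sup>2) t J"

lemma vars_cutE: "vars (cutE c t J) \<subseteq> vars t"
  by (induction J) auto

lemma vars_cut: "vars (cutoff R t J) \<subseteq> vars t"
  unfolding cutoff_def by (rule vars_cutE)

abbreviation evo :: "(nat \<Rightarrow> 'a::complex_hilbert bop) \<Rightarrow> expr \<Rightarrow> 'a bop" where "evo \<equiv> ev adj 1"

lemma ebd_nonneg: "0 \<le> R \<Longrightarrow> 0 \<le> ebd R e" by (induction e) auto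

lemma opb_evo: "(\<And>i. i \<in> vars e \<Longrightarrow> opb (X i) R) \<Longrightarrow> opb (evo X e) (ebd R e)"
  by (induction e) (auto intro: opb_add opb_mult opb_scaleC opb_adj opb_one)

lemma adjoint_pair_app: assumes "opb T K" shows "adjoint_pair (app T) (app (adj T)) (K\<^sup>2)"
proof (rule adjoint_pair.intro)
  show "linear (app T)" "linear (app (adj T))"
    using bounded_linear_app bounded_linear.linear by blast+
  show "inner (app T x) y = inner x (app (adj T) y)" for x y by (rule inner_adj)
  show "(norm (app T x))\<^sup>2 \<le> K\<^sup>2 * (norm x)\<^sup>2" for x
    using power_mono[OF opbD[OF assms], of x 2] by (simp add: power_mult_distrib)
qed simp

lemma adjoint_pair_app': "opb T K \<Longrightarrow> adjoint_pair (app (adj T)) (app T) (K\<^sup>2)"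
  using adjoint_pair_app[OF opb_adj] by fastforce

lemma app_cutE:
  assumes "opb (evo X t) K"
  shows "app (evo X (cutE (K\<^sup>2) t J)) x = adjoint_pair.g (app (evo X t)) (app (adj (evo X t))) (K\<^sup>2) J (app (evo X t) x)"
proof -
  interpret adjoint_pair "app (evo X t)" "app (adj (evo X t))" "K\<^sup>2" by (rule adjoint_pair_app) fact
  show ?thesis by (induction J) (simp_all add: D_def scaleC_of_real del: of_real_divide of_real_add of_real_power)
qed

lemma app_adj_cutE:
  assumes "opb (evo X t) K"
  shows "app (adj (evo X (cutE (K\<^sup>2) t J))) x = adjoint_pair.g (app (adj (evo X t))) (app (evo X t)) (K\<^sup>2) J (app (adj (evo X t)) x)"
proof -
  interpret a: adjoint_pair "app (evo X t)" "app (adj (evo X t))" "K\<^sup>2" by (rule adjoint_pair_app) fact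
  interpret b: adjoint_pair "app (adj (evo X t))" "app (evo X t)" "K\<^sup>2" by (rule adjoint_pair_app') fact
  have "inner y (app (adj (evo X (cutE (K\<^sup>2) t J))) x) = inner y (b.g J (app (adj (evo X t)) x))" for y
    unfolding inner_adj[symmetric] app_cutE[OF assms] a.g_self_adjoint g_intertwine[OF a.adjoint_pair_axioms b.adjoint_pair_axioms, symmetric]
    by (rule refl)
  then show ?thesis using vector_eq_ldot by blast
qed

lemma opb_cut:
  assumes "\<And>i. i \<in> vars t \<Longrightarrow> opb (X i) R"
  shows "opb (evo X (cutoff R t J)) 1"
proof -
  have K: "opb (evo X t) (ebd R t)" using opb_evo assms by blast
  interpret adjoint_pair "app (evo X t)" "app (adj (evo X t))" "(ebd R t)\<^sup>2"
    by (rule adjoint_pair_app[OF K])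
  show ?thesis unfolding cutoff_def opb_def by (auto simp: app_cutE[OF K] norm_g_T)
qed

subsection \<open>The weak operator topology\<close>

lemma openin_wot_basic: "open U \<Longrightarrow> openin weak_operator_topology {T. cinner (app T x) y \<in> U}"
  unfolding weak_operator_topology_def by (rule topology_generated_by_Basis) blast

lemma topspace_wot [simp]: "topspace weak_operator_topology = UNIV"
  using openin_subset[OF openin_wot_basic[of UNIV]] by auto

lemma openin_wot_finite:
  assumes "finite P" "\<And>p. p \<in> P \<Longrightarrow> open (U p)"
  shows "openin weak_operator_topology {T. \<forall>p\<in>P. cinner (app T (fst p)) (snd p) \<in> U p}"
  using assms
proof (induction P)
  case empty
  then show ?case using openin_topspace[of weak_operator_topology] by simp
next
  case (insert p P)
  have "{T. \<forall>q\<in>insert p P. cinner (app T (fst q)) (snd q) \<in> U q} =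
    {T. cinner (app T (fst p)) (snd p) \<in> U p} \<inter> {T. \<forall>p\<in>P. cinner (app T (fst p)) (snd p) \<in> U p}" by auto
  then show ?case using insert by (simp add: openin_Int openin_wot_basic)
qed

lemma openin_wotE:
  assumes "openin weak_operator_topology U" "a \<in> U"
  shows "\<exists>P \<epsilon>. finite P \<and> 0 < \<epsilon> \<and> (\<forall>b. (\<forall>p\<in>P. cmod (cinner (app b (fst p)) (snd p)
    - cinner (app a (fst p)) (snd p)) < \<epsilon>) \<longrightarrow> b \<in> U)"
proof -
  have "generate_topology_on {{T. cinner (app T x) y \<in> U} | x y U. open U} U"
    using assms(1) unfolding weak_operator_topology_def by (rule openin_topology_generated_by)
  then show ?thesis using assms(2)
  proof induction
    case (Int A B)
    from Int.prems have "a \<in> A" "a \<in> B" by auto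
    obtain P e where P: "finite P" "0 < e" "\<forall>b. (\<forall>p\<in>P. cmod (cinner (app b (fst p)) (snd p)
      - cinner (app a (fst p)) (snd p)) < e) \<longrightarrow> b \<in> A"
      using Int.IH(1)[OF \<open>a \<in> A\<close>] by (elim exE conjE)
    obtain Q d where Q: "finite Q" "0 < d" "\<forall>b. (\<forall>p\<in>Q. cmod (cinner (app b (fst p)) (snd p)
      - cinner (app a (fst p)) (snd p)) < d) \<longrightarrow> b \<in> B"
      using Int.IH(2)[OF \<open>a \<in> B\<close>] by (elim exE conjE)
    show ?case by (rule exI[of _ "P \<union> Q"], rule exI[of _ "min e d"]) (use P Q in auto)
  next
    case (UN K)
    then obtain k where k: "k \<in> K" "a \<in> k" by blast
    obtain P e where P: "finite P" "0 < e" "\<forall>b. (\<forall>p\<in>P. cmod (cinner (app b (fst p)) (snd p)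
      - cinner (app a (fst p)) (snd p)) < e) \<longrightarrow> b \<in> k"
      using UN.IH[OF k] by (elim exE conjE)
    show ?case by (rule exI[of _ P], rule exI[of _ e]) (use P k in auto)
  next
    case (Basis s)
    from Basis(1) obtain x y V where s: "s = {T. cinner (app T x) y \<in> V}" "open V"
      unfolding mem_Collect_eq by (elim exE conjE) (rule that)
    have "cinner (app a x) y \<in> V" using Basis s by simp
    then obtain e where e: "0 < e" "\<And>w. dist w (cinner (app a x) y) < e \<Longrightarrow> w \<in> V"
      using s(2) unfolding open_dist by metis
    show ?case by (rule exI[of _ "{(x, y)}"], rule exI[of _ e]) (use e s in \<open>auto simp: dist_norm\<close>)
  qed simp
qed

lemma in_wot_closure_iff:
  "x \<in> weak_operator_topology closure_of A \<longleftrightarrow> (\<forall>P \<epsilon>. finite P \<longrightarrow> 0 < \<epsilon> \<longrightarrow>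
    (\<exists>a\<in>A. \<forall>p\<in>P. cmod (cinner (app a (fst p)) (snd p) - cinner (app x (fst p)) (snd p)) < \<epsilon>))"
proof
  assume x: "x \<in> weak_operator_topology closure_of A"
  show "\<forall>P \<epsilon>. finite P \<longrightarrow> 0 < \<epsilon> \<longrightarrow>
    (\<exists>a\<in>A. \<forall>p\<in>P. cmod (cinner (app a (fst p)) (snd p) - cinner (app x (fst p)) (snd p)) < \<epsilon>)"
  proof (intro allI impI)
    fix P :: "('a \<times> 'a) set" and e :: real assume P: "finite P" "0 < e"
    let ?U = "\<lambda>p. ball (cinner (app x (fst p)) (snd p)) e"
    let ?S = "{T. \<forall>p\<in>P. cinner (app T (fst p)) (snd p) \<in> ?U p}"
    have op: "openin weak_operator_topology ?S" by (rule openin_wot_finite[OF P(1)]) simp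
    have xS: "x \<in> ?S" using P by simp
    have cl: "\<forall>T. x \<in> T \<and> openin weak_operator_topology T \<longrightarrow> (\<exists>y. y \<in> A \<and> y \<in> T)"
      by (rule conjunct2[OF x[unfolded in_closure_of]])
    have "\<exists>y. y \<in> A \<and> y \<in> ?S" by (rule mp[OF spec[OF cl, of ?S] conjI[OF xS op]])
    then obtain a where "a \<in> A" "a \<in> ?S" by (elim exE conjE) (rule that)
    then show "\<exists>a\<in>A. \<forall>p\<in>P. cmod (cinner (app a (fst p)) (snd p) - cinner (app x (fst p)) (snd p)) < e"
      by (intro bexI[of _ a]) (auto simp: dist_norm norm_minus_commute)
  qed
next
  assume R: "\<forall>P \<epsilon>. finite P \<longrightarrow> 0 < \<epsilon> \<longrightarrow>
    (\<exists>a\<in>A. \<forall>p\<in>P. cmod (cinner (app a (fst p)) (snd p) - cinner (app x (fst p)) (snd p)) < \<epsilon>)"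
  show "x \<in> weak_operator_topology closure_of A" unfolding in_closure_of
  proof (intro conjI allI impI)
    fix U assume "x \<in> U \<and> openin weak_operator_topology U"
    then have "openin weak_operator_topology U" "x \<in> U" by auto
    from openin_wotE[OF this] obtain P e where P:
      "finite P" "0 < e" "\<forall>b. (\<forall>p\<in>P. cmod (cinner (app b (fst p)) (snd p)
      - cinner (app x (fst p)) (snd p)) < e) \<longrightarrow> b \<in> U"
      by (elim exE conjE) (rule that)
    obtain a where "a \<in> A" "\<forall>p\<in>P. cmod (cinner (app a (fst p)) (snd p)
      - cinner (app x (fst p)) (snd p)) < e"
      using R[rule_format, OF P(1,2)] by (elim bexE) (rule that)
    then show "\<exists>y. y \<in> A \<and> y \<in> U" using P(3) by (intro exI[of _ a]) simp
  qed simp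
qed

lemma wot_closure_von_neumann_algebra:
  assumes one: "1 \<in> A" and add: "\<And>a b. a \<in> A \<Longrightarrow> b \<in> A \<Longrightarrow> a + b \<in> A"
    and mult: "\<And>a b. a \<in> A \<Longrightarrow> b \<in> A \<Longrightarrow> a * b \<in> A"
    and scale: "\<And>c a. a \<in> A \<Longrightarrow> c *\<^sub>C a \<in> A" and adj: "\<And>a. a \<in> A \<Longrightarrow> adj a \<in> A"
  shows "von_neumann_algebra (weak_operator_topology closure_of A)"
proof -
  let ?C = "weak_operator_topology closure_of A"
  have approx: "\<exists>a\<in>A. \<forall>p\<in>P. cmod (cinner (app a (fst p)) (snd p) - cinner (app x (fst p)) (snd p)) < e"
    if "x \<in> ?C" "finite P" "0 < e" for x P e
    using that(1)[unfolded in_wot_closure_iff, rule_format, OF that(2,3)] .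
  have "x + y \<in> ?C" if x: "x \<in> ?C" and y: "y \<in> ?C" for x y
    unfolding in_wot_closure_iff
  proof (intro allI impI)
    fix P :: "('a \<times> 'a) set" and e :: real assume P: "finite P" "0 < e"
    obtain a where a: "a \<in> A" "\<forall>p\<in>P. cmod (cinner (app a (fst p)) (snd p)
      - cinner (app x (fst p)) (snd p)) < e/2"
      by (rule bexE[OF approx[OF x P(1) half_gt_zero[OF P(2)]]]) (rule that)
    obtain b where b: "b \<in> A" "\<forall>p\<in>P. cmod (cinner (app b (fst p)) (snd p)
      - cinner (app y (fst p)) (snd p)) < e/2"
      by (rule bexE[OF approx[OF y P(1) half_gt_zero[OF P(2)]]]) (rule that)
    show "\<exists>a\<in>A. \<forall>p\<in>P. cmod (cinner (app a (fst p)) (snd p) - cinner (app (x + y) (fst p)) (snd p)) < e"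
    proof (intro bexI[of _ "a + b"] ballI)
      fix p assume p: "p \<in> P"
      have "cinner (app (a + b) (fst p)) (snd p) - cinner (app (x + y) (fst p)) (snd p)
       = (cinner (app a (fst p)) (snd p) - cinner (app x (fst p)) (snd p))
         + (cinner (app b (fst p)) (snd p) - cinner (app y (fst p)) (snd p))"
        by (simp add: cinner_add_left)
      then show "cmod (cinner (app (a + b) (fst p)) (snd p) - cinner (app (x + y) (fst p)) (snd p)) < e"
        using norm_add_less[OF a(2)[rule_format, OF p] b(2)[rule_format, OF p]] by simp
    qed (use a b add in auto)
  qed
  moreover have "x * y \<in> ?C" if x: "x \<in> ?C" and y: "y \<in> ?C" for x y
    unfolding in_wot_closure_iff
  proof (intro allI impI)
    fix P :: "('a \<times> 'a) set" and e :: real assume P: "finite P" "0 < e"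
    obtain a where a: "a \<in> A" "\<forall>p\<in>(\<lambda>p. (app y (fst p), snd p)) ` P. cmod (cinner (app a (fst p)) (snd p) - cinner (app x (fst p)) (snd p)) < e/2"
      by (rule bexE[OF approx[OF x finite_imageI[OF P(1)] half_gt_zero[OF P(2)]]]) (rule that)
    \<comment> \<open>\<open>b\<close> is tested against vectors that depend on the chosen
      \<open>a\<close>: multiplication is only separately continuous in this topology.\<close>
    obtain b where b: "b \<in> A" "\<forall>p\<in>(\<lambda>p. (fst p, app (Defs.adj a) (snd p))) ` P. cmod (cinner (app b (fst p)) (snd p) - cinner (app y (fst p)) (snd p)) < e/2"
      by (rule bexE[OF approx[OF y finite_imageI[OF P(1)] half_gt_zero[OF P(2)]]]) (rule that)
    show "\<exists>a\<in>A. \<forall>p\<in>P. cmod (cinner (app a (fst p)) (snd p) - cinner (app (x * y) (fst p)) (snd p)) < e"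
    proof (intro bexI[of _ "a * b"] ballI)
      fix p assume p: "p \<in> P"
      have "cinner (app (a * b) (fst p)) (snd p) - cinner (app (x * y) (fst p)) (snd p)
       = (cinner (app a (app y (fst p))) (snd p) - cinner (app x (app y (fst p))) (snd p))
        + (cinner (app b (fst p)) (app (Defs.adj a) (snd p))
          - cinner (app y (fst p)) (app (Defs.adj a) (snd p)))"
        by (simp add: cinner_adj)
      moreover have "cmod (cinner (app a (app y (fst p))) (snd p)
        - cinner (app x (app y (fst p))) (snd p)) < e/2"
        using a(2) p by simp
      moreover have "cmod (cinner (app b (fst p)) (app (Defs.adj a) (snd p))
        - cinner (app y (fst p)) (app (Defs.adj a) (snd p))) < e/2"
        using b(2) p by simp
      ultimately show "cmod (cinner (app (a * b) (fst p)) (snd p)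
        - cinner (app (x * y) (fst p)) (snd p)) < e"
        by (smt (verit) field_sum_of_halves norm_triangle_ineq)
    qed (use a b mult in auto)
  qed
  moreover have "c *\<^sub>C x \<in> ?C" if x: "x \<in> ?C" for c x
    unfolding in_wot_closure_iff
  proof (intro allI impI)
    fix P :: "('a \<times> 'a) set" and e :: real assume P: "finite P" "0 < e"
    have "0 < e / (cmod c + 1)" using P by (simp add: add_nonneg_pos)
    from approx[OF x P(1) this] obtain a where a:
      "a \<in> A" "\<forall>p\<in>P. cmod (cinner (app a (fst p)) (snd p) - cinner (app x (fst p)) (snd p))
      < e / (cmod c + 1)"
      by (elim bexE) (rule that)
    show "\<exists>a\<in>A. \<forall>p\<in>P. cmod (cinner (app a (fst p)) (snd p) - cinner (app (c *\<^sub>C x) (fst p)) (snd p))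
      < e"
    proof (intro bexI[of _ "c *\<^sub>C a"] ballI)
      fix p assume p: "p \<in> P"
      have "cmod (cinner (app (c *\<^sub>C a) (fst p)) (snd p) - cinner (app (c *\<^sub>C x) (fst p)) (snd p))
       = cmod c * cmod (cinner (app a (fst p)) (snd p) - cinner (app x (fst p)) (snd p))"
        by (simp add: cinner_scaleC_left flip: right_diff_distrib norm_mult)
      also have "\<dots> \<le> cmod c * (e / (cmod c + 1))" using a(2) p
        by (intro mult_left_mono) (auto intro: less_imp_le)
      also have "\<dots> < e" using P(2) by (simp add: pos_divide_less_eq add_pos_nonneg algebra_simps)
      finally show "cmod (cinner (app (c *\<^sub>C a) (fst p)) (snd p)
        - cinner (app (c *\<^sub>C x) (fst p)) (snd p)) < e" .
    qed (use a scale in auto)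
  qed
  moreover have "Defs.adj x \<in> ?C" if x: "x \<in> ?C" for x
    unfolding in_wot_closure_iff
  proof (intro allI impI)
    fix P :: "('a \<times> 'a) set" and e :: real assume P: "finite P" "0 < e"
    obtain a where a: "a \<in> A" "\<forall>p\<in>(\<lambda>p. (snd p, fst p)) ` P. cmod (cinner (app a (fst p)) (snd p)
      - cinner (app x (fst p)) (snd p)) < e"
      by (rule bexE[OF approx[OF x finite_imageI[OF P(1)] P(2)]]) (rule that)
    show "\<exists>a\<in>A. \<forall>p\<in>P. cmod (cinner (app a (fst p)) (snd p)
      - cinner (app (Defs.adj x) (fst p)) (snd p)) < e"
    proof (intro bexI[of _ "Defs.adj a"] ballI)
      fix p assume p: "p \<in> P"
      have "cinner (app (Defs.adj a) (fst p)) (snd p) - cinner (app (Defs.adj x) (fst p)) (snd p)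
       = cnj (cinner (app a (snd p)) (fst p) - cinner (app x (snd p)) (fst p))"
        unfolding cinner_adj' complex_cnj_diff by (metis cinner_commute)
      then show "cmod (cinner (app (Defs.adj a) (fst p)) (snd p)
        - cinner (app (Defs.adj x) (fst p)) (snd p)) < e"
        using a(2) p by (simp flip: complex_cnj_diff)
    qed (use a adj in auto)
  qed
  moreover have "1 \<in> ?C" using one closure_of_subset[of A weak_operator_topology] by auto
  ultimately show ?thesis unfolding von_neumann_algebra_def by simp
qed

lemma von_neumann_bsot_closed:
  assumes M: "von_neumann_algebra M" and T: "\<And>i. T i \<in> M" and b: "bsot F T T0" and F: "F \<noteq> bot"
  shows "T0 \<in> M"
proof -
  have "M = weak_operator_topology closure_of M"
    using M by (metis closure_of_eq von_neumann_algebra_def)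
  moreover have "T0 \<in> weak_operator_topology closure_of M"
    unfolding in_wot_closure_iff
  proof (intro allI impI)
    fix P :: "('a \<times> 'a) set" and e :: real assume P: "finite P" "0 < e"
    have "\<forall>\<^sub>F i in F. \<forall>p\<in>P. cmod (cinner (app (T i) (fst p)) (snd p)
      - cinner (app T0 (fst p)) (snd p)) < e"
    proof (rule eventually_ball_finite[OF P(1)], rule ballI)
      fix p
      have "((\<lambda>i. cinner (app (T i) (fst p)) (snd p)) \<longlongrightarrow> cinner (app T0 (fst p)) (snd p)) F"
        using b by (intro tendsto_cinner tendsto_const) (auto simp: bsot_def)
      then show "\<forall>\<^sub>F i in F. cmod (cinner (app (T i) (fst p)) (snd p)
        - cinner (app T0 (fst p)) (snd p)) < e"
        using P(2) by (simp add: tendsto_iff dist_norm)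
    qed
    then obtain i where "\<forall>p\<in>P. cmod (cinner (app (T i) (fst p)) (snd p)
      - cinner (app T0 (fst p)) (snd p)) < e"
      using eventually_happens'[OF F] by blast
    then show "\<exists>a\<in>M. \<forall>p\<in>P. cmod (cinner (app a (fst p)) (snd p) - cinner (app T0 (fst p)) (snd p)) < e"
      using T by blast
  qed
  ultimately show ?thesis by simp
qed

subsection \<open>Approximation by star polynomials\<close>

instance complex_hilbert \<subseteq> banach ..

text \<open>The operators and their adjoints converge pointwise separately; passing to the limit in
  the inner product shows that the two limits are adjoint.\<close>

lemma geometric_limit_bop:
  fixes T :: "nat \<Rightarrow> 'a::complex_hilbert bop"
  assumes d: "\<And>n. opb (T (Suc n) - T n) ((1/2) ^ n)" and K: "\<And>n. opb (T n) K"
  obtains T0 where "bsot sequentially T T0"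
proof -
  have *: "\<exists>S0. \<forall>x. (\<lambda>n. app (S n) x) \<longlonglongrightarrow> app S0 x"
    if d: "\<And>n. opb (S (Suc n) - S n) ((1/2) ^ n)" and K: "\<And>n. opb (S n) K" for S :: "nat \<Rightarrow> 'a bop"
  proof -
    have "convergent (\<lambda>n. app (S n) x)" for x
    proof -
      have "summable (\<lambda>n. app (S (Suc n)) x - app (S n) x)"
      proof (rule summable_comparison_test'[where N = 0])
        show "summable (\<lambda>n. (1/2) ^ n * norm x)" by (intro summable_mult2 summable_geometric) simp
        show "norm (app (S (Suc n)) x - app (S n) x) \<le> (1/2) ^ n * norm x" for n
          using opbD[OF d[of n], of x] by simp
      qed
      then have "convergent (\<lambda>n. \<Sum>i<n. app (S (Suc i)) x - app (S i) x)"
        by (simp add: summable_iff_convergent)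
      then have "convergent (\<lambda>n. app (S n) x - app (S 0) x)"
        unfolding sum_lessThan_telescope[of "\<lambda>i. app (S i) x"] .
      then show ?thesis by (simp add: convergent_diff_const_right_iff)
    qed
    then obtain f where f: "\<And>x. (\<lambda>n. app (S n) x) \<longlonglongrightarrow> f x" unfolding convergent_def by metis
    have add: "f (x + y) = f x + f y" for x y
      using tendsto_add[OF f[of x] f[of y]] f[of "x + y"] by (simp add: LIMSEQ_unique)
    have sc: "f (c *\<^sub>C x) = c *\<^sub>C f x" for c x
      using bounded_linear.tendsto[OF bounded_linear_scaleC f[of x], of c] f[of "c *\<^sub>C x"]
      by (simp add: LIMSEQ_unique)
    have sr: "f (r *\<^sub>R x) = r *\<^sub>R f x" for r x
      using sc[of "complex_of_real r" x] by (simp add: scaleC_of_real)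
    have bd: "norm (f x) \<le> norm x * K" for x
    proof (rule LIMSEQ_le_const2[OF tendsto_norm[OF f]])
      show "\<exists>N. \<forall>n\<ge>N. norm (app (S n) x) \<le> norm x * K"
        using opbD[OF K] by (simp add: mult.commute)
    qed
    have "bounded_linear f" by (rule bounded_linear_intro[OF add sr bd])
    then have "bounded_clinear f" using sc by (simp add: bounded_clinear_def)
    then have "app (Abs_bop f) = f" by (simp add: Abs_bop_inverse)
    then show ?thesis using f by metis
  qed
  obtain T0 where T0: "\<And>x. (\<lambda>n. app (T n) x) \<longlonglongrightarrow> app T0 x" using *[OF d K] by blast
  have "opb (adj (T (Suc n)) - adj (T n)) ((1/2) ^ n)" for n
    using opb_adj[OF d[of n]] by simp
  then obtain S0 where S0: "\<And>x. (\<lambda>n. app (adj (T n)) x) \<longlonglongrightarrow> app S0 x"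
    using *[of "\<lambda>n. adj (T n)", OF _ opb_adj[OF K]] by blast
  have "adj T0 = S0"
  proof (rule adjoint_unique)
    fix x y
    have "(\<lambda>n. cinner (app (T n) x) y) \<longlonglongrightarrow> cinner (app T0 x) y"
      by (intro tendsto_cinner tendsto_const T0)
    moreover have "(\<lambda>n. cinner (app (T n) x) y) \<longlonglongrightarrow> cinner x (app S0 y)"
      unfolding cinner_adj by (intro tendsto_cinner tendsto_const S0)
    ultimately show "cinner (app T0 x) y = cinner x (app S0 y)" by (rule LIMSEQ_unique)
  qed
  then have "bsot sequentially T T0" unfolding bsot_def using K T0 S0 by blast
  then show thesis by (rule that)
qed

lemma bsot_unique: assumes "bsot F T S" "bsot F T S'" "F \<noteq> bot" shows "S = S'"
proof (rule bop_eqI)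
  fix x show "app S x = app S' x"
    using assms unfolding bsot_def by (intro tendsto_unique[of F "\<lambda>i. app (T i) x"]) auto
qed

text \<open>
  The equation says \<open>x = (1 + z adj z)\<^sup>-\<^sup>1 z\<close>, so that \<open>x\<close> is the limit of the cutoffs of \<open>z\<close>, and
  nearly the cutoff of any \<open>t\<close> that is close to \<open>z\<close> in the strong-* sense.
\<close>

lemma cutoff_preimage:
  assumes M: "von_neumann_algebra M" and x: "x \<in> M" "opb x (1/8)"
  obtains z where "z \<in> M" "z = x + z * adj z * x"
proof -
  \<comment> \<open>Picard iteration for z = x + z adj(z) x. With \<open>x\<close> of norm 1/8 the
    ball of radius 1/4 is preserved, and consecutive differences shrink by the factor (1/4 + 1/4) /
    8.\<close>
  define zz where "zz = rec_nat 0 (\<lambda>_ z. x + z * adj z * x)"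
  have z0: "zz 0 = 0" and zS: "\<And>n. zz (Suc n) = x + zz n * adj (zz n) * x" by (simp_all add: zz_def)
  have bd: "opb (zz n) (1/4)" for n
  proof (induction n)
    case 0 show ?case using opb_mono[OF opb_zero, of "1/4"] by (simp add: z0)
  next
    case (Suc n)
    have "opb (zz (Suc n)) (1/8 + (1/4 * (1/4)) * (1/8))"
      unfolding zS by (intro opb_add opb_mult opb_adj Suc x)
    then show ?case by (rule opb_mono) simp
  qed
  have d: "opb (zz (Suc n) - zz n) ((1/2) ^ n)" for n
  proof (induction n)
    case 0 show ?case using opb_mono[OF x(2), of 1] by (simp add: z0 zS)
  next
    case (Suc n)
    let ?d = "zz (Suc n) - zz n"
    have "zz (Suc (Suc n)) - zz (Suc n) = (?d * adj (zz (Suc n)) + zz n * adj ?d) * x"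
      by (simp add: zS[of "Suc n"] algebra_simps) (simp add: zS algebra_simps)
    moreover have "opb ((?d * adj (zz (Suc n)) + zz n * adj ?d) * x) (((1/2) ^ n * (1/4)
      + 1/4 * (1/2) ^ n) * (1/8))"
      by (intro opb_mult opb_add opb_adj bd Suc x)
    ultimately show ?case by (auto elim: opb_mono)
  qed
  obtain z where z: "bsot sequentially zz z" using geometric_limit_bop[OF d bd] .
  have zM: "zz n \<in> M" for n
  proof (induction n)
    case 0
    have "0 *\<^sub>C x \<in> M" using M x unfolding von_neumann_algebra_def by blast
    then show ?case by (simp add: z0)
  next
    case (Suc n)
    then have "adj (zz n) \<in> M" using M unfolding von_neumann_algebra_def by blast
    then have "zz n * adj (zz n) \<in> M" using M Suc unfolding von_neumann_algebra_def by blast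
    then have "zz n * adj (zz n) * x \<in> M" using M x unfolding von_neumann_algebra_def by blast
    then show ?case using M x unfolding zS von_neumann_algebra_def by blast
  qed
  have "z \<in> M" using von_neumann_bsot_closed[OF M zM z] by simp
  moreover have "bsot sequentially (\<lambda>n. zz (Suc n)) (x + z * adj z * x)"
    unfolding zS by (intro bsot_add bsot_mult bsot_const bsot_adj z)
  moreover have "bsot sequentially (\<lambda>n. zz (Suc n)) z"
    using z unfolding bsot_def by (auto intro: LIMSEQ_Suc)
  ultimately show thesis using that bsot_unique sequentially_bot by metis
qed

text \<open>1 + z adj(z) maps both x (1 + adj(z) z) and z to z (1 + adj(z) z), and it is injective;
  taking adjoints gives the claim. This is the equation \<open>cutoff_error\<close> needs for the
  adjoint cutoffs.\<close>

lemma cutoff_preimage_adj: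
  assumes z: "z = x + z * adj z * x"
  shows "adj z = adj x + adj z * z * adj x"
proof -
  have "app (x + x * adj z * z) \<xi> = app z \<xi>" for \<xi>
  proof -
    define w where "w = app (x + x * adj z * z) \<xi> - app z \<xi>"
    have e: "x + x * adj z * z + z * adj z * (x + x * adj z * z)
      = (x + z * adj z * x) + (x + z * adj z * x) * (adj z * z)"
      by (simp add: algebra_simps)
    have "x + x * adj z * z + z * adj z * (x + x * adj z * z) = z + z * adj z * z"
      unfolding e using z[symmetric] by (simp add: mult.assoc)
    then have "app (x + x * adj z * z + z * adj z * (x + x * adj z * z)) \<xi>
      = app (z + z * adj z * z) \<xi>" by simp
    then have "w + app z (app (adj z) w) = 0"
      unfolding w_def by (simp add: algebra_simps)
    then have "inner w w + inner w (app z (app (adj z) w)) = 0"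
      by (metis inner_add_right inner_zero_right)
    moreover have "inner w (app z (app (adj z) w)) = inner (app (adj z) w) (app (adj z) w)"
      by (metis inner_adj inner_commute)
    ultimately have "inner w w = 0" by (smt (verit) inner_ge_zero)
    then show ?thesis by (simp add: w_def)
  qed
  then have "z = x + x * adj z * z" by (metis bop_eqI)
  from arg_cong[OF this, of adj] show ?thesis by (simp add: mult.assoc)
qed

section \<open>Strong-star density of star polynomials\<close>

definition polys :: "nat \<Rightarrow> (nat \<Rightarrow> 'a::complex_hilbert bop) \<Rightarrow> 'a bop set"
  where "polys n X = {evo X e | e. vars e \<subseteq> {..<n}}"

lemma polysI: "vars e \<subseteq> {..<n} \<Longrightarrow> evo X e \<in> polys n X"
  unfolding polys_def by blast

lemma polysE: assumes "a \<in> polys n X" obtains e where "vars e \<subseteq> {..<n}" "a = evo X e"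
  using assms unfolding polys_def by blast

lemma polys_closed:
  "1 \<in> polys n X" "a \<in> polys n X \<Longrightarrow> b \<in> polys n X \<Longrightarrow> a + b \<in> polys n X"
  "a \<in> polys n X \<Longrightarrow> b \<in> polys n X \<Longrightarrow> a * b \<in> polys n X"
  "a \<in> polys n X \<Longrightarrow> c *\<^sub>C a \<in> polys n X" "a \<in> polys n X \<Longrightarrow> adj a \<in> polys n X"
proof -
  show "1 \<in> polys n X" using polysI[of One n X] by simp
  show "a + b \<in> polys n X" if ab: "a \<in> polys n X" "b \<in> polys n X"
    by (rule polysE[OF ab(1)], rule polysE[OF ab(2)]) (metis Un_least polysI ev.simps(3) vars.simps(3))
  show "a * b \<in> polys n X" if ab: "a \<in> polys n X" "b \<in> polys n X"
    by (rule polysE[OF ab(1)], rule polysE[OF ab(2)]) (metis Un_least polysI ev.simps(4) vars.simps(4))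
  show "c *\<^sub>C a \<in> polys n X" if a: "a \<in> polys n X"
    by (rule polysE[OF a]) (metis polysI ev.simps(5) vars.simps(5))
  show "adj a \<in> polys n X" if a: "a \<in> polys n X"
    by (rule polysE[OF a]) (metis polysI ev.simps(6) vars.simps(6))
qed

text \<open>The values of \<open>a\<close> and of \<open>adj a\<close> on \<open>V\<close> form one
  tuple. Since \<open>adj\<close> is conjugate linear, such tuples form a real subspace only, which
  \<open>weak_imp_strong_approx\<close> allows; weak approximation controls both halves at
  once.\<close>

lemma strong_star_approx:
  fixes z :: "'a::complex_hilbert bop"
  assumes z: "z \<in> weak_operator_topology closure_of polys n X" and V: "finite V" and "0 < \<epsilon>"
  shows "\<exists>t. vars t \<subseteq> {..<n} \<and> (\<forall>v\<in>V. norm (app (evo X t) v - app z v) < \<epsilon>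
    \<and> norm (app (adj (evo X t)) v - app (adj z) v) < \<epsilon>)"
proof -
  define f where "f a = (\<lambda>(v, b). if b then app a v else app (adj a) v)" for a :: "'a bop"
  define I where "I = V \<times> (UNIV :: bool set)"
  have fin: "finite I" using V by (simp add: I_def)
  have sub: "(\<lambda>i. h i + r *\<^sub>R k i) \<in> f ` polys n X" if hk:
    "h \<in> f ` polys n X" "k \<in> f ` polys n X" for h k r
  proof -
    obtain a where a: "h = f a" "a \<in> polys n X" using hk(1) by (rule imageE)
    obtain b where b: "k = f b" "b \<in> polys n X" using hk(2) by (rule imageE)
    have "(\<lambda>i. h i + r *\<^sub>R k i) = f (a + of_real r *\<^sub>C b)"
      unfolding a b f_def by (auto simp: fun_eq_iff scaleC_of_real)
    moreover have "a + of_real r *\<^sub>C b \<in> polys n X" by (intro polys_closed a b)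
    ultimately show ?thesis by simp
  qed
  have weak: "\<exists>h\<in>f ` polys n X. \<forall>i\<in>I. \<bar>inner (g i) (f z i - h i)\<bar> < e" if "0 < e" for g e
  proof -
    \<comment> \<open>For the adjoint half the test vectors are exchanged: pairing
      \<open>adj a\<close> at \<open>v\<close> with a vector is pairing \<open>v\<close> with
      \<open>a\<close> at that vector.\<close>
    define P where "P = (\<lambda>v. (v, g (v, True))) ` V \<union> (\<lambda>v. (g (v, False), v)) ` V"
    have "finite P" using V by (simp add: P_def)
    from z[unfolded in_wot_closure_iff, rule_format, OF this \<open>0 < e\<close>]
    obtain a where a: "a \<in> polys n X" "\<forall>p\<in>P. cmod (cinner (app a (fst p)) (snd p)
      - cinner (app z (fst p)) (snd p)) < e"
      by (elim bexE) (rule that)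
    have p: "\<bar>inner (app a x - app z x) y\<bar> < e" if "(x, y) \<in> P" for x y
    proof -
      have "\<bar>inner (app a x - app z x) y\<bar> \<le> cmod (cinner (app a x) y - cinner (app z x) y)"
        by (metis Re_cinner cinner_diff_left abs_Re_le_cmod)
      then show ?thesis using a(2) that by fastforce
    qed
    have "\<bar>inner (g i) (f z i - f a i)\<bar> < e" if "i \<in> I" for i
    proof -
      obtain v b where i: "i = (v, b)" "v \<in> V" using \<open>i \<in> I\<close> by (auto simp: I_def)
      show ?thesis
      proof (cases b)
        case True
        have "\<bar>inner (app a v - app z v) (g (v, True))\<bar> < e" by (rule p) (use i in \<open>simp add: P_def\<close>)
        then show ?thesis using True by (simp add: i f_def inner_simps inner_commute abs_minus_commute)
      next
        case False
        have "\<bar>inner (app a (g (v, False)) - app z (g (v, False))) v\<bar> < e"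
          by (rule p) (use i in \<open>simp add: P_def\<close>)
        then show ?thesis using False by (simp add: i f_def inner_simps inner_adj abs_minus_commute)
      qed
    qed
    then show ?thesis using a(1) by blast
  qed
  have ne: "f ` polys n X \<noteq> {}" using polys_closed(1)[of n X] by (metis empty_iff image_is_empty)
  have "\<exists>h\<in>f ` polys n X. (\<Sum>i\<in>I. (norm (f z i - h i))\<^sup>2) < \<epsilon>\<^sup>2"
    by (rule weak_imp_strong_approx[where c = "f z", OF fin ne sub weak]) (use \<open>0 < \<epsilon>\<close> in simp_all)
  then obtain h where h: "h \<in> f ` polys n X" "(\<Sum>i\<in>I. (norm (f z i - h i))\<^sup>2) < \<epsilon>\<^sup>2"
    by (elim bexE) (rule that)
  obtain t where t: "vars t \<subseteq> {..<n}" "h = f (evo X t)" using h(1) by (auto elim: polysE)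
  have *: "norm (f z i - h i) < \<epsilon>" if "i \<in> I" for i
  proof -
    have "(norm (f z i - h i))\<^sup>2 \<le> (\<Sum>i\<in>I. (norm (f z i - h i))\<^sup>2)"
      by (rule member_le_sum[OF that _ fin]) simp
    then have "(norm (f z i - h i))\<^sup>2 < \<epsilon>\<^sup>2" using h(2) by (rule le_less_trans)
    then show ?thesis by (rule power_less_imp_less_base) (use \<open>0 < \<epsilon>\<close> in simp)
  qed
  show ?thesis
  proof (intro exI[of _ t] conjI t ballI)
    fix v assume v: "v \<in> V"
    show "norm (app (evo X t) v - app z v) < \<epsilon>"
      using *[of "(v, True)"] v by (simp add: I_def f_def t norm_minus_commute)
    show "norm (app (adj (evo X t)) v - app (adj z) v) < \<epsilon>"
      using *[of "(v, False)"] v by (simp add: I_def f_def t norm_minus_commute)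
  qed
qed

lemma cut_approx:
  fixes X :: "nat \<Rightarrow> 'a::complex_hilbert bop"
  assumes M: "von_neumann_algebra M" and sub: "M \<subseteq> weak_operator_topology closure_of polys n X"
    and X: "\<And>i. i < n \<Longrightarrow> opb (X i) R" and x: "x \<in> M" "opb x (1/8)" and V: "finite V" and "0 < \<epsilon>"
  shows "\<exists>t J. vars t \<subseteq> {..<n} \<and> (\<forall>v\<in>V. norm (app (evo X (cutoff R t J)) v - app x v) < \<epsilon>
    \<and> norm (app (adj (evo X (cutoff R t J))) v - app (adj x) v) < \<epsilon>)"
proof -
  obtain z where z: "z \<in> M" "z = x + z * adj z * x" using cutoff_preimage[OF M x] .
  note za = cutoff_preimage_adj[OF z(2)]
  \<comment> \<open>Exactly the vectors at which \<open>cutoff_error\<close> compares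
    \<open>t\<close> with \<open>z\<close>, for \<open>x\<close> and for its adjoint.\<close>
  define W where "W = V \<union> app x ` V \<union> app (adj z * x) ` V \<union> app (adj x) ` V \<union> app (z * adj x) ` V"
  \<comment> \<open>The coefficients in \<open>cutoff_error\<close> add up to 2 + 1 + 2 + 1 =
    6.\<close>
  define e where "e = \<epsilon> / 6"
  have e: "0 < e" using \<open>0 < \<epsilon>\<close> by (simp add: e_def)
  have "finite W" using V by (simp add: W_def)
  from strong_star_approx[OF subsetD[OF sub z(1)] this e] obtain t where t: "vars t \<subseteq> {..<n}"
    and tW: "\<forall>v\<in>W. norm (app (evo X t) v - app z v) < e \<and>
      norm (app (adj (evo X t)) v - app (adj z) v) < e"
    by (elim exE conjE) (rule that)
  have tz: "norm (app (evo X t) v - app z v) < e"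
    and tza: "norm (app (adj (evo X t)) v - app (adj z) v) < e"
    if "v \<in> W" for v
    using tW that by simp_all
  define K where "K = ebd R t"
  have K: "opb (evo X t) K" unfolding K_def using t X by (intro opb_evo) auto
  interpret a: adjoint_pair "app (evo X t)" "app (adj (evo X t))" "K\<^sup>2" by (rule adjoint_pair_app) fact
  interpret b: adjoint_pair "app (adj (evo X t))" "app (evo X t)" "K\<^sup>2" by (rule adjoint_pair_app') fact
  \<comment> \<open>The ratio depends on \<open>t\<close> through its bound \<open>K\<close>, so
    \<open>J\<close> can be chosen only after \<open>t\<close>.\<close>
  define q where "q = K\<^sup>2 / (1 + K\<^sup>2)"
  have "0 < 1 + K\<^sup>2" by (simp add: add_pos_nonneg)
  then have q: "0 \<le> q" "q < 1" by (simp_all add: q_def)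
  obtain B where B: "0 < B" "\<And>v. v \<in> V \<Longrightarrow> norm (app x v) \<le> B" "\<And>v. v \<in> V \<Longrightarrow> norm (app (adj x) v) \<le> B"
  proof -
    have "finite (norm ` (app x ` V \<union> app (adj x) ` V))" using V by simp
    then obtain B0 where "\<forall>y\<in>norm ` (app x ` V \<union> app (adj x) ` V). y \<le> B0"
      by (meson bdd_above_finite bdd_above_def)
    then have B0: "norm y \<le> max 1 B0" if "y \<in> app x ` V \<union> app (adj x) ` V" for y
      using that by (simp add: le_max_iff_disj)
    show thesis by (rule that[of "max 1 B0"]) (use B0 in auto)
  qed
  have "(\<lambda>J. q ^ J * B) \<longlonglongrightarrow> 0 * B" using q by (intro tendsto_mult tendsto_const LIMSEQ_power_zero) simp
  then have "\<forall>\<^sub>F J in sequentially. q ^ J * B < e" using e by (simp add: order_tendstoD(2))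
  then obtain J where J: "q ^ J * B < e" unfolding eventually_sequentially by blast
  have qJ: "q ^ J * norm y < e" if "norm y \<le> B" for y :: 'a
    using mult_left_mono[OF that, of "q ^ J"] q J by simp
  show ?thesis
  proof (intro exI[of _ t] exI[of _ J] conjI t ballI)
    fix v assume v: "v \<in> V"
    have w: "v \<in> W" "app x v \<in> W" "app (adj z) (app x v) \<in> W" "app (adj x) v \<in> W"
      "app z (app (adj x) v) \<in> W"
      using v by (auto simp: W_def)
    have "app z v = app x v + app z (app (adj z) (app x v))"
      using arg_cong[OF z(2), of "\<lambda>T. app T v"] by simp
    from a.cutoff_error[where z = "app z" and zs = "app (adj z)" and x = v and y = "app x v"
      and J = J, OF this]
    have "norm (app (evo X (cutoff R t J)) v - app x v) \<le> 2 * norm (app (evo X t) v - app z v)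
      + norm (app (adj (evo X t)) (app x v) - app (adj z) (app x v))
      + 2 * norm (app (evo X t) (app (adj z) (app x v)) - app z (app (adj z) (app x v)))
        + q ^ J * norm (app x v)"
      unfolding cutoff_def K_def[symmetric] app_cutE[OF K] q_def .
    then show "norm (app (evo X (cutoff R t J)) v - app x v) < \<epsilon>"
      using tz[OF w(1)] tza[OF w(2)] tz[OF w(3)] qJ[OF B(2)[OF v]] unfolding e_def by linarith
    have "app (adj z) v = app (adj x) v + app (adj z) (app z (app (adj x) v))"
      using arg_cong[OF za, of "\<lambda>T. app T v"] by simp
    from b.cutoff_error[where z = "app (adj z)" and zs = "app z" and x = v and y = "app (adj x) v"
      and J = J, OF this]
    have "norm (app (adj (evo X (cutoff R t J))) v - app (adj x) v)
      \<le> 2 * norm (app (adj (evo X t)) v - app (adj z) v)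
      + norm (app (evo X t) (app (adj x) v) - app z (app (adj x) v))
      + 2 * norm (app (adj (evo X t)) (app z (app (adj x) v)) - app (adj z) (app z (app (adj x) v)))
        + q ^ J * norm (app (adj x) v)"
      unfolding cutoff_def K_def[symmetric] app_adj_cutE[OF K] q_def .
    then show "norm (app (adj (evo X (cutoff R t J))) v - app (adj x) v) < \<epsilon>"
      using tza[OF w(1)] tz[OF w(4)] tza[OF w(5)] qJ[OF B(3)[OF v]] unfolding e_def by linarith
  qed
qed

text \<open>Index set of the approximating nets: finite sets of test vectors with a precision. The
  Hilbert space may be nonseparable, so sequences would not do.\<close>

definition approx_filter :: "('h set \<times> nat) filter"
  where "approx_filter = finite_subsets_at_top UNIV \<times>\<^sub>F sequentially"

lemma approx_filter_nonbot: "approx_filter \<noteq> bot"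
  unfolding approx_filter_def by (simp add: prod_filter_eq_bot)

lemma bsot_cut:
  fixes X :: "nat \<Rightarrow> 'a::complex_hilbert bop"
  assumes M: "von_neumann_algebra M" and sub: "M \<subseteq> weak_operator_topology closure_of polys n X"
    and X: "\<And>i. i < n \<Longrightarrow> opb (X i) R" and x: "x \<in> M" "opb x (1/8)"
  obtains t J where "\<And>i::'a set \<times> nat. vars (t i) \<subseteq> {..<n}"
    "bsot approx_filter (\<lambda>i. evo X (cutoff R (t i) (J i))) x"
proof -
  define P where "P i t J \<longleftrightarrow> vars t \<subseteq> {..<n} \<and> (finite (fst i) \<longrightarrow>
    (\<forall>v\<in>fst i. norm (app (evo X (cutoff R t J)) v - app x v) < 1 / Suc (snd i)
    \<and> norm (app (adj (evo X (cutoff R t J))) v - app (adj x) v) < 1 / Suc (snd i)))" for i ::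
      "'a set \<times> nat" and t J
  have "\<exists>t J. P i t J" for i
  proof (cases "finite (fst i)")
    case True
    show ?thesis using cut_approx[OF M sub X x True, of "1 / Suc (snd i)"] unfolding P_def by auto
  next
    case False
    \<comment> \<open>Infinite sets of test vectors are eventually excluded by the filter; any
      expression without variables serves there.\<close>
    then show ?thesis unfolding P_def by (intro exI[of _ One]) auto
  qed
  then obtain t J where P: "\<And>i. P i (t i) (J i)" by metis
  have t: "vars (t i) \<subseteq> {..<n}" for i using P by (simp add: P_def)
  have c: "norm (app (evo X (cutoff R (t i) (J i))) v - app x v) < 1 / Suc (snd i)
    \<and> norm (app (adj (evo X (cutoff R (t i) (J i)))) v - app (adj x) v) < 1 / Suc (snd i)"
    if "finite (fst i)" "v \<in> fst i" for i v
    using P[of i] that by (simp add: P_def)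
  have ev: "\<forall>\<^sub>F i in approx_filter. finite (fst i) \<and> v \<in> fst i \<and>
    1 / Suc (snd i) < e" if "0 < e" for v :: 'a and e
  proof -
    have "\<forall>\<^sub>F V in finite_subsets_at_top UNIV. finite V \<and> v \<in> V"
      by (subst eventually_finite_subsets_at_top) (auto intro!: exI[of _ "{v}"])
    moreover have "\<forall>\<^sub>F m in sequentially. 1 / real (Suc m) < e"
      using LIMSEQ_inverse_real_of_nat \<open>0 < e\<close>
        by (auto dest!: order_tendstoD(2) simp: inverse_eq_divide)
    ultimately have "\<forall>\<^sub>F p in approx_filter. (finite (fst p) \<and> v \<in> fst p) \<and> 1 / real (Suc (snd p)) < e"
      unfolding approx_filter_def by (rule eventually_prodI)
    then show ?thesis by (rule eventually_mono) auto
  qed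
  have "bsot approx_filter (\<lambda>i. evo X (cutoff R (t i) (J i))) x"
    unfolding bsot_def
  proof (intro conjI allI)
    have "opb (evo X (cutoff R (t i) (J i))) 1" for i using t X by (intro opb_cut) blast
    then show "\<exists>K. \<forall>i. opb (evo X (cutoff R (t i) (J i))) K" by blast
    fix v
    show "((\<lambda>i. app (evo X (cutoff R (t i) (J i))) v) \<longlongrightarrow> app x v) approx_filter"
      unfolding tendsto_iff dist_norm
    proof (intro allI impI)
      fix e :: real assume "0 < e"
      from ev[OF this, of v] show "\<forall>\<^sub>F i in approx_filter. norm (app (evo X (cutoff R (t i) (J i))) v - app x v) < e"
      proof (rule eventually_mono)
        fix i assume a: "finite (fst i) \<and> v \<in> fst i \<and> 1 / Suc (snd i) < e"
        then have "norm (app (evo X (cutoff R (t i) (J i))) v - app x v) < 1 / Suc (snd i)"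
          using c[of i v] by blast
        with a show "norm (app (evo X (cutoff R (t i) (J i))) v - app x v) < e" by linarith
      qed
    qed
    show "((\<lambda>i. app (adj (evo X (cutoff R (t i) (J i)))) v) \<longlongrightarrow> app (adj x) v) approx_filter"
      unfolding tendsto_iff dist_norm
    proof (intro allI impI)
      fix e :: real assume "0 < e"
      from ev[OF this, of v] show "\<forall>\<^sub>F i in approx_filter. norm (app (adj (evo X (cutoff R (t i) (J i)))) v - app (adj x) v) < e"
      proof (rule eventually_mono)
        fix i assume a: "finite (fst i) \<and> v \<in> fst i \<and> 1 / Suc (snd i) < e"
        then have "norm (app (adj (evo X (cutoff R (t i) (J i)))) v - app (adj x) v)
          < 1 / Suc (snd i)" using c[of i v] by blast
        with a show "norm (app (adj (evo X (cutoff R (t i) (J i)))) v - app (adj x) v) < e" by linarith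
      qed
    qed
  qed
  with t show thesis by (rule that)
qed

lemma opb_common: obtains R where "0 \<le> R" "\<And>i. i < (n::nat) \<Longrightarrow> opb (X i) R"
proof -
  have "\<forall>i. \<exists>K. opb (X i) K" using opb_ex by blast
  from choice[OF this] obtain K where K: "\<And>i. opb (X i) (K i)" by blast
  have "opb (X i) (\<Sum>j<n. K j)" if "i < n" for i
    using K that by (intro opb_mono[OF K] member_le_sum) (auto simp: opb_def)
  moreover have "0 \<le> (\<Sum>j<n. K j)" using K by (intro sum_nonneg) (auto simp: opb_def)
  ultimately show thesis using that by blast
qed

text \<open>Scale \<open>x\<close> into the ball of radius 1/8, take cutoffs and scale back. The
  cutoffs supply the uniform bound that \<open>bsot\<close> demands of the net.\<close>

lemma bsot_poly:
  fixes X :: "nat \<Rightarrow> 'a::complex_hilbert bop"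
  assumes M: "von_neumann_algebra M" and sub: "M \<subseteq> weak_operator_topology closure_of polys n X"
    and x: "x \<in> M"
  obtains f where "\<And>i::'a set \<times> nat. vars (f i) \<subseteq> {..<n}" "bsot approx_filter (\<lambda>i. evo X (f i)) x"
proof -
  obtain R where R: "\<And>i. i < n \<Longrightarrow> opb (X i) R" using opb_common by blast
  obtain K where K: "opb x K" using opb_ex by blast
  define s where "s = 1 / (8 * (K + 1))"
  have s: "0 < s" "s * K \<le> 1/8" using K by (simp_all add: s_def opb_def field_simps)
  have x1: "complex_of_real s *\<^sub>C x \<in> M" using M x unfolding von_neumann_algebra_def by blast
  have x2: "opb (complex_of_real s *\<^sub>C x) (1/8)"
    by (rule opb_mono[OF opb_scaleC[OF K]]) (use s in simp)
  obtain t J where t: "\<And>i::'a set \<times> nat. vars (t i) \<subseteq> {..<n}"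
    and b: "bsot approx_filter (\<lambda>i. evo X (cutoff R (t i) (J i))) (complex_of_real s *\<^sub>C x)"
    by (rule bsot_cut[OF M sub _ x1 x2, where R = R], erule R, rule that)
  have "bsot approx_filter (\<lambda>i. complex_of_real (1/s) *\<^sub>C evo X (cutoff R (t i) (J i))) (complex_of_real (1/s) *\<^sub>C (complex_of_real s *\<^sub>C x))"
    by (rule bsot_scaleC[OF b])
  moreover have "complex_of_real (1/s) *\<^sub>C (complex_of_real s *\<^sub>C x) = x" using s by simp
  ultimately have l: "bsot approx_filter (\<lambda>i. evo X (Scal (complex_of_real (1/s)) (cutoff R (t i) (J i)))) x" by simp
  have "vars (Scal (complex_of_real (1/s)) (cutoff R (t i) (J i))) \<subseteq> {..<n}" for i
    using subset_trans[OF vars_cut t] by simp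
  then show thesis using l by (rule that)
qed

lemma bsot_ev:
  assumes "\<And>j. j \<in> vars e \<Longrightarrow> bsot F (\<lambda>i. Y i j) (X j)"
  shows "bsot F (\<lambda>i. evo (Y i) e) (evo X e)"
  using assms by (induction e) (auto intro: bsot_const bsot_add bsot_mult bsot_adj bsot_scaleC)

lemma von_neumann_ev: "von_neumann_algebra M \<Longrightarrow> (\<And>j. j \<in> vars e \<Longrightarrow> X j \<in> M) \<Longrightarrow> evo X e \<in> M"
  unfolding von_neumann_algebra_def by (induction e) auto

lemma vN_generated_least: "von_neumann_algebra A \<Longrightarrow> S \<subseteq> A \<Longrightarrow> vN_generated S \<subseteq> A"
  unfolding vN_generated_def by blast

lemma subset_vN_generated: "S \<subseteq> vN_generated S"
  unfolding vN_generated_def by blast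

lemma polys_closure_von_neumann: "von_neumann_algebra (weak_operator_topology closure_of polys n X)"
  by (rule wot_closure_von_neumann_algebra) (use polys_closed in auto)

lemma vars_in_polys_closure: "i < n \<Longrightarrow> X i \<in> weak_operator_topology closure_of polys n X"
  using closure_of_subset[of "polys n X" weak_operator_topology] polysI[of "Var i" n X] by auto

subsection \<open>Matrices of all sizes\<close>

text \<open>
  Finitely supported infinite matrices contain the \<open>k \<times> k\<close> matrices for every \<open>k\<close>; the norm
  is the unnormalised Hilbert-Schmidt norm.
\<close>

typedef fmat = "{f :: nat \<Rightarrow> nat \<Rightarrow> complex. \<exists>k. \<forall>i j. k \<le> i \<or> k \<le> j \<longrightarrow> f i j = 0}"
  morphisms ent Abs_fmat
  by (rule exI[of _ "\<lambda>_ _. 0"]) simp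

definition supp :: "nat \<Rightarrow> fmat \<Rightarrow> bool"
  where "supp k f \<longleftrightarrow> (\<forall>i j. k \<le> i \<or> k \<le> j \<longrightarrow> ent f i j = 0)"

lemma ent_Abs: "(\<And>i j. k \<le> i \<or> k \<le> j \<Longrightarrow> f i j = 0) \<Longrightarrow> ent (Abs_fmat f) = f"
  by (rule Abs_fmat_inverse) blast

lemma fmat_eqI: "(\<And>i j. ent f i j = ent g i j) \<Longrightarrow> f = g"
  by (metis ent_inject ext)

lemma suppD: "supp k f \<Longrightarrow> k \<le> i \<or> k \<le> j \<Longrightarrow> ent f i j = 0"
  unfolding supp_def by blast

lemma supp_mono: "supp k f \<Longrightarrow> k \<le> l \<Longrightarrow> supp l f"
  unfolding supp_def by (meson order_trans)

lemma supp_ex: "\<exists>k. supp k f"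
  using ent[of f] by (simp add: supp_def)

lemma supp_ex3: obtains k where "supp k f" "supp k g" "supp k h"
proof -
  obtain a b c where "supp a f" "supp b g" "supp c h" using supp_ex by metis
  then show thesis by (intro that[of "max a (max b c)"]) (auto elim: supp_mono)
qed

lemma sum_row: "supp k f \<Longrightarrow> (\<Sum>l\<in>{l. ent f i l \<noteq> 0}. ent f i l * h l) = (\<Sum>l<k. ent f i l * h l)"
  by (rule sum.mono_neutral_left) (auto simp: supp_def not_less[symmetric])

instantiation fmat :: "{ring, scaleC}"
begin

definition "0 = Abs_fmat (\<lambda>_ _. 0)"
definition "f + g = Abs_fmat (\<lambda>i j. ent f i j + ent g i j)"
definition "- f = Abs_fmat (\<lambda>i j. - ent f i j)"
definition "f - g = Abs_fmat (\<lambda>i j. ent f i j - ent g i j)"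
definition "f * g = Abs_fmat (\<lambda>i j. \<Sum>l\<in>{l. ent f i l \<noteq> 0}. ent f i l * ent g l j)"
definition "c *\<^sub>C f = Abs_fmat (\<lambda>i j. c * ent f i j)"

lemma ent_zero [simp]: "ent 0 i j = 0"
  unfolding zero_fmat_def by (subst ent_Abs[of 0]) auto

lemma ent_add [simp]: "ent (f + g) i j = ent f i j + ent g i j"
proof -
  obtain k where "supp k f" "supp k g" by (rule supp_ex3)
  then show ?thesis unfolding plus_fmat_def by (subst ent_Abs[of k]) (auto simp: suppD)
qed

lemma ent_minus [simp]: "ent (- f) i j = - ent f i j"
proof -
  obtain k where "supp k f" by (rule supp_ex3)
  then show ?thesis unfolding uminus_fmat_def by (subst ent_Abs[of k]) (auto simp: suppD)
qed

lemma ent_diff [simp]: "ent (f - g) i j = ent f i j - ent g i j"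
proof -
  obtain k where "supp k f" "supp k g" by (rule supp_ex3)
  then show ?thesis unfolding minus_fmat_def by (subst ent_Abs[of k]) (auto simp: suppD)
qed

lemma ent_scaleC [simp]: "ent (c *\<^sub>C f) i j = c * ent f i j"
proof -
  obtain k where "supp k f" by (rule supp_ex3)
  then show ?thesis unfolding scaleC_fmat_def by (subst ent_Abs[of k]) (auto simp: suppD)
qed

lemma ent_mult: assumes "supp k f" shows "ent (f * g) i j = (\<Sum>l<k. ent f i l * ent g l j)"
proof -
  obtain m where m: "supp m f" "supp m g" by (rule supp_ex3)
  have "ent (f * g) i j = (\<Sum>l\<in>{l. ent f i l \<noteq> 0}. ent f i l * ent g l j)"
    unfolding times_fmat_def by (subst ent_Abs[of m]) (use m in \<open>auto simp: suppD intro!: sum.neutral\<close>)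
  then show ?thesis using sum_row[OF assms] by simp
qed

lemma supp_add: "supp k f \<Longrightarrow> supp k g \<Longrightarrow> supp k (f + g)"
  by (simp add: supp_def)

lemma supp_mult: "supp k f \<Longrightarrow> supp k g \<Longrightarrow> supp k (f * g)"
  by (auto simp: supp_def ent_mult[of k])

instance
proof
  fix f g h :: fmat
  show "f * g * h = f * (g * h)"
  proof (rule fmat_eqI)
    fix i j
    obtain k where k: "supp k f" "supp k g" "supp k h" by (rule supp_ex3)
    have "ent (f * g * h) i j = (\<Sum>l<k. \<Sum>m<k. ent f i m * ent g m l * ent h l j)"
      using k by (simp add: ent_mult[of k] supp_mult sum_distrib_right)
    also have "\<dots> = (\<Sum>m<k. \<Sum>l<k. ent f i m * ent g m l * ent h l j)" by (rule sum.swap)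
    also have "\<dots> = ent (f * (g * h)) i j"
      using k by (simp add: ent_mult[of k] sum_distrib_left mult.assoc)
    finally show "ent (f * g * h) i j = ent (f * (g * h)) i j" .
  qed
  show "f + g + h = f + (g + h)" "f + g = g + f" "0 + f = f" "- f + f = 0" "f - g = f + - g"
    by (rule fmat_eqI; simp)+
  obtain k where k: "supp k f" "supp k g" "supp k h" by (rule supp_ex3)
  show "(f + g) * h = f * h + g * h"
    by (rule fmat_eqI) (use k in \<open>simp add: ent_mult[of k] supp_add sum.distrib distrib_right\<close>)
  show "f * (g + h) = f * g + f * h"
    by (rule fmat_eqI) (use k in \<open>simp add: ent_mult[of k] supp_add sum.distrib distrib_left\<close>)
qed

end

definition hsp :: "fmat \<Rightarrow> fmat \<Rightarrow> complex"
  where "hsp f g = (\<Sum>p\<in>{p. ent f (fst p) (snd p) \<noteq> 0}. ent f (fst p) (snd p) * cnj (ent g (fst p) (snd p)))"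

lemma hsp_eq: assumes "supp k f" shows "hsp f g = (\<Sum>i<k. \<Sum>j<k. ent f i j * cnj (ent g i j))"
proof -
  have "hsp f g = (\<Sum>p\<in>{..<k} \<times> {..<k}. ent f (fst p) (snd p) * cnj (ent g (fst p) (snd p)))"
    unfolding hsp_def
  proof (rule sum.mono_neutral_left)
    have "fst p < k \<and> snd p < k" if "ent f (fst p) (snd p) \<noteq> 0" for p
      using suppD[OF assms] that by (meson not_le)
    then show "{p. ent f (fst p) (snd p) \<noteq> 0} \<subseteq> {..<k} \<times> {..<k}" by (auto simp: mem_Times_iff)
  qed auto
  then show ?thesis by (simp add: sum.cartesian_product case_prod_beta)
qed

lemma hsp_self: "supp k f \<Longrightarrow> hsp f f = of_real (\<Sum>i<k. \<Sum>j<k. (cmod (ent f i j))\<^sup>2)"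
  by (simp add: hsp_eq complex_norm_square[symmetric])

instantiation fmat :: real_inner
begin

definition "scaleR r (f::fmat) = complex_of_real r *\<^sub>C f"
definition "inner f g = Re (hsp f g)"
definition "norm (f::fmat) = sqrt (inner f f)"
definition "dist (f::fmat) g = norm (f - g)"
definition "sgn (f::fmat) = scaleR (inverse (norm f)) f"
definition "uniformity = (INF e\<in>{0<..}. principal {(x::fmat, y). dist x y < e})"
definition "open (U::fmat set) \<longleftrightarrow> (\<forall>x\<in>U. eventually (\<lambda>(x', y). x' = x \<longrightarrow> y \<in> U) uniformity)"

lemma ent_scaleR [simp]: "ent (r *\<^sub>R f) i j = of_real r * ent f i j"
  by (simp add: scaleR_fmat_def)

lemma supp_scaleR: "supp k f \<Longrightarrow> supp k (r *\<^sub>R f)"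
  by (simp add: supp_def)

instance
proof
  fix f g h :: fmat and a b :: real
  show "a *\<^sub>R (f + g) = a *\<^sub>R f + a *\<^sub>R g" "(a + b) *\<^sub>R f = a *\<^sub>R f + b *\<^sub>R f"
    "a *\<^sub>R b *\<^sub>R f = (a * b) *\<^sub>R f" "1 *\<^sub>R f = f"
    by (rule fmat_eqI; simp add: algebra_simps)+
  show "sgn f = inverse (norm f) *\<^sub>R f" "dist f g = norm (f - g)" "norm f = sqrt (inner f f)"
    by (simp_all add: sgn_fmat_def dist_fmat_def norm_fmat_def)
  show "uniformity = (INF e\<in>{0<..}. principal {(x::fmat, y). dist x y < e})"
    by (rule uniformity_fmat_def)
  show "open U \<longleftrightarrow> (\<forall>x\<in>U. eventually (\<lambda>(x', y). x' = x \<longrightarrow> y \<in> U) uniformity)" for U :: "fmat set"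
    by (rule open_fmat_def)
  obtain k where k: "supp k f" "supp k g" "supp k h" by (rule supp_ex3)
  have "hsp g f = cnj (hsp f g)" using k by (simp add: hsp_eq[of k] mult.commute)
  then show "inner f g = inner g f" by (simp add: inner_fmat_def)
  show "inner (f + g) h = inner f h + inner g h"
    using k by (simp add: inner_fmat_def hsp_eq[of k] supp_add distrib_right sum.distrib)
  show "inner (a *\<^sub>R f) g = a * inner f g"
    using k by (simp add: inner_fmat_def hsp_eq[of k] supp_scaleR sum_distrib_left mult.assoc algebra_simps)
  show "0 \<le> inner f f" using k by (simp add: inner_fmat_def hsp_self[of k] sum_nonneg del: of_real_sum)
  show "inner f f = 0 \<longleftrightarrow> f = 0"
  proof
    assume "inner f f = 0"
    then have z: "(\<Sum>i<k. \<Sum>j<k. (cmod (ent f i j))\<^sup>2) = 0"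
      using k by (simp add: inner_fmat_def hsp_self[of k] del: of_real_sum)
    have "ent f i j = 0" if "i < k" "j < k" for i j
    proof -
      have "(\<Sum>j<k. (cmod (ent f i j))\<^sup>2) = 0"
        using z that(1) by (subst (asm) sum_nonneg_eq_0_iff) (auto intro: sum_nonneg)
      then have "(cmod (ent f i j))\<^sup>2 = 0"
        using that(2) by (subst (asm) sum_nonneg_eq_0_iff) auto
      then show ?thesis by simp
    qed
    then show "f = 0" using k by (intro fmat_eqI) (metis ent_zero not_le suppD)
  next
    assume "f = 0" then show "inner f f = 0" by (simp add: inner_fmat_def hsp_def)
  qed
qed

end

lemma norm_fmat_sq: "supp k f \<Longrightarrow> (norm f)\<^sup>2 = (\<Sum>i<k. \<Sum>j<k. (cmod (ent f i j))\<^sup>2)"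
  by (simp add: power2_norm_eq_inner inner_fmat_def hsp_self del: of_real_sum)

lemma supp_diff: "supp k f \<Longrightarrow> supp k g \<Longrightarrow> supp k (f - g)"
  by (simp add: supp_def)

lemma supp_scaleC: "supp k f \<Longrightarrow> supp k (c *\<^sub>C f)"
  by (simp add: supp_def)

lemma supp_zero [simp]: "supp k 0"
  by (simp add: supp_def)

lemma supp_sum: "(\<And>i. i \<in> I \<Longrightarrow> supp k (f i)) \<Longrightarrow> supp k (\<Sum>i\<in>I. f i)"
  by (induction I rule: infinite_finite_induct) (auto intro: supp_add)

lemma ent_sum: "ent (\<Sum>i\<in>I. f i) a b = (\<Sum>i\<in>I. ent (f i) a b)"
  by (induction I rule: infinite_finite_induct) auto

lemma norm_scaleC_fmat: "norm (c *\<^sub>C f) = cmod c * norm (f::fmat)"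
proof -
  obtain k where k: "supp k f" by (rule supp_ex3)
  have "(norm (c *\<^sub>C f))\<^sup>2 = (cmod c * norm f)\<^sup>2"
    using k by (simp add: norm_fmat_sq[of k] supp_scaleC norm_mult power_mult_distrib sum_distrib_left)
  then show ?thesis by (simp add: power2_eq_iff_nonneg)
qed

definition fadj :: "fmat \<Rightarrow> fmat"
  where "fadj f = Abs_fmat (\<lambda>i j. cnj (ent f j i))"

lemma ent_fadj [simp]: "ent (fadj f) i j = cnj (ent f j i)"
proof -
  obtain k where "supp k f" by (rule supp_ex3)
  then show ?thesis unfolding fadj_def by (subst ent_Abs[of k]) (auto simp: suppD)
qed

lemma supp_fadj: "supp k f \<Longrightarrow> supp k (fadj f)"
  by (simp add: supp_def)

lemma fadj_simps [simp]: "fadj (fadj f) = f" "fadj (f + g) = fadj f + fadj g"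
  "fadj (f - g) = fadj f - fadj g"
  "fadj (c *\<^sub>C f) = cnj c *\<^sub>C fadj f" "fadj 0 = 0"
  by (rule fmat_eqI; simp)+

lemma fadj_mult [simp]: "fadj (f * g) = fadj g * fadj f"
proof (rule fmat_eqI)
  fix i j
  obtain k where k: "supp k f" "supp k g" by (rule supp_ex3)
  then show "ent (fadj (f * g)) i j = ent (fadj g * fadj f) i j"
    by (simp add: ent_mult[of k] supp_fadj mult.commute)
qed

lemma scaleC_fmat_simps [simp]:
  fixes f g :: fmat
  shows "1 *\<^sub>C f = f" "0 *\<^sub>C f = 0" "c *\<^sub>C d *\<^sub>C f = (c * d) *\<^sub>C f"
  by (rule fmat_eqI; simp)+

lemma scaleC_fmat_add: "c *\<^sub>C (f + g :: fmat) = c *\<^sub>C f + c *\<^sub>C g"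
  by (rule fmat_eqI) (simp add: distrib_left)

lemma scaleC_fmat_diff: "c *\<^sub>C (f - g :: fmat) = c *\<^sub>C f - c *\<^sub>C g"
  by (rule fmat_eqI) (simp add: right_diff_distrib)

lemma scaleC_fmat_mult [simp]:
  fixes f g :: fmat
  shows "(c *\<^sub>C f) * g = c *\<^sub>C (f * g)" "f * (c *\<^sub>C g) = c *\<^sub>C (f * g)"
proof -
  obtain k where k: "supp k f" "supp k g" by (rule supp_ex3)
  show "(c *\<^sub>C f) * g = c *\<^sub>C (f * g)"
    by (rule fmat_eqI) (use k in \<open>simp add: ent_mult[of k] supp_scaleC sum_distrib_left mult.assoc\<close>)
  show "f * (c *\<^sub>C g) = c *\<^sub>C (f * g)"
    by (rule fmat_eqI) (use k in \<open>simp add: ent_mult[of k] sum_distrib_left mult_ac\<close>)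
qed

lemma scaleR_fmat_mult [simp]:
  fixes f g :: fmat
  shows "(r *\<^sub>R f) * g = r *\<^sub>R (f * g)" "f * (r *\<^sub>R g) = r *\<^sub>R (f * g)"
  by (simp_all add: scaleR_fmat_def)

lemma norm_fadj [simp]: "norm (fadj f) = norm f"
proof -
  obtain k where k: "supp k f" by (rule supp_ex3)
  have "(norm (fadj f))\<^sup>2 = (\<Sum>i<k. \<Sum>j<k. (cmod (ent f j i))\<^sup>2)"
    using k by (simp add: norm_fmat_sq[of k] supp_fadj)
  also have "\<dots> = (norm f)\<^sup>2" using k by (subst sum.swap) (simp add: norm_fmat_sq[of k])
  finally show ?thesis by (simp add: power2_eq_iff_nonneg)
qed

lemma inner_mult_fadj: "inner (a * x) y = inner x (fadj a * y)" for a x y :: fmat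
proof -
  obtain k where k: "supp k a" "supp k x" "supp k y" by (rule supp_ex3)
  have "hsp (a * x) y = (\<Sum>i<k. \<Sum>j<k. \<Sum>l<k. ent a i l * ent x l j * cnj (ent y i j))"
    using k by (simp add: hsp_eq[of k] supp_mult ent_mult[of k] sum_distrib_right)
  also have "\<dots> = (\<Sum>i<k. \<Sum>l<k. \<Sum>j<k. ent a i l * ent x l j * cnj (ent y i j))"
    by (intro sum.cong refl sum.swap)
  also have "\<dots> = (\<Sum>l<k. \<Sum>i<k. \<Sum>j<k. ent a i l * ent x l j * cnj (ent y i j))" by (rule sum.swap)
  also have "\<dots> = (\<Sum>l<k. \<Sum>j<k. \<Sum>i<k. ent a i l * ent x l j * cnj (ent y i j))"
    by (intro sum.cong refl sum.swap)
  also have "\<dots> = hsp x (fadj a * y)"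
    using k by (simp add: hsp_eq[of k] supp_mult supp_fadj ent_mult[of k] sum_distrib_left mult_ac)
  finally show ?thesis by (simp add: inner_fmat_def)
qed

definition idm :: "nat \<Rightarrow> fmat"
  where "idm k = Abs_fmat (\<lambda>i j. if i = j \<and> i < k then 1 else 0)"

lemma ent_idm: "ent (idm k) i j = (if i = j \<and> i < k then 1 else 0)"
  unfolding idm_def by (subst ent_Abs[of k]) auto

lemma supp_idm: "supp k (idm k)"
  by (simp add: supp_def ent_idm)

lemma idm_mult: assumes "supp k f" shows "idm k * f = f" "f * idm k = f"
proof -
  have "ent (idm k * f) i j = ent f i j" for i j
    using suppD[OF assms, of i j]
    by (cases "i < k") (simp_all add: ent_mult[OF supp_idm] ent_idm if_distrib[of "\<lambda>x. x * _"] cong: if_cong)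
  then show "idm k * f = f" by (rule fmat_eqI)
  have "ent (f * idm k) i j = ent f i j" for i j
    using suppD[OF assms, of i j]
    by (cases "j < k") (simp_all add: ent_mult[OF assms] ent_idm if_distrib[of "\<lambda>x. _ * x"] eq_commute[of _ j] cong: if_cong conj_cong)
  then show "f * idm k = f" by (rule fmat_eqI)
qed

lemma fadj_idm [simp]: "fadj (idm k) = idm k"
  by (rule fmat_eqI) (simp add: ent_idm)

subsection \<open>Operator bounds for matrices\<close>

text \<open>On Hilbert-Schmidt matrices left multiplication by \<open>a\<close> has the operator
  norm of \<open>a\<close> as its norm; the agreement with \<open>opnorm_mat\<close> is
  \<open>opnorm_imp_lbd\<close> and \<open>lbd_imp_opnorm\<close>.\<close>

definition lbd :: "fmat \<Rightarrow> real \<Rightarrow> bool"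
  where "lbd a K \<longleftrightarrow> 0 \<le> K \<and> (\<forall>x. norm (a * x) \<le> K * norm x)"

lemma lbdD: "lbd a K \<Longrightarrow> norm (a * x) \<le> K * norm x" by (simp add: lbd_def)

lemma lbd_mono: "lbd a K \<Longrightarrow> K \<le> L \<Longrightarrow> lbd a L"
  unfolding lbd_def by (meson mult_right_mono norm_ge_zero order_trans)

lemma lbd_add: "lbd a K \<Longrightarrow> lbd b L \<Longrightarrow> lbd (a + b) (K + L)"
  unfolding lbd_def by (auto simp: distrib_right intro!: order_trans[OF norm_triangle_ineq] add_mono)

lemma lbd_mult: assumes "lbd a K" "lbd b L" shows "lbd (a * b) (K * L)"
  unfolding lbd_def
proof (intro conjI allI)
  show "0 \<le> K * L" using assms by (simp add: lbd_def)
  fix x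
  have "norm (a * (b * x)) \<le> K * norm (b * x)" using assms by (simp add: lbd_def)
  also have "\<dots> \<le> K * (L * norm x)" using assms by (intro mult_left_mono) (auto simp: lbd_def)
  finally show "norm (a * b * x) \<le> K * L * norm x" by (simp add: mult.assoc)
qed

lemma lbd_scaleC: "lbd a K \<Longrightarrow> lbd (c *\<^sub>C a) (cmod c * K)"
  unfolding lbd_def by (simp add: norm_scaleC_fmat mult.assoc mult_left_mono)

lemma lbd_idm: "lbd (idm k) 1"
  unfolding lbd_def
proof (intro conjI allI)
  fix x
  have "inner (idm k * x) (idm k * x) = inner (idm k * x) x"
    by (metis fadj_idm idm_mult(1) inner_commute inner_mult_fadj mult.assoc supp_idm)
  then have "(norm (idm k * x))\<^sup>2 \<le> norm (idm k * x) * norm x"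
    by (metis power2_norm_eq_inner norm_cauchy_schwarz)
  then show "norm (idm k * x) \<le> 1 * norm x"
    by (cases "norm (idm k * x) = 0") (auto simp: power2_eq_square)
qed simp

lemma lbd_fadj: assumes K: "lbd a K" shows "lbd (fadj a) K"
  unfolding lbd_def
proof (intro conjI allI)
  show "0 \<le> K" using K by (simp add: lbd_def)
  fix x
  show "norm (fadj a * x) \<le> K * norm x"
  proof (cases "fadj a * x = 0")
    case True then show ?thesis using K by (simp add: lbd_def)
  next
    case False
    have "norm (fadj a * x) * norm (fadj a * x) = inner (a * (fadj a * x)) x"
      by (simp add: inner_mult_fadj power2_norm_eq_inner[symmetric] power2_eq_square)
    also have "\<dots> \<le> norm (a * (fadj a * x)) * norm x" by (rule norm_cauchy_schwarz)
    also have "\<dots> \<le> (K * norm (fadj a * x)) * norm x" by (intro mult_right_mono lbdD K) simp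
    finally have "norm (fadj a * x) * norm (fadj a * x) \<le> norm (fadj a * x) * (K * norm x)"
      by (simp add: mult_ac)
    then show ?thesis using False by simp
  qed
qed

lemma lbd_right: "lbd a K \<Longrightarrow> norm (x * a) \<le> norm x * K"
  by (metis fadj_mult lbdD lbd_fadj mult.commute norm_fadj)

abbreviation evf :: "nat \<Rightarrow> (nat \<Rightarrow> fmat) \<Rightarrow> expr \<Rightarrow> fmat" where "evf k \<equiv> ev fadj (idm k)"

lemma lbd_evf: "(\<And>i. i \<in> vars e \<Longrightarrow> lbd (X i) R) \<Longrightarrow> lbd (evf k X e) (ebd R e)"
  by (induction e) (auto intro: lbd_add lbd_mult lbd_scaleC lbd_fadj lbd_idm)

lemma supp_evf: "(\<And>i. i \<in> vars e \<Longrightarrow> supp k (X i)) \<Longrightarrow> supp k (evf k X e)"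
  by (induction e) (auto intro: supp_add supp_mult supp_scaleC supp_fadj supp_idm)

text \<open>Left multiplication by a matrix is an instance of the abstract pair, so the estimate
  that bounds the operator cutoffs also bounds matrices of every size, whatever the degree of
  \<open>t\<close>.\<close>

lemma lbd_cut:
  assumes "\<And>i. i \<in> vars t \<Longrightarrow> lbd (X i) R"
  shows "lbd (evf k X (cutoff R t J)) 1"
proof -
  define K where "K = ebd R t"
  let ?a = "evf k X t"
  have K: "lbd ?a K" unfolding K_def using lbd_evf assms by blast
  interpret adjoint_pair "\<lambda>x. ?a * x" "\<lambda>x. fadj ?a * x" "K\<^sup>2"
  proof (rule adjoint_pair.intro)
    show "linear ((*) ?a)" "linear ((*) (fadj ?a))"
      by (auto intro!: linearI simp: distrib_left)
    show "inner (?a * x) y = inner x (fadj ?a * y)" for x y by (rule inner_mult_fadj)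
    show "(norm (?a * x))\<^sup>2 \<le> K\<^sup>2 * (norm x)\<^sup>2" for x
      using power_mono[OF lbdD[OF K], of x 2] by (simp add: power_mult_distrib)
  qed simp
  have "evf k X (cutE (K\<^sup>2) t J) * x = g J (?a * x)" for x
  proof (induction J)
    case (Suc J)
    have m1: "(-1) *\<^sub>C f = - f" for f :: fmat by (rule fmat_eqI) simp
    show ?case
      by (simp add: D_def scaleR_fmat_def distrib_right distrib_left left_diff_distrib mult.assoc Suc[symmetric] m1
          scaleC_fmat_add scaleC_fmat_diff del: of_real_divide of_real_add of_real_power)
  qed simp
  then show ?thesis unfolding cutoff_def lbd_def K_def[symmetric] using norm_g_T by simp
qed

text \<open>One constant must serve all matrix sizes, hence \<open>k\<close> is quantified inside.
  Differences are measured in the Hilbert-Schmidt norm, while the operator bound \<open>R\<close>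
  controls the other factor of a product.\<close>

definition hs_lipschitz :: "real \<Rightarrow> expr \<Rightarrow> real \<Rightarrow> bool"
  where "hs_lipschitz R e L \<longleftrightarrow> 0 \<le> L \<and> (\<forall>k X Y n. vars e \<subseteq> {..<n} \<longrightarrow> (\<forall>i<n. lbd (X i) R \<and> lbd (Y i) R) \<longrightarrow>
    norm (evf k X e - evf k Y e) \<le> L * (\<Sum>i<n. norm (X i - Y i)))"

lemma hs_lipschitzD: "hs_lipschitz R e L \<Longrightarrow> vars e \<subseteq> {..<n} \<Longrightarrow> \<forall>i<n. lbd (X i) R \<and> lbd (Y i) R \<Longrightarrow>
    norm (evf k X e - evf k Y e) \<le> L * (\<Sum>i<n. norm (X i - Y i))"
  unfolding hs_lipschitz_def by blast

lemma evf_lipschitz: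
  assumes R: "0 \<le> R"
  shows "\<exists>L. hs_lipschitz R e L"
proof (induction e)
  case (Var i)
  show ?case unfolding hs_lipschitz_def by (rule exI[of _ 1]) (auto intro: member_le_sum)
next
  case One
  show ?case unfolding hs_lipschitz_def by (rule exI[of _ 0]) auto
next
  case (Add e f)
  then obtain L M where L: "hs_lipschitz R e L" and M: "hs_lipschitz R f M" by blast
  then have LM: "0 \<le> L" "0 \<le> M" by (simp_all add: hs_lipschitz_def)
  show ?case unfolding hs_lipschitz_def
  proof (intro exI[of _ "L + M"] conjI allI impI)
    fix k X Y n assume a: "vars (Add e f) \<subseteq> {..<n}" "\<forall>i<n. lbd (X i) R \<and> lbd (Y i) R"
    have "evf k X (Add e f) - evf k Y (Add e f) = (evf k X e - evf k Y e) + (evf k X f - evf k Y f)"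
      by simp
    then have "norm (evf k X (Add e f) - evf k Y (Add e f))
      \<le> norm (evf k X e - evf k Y e) + norm (evf k X f - evf k Y f)"
      by (metis norm_triangle_ineq)
    also have "\<dots> \<le> L * (\<Sum>i<n. norm (X i - Y i)) + M * (\<Sum>i<n. norm (X i - Y i))"
      using a by (intro add_mono hs_lipschitzD[OF L] hs_lipschitzD[OF M]) auto
    finally show "norm (evf k X (Add e f) - evf k Y (Add e f)) \<le> (L + M) * (\<Sum>i<n. norm (X i - Y i))"
      by (simp add: distrib_right)
  qed (use LM in auto)
next
  case (Mul e f)
  then obtain L M where L: "hs_lipschitz R e L" and M: "hs_lipschitz R f M" by blast
  then have LM: "0 \<le> L" "0 \<le> M" by (simp_all add: hs_lipschitz_def)
  show ?case unfolding hs_lipschitz_def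
  proof (intro exI[of _ "L * ebd R f + ebd R e * M"] conjI allI impI)
    fix k X Y n assume a: "vars (Mul e f) \<subseteq> {..<n}" "\<forall>i<n. lbd (X i) R \<and> lbd (Y i) R"
    have bf: "lbd (evf k X f) (ebd R f)" and be: "lbd (evf k Y e) (ebd R e)" using a
      by (auto intro!: lbd_evf)
    have "evf k X (Mul e f) - evf k Y (Mul e f)
      = (evf k X e - evf k Y e) * evf k X f + evf k Y e * (evf k X f - evf k Y f)"
      by (simp add: algebra_simps)
    then have "norm (evf k X (Mul e f) - evf k Y (Mul e f)) \<le>
      norm ((evf k X e - evf k Y e) * evf k X f) + norm (evf k Y e * (evf k X f - evf k Y f))"
      by (metis norm_triangle_ineq)
    also have "\<dots> \<le> norm (evf k X e - evf k Y e) * ebd R f + ebd R e * norm (evf k X f - evf k Y f)"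
      by (intro add_mono lbd_right lbdD bf be)
    also have "\<dots> \<le> (L * (\<Sum>i<n. norm (X i - Y i))) * ebd R f + ebd R e * (M * (\<Sum>i<n. norm (X i - Y i)))"
      using a by (intro add_mono mult_right_mono mult_left_mono hs_lipschitzD[OF L] hs_lipschitzD[OF M] ebd_nonneg R) auto
    finally show "norm (evf k X (Mul e f) - evf k Y (Mul e f))
      \<le> (L * ebd R f + ebd R e * M) * (\<Sum>i<n. norm (X i - Y i))"
      by (simp add: algebra_simps)
  qed (use LM ebd_nonneg[OF R] in auto)
next
  case (Scal c e)
  then obtain L where L: "hs_lipschitz R e L" by blast
  then have LM: "0 \<le> L" by (simp add: hs_lipschitz_def)
  show ?case unfolding hs_lipschitz_def
  proof (intro exI[of _ "cmod c * L"] conjI allI impI)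
    fix k X Y n assume a: "vars (Scal c e) \<subseteq> {..<n}" "\<forall>i<n. lbd (X i) R \<and> lbd (Y i) R"
    have "norm (evf k X (Scal c e) - evf k Y (Scal c e)) = cmod c * norm (evf k X e - evf k Y e)"
      by (simp add: norm_scaleC_fmat flip: scaleC_fmat_diff)
    also have "\<dots> \<le> cmod c * (L * (\<Sum>i<n. norm (X i - Y i)))"
      using a by (intro mult_left_mono hs_lipschitzD[OF L]) auto
    finally show "norm (evf k X (Scal c e) - evf k Y (Scal c e))
      \<le> cmod c * L * (\<Sum>i<n. norm (X i - Y i))"
      by (simp add: mult.assoc)
  qed (use LM in auto)
next
  case (Adj e)
  then show ?case by (simp add: hs_lipschitz_def flip: fadj_simps(3))
qed

subsection \<open>Words and star polynomials\<close>

definition lit :: "nat \<times> bool \<Rightarrow> expr"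
  where "lit l = (if snd l then Adj (Var (fst l)) else Var (fst l))"

primrec wexpr :: "(nat \<times> bool) list \<Rightarrow> expr" where
  "wexpr [] = One"
| "wexpr (l # w) = Mul (lit l) (wexpr w)"

definition wflip :: "(nat \<times> bool) list \<Rightarrow> (nat \<times> bool) list"
  where "wflip w = rev (map (\<lambda>l. (fst l, \<not> snd l)) w)"

text \<open>Expansion of an expression into a combination of words: microstates constrain the traces
  of words only.\<close>

primrec nf :: "expr \<Rightarrow> (complex \<times> (nat \<times> bool) list) list" where
  "nf (Var i) = [(1, [(i, False)])]"
| "nf One = [(1, [])]"
| "nf (Add e f) = nf e @ nf f"
| "nf (Mul e f) = concat (map (\<lambda>p. map (\<lambda>q. (fst p * fst q, snd p @ snd q)) (nf f)) (nf e))"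
| "nf (Scal c e) = map (\<lambda>p. (c * fst p, snd p)) (nf e)"
| "nf (Adj e) = map (\<lambda>p. (cnj (fst p), wflip (snd p))) (nf e)"

lemma vars_lit [simp]: "vars (lit l) = {fst l}"
  by (simp add: lit_def)

lemma vars_wexpr: "vars (wexpr w) = fst ` set w"
  by (induction w) auto

lemma fst_set_wflip: "fst ` set (wflip w) = fst ` set w"
  by (simp add: wflip_def image_image)

lemma vars_nf: "p \<in> set (nf e) \<Longrightarrow> fst ` set (snd p) \<subseteq> vars e"
proof (induction e arbitrary: p)
  case (Mul e f)
  then obtain r q where "r \<in> set (nf e)" "q \<in> set (nf f)" "snd p = snd r @ snd q" by auto
  then show ?case using Mul.IH(1)[of r] Mul.IH(2)[of q] by (auto simp: image_Un)
next
  case (Adj e)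
  then obtain r where "r \<in> set (nf e)" "snd p = wflip (snd r)" by auto
  then show ?case using Adj.IH[of r] by (simp add: fst_set_wflip)
next
  case (Scal c e)
  then obtain r where "r \<in> set (nf e)" "snd p = snd r" by auto
  then show ?case using Scal.IH[of r] by simp
next
  case (Add e f)
  show ?case
  proof (cases "p \<in> set (nf e)")
    case True
    then show ?thesis using Add.IH(1)[of p] by auto
  next
    case False
    then show ?thesis using Add.IH(2)[of p] Add.prems by auto
  qed
qed auto

text \<open>Covers a von Neumann algebra and the \<open>k \<times> k\<close> corner of
  \<open>fmat\<close> alike. In the latter \<open>idm k\<close> is a unit on the corner alone, hence
  the carrier \<open>C\<close>.\<close>

locale star_algebra =
  fixes st :: "'a::{ring,scaleC} \<Rightarrow> 'a" and e1 :: 'a and C :: "'a set"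
  assumes C: "e1 \<in> C" "0 \<in> C" "\<And>a b. a \<in> C \<Longrightarrow> b \<in> C \<Longrightarrow> a + b \<in> C"
      "\<And>a b. a \<in> C \<Longrightarrow> b \<in> C \<Longrightarrow> a * b \<in> C" "\<And>c a. a \<in> C \<Longrightarrow> c *\<^sub>C a \<in> C" "\<And>a. a \<in> C \<Longrightarrow> st a \<in> C"
    and unit: "\<And>a. a \<in> C \<Longrightarrow> e1 * a = a" "\<And>a. a \<in> C \<Longrightarrow> a * e1 = a"
    and st: "\<And>a b. st (a * b) = st b * st a" "\<And>a b. st (a + b) = st a + st b"
      "\<And>c a. st (c *\<^sub>C a) = cnj c *\<^sub>C st a" "\<And>a. st (st a) = a" "st 0 = 0" "st e1 = e1"
    and sc: "\<And>c (a::'a) b. c *\<^sub>C (a + b) = c *\<^sub>C a + c *\<^sub>C b"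
      "\<And>c (a::'a) b. (c *\<^sub>C a) * b = c *\<^sub>C (a * b)"
      "\<And>c (a::'a) b. a * (c *\<^sub>C b) = c *\<^sub>C (a * b)" "\<And>c d (a::'a). c *\<^sub>C (d *\<^sub>C a) = (c * d) *\<^sub>C a"
      "\<And>a::'a. 1 *\<^sub>C a = a" "\<And>c. c *\<^sub>C (0::'a) = 0"
begin

definition val :: "(nat \<Rightarrow> 'a) \<Rightarrow> (complex \<times> (nat \<times> bool) list) list \<Rightarrow> 'a"
  where "val X ps = (\<Sum>p\<leftarrow>ps. fst p *\<^sub>C ev st e1 X (wexpr (snd p)))"

lemma val_simps: "val X [] = 0" "val X (p # ps) = fst p *\<^sub>C ev st e1 X (wexpr (snd p)) + val X ps"
  "val X (ps @ qs) = val X ps + val X qs"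
  by (simp_all add: val_def)

lemma ev_in: "(\<And>i. i \<in> vars e \<Longrightarrow> X i \<in> C) \<Longrightarrow> ev st e1 X e \<in> C"
  by (induction e) (auto intro: C)

definition ok :: "(nat \<Rightarrow> 'a) \<Rightarrow> (complex \<times> (nat \<times> bool) list) list \<Rightarrow> bool"
  where "ok X ps \<longleftrightarrow> (\<forall>p\<in>set ps. \<forall>l\<in>set (snd p). X (fst l) \<in> C)"

lemma ok_nf: assumes "\<And>i. i \<in> vars e \<Longrightarrow> X i \<in> C" shows "ok X (nf e)"
  unfolding ok_def
proof (intro ballI)
  fix p l assume "p \<in> set (nf e)" "l \<in> set (snd p)"
  then have "fst l \<in> vars e" using vars_nf[of p e] by auto
  then show "X (fst l) \<in> C" by (rule assms)
qed

lemma ev_wexpr_in: "\<forall>l\<in>set w. X (fst l) \<in> C \<Longrightarrow> ev st e1 X (wexpr w) \<in> C"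
  by (rule ev_in) (auto simp: vars_wexpr)

lemma ev_wexpr_append:
  "\<forall>l\<in>set (w @ v). X (fst l) \<in> C \<Longrightarrow> ev st e1 X (wexpr (w @ v))
    = ev st e1 X (wexpr w) * ev st e1 X (wexpr v)"
proof (induction w)
  case Nil
  then show ?case by (simp add: unit ev_wexpr_in)
next
  case (Cons l w)
  then show ?case by (simp add: mult.assoc)
qed

lemma ev_wflip:
  "\<forall>l\<in>set w. X (fst l) \<in> C \<Longrightarrow> ev st e1 X (wexpr (wflip w)) = st (ev st e1 X (wexpr w))"
proof (induction w)
  case Nil
  then show ?case by (simp add: wflip_def st)
next
  case (Cons l w)
  have "X (fst l) \<in> C" using Cons.prems by simp
  then have l: "ev st e1 X (wexpr [(fst l, \<not> snd l)]) = st (ev st e1 X (lit l))"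
    by (auto simp: lit_def st unit C)
  have w: "wflip (l # w) = wflip w @ [(fst l, \<not> snd l)]" by (simp add: wflip_def)
  have "\<forall>l\<in>set (wflip w @ [(fst l, \<not> snd l)]). X (fst l) \<in> C" using Cons.prems by (auto simp: wflip_def)
  from ev_wexpr_append[OF this]
  have "ev st e1 X (wexpr (wflip (l # w))) = st (ev st e1 X (wexpr w)) * st (ev st e1 X (lit l))"
    unfolding w l using Cons by simp
  then show ?case by (simp add: st)
qed

lemma val_mult_word:
  assumes "\<forall>l\<in>set w. X (fst l) \<in> C"
  shows "ok X qs \<Longrightarrow> val X (map (\<lambda>q. (c * fst q, w @ snd q)) qs) = c *\<^sub>C ev st e1 X (wexpr w) * val X qs"
proof (induction qs)
  case (Cons q qs)
  have "ev st e1 X (wexpr (w @ snd q)) = ev st e1 X (wexpr w) * ev st e1 X (wexpr (snd q))"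
    using assms Cons.prems by (intro ev_wexpr_append) (auto simp: ok_def)
  then show ?case using Cons by (simp add: val_simps sc distrib_left ok_def mult.commute)
qed (simp add: val_simps)

lemma val_concat:
  assumes "ok X qs"
  shows "ok X ps \<Longrightarrow> val X (concat (map (\<lambda>p. map (\<lambda>q. (fst p * fst q, snd p @ snd q)) qs) ps))
    = val X ps * val X qs"
proof (induction ps)
  case (Cons p ps)
  have "val X (map (\<lambda>q. (fst p * fst q, snd p @ snd q)) qs)
    = fst p *\<^sub>C ev st e1 X (wexpr (snd p)) * val X qs"
    using Cons.prems assms by (intro val_mult_word) (auto simp: ok_def)
  then show ?case using Cons by (simp add: val_simps distrib_right ok_def)
qed (simp add: val_simps)

lemma val_scale: "val X (map (\<lambda>p. (c * fst p, snd p)) ps) = c *\<^sub>C val X ps"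
  by (induction ps) (simp_all add: val_simps sc)

lemma val_flip: "ok X ps \<Longrightarrow> val X (map (\<lambda>p. (cnj (fst p), wflip (snd p))) ps) = st (val X ps)"
proof (induction ps)
  case (Cons p ps)
  have "ev st e1 X (wexpr (wflip (snd p))) = st (ev st e1 X (wexpr (snd p)))"
    using Cons.prems by (intro ev_wflip) (auto simp: ok_def)
  then show ?case using Cons by (simp add: val_simps st ok_def)
qed (simp add: val_simps st)

lemma ev_nf: "(\<And>i. i \<in> vars e \<Longrightarrow> X i \<in> C) \<Longrightarrow> ev st e1 X e = val X (nf e)"
proof (induction e)
  case (Mul e f)
  have "ok X (nf e)" "ok X (nf f)" using Mul.prems by (auto intro!: ok_nf)
  then show ?case using Mul by (simp add: val_concat)
next
  case (Adj e)
  have "ok X (nf e)" using Adj.prems by (auto intro!: ok_nf)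
  then show ?case using Adj by (simp add: val_flip)
qed (simp_all add: val_simps lit_def unit sc val_scale)

text \<open>Used for \<open>\<tau>\<close> and for \<open>trk k\<close> with the same coefficients,
  so that the difference of two polynomial moments becomes a combination of differences of word
  moments.\<close>

lemma linear_nf:
  assumes X: "\<And>i. i \<in> vars e \<Longrightarrow> X i \<in> C"
    and add: "\<And>a b. a \<in> C \<Longrightarrow> b \<in> C \<Longrightarrow> \<phi> (a + b) = \<phi> a + (\<phi> b :: complex)"
    and scale: "\<And>c a. a \<in> C \<Longrightarrow> \<phi> (c *\<^sub>C a) = c * \<phi> a"
  shows "\<phi> (ev st e1 X e) = (\<Sum>p\<leftarrow>nf e. fst p * \<phi> (ev st e1 X (wexpr (snd p))))"
proof -
  have z: "\<phi> 0 = 0" using add[of 0 0] C by simp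
  have "ok X ps \<Longrightarrow> \<phi> (val X ps) = (\<Sum>p\<leftarrow>ps. fst p * \<phi> (ev st e1 X (wexpr (snd p)))) \<and> val X ps \<in> C" for ps
  proof (induction ps)
    case (Cons p ps)
    have "ev st e1 X (wexpr (snd p)) \<in> C" using Cons.prems by (intro ev_wexpr_in) (auto simp: ok_def)
    then show ?case using Cons by (simp add: val_simps add scale C ok_def)
  qed (simp add: val_simps z C)
  then show ?thesis using ev_nf[OF X] ok_nf[OF X] by simp
qed

end

lemma star_algebra_bop: "von_neumann_algebra M \<Longrightarrow> star_algebra adj 1 M"
proof -
  assume M: "von_neumann_algebra M"
  then have "0 *\<^sub>C 1 \<in> M" unfolding von_neumann_algebra_def by blast
  then have "0 \<in> M" by simp
  moreover have "c *\<^sub>C (0::'a bop) = 0" for c by (rule bop_eqI) simp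
  ultimately show ?thesis using M unfolding von_neumann_algebra_def
    by unfold_locales (simp_all add: scaleC_bop_distrib)
qed

lemma star_algebra_fmat: "star_algebra fadj (idm k) {f. supp k f}"
proof -
  have "c *\<^sub>C (0::fmat) = 0" for c by (rule fmat_eqI) simp
  then show ?thesis
    by unfold_locales (simp_all add: supp_idm supp_add supp_mult supp_scaleC supp_fadj idm_mult scaleC_fmat_add)
qed

subsection \<open>Matrices as finitely supported matrices\<close>

definition fm :: "complex mat \<Rightarrow> fmat"
  where "fm A = Abs_fmat (\<lambda>i j. if i < dim_row A \<and> j < dim_col A then A $$ (i, j) else 0)"

lemma ent_fm: "ent (fm A) i j = (if i < dim_row A \<and> j < dim_col A then A $$ (i, j) else 0)"
  unfolding fm_def by (subst ent_Abs[of "max (dim_row A) (dim_col A)"]) auto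

lemma supp_fm: "A \<in> carrier_mat k k \<Longrightarrow> supp k (fm A)"
  by (auto simp: supp_def ent_fm)

definition mk :: "nat \<Rightarrow> fmat \<Rightarrow> complex mat"
  where "mk k f = mat k k (\<lambda>p. ent f (fst p) (snd p))"

lemma mk_carrier [simp]: "mk k f \<in> carrier_mat k k"
  by (simp add: mk_def)

lemma fm_mk: "supp k f \<Longrightarrow> fm (mk k f) = f"
  by (rule fmat_eqI) (auto simp: ent_fm mk_def supp_def not_less)

lemma mat_adjoint_carrier: "A \<in> carrier_mat k k \<Longrightarrow> mat_adjoint A \<in> carrier_mat k k"
  by (auto simp: mat_adjoint_def)

lemma fm_adjoint: "A \<in> carrier_mat k k \<Longrightarrow> fm (mat_adjoint A) = fadj (fm A)"
  by (rule fmat_eqI) (auto simp: ent_fm mat_adjoint_def mat_of_rows_def)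

lemma fm_mult: "A \<in> carrier_mat k k \<Longrightarrow> B \<in> carrier_mat k k \<Longrightarrow> fm (A * B) = fm A * fm B"
proof (rule fmat_eqI)
  fix i j assume A: "A \<in> carrier_mat k k" and B: "B \<in> carrier_mat k k"
  show "ent (fm (A * B)) i j = ent (fm A * fm B) i j"
    unfolding ent_mult[OF supp_fm[OF A]] using A B
    by (auto simp: ent_fm scalar_prod_def lessThan_atLeast0 intro!: sum.cong)
qed

lemma fm_diff: "A \<in> carrier_mat k k \<Longrightarrow> B \<in> carrier_mat k k \<Longrightarrow> fm (A - B) = fm A - fm B"
  by (rule fmat_eqI) (auto simp: ent_fm)

lemma fm_one: "fm (1\<^sub>m k) = idm k"
  by (rule fmat_eqI) (auto simp: ent_fm ent_idm)

definition trk :: "nat \<Rightarrow> fmat \<Rightarrow> complex"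
  where "trk k f = (\<Sum>i<k. ent f i i) / of_nat k"

lemma tau_mat_fm: "A \<in> carrier_mat k k \<Longrightarrow> tau_mat A = trk k (fm A)"
  by (auto simp: tau_mat_def trk_def ent_fm)

lemma trk_simps: "trk k (f + g) = trk k f + trk k g" "trk k (f - g) = trk k f - trk k g"
  "trk k (c *\<^sub>C f) = c * trk k f"
  by (simp_all add: trk_def sum.distrib sum_subtractf sum_distrib_left add_divide_distrib diff_divide_distrib)

lemma trk_idm: "0 < k \<Longrightarrow> trk k (idm k) = 1"
  by (simp add: trk_def ent_idm)

lemma trk_commute: assumes "supp k f" "supp k g" shows "trk k (f * g) = trk k (g * f)"
proof -
  have "(\<Sum>i<k. \<Sum>l<k. ent f i l * ent g l i) = (\<Sum>l<k. \<Sum>i<k. ent f i l * ent g l i)" by (rule sum.swap)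
  then show ?thesis unfolding trk_def using assms by (simp add: ent_mult[of k] mult.commute)
qed

lemma trk_fadj_mult: assumes "supp k f"
  shows "of_nat k * trk k (fadj f * g) = (\<Sum>i<k. \<Sum>j<k. cnj (ent f i j) * ent g i j)"
proof (cases "k = 0")
  case False
  have "(\<Sum>i<k. ent (fadj f * g) i i) = (\<Sum>j<k. \<Sum>i<k. cnj (ent f i j) * ent g i j)"
    using assms by (simp add: ent_mult[of k] supp_fadj)
  also have "\<dots> = (\<Sum>i<k. \<Sum>j<k. cnj (ent f i j) * ent g i j)" by (rule sum.swap)
  finally show ?thesis using False by (simp add: trk_def)
qed simp

lemma norm_sq_trk: assumes "supp k f" shows "(norm f)\<^sup>2 = real k * Re (trk k (fadj f * f))"
proof -
  have "of_nat k * trk k (fadj f * f) = of_real (\<Sum>i<k. \<Sum>j<k. (cmod (ent f i j))\<^sup>2)"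
    unfolding trk_fadj_mult[OF assms] of_real_sum complex_norm_square by (simp add: mult.commute)
  then have "Re (of_nat k * trk k (fadj f * f)) = (norm f)\<^sup>2"
    using norm_fmat_sq[OF assms] by (simp del: of_real_sum)
  then show ?thesis by simp
qed

section \<open>The operator norm of a matrix as a left multiplication bound\<close>

lemma lbd_norm: "lbd a (norm a)"
  unfolding lbd_def
proof (intro conjI allI)
  fix x
  obtain k where k: "supp k a" "supp k x" by (rule supp_ex3)
  have "(norm (a * x))\<^sup>2 = (\<Sum>i<k. \<Sum>j<k. (cmod (\<Sum>l<k. ent a i l * ent x l j))\<^sup>2)"
    using k by (simp add: norm_fmat_sq[of k] supp_mult ent_mult[of k])
  also have "\<dots> \<le> (\<Sum>i<k. \<Sum>j<k. (\<Sum>l<k. (cmod (ent a i l))\<^sup>2) * (\<Sum>l<k. (cmod (ent x l j))\<^sup>2))"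
  proof (intro sum_mono)
    fix i j
    have "cmod (\<Sum>l<k. ent a i l * ent x l j) \<le> (\<Sum>l<k. cmod (ent a i l) * cmod (ent x l j))"
      by (rule order_trans[OF norm_sum]) (simp add: norm_mult)
    then have "(cmod (\<Sum>l<k. ent a i l * ent x l j))\<^sup>2 \<le> (\<Sum>l<k. cmod (ent a i l) * cmod (ent x l j))\<^sup>2"
      by (rule power_mono) simp
    also have "\<dots> \<le> (\<Sum>l<k. (cmod (ent a i l))\<^sup>2) * (\<Sum>l<k. (cmod (ent x l j))\<^sup>2)"
      by (rule Cauchy_Schwarz_ineq_sum)
    finally show "(cmod (\<Sum>l<k. ent a i l * ent x l j))\<^sup>2
      \<le> (\<Sum>l<k. (cmod (ent a i l))\<^sup>2) * (\<Sum>l<k. (cmod (ent x l j))\<^sup>2)" .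
  qed
  also have "\<dots> = (\<Sum>i<k. \<Sum>l<k. (cmod (ent a i l))\<^sup>2) * (\<Sum>j<k. \<Sum>l<k. (cmod (ent x l j))\<^sup>2)"
    by (simp add: sum_product)
  also have "(\<Sum>j<k. \<Sum>l<k. (cmod (ent x l j))\<^sup>2) = (norm x)\<^sup>2"
    using k by (subst sum.swap) (simp add: norm_fmat_sq[of k])
  also have "(\<Sum>i<k. \<Sum>l<k. (cmod (ent a i l))\<^sup>2) = (norm a)\<^sup>2"
    using k by (simp add: norm_fmat_sq[of k])
  finally have "(norm (a * x))\<^sup>2 \<le> (norm a * norm x)\<^sup>2" by (simp add: power_mult_distrib)
  then show "norm (a * x) \<le> norm a * norm x" by (rule power2_le_imp_le) simp
qed simp

text \<open>A vector as the first column of a matrix, so that left multiplication includes the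
  action on vectors.\<close>

definition vf :: "complex vec \<Rightarrow> fmat"
  where "vf v = Abs_fmat (\<lambda>i j. if i < dim_vec v \<and> j = 0 then v $ i else 0)"

lemma ent_vf: "ent (vf v) i j = (if i < dim_vec v \<and> j = 0 then v $ i else 0)"
  unfolding vf_def by (subst ent_Abs[of "Suc (dim_vec v)"]) auto

lemma norm_vf: "norm (vf v) = norm_cvec v"
proof -
  have s: "supp (Suc (dim_vec v)) (vf v)" by (auto simp: supp_def ent_vf)
  have "(norm (vf v))\<^sup>2 = (\<Sum>i<Suc (dim_vec v). \<Sum>j<Suc (dim_vec v). if j
    = 0 then (cmod (ent (vf v) i 0))\<^sup>2 else 0)"
    unfolding norm_fmat_sq[OF s] by (intro sum.cong refl) (simp add: ent_vf)
  also have "\<dots> = (\<Sum>i<Suc (dim_vec v). (cmod (ent (vf v) i 0))\<^sup>2)"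
    by (simp add: sum.delta del: sum.lessThan_Suc)
  also have "\<dots> = (\<Sum>i<dim_vec v. (cmod (v $ i))\<^sup>2)" by (simp add: ent_vf)
  finally show ?thesis unfolding norm_cvec_def by (rule real_sqrt_unique[symmetric]) simp_all
qed

lemma fm_mult_vf: assumes "A \<in> carrier_mat k k" "v \<in> carrier_vec k" shows "fm A * vf v = vf (A *\<^sub>v v)"
  by (rule fmat_eqI) (use assms in \<open>auto simp: ent_mult[OF supp_fm] ent_fm ent_vf scalar_prod_def lessThan_atLeast0 intro!: sum.cong\<close>)

lemma opnorm_bdd: assumes "A \<in> carrier_mat k k"
  shows "bdd_above ((\<lambda>v. norm_cvec (A *\<^sub>v v)) ` {v \<in> carrier_vec (dim_col A). norm_cvec v \<le> 1})"
proof (rule bdd_aboveI2)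
  fix v assume "v \<in> {v \<in> carrier_vec (dim_col A). norm_cvec v \<le> 1}"
  then have v: "v \<in> carrier_vec k" "norm_cvec v \<le> 1" using assms by auto
  have "norm_cvec (A *\<^sub>v v) \<le> norm (fm A) * norm_cvec v"
    using lbdD[OF lbd_norm, of "fm A" "vf v"] by (simp add: fm_mult_vf[OF assms v(1)] norm_vf)
  also have "\<dots> \<le> norm (fm A) * 1" using v by (intro mult_left_mono) auto
  finally show "norm_cvec (A *\<^sub>v v) \<le> norm (fm A)" by simp
qed

lemma norm_cvec_smult: "norm_cvec (c \<cdot>\<^sub>v v) = cmod c * norm_cvec v"
  by (simp add: norm_cvec_def norm_mult power_mult_distrib sum_distrib_left[symmetric] real_sqrt_mult)

lemma opnorm_imp_vec: assumes A: "A \<in> carrier_mat k k" and R: "opnorm_mat A \<le> R"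
  and v: "v \<in> carrier_vec k"
  shows "norm_cvec (A *\<^sub>v v) \<le> R * norm_cvec v"
proof (cases "norm_cvec v = 0")
  case True
  have "norm (fm A * vf v) \<le> norm (fm A) * norm (vf v)" by (rule lbdD[OF lbd_norm])
  then show ?thesis using True by (simp add: fm_mult_vf[OF A v] norm_vf)
next
  case False
  have n: "0 < norm_cvec v" using False norm_ge_zero[of "vf v"] by (simp add: norm_vf)
  define u where "u = complex_of_real (1 / norm_cvec v) \<cdot>\<^sub>v v"
  have u: "u \<in> carrier_vec (dim_col A)" "norm_cvec u \<le> 1" using A v n
    by (simp_all add: u_def norm_cvec_smult norm_divide)
  have "norm_cvec (A *\<^sub>v u) \<le> opnorm_mat A"
    unfolding opnorm_mat_def by (rule cSUP_upper[OF _ opnorm_bdd[OF A]]) (use u in simp)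
  moreover have "norm_cvec (A *\<^sub>v u) = norm_cvec (A *\<^sub>v v) / norm_cvec v"
    unfolding u_def mult_mat_vec[OF A v] norm_cvec_smult using n by (simp add: norm_divide)
  ultimately have "norm_cvec (A *\<^sub>v v) \<le> opnorm_mat A * norm_cvec v" using n
    by (simp add: pos_divide_le_eq)
  also have "\<dots> \<le> R * norm_cvec v" by (rule mult_right_mono[OF R]) (use n in simp)
  finally show ?thesis .
qed

text \<open>The squared Hilbert-Schmidt norm is a sum over columns, and left multiplication acts on
  each column separately.\<close>

lemma opnorm_imp_lbd: assumes A: "A \<in> carrier_mat k k" and R: "opnorm_mat A \<le> R" "0 \<le> R"
  shows "lbd (fm A) R"
  unfolding lbd_def
proof (intro conjI allI)
  fix x
  obtain m where m: "supp m x" "supp m (fm A)" by (rule supp_ex3)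
  \<comment> \<open>\<open>x\<close> may be larger than \<open>k\<close>; entries below row
    \<open>k\<close> are cut off, which \<open>fm A\<close> does not see.\<close>
  define col where "col j = vec k (\<lambda>i. ent x i j)" for j
  have col: "col j \<in> carrier_vec k" for j by (simp add: col_def)
  have cs: "(norm_cvec (col j))\<^sup>2 = (\<Sum>i<k. (cmod (ent x i j))\<^sup>2)" for j
    by (simp add: norm_cvec_def col_def sum_nonneg)
  have c0: "ent (fm A * x) i j = (if i < k then (A *\<^sub>v col j) $ i else 0)" for i j
    unfolding ent_mult[OF supp_fm[OF A]] using A
    by (auto simp: ent_fm col_def scalar_prod_def lessThan_atLeast0 intro!: sum.cong)
  define n where "n = max k m"
  have n: "supp n x" "supp n (fm A * x)" using m supp_fm[OF A] unfolding n_def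
    by (auto intro: supp_mono intro!: supp_mult)
  have kn: "{..<k} \<subseteq> {..<n}" by (auto simp: n_def)
  have "(norm (fm A * x))\<^sup>2 = (\<Sum>j<n. \<Sum>i<n. (cmod (ent (fm A * x) i j))\<^sup>2)"
    unfolding norm_fmat_sq[OF n(2)] by (rule sum.swap)
  also have "\<dots> = (\<Sum>j<n. \<Sum>i<k. (cmod (ent (fm A * x) i j))\<^sup>2)"
    by (intro sum.cong refl sum.mono_neutral_right kn) (auto simp: c0)
  also have "\<dots> = (\<Sum>j<n. (norm_cvec (A *\<^sub>v col j))\<^sup>2)"
    using A by (intro sum.cong refl) (auto simp: c0 norm_cvec_def sum_nonneg)
  also have "\<dots> \<le> (\<Sum>j<n. R\<^sup>2 * (norm_cvec (col j))\<^sup>2)"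
    unfolding power_mult_distrib[symmetric]
    by (intro sum_mono power_mono opnorm_imp_vec[OF A R(1) col]) (simp add: norm_cvec_def sum_nonneg)
  also have "\<dots> = R\<^sup>2 * (\<Sum>j<n. \<Sum>i<k. (cmod (ent x i j))\<^sup>2)" by (simp add: cs sum_distrib_left)
  also have "\<dots> \<le> R\<^sup>2 * (\<Sum>j<n. \<Sum>i<n. (cmod (ent x i j))\<^sup>2)"
    by (intro mult_left_mono sum_mono sum_mono2 kn) auto
  also have "(\<Sum>j<n. \<Sum>i<n. (cmod (ent x i j))\<^sup>2) = (norm x)\<^sup>2"
    unfolding norm_fmat_sq[OF n(1)] by (rule sum.swap)
  finally have "(norm (fm A * x))\<^sup>2 \<le> (R * norm x)\<^sup>2" by (simp add: power_mult_distrib)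
  then show "norm (fm A * x) \<le> R * norm x" by (rule power2_le_imp_le) (use R in simp)
qed fact

lemma lbd_imp_opnorm: assumes A: "A \<in> carrier_mat k k" and R: "lbd (fm A) R"
  shows "opnorm_mat A \<le> R"
  unfolding opnorm_mat_def
proof (rule cSUP_least)
  have "0\<^sub>v (dim_col A) \<in> {v \<in> carrier_vec (dim_col A). norm_cvec v \<le> 1}" by (simp add: norm_cvec_def)
  then show "{v \<in> carrier_vec (dim_col A). norm_cvec v \<le> 1} \<noteq> {}" by blast
  fix v assume "v \<in> {v \<in> carrier_vec (dim_col A). norm_cvec v \<le> 1}"
  then have v: "v \<in> carrier_vec k" "norm_cvec v \<le> 1" using A by auto
  have "norm_cvec (A *\<^sub>v v) \<le> R * norm_cvec v"
    using lbdD[OF R, of "vf v"] by (simp add: fm_mult_vf[OF A v(1)] norm_vf)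
  also have "\<dots> \<le> R * 1" using v R by (intro mult_left_mono) (auto simp: lbd_def)
  finally show "norm_cvec (A *\<^sub>v v) \<le> R" by simp
qed

subsection \<open>Microstates\<close>

definition mstate :: "('a::complex_hilbert bop \<Rightarrow> complex) \<Rightarrow> real \<Rightarrow> 'a bop list \<Rightarrow> nat \<Rightarrow> nat \<Rightarrow> real \<Rightarrow> (nat \<Rightarrow> fmat) \<Rightarrow> bool"
  where "mstate \<tau> R xs m k \<epsilon> X \<longleftrightarrow> (\<forall>i<length xs. supp k (X i) \<and> lbd (X i) R) \<and>
    (\<forall>w. 1 \<le> length w \<and> length w \<le> m \<and> fst ` set w \<subseteq> {..<length xs} \<longrightarrow>
      cmod (trk k (evf k X (wexpr w)) - \<tau> (evo ((!) xs) (wexpr w))) < \<epsilon>)"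

lemma word_op_wexpr: "word_op xs w = evo ((!) xs) (wexpr w)"
  unfolding word_op_def by (induction w) (auto simp: lit_def)

lemma fm_word_mat:
  assumes "set As \<subseteq> carrier_mat k k" "fst ` set w \<subseteq> {..<length As}"
  shows "word_mat k As w \<in> carrier_mat k k \<and> fm (word_mat k As w) = evf k (\<lambda>i. fm (As ! i)) (wexpr w)"
  using assms(2)
proof (induction w)
  case Nil
  then show ?case by (simp add: word_mat_def fm_one)
next
  case (Cons l w)
  then have IH: "word_mat k As w \<in> carrier_mat k k"
    "fm (word_mat k As w) = evf k (\<lambda>i. fm (As ! i)) (wexpr w)" by auto
  have l: "As ! fst l \<in> carrier_mat k k" using assms(1) Cons.prems by (auto intro!: nth_mem)
  have "word_mat k As (l # w) = (if snd l then mat_adjoint (As ! fst l) else As ! fst l) * word_mat k As w"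
    by (simp add: word_mat_def case_prod_beta)
  then show ?case using IH l mat_adjoint_carrier[OF l]
    by (auto simp: lit_def fm_adjoint fm_mult)
qed

lemma microstates_iff:
  assumes R: "0 \<le> R"
  shows "As \<in> microstates \<tau> R xs m k \<epsilon> \<longleftrightarrow>
    As \<in> mat_tuples k (length xs) \<and> mstate \<tau> R xs m k \<epsilon> (\<lambda>i. fm (As ! i))"
proof (cases "As \<in> mat_tuples k (length xs)")
  case True
  then have As: "length As = length xs" "set As \<subseteq> carrier_mat k k" by (auto simp: mat_tuples_def)
  have c: "As ! i \<in> carrier_mat k k" if "i < length xs" for i using As that by (auto intro!: nth_mem)
  have "opnorm_mat (As ! i) \<le> R \<longleftrightarrow> supp k (fm (As ! i)) \<and> lbd (fm (As ! i)) R" if "i < length xs" for i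
    using opnorm_imp_lbd[OF c[OF that] _ R] lbd_imp_opnorm[OF c[OF that]] supp_fm[OF c[OF that]]
      by blast
  then have 1: "(\<forall>A\<in>set As. opnorm_mat A \<le> R) \<longleftrightarrow> (\<forall>i<length xs. supp k (fm (As ! i)) \<and>
    lbd (fm (As ! i)) R)"
    unfolding all_set_conv_all_nth As(1) by simp
  have w: "(\<forall>(i, s)\<in>set w. i < length xs) \<longleftrightarrow> fst ` set w \<subseteq> {..<length xs}" for w ::
    "(nat \<times> bool) list" by force
  have t: "tau_mat (word_mat k As w) = trk k (evf k (\<lambda>i. fm (As ! i)) (wexpr w))" if "fst ` set w
    \<subseteq> {..<length xs}" for w
  proof -
    have "word_mat k As w \<in> carrier_mat k k" "fm (word_mat k As w) = evf k (\<lambda>i. fm (As ! i)) (wexpr w)"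
      using fm_word_mat[OF As(2), of w] that As(1) by simp_all
    then show ?thesis by (simp only: tau_mat_fm)
  qed
  have 2: "(\<forall>w. 1 \<le> length w \<and> length w \<le> m \<and> fst ` set w \<subseteq> {..<length xs} \<longrightarrow>
        cmod (tau_mat (word_mat k As w) - \<tau> (evo ((!) xs) (wexpr w))) < \<epsilon>) \<longleftrightarrow>
    (\<forall>w. 1 \<le> length w \<and> length w \<le> m \<and> fst ` set w \<subseteq> {..<length xs} \<longrightarrow>
        cmod (trk k (evf k (\<lambda>i. fm (As ! i)) (wexpr w)) - \<tau> (evo ((!) xs) (wexpr w))) < \<epsilon>)"
    by (intro all_cong1 imp_cong refl) (simp only: t)
  show ?thesis unfolding microstates_def mstate_def mem_Collect_eq 1 w word_op_wexpr 2 using True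
    by simp
qed (simp add: microstates_def)

lemma trace_von_neumann:
  assumes "tracial_state M \<tau>"
  shows "\<And>a b. a \<in> M \<Longrightarrow> b \<in> M \<Longrightarrow> \<tau> (a + b) = \<tau> a + \<tau> b" "\<And>c a. a \<in> M \<Longrightarrow> \<tau> (c *\<^sub>C a) = c * \<tau> a" "\<tau> 1 = 1"
  using assms by (simp_all add: tracial_state_def)

lemma sum_list_cmod_le: "cmod (\<Sum>p\<leftarrow>ps. f p) \<le> (\<Sum>p\<leftarrow>ps. cmod (f p))"
  by (induction ps) (auto intro: order_trans[OF norm_triangle_ineq])

lemma mstate_moment:
  assumes M: "von_neumann_algebra M" and tr: "tracial_state M \<tau>" and xs: "set xs \<subseteq> M"
    and e: "vars e \<subseteq> {..<length xs}" and pos: "0 < \<eta>"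
  shows "\<exists>m \<epsilon>. 0 < \<epsilon> \<and> (\<forall>k X R. 0 < k \<longrightarrow> mstate \<tau> R xs m k \<epsilon> X \<longrightarrow>
    cmod (trk k (evf k X e) - \<tau> (evo ((!) xs) e)) < \<eta>)"
proof -
  \<comment> \<open>The total length bounds the length of each word; below, 1 + \<open>s\<close> is
    the divisor because \<open>s\<close> may be 0.\<close>
  define m where "m = (\<Sum>p\<leftarrow>nf e. length (snd p))"
  define s where "s = (\<Sum>p\<leftarrow>nf e. cmod (fst p))"
  define \<epsilon> where "\<epsilon> = \<eta> / (1 + s)"
  have s0: "0 \<le> s" unfolding s_def by (intro sum_list_nonneg) auto
  have e0: "0 < \<epsilon>" using pos s0 by (simp add: \<epsilon>_def)
  have "cmod (trk k (evf k X e) - \<tau> (evo ((!) xs) e)) < \<eta>" if k: "0 < k"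
    and ms: "mstate \<tau> R xs m k \<epsilon> X" for k X R
  proof -
    interpret B: star_algebra adj 1 M by (rule star_algebra_bop[OF M])
    interpret F: star_algebra fadj "idm k" "{f. supp k f}" by (rule star_algebra_fmat)
    have XM: "xs ! i \<in> M" if "i \<in> vars e" for i using that e xs by (auto intro!: nth_mem)
    have Xs: "X i \<in> {f. supp k f}" if "i \<in> vars e" for i using that e ms by (auto simp: mstate_def)
    have t1: "\<tau> (evo ((!) xs) e) = (\<Sum>p\<leftarrow>nf e. fst p * \<tau> (evo ((!) xs) (wexpr (snd p))))"
      by (rule B.linear_nf) (use XM trace_von_neumann[OF tr] in auto)
    have t2: "trk k (evf k X e) = (\<Sum>p\<leftarrow>nf e. fst p * trk k (evf k X (wexpr (snd p))))"
      by (rule F.linear_nf) (use Xs trk_simps in auto)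
    have "trk k (evf k X e) - \<tau> (evo ((!) xs) e) =
      (\<Sum>p\<leftarrow>nf e. fst p * (trk k (evf k X (wexpr (snd p))) - \<tau> (evo ((!) xs) (wexpr (snd p)))))"
      unfolding t1 t2 by (simp add: sum_list_subtractf right_diff_distrib)
    also have "cmod \<dots> \<le> (\<Sum>p\<leftarrow>nf e. cmod (fst p * (trk k (evf k X (wexpr (snd p)))
      - \<tau> (evo ((!) xs) (wexpr (snd p))))))"
      by (rule sum_list_cmod_le)
    also have "\<dots> \<le> (\<Sum>p\<leftarrow>nf e. cmod (fst p) * \<epsilon>)"
    proof (rule sum_list_mono)
      fix p assume p: "p \<in> set (nf e)"
      have "cmod (trk k (evf k X (wexpr (snd p))) - \<tau> (evo ((!) xs) (wexpr (snd p)))) \<le> \<epsilon>"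
      proof (cases "snd p = []")
        \<comment> \<open>The empty word is not constrained by microstates, but both traces of the
          unit are 1 for \<open>0 < k\<close>.\<close>
        case True
        then show ?thesis using trk_idm[OF k] trace_von_neumann(3)[OF tr] e0 by simp
      next
        case False
        have "length (snd p) \<le> m" unfolding m_def by (rule member_le_sum_list) (use p in auto)
        moreover have "fst ` set (snd p) \<subseteq> {..<length xs}" using vars_nf[OF p] e by blast
        ultimately show ?thesis using ms False unfolding mstate_def
          by (intro less_imp_le) (simp add: Suc_le_eq)
      qed
      then show "cmod (fst p * (trk k (evf k X (wexpr (snd p))) - \<tau> (evo ((!) xs) (wexpr (snd p)))))
        \<le> cmod (fst p) * \<epsilon>"
        unfolding norm_mult by (rule mult_left_mono) simp
    qed
    also have "\<dots> = s * \<epsilon>" by (simp add: s_def sum_list_mult_const)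
    also have "\<dots> < \<eta>" using pos s0 by (simp add: \<epsilon>_def field_simps)
    finally show ?thesis .
  qed
  with e0 show ?thesis by blast
qed

lemma mstate_mono:
  assumes "mstate \<tau> R xs m k \<epsilon> X" "m' \<le> m" "\<epsilon> \<le> \<epsilon>'"
  shows "mstate \<tau> R xs m' k \<epsilon>' X"
  unfolding mstate_def
proof (intro conjI allI impI)
  fix w :: "(nat \<times> bool) list" assume w: "1 \<le> length w \<and> length w \<le> m' \<and> fst ` set w \<subseteq> {..<length xs}"
  then have "1 \<le> length w \<and> length w \<le> m \<and> fst ` set w \<subseteq> {..<length xs}" using assms(2) by simp
  then have "cmod (trk k (evf k X (wexpr w)) - \<tau> (evo ((!) xs) (wexpr w))) < \<epsilon>"
    using assms(1) unfolding mstate_def by blast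
  then show "cmod (trk k (evf k X (wexpr w)) - \<tau> (evo ((!) xs) (wexpr w))) < \<epsilon>'" using assms(3) by simp
qed (use assms(1) in \<open>simp_all add: mstate_def\<close>)

lemma mstate_moments:
  assumes M: "von_neumann_algebra M" and tr: "tracial_state M \<tau>" and xs: "set xs \<subseteq> M"
    and fin: "finite E" and E: "\<And>e. e \<in> E \<Longrightarrow> vars e \<subseteq> {..<length xs}" and pos: "0 < \<eta>"
  shows "\<exists>m \<epsilon>. 0 < \<epsilon> \<and> (\<forall>k X R. 0 < k \<longrightarrow> mstate \<tau> R xs m k \<epsilon> X \<longrightarrow>
    (\<forall>e\<in>E. cmod (trk k (evf k X e) - \<tau> (evo ((!) xs) e)) < \<eta>))"
  using fin E
proof (induction E)
  case empty
  show ?case by (intro exI[of _ 0] exI[of _ 1]) simp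
next
  case (insert e E)
  from mstate_moment[OF M tr xs insert.prems[OF insertI1] pos]
  obtain m1 d1 where 1: "0 < d1" "\<forall>k X R. 0 < k \<longrightarrow> mstate \<tau> R xs m1 k d1 X \<longrightarrow>
    cmod (trk k (evf k X e) - \<tau> (evo ((!) xs) e)) < \<eta>"
    by (elim exE conjE) (rule that)
  have "\<exists>m \<epsilon>. 0 < \<epsilon> \<and> (\<forall>k X R. 0 < k \<longrightarrow> mstate \<tau> R xs m k \<epsilon> X \<longrightarrow>
    (\<forall>e\<in>E. cmod (trk k (evf k X e) - \<tau> (evo ((!) xs) e)) < \<eta>))"
    by (rule insert.IH) (use insert.prems in simp)
  then obtain m2 d2 where 2: "0 < d2" "\<forall>k X R. 0 < k \<longrightarrow> mstate \<tau> R xs m2 k d2 X \<longrightarrow>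
    (\<forall>e\<in>E. cmod (trk k (evf k X e) - \<tau> (evo ((!) xs) e)) < \<eta>)" by (elim exE conjE) (rule that)
  show ?case
  proof (intro exI[of _ "max m1 m2"] exI[of _ "min d1 d2"] conjI allI impI ballI)
    show "0 < min d1 d2" using 1 2 by simp
    fix k X R e' assume k: "0 < k" and ms: "mstate \<tau> R xs (max m1 m2) k (min d1 d2) X"
      and e': "e' \<in> insert e E"
    have "mstate \<tau> R xs m1 k d1 X" "mstate \<tau> R xs m2 k d2 X" using mstate_mono[OF ms] by simp_all
    then show "cmod (trk k (evf k X e') - \<tau> (evo ((!) xs) e')) < \<eta>"
      using 1(2)[rule_format, OF k] 2(2)[rule_format, OF k] e' by auto
  qed
qed

subsection \<open>Covering the image of a ball\<close>

definition orthonormal :: "'v::real_inner set \<Rightarrow> bool"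
  where "orthonormal F \<longleftrightarrow> (\<forall>f\<in>F. \<forall>g\<in>F. inner f g = (if f = g then 1 else 0))"

definition proj :: "'v::real_inner set \<Rightarrow> 'v \<Rightarrow> 'v"
  where "proj F v = (\<Sum>f\<in>F. inner f v *\<^sub>R f)"

lemma inner_proj: "finite F \<Longrightarrow> orthonormal F \<Longrightarrow> f \<in> F \<Longrightarrow> inner f (proj F v) = inner f v"
  unfolding proj_def orthonormal_def inner_sum_right inner_scaleR_right
  by (subst sum.cong[OF refl, of _ _ "\<lambda>g. if g = f then inner f v else 0"]) auto

lemma norm_proj: assumes "finite F" "orthonormal F" shows "(norm (proj F v))\<^sup>2 = (\<Sum>f\<in>F. (inner f v)\<^sup>2)"
proof -
  have "inner (proj F v) (proj F v) = (\<Sum>f\<in>F. inner f v * inner f (proj F v))"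
    by (subst proj_def) (simp add: inner_sum_left)
  also have "\<dots> = (\<Sum>f\<in>F. inner f v * inner f v)" using inner_proj[OF assms] by (intro sum.cong) auto
  finally show ?thesis unfolding power2_norm_eq_inner by (simp add: power2_eq_square)
qed

lemma bessel: assumes "finite F" "orthonormal F" shows "(\<Sum>f\<in>F. (inner f v)\<^sup>2) \<le> (norm v)\<^sup>2"
proof -
  have "inner v (proj F v) = (\<Sum>f\<in>F. (inner f v)\<^sup>2)"
    unfolding proj_def by (simp add: inner_sum_right inner_commute power2_eq_square)
  moreover have "0 \<le> inner (v - proj F v) (v - proj F v)" by simp
  ultimately show ?thesis using norm_proj[OF assms, of v]
    by (simp add: inner_simps inner_commute power2_norm_eq_inner)
qed

lemma proj_diff: "proj F (v - w) = proj F v - proj F w"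
  unfolding proj_def by (simp add: inner_diff_right scaleR_left_diff_distrib sum_subtractf)

text \<open>
  A greedy choice: while some vector of the image of the unit ball has distance more than \<open>\<kappa>\<close>
  from the span of \<open>F\<close>, add the direction of its orthogonal component.  By Bessel's
  inequality each step uses up \<open>\<kappa>\<^sup>2\<close> of the Hilbert-Schmidt norm.
\<close>

lemma greedy_subspace:
  fixes e :: "'i \<Rightarrow> 'v::real_inner"
  assumes I: "finite I" and k: "0 < \<kappa>"
  shows "\<exists>F. finite F \<and> orthonormal F \<and> real (card F) * \<kappa>\<^sup>2 \<le> (\<Sum>b\<in>I. (norm (e b))\<^sup>2) \<and>
    (\<forall>x. (\<Sum>b\<in>I. (x b)\<^sup>2) \<le> 1 \<longrightarrow> norm ((\<Sum>b\<in>I. x b *\<^sub>R e b) - proj F (\<Sum>b\<in>I. x b *\<^sub>R e b)) \<le> \<kappa>)"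
proof -
  define good where "good F \<longleftrightarrow> finite F \<and> orthonormal F \<and>
    (\<forall>f\<in>F. \<kappa>\<^sup>2 \<le> (\<Sum>b\<in>I. (inner f (e b))\<^sup>2))" for F :: "'v set"
  have bound: "real (card F) * \<kappa>\<^sup>2 \<le> (\<Sum>b\<in>I. (norm (e b))\<^sup>2)" if "good F" for F
  proof -
    have "real (card F) * \<kappa>\<^sup>2 = (\<Sum>f\<in>F. \<kappa>\<^sup>2)" by simp
    also have "\<dots> \<le> (\<Sum>f\<in>F. \<Sum>b\<in>I. (inner f (e b))\<^sup>2)" using that by (intro sum_mono) (auto simp: good_def)
    also have "\<dots> = (\<Sum>b\<in>I. \<Sum>f\<in>F. (inner f (e b))\<^sup>2)" by (rule sum.swap)
    also have "\<dots> \<le> (\<Sum>b\<in>I. (norm (e b))\<^sup>2)" using that by (intro sum_mono bessel) (auto simp: good_def)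
    finally show ?thesis .
  qed
  define P where "P n \<longleftrightarrow> (\<exists>F. good F \<and> card F = n)" for n
  define N where "N = nat \<lceil>(\<Sum>b\<in>I. (norm (e b))\<^sup>2) / \<kappa>\<^sup>2\<rceil>"
  have P0: "P 0" unfolding P_def good_def by (intro exI[of _ "{}"]) (simp add: orthonormal_def)
  have PN: "n \<le> N" if Pn: "P n" for n
  proof -
    obtain F where F: "good F" "card F = n" using Pn P_def by blast
    have "real n \<le> (\<Sum>b\<in>I. (norm (e b))\<^sup>2) / \<kappa>\<^sup>2" using bound[OF F(1)] F(2) k
      by (simp add: pos_le_divide_eq)
    then show ?thesis unfolding N_def by linarith
  qed
  \<comment> \<open>A good family of greatest cardinality replaces the greedy process; it exists by
    the bound on cardinalities.\<close>
  obtain n where n: "P n" "\<And>m. P m \<Longrightarrow> m \<le> n" using Nat.ex_has_greatest_nat[of P 0 N] P0 PN by metis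
  obtain F where F: "good F" "card F = n" using n(1) P_def by blast
  have Ff: "finite F" "orthonormal F" using F(1) by (simp_all add: good_def)
  have "norm ((\<Sum>b\<in>I. x b *\<^sub>R e b) - proj F (\<Sum>b\<in>I. x b *\<^sub>R e b)) \<le> \<kappa>" if x: "(\<Sum>b\<in>I. (x b)\<^sup>2) \<le> 1" for x
  proof (rule ccontr)
    define y where "y = (\<Sum>b\<in>I. x b *\<^sub>R e b)"
    define r where "r = y - proj F y"
    define f where "f = (1 / norm r) *\<^sub>R r"
    assume "\<not> ?thesis"
    then have r: "\<kappa> < norm r" by (simp add: r_def y_def)
    then have r0: "0 < norm r" using k by linarith
    have rF: "inner g r = 0" if "g \<in> F" for g
      unfolding r_def using inner_proj[OF Ff that] by (simp add: inner_diff_right)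
    have "inner r (proj F y) = 0"
      unfolding proj_def by (simp add: inner_sum_right inner_commute[of r] rF)
    then have "inner r y = (norm r)\<^sup>2" unfolding power2_norm_eq_inner
      by (subst (3) r_def) (simp add: inner_diff_right)
    then have fy: "inner f y = norm r" unfolding f_def using r0 by (simp add: power2_eq_square)
    \<comment> \<open>The direction \<open>f\<close> pairs with \<open>y\<close> to more than
      \<open>\<kappa>\<close>, and \<open>y\<close> has coefficients in the unit ball, so
      Cauchy-Schwarz makes \<open>f\<close> an admissible new member.\<close>
    have "(norm r)\<^sup>2 = (\<Sum>b\<in>I. x b * inner f (e b))\<^sup>2"
      unfolding fy[symmetric] y_def by (simp add: inner_sum_right)
    also have "\<dots> \<le> (\<Sum>b\<in>I. (x b)\<^sup>2) * (\<Sum>b\<in>I. (inner f (e b))\<^sup>2)" by (rule Cauchy_Schwarz_ineq_sum)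
    also have "\<dots> \<le> 1 * (\<Sum>b\<in>I. (inner f (e b))\<^sup>2)" using x
      by (intro mult_right_mono) (auto intro: sum_nonneg)
    finally have "(norm r)\<^sup>2 \<le> (\<Sum>b\<in>I. (inner f (e b))\<^sup>2)" by simp
    moreover have "\<kappa>\<^sup>2 \<le> (norm r)\<^sup>2" by (rule power_mono) (use r k in simp_all)
    ultimately have f1: "\<kappa>\<^sup>2 \<le> (\<Sum>b\<in>I. (inner f (e b))\<^sup>2)" by linarith
    have ff: "inner f f = 1" unfolding f_def using r0
      by (simp add: power2_norm_eq_inner[symmetric] power2_eq_square)
    have fF: "inner g f = 0" "inner f g = 0" if "g \<in> F" for g
      unfolding f_def using rF[OF that] by (simp_all add: inner_commute)
    then have nf: "f \<notin> F" using ff by force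
    have "good (insert f F)"
      using F(1) f1 ff fF nf unfolding good_def orthonormal_def by auto
    moreover have "card (insert f F) = Suc n" using nf Ff F(2) by simp
    ultimately have "P (Suc n)" unfolding P_def by blast
    then show False using n(2) by fastforce
  qed
  then show ?thesis using Ff bound[OF F(1)] by blast
qed

text \<open>The sum of 2^(- |c|) over all integers is 3, and the tails beyond \<open>S\<close>
  contribute 2 * 2^(- S); scaled by 2^S they give the summand 2, which carries the
  induction.\<close>

lemma sum_two_powers: "(\<Sum>c\<in>{- int S..int S}. 2 ^ (S - nat \<bar>c\<bar>)) + 2 \<le> 3 * (2::nat) ^ S"
proof (induction S)
  case (Suc S)
  have "{- int (Suc S)..int (Suc S)} = insert (- int (Suc S)) (insert (int (Suc S)) {- int S..int S})" by auto
  then have "(\<Sum>c\<in>{- int (Suc S)..int (Suc S)}. 2 ^ (Suc S - nat \<bar>c\<bar>)) =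
    1 + (1 + (\<Sum>c\<in>{- int S..int S}. (2::nat) ^ (Suc S - nat \<bar>c\<bar>)))" by (simp add: nat_add_distrib)
  also have "(\<Sum>c\<in>{- int S..int S}. (2::nat) ^ (Suc S - nat \<bar>c\<bar>))
    = 2 * (\<Sum>c\<in>{- int S..int S}. 2 ^ (S - nat \<bar>c\<bar>))"
    unfolding sum_distrib_left by (intro sum.cong refl) (auto simp: Suc_diff_le simp flip: power_Suc)
  finally show ?case using Suc by simp
qed simp

definition int_cells :: "'f set \<Rightarrow> nat \<Rightarrow> ('f \<Rightarrow> int) set"
  where "int_cells F S = {z. (\<forall>f. f \<notin> F \<longrightarrow> z f = 0) \<and> (\<Sum>f\<in>F. nat \<bar>z f\<bar>) \<le> S}"

text \<open>Each integer point whose absolute coordinates sum to at most \<open>S\<close> is counted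
  with a weight 2^(S - sum) \<ge> 1; the weights factor over the coordinates, one factor 3 for each.
  The bound is exponential in card F + S, with no logarithm of the dimension.\<close>

lemma card_int_cells: "finite F \<Longrightarrow> finite (int_cells F S) \<and> card (int_cells F S) \<le> 3 ^ card F * 2 ^ S"
proof (induction F arbitrary: S rule: finite_induct)
  case empty
  have "int_cells {} S = {\<lambda>_::'a. 0}" by (auto simp: int_cells_def fun_eq_iff)
  then show ?case by simp
next
  case (insert g F)
  let ?A = "SIGMA c:{- int S..int S}. int_cells F (S - nat \<bar>c\<bar>)"
  define h where "h z = (z g, z(g := 0))" for z :: "'a \<Rightarrow> int"
  have inj: "inj_on h (int_cells (insert g F) S)"
  proof (rule inj_onI)
    fix z z' assume "h z = h z'"
    then have "z g = z' g" "z(g := 0) = z'(g := 0)" by (simp_all add: h_def)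
    then have "(z(g := 0))(g := z g) = (z'(g := 0))(g := z' g)" by simp
    then show "z = z'" by simp
  qed
  have sub: "h ` int_cells (insert g F) S \<subseteq> ?A"
  proof (rule image_subsetI)
    fix z assume "z \<in> int_cells (insert g F) S"
    then have z: "\<And>f. f \<notin> insert g F \<Longrightarrow> z f = 0" "nat \<bar>z g\<bar> + (\<Sum>f\<in>F. nat \<bar>z f\<bar>) \<le> S"
      using insert by (auto simp: int_cells_def)
    have "(\<Sum>f\<in>F. nat \<bar>(z(g := 0)) f\<bar>) = (\<Sum>f\<in>F. nat \<bar>z f\<bar>)"
      using insert by (intro sum.cong) auto
    then show "h z \<in> ?A" using z by (auto simp: h_def int_cells_def)
  qed
  have finA: "finite ?A" using insert by auto
  have fin: "finite (int_cells (insert g F) S)"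
    using inj sub finA by (meson finite_imageD finite_subset)
  have "card (int_cells (insert g F) S) \<le> card ?A" by (rule card_inj_on_le[OF inj sub finA])
  also have "\<dots> = (\<Sum>c\<in>{- int S..int S}. card (int_cells F (S - nat \<bar>c\<bar>)))"
    using insert by (subst card_SigmaI) auto
  also have "\<dots> \<le> (\<Sum>c\<in>{- int S..int S}. 3 ^ card F * 2 ^ (S - nat \<bar>c\<bar>))"
    using insert by (intro sum_mono) auto
  also have "\<dots> \<le> 3 ^ card F * (3 * 2 ^ S)"
    unfolding sum_distrib_left[symmetric] using sum_two_powers[of S] by (intro mult_left_mono) auto
  also have "\<dots> = 3 ^ card (insert g F) * 2 ^ S" using insert by simp
  finally show ?case using fin by simp
qed

text \<open>Round the coordinates with respect to the orthonormal family of
  \<open>greedy_subspace\<close>, of size at most \<open>D\<close>. The sum of the absolute rounded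
  values is bounded through the sum of squares, that is by Bessel; this elementary count takes the
  place of a volume comparison.\<close>

lemma ball_image_cells:
  fixes e :: "'i \<Rightarrow> 'v::real_inner"
  assumes I: "finite I" and H: "(\<Sum>b\<in>I. (norm (e b))\<^sup>2) \<le> H" "0 < H"
    and pos: "0 < \<kappa>" "0 < \<theta>" "0 \<le> \<rho>"
  obtains cell :: "'v \<Rightarrow> 'v \<Rightarrow> int" and Z where "finite Z"
    "real (card Z) \<le> exp (H / \<kappa>\<^sup>2 * (5 + \<rho>\<^sup>2 / \<theta>\<^sup>2))"
    "\<And>x. norm (\<Sum>b\<in>I. x b *\<^sub>R e b) \<le> \<rho> \<Longrightarrow> cell (\<Sum>b\<in>I. x b *\<^sub>R e b) \<in> Z"
    "\<And>x x'. (\<Sum>b\<in>I. (x b)\<^sup>2) \<le> 1 \<Longrightarrow> (\<Sum>b\<in>I. (x' b)\<^sup>2) \<le> 1 \<Longrightarrow>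
      cell (\<Sum>b\<in>I. x b *\<^sub>R e b) = cell (\<Sum>b\<in>I. x' b *\<^sub>R e b) \<Longrightarrow>
      norm ((\<Sum>b\<in>I. x b *\<^sub>R e b) - (\<Sum>b\<in>I. x' b *\<^sub>R e b)) \<le> 2 * \<kappa> + \<theta>"
proof -
  from greedy_subspace[OF I pos(1), of e]
  obtain F where F: "finite F" "orthonormal F" "real (card F) * \<kappa>\<^sup>2 \<le> (\<Sum>b\<in>I. (norm (e b))\<^sup>2)"
    and near: "\<forall>x. (\<Sum>b\<in>I. (x b)\<^sup>2) \<le> 1 \<longrightarrow> norm ((\<Sum>b\<in>I. x b *\<^sub>R e b) - proj F (\<Sum>b\<in>I. x b *\<^sub>R e b)) \<le> \<kappa>"
    by (elim exE conjE) (rule that)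
  define D where "D = H / \<kappa>\<^sup>2"
  have D: "0 < D" using H pos by (simp add: D_def)
  have dD: "real (card F) \<le> D" unfolding D_def using F(3) H pos by (simp add: pos_le_divide_eq)
  \<comment> \<open>With this mesh at most \<open>D\<close> coordinates, each off by at most
    \<open>s\<close>, are off by \<open>\<theta>\<close> in norm.\<close>
  define s where "s = \<theta> / sqrt D"
  have s: "0 < s" using pos D by (simp add: s_def)
  have s2: "s\<^sup>2 = \<theta>\<^sup>2 / D" using D by (simp add: s_def power_divide)
  define cell where "cell y f = (if f \<in> F then \<lfloor>inner f y / s\<rfloor> else 0)" for y f :: 'v
  \<comment> \<open>Rounding gives at most c^2 + 2 per coordinate c, and the squares add up to at
    most \<rho>^2 / s^2 = D \<rho>^2 / \<theta>^2.\<close>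
  define q where "q = D * (\<rho>\<^sup>2 / \<theta>\<^sup>2 + 2)"
  have q0: "0 \<le> q" using D by (simp add: q_def)
  define S where "S = nat \<lfloor>q\<rfloor>"
  define Z where "Z = int_cells F S"
  have Z: "finite Z" "card Z \<le> 3 ^ card F * 2 ^ S" using card_int_cells[OF F(1)] by (auto simp: Z_def)
  have inZ: "cell y \<in> Z" if "norm y \<le> \<rho>" for y
  proof -
    have "real (\<Sum>f\<in>F. nat \<bar>cell y f\<bar>) = (\<Sum>f\<in>F. \<bar>real_of_int \<lfloor>inner f y / s\<rfloor>\<bar>)" by (simp add: cell_def)
    also have "\<dots> \<le> (\<Sum>f\<in>F. (inner f y)\<^sup>2 / s\<^sup>2 + 2)"
    proof (rule sum_mono)
      fix f
      define c where "c = inner f y / s"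
      have "\<bar>real_of_int \<lfloor>c\<rfloor>\<bar> \<le> \<bar>c\<bar> + 1" by linarith
      moreover have "\<bar>c\<bar> \<le> c\<^sup>2 + 1"
      proof (cases "\<bar>c\<bar> \<le> 1")
        case False
        then have "\<bar>c\<bar> * 1 \<le> \<bar>c\<bar> * \<bar>c\<bar>" by (intro mult_left_mono) auto
        then show ?thesis by (simp add: power2_eq_square)
      next
        case True
        then show ?thesis using zero_le_power2[of c] by linarith
      qed
      ultimately have "\<bar>real_of_int \<lfloor>c\<rfloor>\<bar> \<le> c\<^sup>2 + 2" by linarith
      then show "\<bar>real_of_int \<lfloor>inner f y / s\<rfloor>\<bar> \<le> (inner f y)\<^sup>2 / s\<^sup>2 + 2"
        by (simp add: c_def power_divide)
    qed
    also have "\<dots> = (\<Sum>f\<in>F. (inner f y)\<^sup>2) / s\<^sup>2 + 2 * real (card F)"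
      by (simp add: sum.distrib sum_divide_distrib)
    also have "\<dots> \<le> \<rho>\<^sup>2 / s\<^sup>2 + 2 * D"
    proof (intro add_mono divide_right_mono mult_left_mono dD)
      show "(\<Sum>f\<in>F. (inner f y)\<^sup>2) \<le> \<rho>\<^sup>2"
        using bessel[OF F(1,2), of y] power_mono[OF that, of 2] by simp
    qed simp_all
    also have "\<dots> = q" using D pos by (simp add: q_def s2 field_simps)
    finally have "(\<Sum>f\<in>F. nat \<bar>cell y f\<bar>) \<le> S" unfolding S_def using q0 by linarith
    then show ?thesis by (simp add: Z_def int_cells_def cell_def)
  qed
  have close: "norm (proj F y - proj F y') \<le> \<theta>" if "cell y = cell y'" for y y'
  proof -
    have *: "(inner f (y - y'))\<^sup>2 \<le> s\<^sup>2" if "f \<in> F" for f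
    proof -
      have "\<lfloor>inner f y / s\<rfloor> = \<lfloor>inner f y' / s\<rfloor>"
        using fun_cong[OF \<open>cell y = cell y'\<close>, of f] that by (simp add: cell_def)
      then have "\<bar>inner f y / s - inner f y' / s\<bar> \<le> 1" by linarith
      then have "\<bar>inner f (y - y')\<bar> \<le> s" using s
        by (simp add: inner_diff_right flip: diff_divide_distrib)
      then show ?thesis using s by (simp add: abs_le_square_iff[symmetric])
    qed
    have "(norm (proj F y - proj F y'))\<^sup>2 = (\<Sum>f\<in>F. (inner f (y - y'))\<^sup>2)"
      unfolding proj_diff[symmetric] by (rule norm_proj[OF F(1,2)])
    also have "\<dots> \<le> (\<Sum>f\<in>F. s\<^sup>2)" by (intro sum_mono *)
    also have "\<dots> = real (card F) * s\<^sup>2" by simp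
    also have "\<dots> \<le> D * s\<^sup>2" by (intro mult_right_mono dD) simp
    also have "\<dots> = \<theta>\<^sup>2" using D by (simp add: s2)
    finally show ?thesis using pos by (simp add: power2_le_iff_abs_le)
  qed
  show thesis
  proof (rule that[of Z cell])
    show "finite Z" by (rule Z)
    have "real (card Z) \<le> 3 ^ card F * 2 ^ S"
      using of_nat_mono[OF Z(2), where 'a = real] by simp
    also have "\<dots> \<le> exp 2 ^ card F * exp 1 ^ S"
    proof (intro mult_mono power_mono)
      show "(3::real) \<le> exp 2" using exp_ge_add_one_self[of "2::real"] by simp
      show "(2::real) \<le> exp 1" using exp_ge_add_one_self[of "1::real"] by simp
    qed auto
    also have "\<dots> = exp (2 * real (card F) + real S)"
      using exp_of_nat2_mult[of "1::real" S] by (simp add: exp_add exp_of_nat2_mult)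
    also have "\<dots> \<le> exp (H / \<kappa>\<^sup>2 * (5 + \<rho>\<^sup>2 / \<theta>\<^sup>2))"
    proof -
      have "real S \<le> q" unfolding S_def using q0 by linarith
      then have "2 * real (card F) + real S \<le> 2 * D + q" using dD by linarith
      also have "\<dots> \<le> D * (5 + \<rho>\<^sup>2 / \<theta>\<^sup>2)" unfolding q_def using D by (simp add: algebra_simps)
      finally show ?thesis by (simp add: D_def)
    qed
    finally show "real (card Z) \<le> exp (H / \<kappa>\<^sup>2 * (5 + \<rho>\<^sup>2 / \<theta>\<^sup>2))" .
    show "cell (\<Sum>b\<in>I. x b *\<^sub>R e b) \<in> Z" if "norm (\<Sum>b\<in>I. x b *\<^sub>R e b) \<le> \<rho>" for x
      by (rule inZ) fact
    fix x x' :: "'i \<Rightarrow> real"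
    let ?y = "\<Sum>b\<in>I. x b *\<^sub>R e b" and ?y' = "\<Sum>b\<in>I. x' b *\<^sub>R e b"
    assume a: "(\<Sum>b\<in>I. (x b)\<^sup>2) \<le> 1" "(\<Sum>b\<in>I. (x' b)\<^sup>2) \<le> 1" "cell ?y = cell ?y'"
    have tri: "norm (a + b - c) \<le> norm a + norm b + norm c" for a b c :: 'v
      by (rule order_trans[OF norm_triangle_ineq4 add_right_mono[OF norm_triangle_ineq]])
    have "norm (?y - ?y') = norm ((?y - proj F ?y) + (proj F ?y - proj F ?y') - (?y' - proj F ?y'))"
      by simp
    also have "\<dots> \<le> norm (?y - proj F ?y) + norm (proj F ?y - proj F ?y') + norm (?y' - proj F ?y')"
      by (rule tri)
    finally show "norm (?y - ?y') \<le> 2 * \<kappa> + \<theta>"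
      using near[rule_format, OF a(1)] near[rule_format, OF a(2)] close[OF a(3)] by linarith
  qed
qed

subsection \<open>Unitary conjugation and orbit balls\<close>

definition uf :: "nat \<Rightarrow> fmat \<Rightarrow> bool"
  where "uf k w \<longleftrightarrow> supp k w \<and> fadj w * w = idm k \<and> w * fadj w = idm k"

text \<open>The inverse of the conjugation in \<open>orbit_ball\<close>: it rotates a tuple towards
  the centre of its ball instead of the centre towards the tuple.\<close>

definition conjf :: "fmat \<Rightarrow> fmat \<Rightarrow> fmat"
  where "conjf w x = fadj w * x * w"

lemma supp_conjf: "uf k w \<Longrightarrow> supp k x \<Longrightarrow> supp k (conjf w x)"
  unfolding conjf_def uf_def by (intro supp_mult supp_fadj) auto

lemma conjf_diff: "conjf w (x - y) = conjf w x - conjf w y"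
  by (simp add: conjf_def algebra_simps)

lemma norm_unitary_left: assumes "uf k w" "supp k x" shows "norm (fadj w * x) = norm x"
proof -
  have "inner (fadj w * x) (fadj w * x) = inner x (w * fadj w * x)"
    by (simp add: inner_mult_fadj mult.assoc)
  also have "w * fadj w * x = x" using assms by (simp add: uf_def idm_mult)
  finally show ?thesis by (simp add: norm_eq_sqrt_inner)
qed

lemma norm_conjf: assumes "uf k w" "supp k x" shows "norm (conjf w x) = norm x"
proof -
  have s: "supp k (fadj (fadj w * x))" using assms by (intro supp_fadj supp_mult) (auto simp: uf_def)
  have "norm (conjf w x) = norm (fadj w * fadj (fadj w * x))"
    unfolding conjf_def by (subst norm_fadj[symmetric]) simp
  also have "\<dots> = norm (fadj w * x)" using norm_unitary_left[OF assms(1) s] by (simp only: norm_fadj)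
  finally show ?thesis using norm_unitary_left[OF assms] by simp
qed

lemma lbd_unitary: assumes "uf k w" shows "lbd w 1"
  unfolding lbd_def
proof (intro conjI allI)
  fix x
  have "(norm (w * x))\<^sup>2 = inner x (idm k * x)"
    unfolding power2_norm_eq_inner inner_mult_fadj using assms by (simp add: uf_def flip: mult.assoc)
  also have "\<dots> \<le> norm x * norm (idm k * x)" by (rule norm_cauchy_schwarz)
  also have "\<dots> \<le> norm x * (1 * norm x)" by (intro mult_left_mono lbdD[OF lbd_idm]) simp
  finally have "(norm (w * x))\<^sup>2 \<le> (1 * norm x)\<^sup>2" by (simp add: power2_eq_square)
  then show "norm (w * x) \<le> 1 * norm x" by (rule power2_le_imp_le) simp
qed simp

lemma lbd_conjf: assumes "uf k w" "lbd a R" shows "lbd (conjf w a) R"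
proof -
  have "lbd (fadj w * a * w) (1 * R * 1)"
    by (intro lbd_mult lbd_fadj lbd_unitary[OF assms(1)] assms)
  then show ?thesis by (simp add: conjf_def)
qed

lemma conjf_mult: assumes "uf k w" "supp k a" shows "conjf w (a * b) = conjf w a * conjf w b"
proof -
  have "conjf w a * conjf w b = fadj w * (a * (w * fadj w)) * b * w"
    by (simp add: conjf_def mult.assoc)
  also have "a * (w * fadj w) = a" using assms by (simp add: uf_def idm_mult)
  finally show ?thesis by (simp add: conjf_def mult.assoc)
qed

lemma evf_conjf:
  assumes w: "uf k w"
  shows "(\<And>i. i \<in> vars e \<Longrightarrow> supp k (X i)) \<Longrightarrow> evf k (\<lambda>i. conjf w (X i)) e = conjf w (evf k X e)"
proof (induction e)
  case One
  have "conjf w (idm k) = idm k" using w by (simp add: conjf_def uf_def idm_mult supp_fadj)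
  then show ?case by simp
next
  case (Mul e f)
  have "supp k (evf k X e)" using Mul.prems by (intro supp_evf) auto
  then show ?case using Mul conjf_mult[OF w] by simp
qed (simp_all add: conjf_def algebra_simps)

lemma trk_conjf: assumes w: "uf k w" and x: "supp k x" shows "trk k (conjf w x) = trk k x"
proof -
  have s: "supp k w" "supp k (fadj w * x)" using assms
    by (auto simp: uf_def intro!: supp_mult supp_fadj)
  have "trk k (conjf w x) = trk k (w * (fadj w * x))" unfolding conjf_def
    by (rule trk_commute[OF s(2,1)])
  also have "w * (fadj w * x) = x" using assms by (simp add: uf_def idm_mult flip: mult.assoc)
  finally show ?thesis .
qed

lemma fm_inj: assumes "A \<in> carrier_mat k k" "B \<in> carrier_mat k k" "fm A = fm B" shows "A = B"
proof (rule eq_matI)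
  fix i j assume "i < dim_row B" "j < dim_col B"
  then show "A $$ (i, j) = B $$ (i, j)"
    using arg_cong[OF assms(3), of "\<lambda>f. ent f i j"] assms(1,2) by (simp add: ent_fm)
qed (use assms in auto)

lemma uf_fm: assumes "W \<in> unitary_mats k" shows "uf k (fm W)"
proof -
  have W: "W \<in> carrier_mat k k" "mat_adjoint W * W = 1\<^sub>m k" "W * mat_adjoint W = 1\<^sub>m k"
    using assms by (auto simp: unitary_mats_def)
  have "fadj (fm W) * fm W = fm (mat_adjoint W * W)" "fm W * fadj (fm W) = fm (W * mat_adjoint W)"
    using W(1) mat_adjoint_carrier[OF W(1)] by (simp_all add: fm_mult fm_adjoint)
  then show ?thesis unfolding uf_def W fm_one using supp_fm[OF W(1)] by simp
qed

lemma mk_unitary: assumes "uf k w" shows "mk k w \<in> unitary_mats k"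
proof -
  have c: "mk k w \<in> carrier_mat k k" "mat_adjoint (mk k w) \<in> carrier_mat k k"
    by (simp_all add: mat_adjoint_carrier)
  have f: "fm (mk k w) = w" using assms by (simp add: fm_mk uf_def)
  have fa: "fm (mat_adjoint (mk k w)) = fadj w" by (simp only: fm_adjoint[OF c(1)] f)
  have "mat_adjoint (mk k w) * mk k w = 1\<^sub>m k"
    by (rule fm_inj[OF mult_carrier_mat[OF c(2,1)]]) (use assms
      in \<open>simp_all add: fm_mult[OF c(2,1)] fa f fm_one uf_def\<close>)
  moreover have "mk k w * mat_adjoint (mk k w) = 1\<^sub>m k"
    by (rule fm_inj[OF mult_carrier_mat[OF c]]) (use assms
      in \<open>simp_all add: fm_mult[OF c] fa f fm_one uf_def\<close>)
  ultimately show ?thesis using c by (simp add: unitary_mats_def)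
qed

lemma uf_mult_fadj: assumes "uf k v" "uf k w" shows "uf k (v * fadj w)"
proof -
  have "fadj (v * fadj w) * (v * fadj w) = w * (fadj v * v) * fadj w" by (simp add: mult.assoc)
  moreover have "(v * fadj w) * fadj (v * fadj w) = v * (fadj w * w) * fadj v" by (simp add: mult.assoc)
  ultimately show ?thesis using assms by (simp add: uf_def idm_mult supp_mult supp_fadj)
qed

lemma mat_tuplesD: "As \<in> mat_tuples k p \<Longrightarrow> j < p \<Longrightarrow> As ! j \<in> carrier_mat k k"
  by (auto simp: mat_tuples_def)

lemma dist2_mats_fm:
  assumes "As \<in> mat_tuples k p" "Bs \<in> mat_tuples k p" "0 < k"
  shows "dist2_mats As Bs = sqrt ((\<Sum>j<p. (norm (fm (As ! j) - fm (Bs ! j)))\<^sup>2) / real k)"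
proof -
  have "Re (tau_mat (mat_adjoint (As ! j - Bs ! j) * (As ! j - Bs ! j)))
    = (norm (fm (As ! j) - fm (Bs ! j)))\<^sup>2 / real k"
    if "j < p" for j
  proof -
    have a: "As ! j \<in> carrier_mat k k" and b: "Bs ! j \<in> carrier_mat k k" using assms that
      by (auto intro: mat_tuplesD)
    have d: "As ! j - Bs ! j \<in> carrier_mat k k" by (rule minus_carrier_mat[OF b])
    have "Re (tau_mat (mat_adjoint (As ! j - Bs ! j) * (As ! j - Bs ! j))) =
      Re (trk k (fadj (fm (As ! j - Bs ! j)) * fm (As ! j - Bs ! j)))"
      using d mat_adjoint_carrier[OF d] by (simp add: tau_mat_fm[of _ k] fm_mult fm_adjoint)
    also have "\<dots> = (norm (fm (As ! j - Bs ! j)))\<^sup>2 / real k"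
      using norm_sq_trk[OF supp_fm[OF d]] assms(3) by simp
    finally show ?thesis by (simp add: fm_diff[OF a b])
  qed
  then show ?thesis using assms(1) unfolding dist2_mats_def
    by (simp add: mat_tuples_def sum_divide_distrib)
qed

lemma fm_conjugate:
  assumes "W \<in> carrier_mat k k" "B \<in> carrier_mat k k"
  shows "fm (W * B * mat_adjoint W) = fm W * fm B * fadj (fm W)"
    "W * B * mat_adjoint W \<in> carrier_mat k k"
  using assms mat_adjoint_carrier[OF assms(1)] by (simp_all add: fm_mult[of _ k] fm_adjoint mult.assoc)

text \<open>Both tuples have been rotated into a common position, by different unitaries;
  \<open>w1 * fadj w2\<close> carries the second into the position of the first.\<close>

lemma orbit_ballI:
  assumes A: "As \<in> mat_tuples k p" and B: "Bs \<in> mat_tuples k p" and k: "0 < k" and \<omega>: "0 < \<omega>"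
    and w: "uf k w1" "uf k w2"
    and d: "(\<Sum>j<p. (norm (conjf w1 (fm (As ! j)) - conjf w2 (fm (Bs ! j))))\<^sup>2) < \<omega>\<^sup>2 * real k"
  shows "As \<in> orbit_ball k Bs \<omega>"
proof -
  define w where "w = w1 * fadj w2"
  define W where "W = mk k w"
  have uw: "uf k w" unfolding w_def by (rule uf_mult_fadj) (use w in auto)
  have W: "W \<in> unitary_mats k" "fm W = w" "W \<in> carrier_mat k k"
    unfolding W_def using mk_unitary[OF uw] uw by (simp_all add: fm_mk uf_def)
  let ?C = "map (\<lambda>B. W * B * mat_adjoint W) Bs"
  have C: "?C \<in> mat_tuples k p" using B fm_conjugate(2)[OF W(3)] by (auto simp: mat_tuples_def)
  have eq: "norm (fm (As ! j) - fm (?C ! j)) = norm (conjf w1 (fm (As ! j))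
    - conjf w2 (fm (Bs ! j)))" if j: "j < p" for j
  proof -
    have a: "supp k (fm (As ! j))" and b: "supp k (fm (Bs ! j))" using A B j
      by (auto intro: supp_fm mat_tuplesD)
    have c: "fm (?C ! j) = w1 * conjf w2 (fm (Bs ! j)) * fadj w1"
      using B j fm_conjugate(1)[OF W(3) mat_tuplesD[OF B j]]
      by (simp add: mat_tuples_def W(2) w_def conjf_def mult.assoc)
    have sc: "supp k (fm (?C ! j))" using C j by (auto intro: supp_fm mat_tuplesD)
    have "conjf w1 (fm (?C ! j)) = (fadj w1 * w1) * conjf w2 (fm (Bs ! j)) * (fadj w1 * w1)"
      unfolding c by (simp add: conjf_def mult.assoc)
    also have "\<dots> = conjf w2 (fm (Bs ! j))"
      using w supp_conjf[OF w(2) b] by (simp add: uf_def idm_mult)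
    finally have "conjf w1 (fm (As ! j) - fm (?C ! j))
      = conjf w1 (fm (As ! j)) - conjf w2 (fm (Bs ! j))"
      by (simp add: conjf_diff)
    then show ?thesis using norm_conjf[OF w(1) supp_diff[OF a sc]] by simp
  qed
  have "dist2_mats As ?C = sqrt ((\<Sum>j<p. (norm (conjf w1 (fm (As ! j))
    - conjf w2 (fm (Bs ! j))))\<^sup>2) / real k)"
    unfolding dist2_mats_fm[OF A C k] using eq by simp
  also have "\<dots> < sqrt (\<omega>\<^sup>2)" using d k by (subst real_sqrt_less_iff) (simp add: pos_divide_less_eq)
  finally have "dist2_mats As ?C < \<omega>" using \<omega> by simp
  then show ?thesis using A B unfolding orbit_ball_def mat_tuples_def by (auto intro!: bexI[OF _ W(1)])
qed

lemma orbit_ballE: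
  assumes As: "As \<in> orbit_ball k Bs \<omega>" and B: "Bs \<in> mat_tuples k p" and k: "0 < k"
  shows "\<exists>w. uf k w \<and> (\<forall>j<p. norm (conjf w (fm (As ! j)) - fm (Bs ! j)) \<le> \<omega> * sqrt (real k))"
proof -
  have A: "As \<in> mat_tuples k p" using As B by (auto simp: orbit_ball_def mat_tuples_def)
  obtain W where W: "W \<in> unitary_mats k" and d: "dist2_mats As (map (\<lambda>B. W * B * mat_adjoint W) Bs) < \<omega>"
    using As unfolding orbit_ball_def by blast
  have Wc: "W \<in> carrier_mat k k" using W by (simp add: unitary_mats_def)
  let ?C = "map (\<lambda>B. W * B * mat_adjoint W) Bs"
  have C: "?C \<in> mat_tuples k p" using B fm_conjugate(2)[OF Wc] by (auto simp: mat_tuples_def)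
  have u: "uf k (fm W)" by (rule uf_fm[OF W])
  have "norm (conjf (fm W) (fm (As ! j)) - fm (Bs ! j)) \<le> \<omega> * sqrt (real k)" if j: "j < p" for j
  proof -
    have a: "supp k (fm (As ! j))" and b: "supp k (fm (Bs ! j))" using A B j
      by (auto intro: supp_fm mat_tuplesD)
    have c: "fm (?C ! j) = fm W * fm (Bs ! j) * fadj (fm W)"
      using B j fm_conjugate(1)[OF Wc mat_tuplesD[OF B j]] by (simp add: mat_tuples_def)
    have sc: "supp k (fm (?C ! j))" using C j by (auto intro: supp_fm mat_tuplesD)
    have "conjf (fm W) (fm (?C ! j)) = (fadj (fm W) * fm W) * fm (Bs ! j) * (fadj (fm W) * fm W)"
      unfolding c by (simp add: conjf_def mult.assoc)
    also have "\<dots> = fm (Bs ! j)" using u b by (simp add: uf_def idm_mult)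
    finally have "conjf (fm W) (fm (As ! j)) - fm (Bs ! j) = conjf (fm W) (fm (As ! j) - fm (?C ! j))"
      by (simp add: conjf_diff)
    then have "norm (conjf (fm W) (fm (As ! j)) - fm (Bs ! j)) = norm (fm (As ! j) - fm (?C ! j))"
      using norm_conjf[OF u supp_diff[OF a sc]] by simp
    also have "\<dots> = sqrt ((norm (fm (As ! j) - fm (?C ! j)))\<^sup>2)" by simp
    also have "\<dots> \<le> sqrt (\<Sum>j<p. (norm (fm (As ! j) - fm (?C ! j)))\<^sup>2)"
      by (rule real_sqrt_le_mono, rule member_le_sum) (use j in auto)
    also have "\<dots> = dist2_mats As ?C * sqrt (real k)"
      unfolding dist2_mats_fm[OF A C k] using k by (simp add: real_sqrt_divide)
    also have "\<dots> \<le> \<omega> * sqrt (real k)" using d by (intro mult_right_mono) auto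
    finally show ?thesis .
  qed
  then show ?thesis using u by blast
qed

section \<open>Covering numbers from finite classifications\<close>

text \<open>Centres must lie in \<open>G\<close>, so a representative of each class is taken as the
  centre.\<close>

lemma covering_of_classes:
  assumes fin: "finite (c ` G)" and cl: "\<And>A B. A \<in> G \<Longrightarrow> B \<in> G \<Longrightarrow> c A = c B \<Longrightarrow> A \<in> orbit_ball k B \<omega>"
  shows "\<exists>C. C \<subseteq> G \<and> finite C \<and> card C = card (c ` G) \<and> G \<subseteq> (\<Union>B\<in>C. orbit_ball k B \<omega>)"
proof -
  define r where "r z = (SOME B. B \<in> G \<and> c B = z)" for z
  have r: "r z \<in> G" "c (r z) = z" if "z \<in> c ` G" for z
  proof -
    have "\<exists>B. B \<in> G \<and> c B = z" using that by blast
    then have "r z \<in> G \<and> c (r z) = z" unfolding r_def by (rule someI_ex)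
    then show "r z \<in> G" "c (r z) = z" by auto
  qed
  have "inj_on r (c ` G)" by (rule inj_on_inverseI[of _ c]) (use r(2) in auto)
  then have "card (r ` c ` G) = card (c ` G)" by (rule card_image)
  moreover have "G \<subseteq> (\<Union>B\<in>r ` c ` G. orbit_ball k B \<omega>)"
  proof
    fix A assume A: "A \<in> G"
    then have "c A \<in> c ` G" by simp
    then have "A \<in> orbit_ball k (r (c A)) \<omega>" using r A by (intro cl) auto
    then show "A \<in> (\<Union>B\<in>r ` c ` G. orbit_ball k B \<omega>)" using A by blast
  qed
  ultimately show ?thesis using r(1) fin by (intro exI[of _ "r ` c ` G"]) auto
qed

lemma covering_number_le:
  assumes fin: "finite Z" "c ` G \<subseteq> Z" and cl: "\<And>A B. A \<in> G \<Longrightarrow> B \<in> G \<Longrightarrow> c A = c B \<Longrightarrow> A \<in> orbit_ball k B \<omega>"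
  shows "orbit_covering_number k G \<omega> \<le> max 1 (card Z)"
proof (cases "G = {}")
  case False
  have f: "finite (c ` G)" using fin finite_subset by blast
  define Q where "Q N \<longleftrightarrow> (\<exists>C. C \<subseteq> G \<and> finite C \<and> card C = N \<and> G \<subseteq> (\<Union>B\<in>C. orbit_ball k B \<omega>))" for N
  have "Q (card (c ` G))" unfolding Q_def by (rule covering_of_classes[OF f cl])
  then have "(LEAST N. Q N) \<le> card (c ` G)" by (rule Least_le)
  moreover have "orbit_covering_number k G \<omega> = (LEAST N. Q N)"
    unfolding orbit_covering_number_def Q_def using False by simp
  ultimately have "orbit_covering_number k G \<omega> \<le> card (c ` G)" by simp
  also have "\<dots> \<le> card Z" by (rule card_mono) (use fin in auto)
  finally show ?thesis by simp
qed (simp add: orbit_covering_number_def)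

text \<open>The \<open>LEAST\<close> in the definition is attained once some finite covering is
  known; the classification is there to supply one.\<close>

lemma covering_number_attained:
  assumes ne: "G \<noteq> {}" and fin: "finite (c ` G)"
    and cl: "\<And>A B. A \<in> G \<Longrightarrow> B \<in> G \<Longrightarrow> c A = c B \<Longrightarrow> A \<in> orbit_ball k B \<omega>"
  shows "\<exists>C. C \<subseteq> G \<and> finite C \<and> card C = orbit_covering_number k G \<omega> \<and> G \<subseteq> (\<Union>B\<in>C. orbit_ball k B \<omega>)"
proof -
  define Q where "Q N \<longleftrightarrow> (\<exists>C. C \<subseteq> G \<and> finite C \<and> card C = N \<and> G \<subseteq> (\<Union>B\<in>C. orbit_ball k B \<omega>))" for N
  have "Q (card (c ` G))" unfolding Q_def by (rule covering_of_classes[OF fin cl])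
  then have "Q (LEAST N. Q N)" by (rule LeastI)
  moreover have "orbit_covering_number k G \<omega> = (LEAST N. Q N)"
    unfolding orbit_covering_number_def Q_def using ne by simp
  ultimately have "Q (orbit_covering_number k G \<omega>)" by simp
  then show ?thesis unfolding Q_def .
qed

subsection \<open>Cells for matrices almost fixed by an averaging operator\<close>

text \<open>Matrix units and their multiples by \<open>\<i>\<close>: an orthonormal basis of the
  \<open>k \<times> k\<close> matrices as a real space, since the cells are constructed over the
  reals.\<close>

definition unit_basis :: "bool \<times> nat \<times> nat \<Rightarrow> fmat"
  where "unit_basis b = Abs_fmat (\<lambda>i j. if i = fst (snd b) \<and>
    j = snd (snd b) then (if fst b then 1 else \<i>) else 0)"

definition coord :: "fmat \<Rightarrow> bool \<times> nat \<times> nat \<Rightarrow> real"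
  where "coord x b = (if fst b then Re (ent x (fst (snd b)) (snd (snd b))) else Im (ent x (fst (snd b)) (snd (snd b))))"

abbreviation basis_index :: "nat \<Rightarrow> (bool \<times> nat \<times> nat) set"
  where "basis_index k \<equiv> UNIV \<times> {..<k} \<times> {..<k}"

lemma ent_unit_basis: "ent (unit_basis (c, p, q)) i j = (if i = p \<and>
  j = q then (if c then 1 else \<i>) else 0)"
  unfolding unit_basis_def by (subst ent_Abs[of "Suc (max p q)"]) auto

lemma sum_basis_index: "(\<Sum>b\<in>basis_index k. f b) = (\<Sum>p<k. \<Sum>q<k. f (True, p, q) + f (False, p, q))"
proof -
  have "(\<Sum>b\<in>basis_index k. f b) = (\<Sum>c\<in>UNIV. \<Sum>pq\<in>{..<k} \<times> {..<k}. f (c, pq))"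
    by (simp add: sum.cartesian_product)
  also have "\<dots> = (\<Sum>c\<in>UNIV. \<Sum>p<k. \<Sum>q<k. f (c, p, q))"
    by (simp add: sum.cartesian_product case_prod_beta)
  also have "\<dots> = (\<Sum>p<k. \<Sum>q<k. f (True, p, q) + f (False, p, q))"
    by (simp add: UNIV_bool sum.distrib add.commute)
  finally show ?thesis .
qed

lemma unit_basis_expansion: assumes "supp k x"
  shows "x = (\<Sum>b\<in>basis_index k. coord x b *\<^sub>R unit_basis b)"
proof (rule fmat_eqI)
  fix i j
  have "ent (\<Sum>b\<in>basis_index k. coord x b *\<^sub>R unit_basis b) i j =
    (\<Sum>p<k. \<Sum>q<k. if p = i \<and> q = j then ent x i j else 0)"
    unfolding ent_sum sum_basis_index
    by (intro sum.cong refl) (auto simp: ent_unit_basis coord_def complex_eq_iff)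
  also have "\<dots> = (\<Sum>p<k. if p = i then (\<Sum>q<k. if q = j then ent x i j else 0) else 0)"
    by (intro sum.cong refl) auto
  also have "\<dots> = (if i < k \<and> j < k then ent x i j else 0)" by simp
  also have "\<dots> = ent x i j" using suppD[OF assms, of i j] by auto
  finally show "ent x i j = ent (\<Sum>b\<in>basis_index k. coord x b *\<^sub>R unit_basis b) i j" by simp
qed

lemma sum_coord_sq: assumes "supp k x" shows "(\<Sum>b\<in>basis_index k. (coord x b)\<^sup>2) = (norm x)\<^sup>2"
  unfolding sum_basis_index norm_fmat_sq[OF assms] by (simp add: coord_def cmod_power2)

definition avg :: "nat \<Rightarrow> (nat \<Rightarrow> fmat) \<Rightarrow> (nat \<Rightarrow> fmat) \<Rightarrow> fmat \<Rightarrow> fmat"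
  where "avg N a b x = (1 / real N) *\<^sub>R (\<Sum>t<N. a t * x * b t)"

lemma avg_sum: "finite I \<Longrightarrow> avg N a b (\<Sum>i\<in>I. c i *\<^sub>R f i) = (\<Sum>i\<in>I. c i *\<^sub>R avg N a b (f i))"
proof -
  have "(\<Sum>t<N. a t * (\<Sum>i\<in>I. c i *\<^sub>R f i) * b t) = (\<Sum>t<N. \<Sum>i\<in>I. c i *\<^sub>R (a t * f i * b t))"
    by (simp add: sum_distrib_left sum_distrib_right)
  also have "\<dots> = (\<Sum>i\<in>I. \<Sum>t<N. c i *\<^sub>R (a t * f i * b t))" by (rule sum.swap)
  finally show ?thesis unfolding avg_def by (simp add: scaleR_sum_right mult.commute)
qed

text \<open>
  The square of the Hilbert-Schmidt norm of the averaging operator is expressed by traces; if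
  \<open>a\<close> and \<open>b\<close> are close to powers of Haar unitaries, only the diagonal terms survive.
\<close>

lemma avg_hilbert_schmidt:
  assumes a: "\<And>t. t < N \<Longrightarrow> supp k (a t)" and b: "\<And>t. t < N \<Longrightarrow> supp k (b t)"
  shows "(\<Sum>c\<in>basis_index k. (norm (avg N a b (unit_basis c)))\<^sup>2) =
    2 * (real k)\<^sup>2 / (real N)\<^sup>2 * Re (\<Sum>t<N. \<Sum>s<N. trk k (fadj (a s) * a t) * trk k (fadj (b s) * b t))"
proof -
  \<comment> \<open>The entry at (i, j) of a matrix unit between \<open>a t\<close> and
    \<open>b t\<close> is a product of one entry from each; the flag contributes a factor of modulus
    1, hence the 2 in the result.\<close>
  define T where "T p q = (\<Sum>i<k. \<Sum>j<k. (cmod (\<Sum>t<N. ent (a t) i p * ent (b t) q j))\<^sup>2)" for p q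
  have n: "(norm (avg N a b (unit_basis (c, p, q))))\<^sup>2 = T p q / (real N)\<^sup>2" if pq:
    "p < k" "q < k" for c p q
  proof -
    have su: "supp k (unit_basis (c, p, q))" using pq by (auto simp: supp_def ent_unit_basis)
    have s: "supp k (\<Sum>t<N. a t * unit_basis (c, p, q) * b t)"
      by (intro supp_sum supp_mult a b su) auto
    have e: "ent (a t * unit_basis (c, p, q) * b t) i j
      = (if c then 1 else \<i>) * (ent (a t) i p * ent (b t) q j)"
      if "t < N" for t i j
    proof -
      have "ent (a t * unit_basis (c, p, q)) i l = (if l
        = q then (if c then 1 else \<i>) * ent (a t) i p else 0)" for l
      proof -
        have "ent (a t * unit_basis (c, p, q)) i l = (\<Sum>m<k. if m = p then (if l
          = q then (if c then 1 else \<i>) * ent (a t) i p else 0) else 0)"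
          unfolding ent_mult[OF a[OF that]] by (intro sum.cong refl) (auto simp: ent_unit_basis)
        then show ?thesis using pq by simp
      qed
      then have "ent (a t * unit_basis (c, p, q) * b t) i j =
        (\<Sum>l<k. if l = q then (if c then 1 else \<i>) * ent (a t) i p * ent (b t) q j else 0)"
        unfolding ent_mult[OF supp_mult[OF a[OF that] su]] by (intro sum.cong refl) auto
      then show ?thesis using pq by simp
    qed
    have "(norm (\<Sum>t<N. a t * unit_basis (c, p, q) * b t))\<^sup>2 = T p q"
      unfolding norm_fmat_sq[OF s] T_def ent_sum
    proof (intro sum.cong refl)
      fix i j
      have "(\<Sum>t<N. ent (a t * unit_basis (c, p, q) * b t) i j)
        = (if c then 1 else \<i>) * (\<Sum>t<N. ent (a t) i p * ent (b t) q j)"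
        unfolding sum_distrib_left by (intro sum.cong refl e) simp
      then show "(cmod (\<Sum>t<N. ent (a t * unit_basis (c, p, q) * b t) i j))\<^sup>2
        = (cmod (\<Sum>t<N. ent (a t) i p * ent (b t) q j))\<^sup>2"
        by (simp add: norm_mult)
    qed
    then show ?thesis unfolding avg_def by (simp add: power_divide)
  qed
  have "complex_of_real (\<Sum>p<k. \<Sum>q<k. T p q) =
    (\<Sum>p<k. \<Sum>q<k. \<Sum>i<k. \<Sum>j<k. \<Sum>t<N. \<Sum>s<N. (cnj (ent (a s) i p) * ent (a t) i p) * (cnj (ent (b s) q j) * ent (b t) q j))"
    unfolding T_def of_real_sum complex_norm_square cnj_sum sum_product
    by (intro sum.cong refl) (simp add: mult_ac)
  \<comment> \<open>With both index sets fixed, the swap rule applies in one direction only and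
    unfolding terminates.\<close>
  also have "\<dots> = (\<Sum>t<N. \<Sum>s<N. \<Sum>p<k. \<Sum>q<k. \<Sum>i<k. \<Sum>j<k. (cnj (ent (a s) i p) * ent (a t) i p) * (cnj (ent (b s) q j) * ent (b t) q j))"
    unfolding sum.swap[of _ "{..<N}" "{..<k}"] ..
  also have "\<dots> = (\<Sum>t<N. \<Sum>s<N. (of_nat k * trk k (fadj (a s) * a t)) * (of_nat k * trk k (fadj (b s) * b t)))"
  proof (intro sum.cong refl)
    fix t s assume "t \<in> {..<N}" "s \<in> {..<N}"
    then have as: "supp k (a s)" "supp k (b s)" using a b by auto
    have "(\<Sum>p<k. \<Sum>q<k. \<Sum>i<k. \<Sum>j<k. (cnj (ent (a s) i p) * ent (a t) i p) * (cnj (ent (b s) q j) * ent (b t) q j))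
      = (\<Sum>p<k. \<Sum>i<k. \<Sum>q<k. \<Sum>j<k. (cnj (ent (a s) i p) * ent (a t) i p) * (cnj (ent (b s) q j) * ent (b t) q j))"
      by (intro sum.cong refl sum.swap)
    also have "\<dots> = (\<Sum>p<k. \<Sum>i<k. cnj (ent (a s) i p) * ent (a t) i p) * (\<Sum>q<k. \<Sum>j<k. cnj (ent (b s) q j) * ent (b t) q j)"
      by (simp only: sum_distrib_right) (simp only: sum_distrib_left)
    also have "(\<Sum>p<k. \<Sum>i<k. cnj (ent (a s) i p) * ent (a t) i p) = of_nat k * trk k (fadj (a s) * a t)"
      unfolding trk_fadj_mult[OF as(1)] by (rule sum.swap)
    also have "(\<Sum>q<k. \<Sum>j<k. cnj (ent (b s) q j) * ent (b t) q j) = of_nat k * trk k (fadj (b s) * b t)"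
      unfolding trk_fadj_mult[OF as(2)] ..
    finally show "(\<Sum>p<k. \<Sum>q<k. \<Sum>i<k. \<Sum>j<k. (cnj (ent (a s) i p) * ent (a t) i p) * (cnj (ent (b s) q j) * ent (b t) q j)) =
      (of_nat k * trk k (fadj (a s) * a t)) * (of_nat k * trk k (fadj (b s) * b t))" .
  qed
  also have "\<dots> = of_real ((real k)\<^sup>2) * (\<Sum>t<N. \<Sum>s<N. trk k (fadj (a s) * a t) * trk k (fadj (b s) * b t))"
    by (simp add: sum_distrib_left power2_eq_square mult_ac)
  finally have c: "complex_of_real (\<Sum>p<k. \<Sum>q<k. T p q) =
    of_real ((real k)\<^sup>2) * (\<Sum>t<N. \<Sum>s<N. trk k (fadj (a s) * a t) * trk k (fadj (b s) * b t))" .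
  have "(\<Sum>p<k. \<Sum>q<k. T p q) = (real k)\<^sup>2 * Re (\<Sum>t<N. \<Sum>s<N. trk k (fadj (a s) * a t) * trk k (fadj (b s) * b t))"
    using arg_cong[OF c, of Re] by (simp del: of_real_sum of_real_power)
  moreover have "(\<Sum>c\<in>basis_index k. (norm (avg N a b (unit_basis c)))\<^sup>2)
    = (\<Sum>p<k. \<Sum>q<k. 2 * (T p q / (real N)\<^sup>2))"
    unfolding sum_basis_index by (intro sum.cong refl) (simp add: n)
  ultimately show ?thesis by (simp add: sum_divide_distrib[symmetric] sum_distrib_left[symmetric])
qed

text \<open>An almost fixed \<open>x\<close> is close to its average, so it inherits the cell of the
  average, which lies in the image of a ball under an operator of small Hilbert-Schmidt norm.
  Dividing by the root of \<open>k\<close> turns the operator bound 1 into the unit ball, and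
  \<open>\<delta> \<le> 1\<close> gives the radius 2 of the image.\<close>

lemma almost_fixed_cells:
  assumes k: "0 < k" and N: "0 < N" and a: "\<And>t. t < N \<Longrightarrow> supp k (a t)" and b: "\<And>t. t < N \<Longrightarrow> supp k (b t)"
    and h: "Re (\<Sum>t<N. \<Sum>s<N. trk k (fadj (a s) * a t) * trk k (fadj (b s) * b t)) \<le> 2 * real N"
    and pos: "0 < \<kappa>" "0 < \<theta>" "0 \<le> \<delta>" "\<delta> \<le> 1"
  shows "\<exists>(cell :: fmat \<Rightarrow> fmat \<Rightarrow> int) Z. finite Z \<and>
    real (card Z) \<le> exp ((real k)\<^sup>2 * (4 / (real N * \<kappa>\<^sup>2) * (5 + 4 / \<theta>\<^sup>2))) \<and>
    (\<forall>x. supp k x \<longrightarrow> lbd x 1 \<longrightarrow> norm (avg N a b x - x) \<le> \<delta> * sqrt (real k) \<longrightarrow> cell x \<in> Z) \<and>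
    (\<forall>x y. supp k x \<longrightarrow> lbd x 1 \<longrightarrow> norm (avg N a b x - x) \<le> \<delta> * sqrt (real k) \<longrightarrow>
      supp k y \<longrightarrow> lbd y 1 \<longrightarrow> norm (avg N a b y - y) \<le> \<delta> * sqrt (real k) \<longrightarrow> cell x = cell y \<longrightarrow>
      norm (x - y) \<le> (2 * \<kappa> + \<theta> + 2 * \<delta>) * sqrt (real k))"
proof -
  define r where "r = sqrt (real k)"
  have r: "0 < r" "r\<^sup>2 = real k" using k by (simp_all add: r_def)
  let ?I = "basis_index k"
  let ?e = "\<lambda>c. avg N a b (unit_basis c)"
  \<comment> \<open>One factor 2 comes from the real basis, the other from the hypothesis
    \<open>h\<close>.\<close>
  define H where "H = 4 * (real k)\<^sup>2 / real N"
  have Hpos: "0 < H" using k N by (simp add: H_def)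
  have "(\<Sum>c\<in>?I. (norm (?e c))\<^sup>2) = 2 * (real k)\<^sup>2 / (real N)\<^sup>2 *
    Re (\<Sum>t<N. \<Sum>s<N. trk k (fadj (a s) * a t) * trk k (fadj (b s) * b t))"
    by (rule avg_hilbert_schmidt) (use a b in auto)
  also have "\<dots> \<le> 2 * (real k)\<^sup>2 / (real N)\<^sup>2 * (2 * real N)"
    by (rule mult_left_mono[OF h]) simp
  also have "\<dots> = H" using N by (simp add: H_def power2_eq_square)
  finally have H: "(\<Sum>c\<in>?I. (norm (?e c))\<^sup>2) \<le> H" .
  obtain cell :: "fmat \<Rightarrow> fmat \<Rightarrow> int" and Z where fZ: "finite Z"
    and cZ: "real (card Z) \<le> exp (H / \<kappa>\<^sup>2 * (5 + 2\<^sup>2 / \<theta>\<^sup>2))"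
    and inZ: "\<And>x. norm (\<Sum>c\<in>?I. x c *\<^sub>R ?e c) \<le> 2 \<Longrightarrow> cell (\<Sum>c\<in>?I. x c *\<^sub>R ?e c) \<in> Z"
    and same: "\<And>x x'. (\<Sum>c\<in>?I. (x c)\<^sup>2) \<le> 1 \<Longrightarrow> (\<Sum>c\<in>?I. (x' c)\<^sup>2) \<le> 1 \<Longrightarrow>
      cell (\<Sum>c\<in>?I. x c *\<^sub>R ?e c) = cell (\<Sum>c\<in>?I. x' c *\<^sub>R ?e c) \<Longrightarrow>
      norm ((\<Sum>c\<in>?I. x c *\<^sub>R ?e c) - (\<Sum>c\<in>?I. x' c *\<^sub>R ?e c)) \<le> 2 * \<kappa> + \<theta>"
    by (rule ball_image_cells[of ?I ?e H \<kappa> \<theta> 2, OF _ H Hpos pos(1,2)]) (simp, simp, rule that)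
  define cell' where "cell' x = cell ((1 / r) *\<^sub>R avg N a b x)" for x
  have ex: "(1 / r) *\<^sub>R avg N a b x = (\<Sum>c\<in>?I. (coord x c / r) *\<^sub>R ?e c)" if "supp k x" for x
  proof -
    have "avg N a b x = (\<Sum>c\<in>?I. coord x c *\<^sub>R ?e c)"
      by (subst unit_basis_expansion[OF that]) (rule avg_sum, simp)
    then show ?thesis by (simp add: scaleR_sum_right divide_inverse mult.commute)
  qed
  have nx: "norm x \<le> r" if "supp k x" "lbd x 1" for x
  proof -
    have "(norm (idm k))\<^sup>2 = real k"
      using norm_sq_trk[OF supp_idm, of k] k by (simp add: idm_mult supp_idm trk_idm)
    then have "(norm (idm k))\<^sup>2 = r\<^sup>2" using r(2) by simp
    then have "norm (idm k) = r" by (rule power2_eq_imp_eq) (use r(1) in simp_all)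
    moreover have "norm (x * idm k) \<le> 1 * norm (idm k)" by (rule lbdD) fact
    ultimately show ?thesis using that by (simp add: idm_mult)
  qed
  have c1: "(\<Sum>c\<in>?I. (coord x c / r)\<^sup>2) \<le> 1" if "supp k x" "lbd x 1" for x
  proof -
    have "(\<Sum>c\<in>?I. (coord x c / r)\<^sup>2) = (norm x)\<^sup>2 / r\<^sup>2"
      unfolding sum_coord_sq[OF that(1), symmetric] by (simp add: power_divide sum_divide_distrib)
    also have "\<dots> \<le> r\<^sup>2 / r\<^sup>2" by (intro divide_right_mono power_mono nx that) auto
    also have "r\<^sup>2 / r\<^sup>2 = 1" using r(1) by simp
    finally show ?thesis .
  qed
  show ?thesis
  proof (intro exI[of _ cell'] exI[of _ Z] conjI allI impI)
    show "finite Z" by (rule fZ)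
    have "H / \<kappa>\<^sup>2 * (5 + 2\<^sup>2 / \<theta>\<^sup>2) = (real k)\<^sup>2 * (4 / (real N * \<kappa>\<^sup>2) * (5 + 4 / \<theta>\<^sup>2))"
      by (simp add: H_def)
    then show "real (card Z) \<le> exp ((real k)\<^sup>2 * (4 / (real N * \<kappa>\<^sup>2) * (5 + 4 / \<theta>\<^sup>2)))" using cZ by simp
  next
    fix x assume x: "supp k x" "lbd x 1" "norm (avg N a b x - x) \<le> \<delta> * sqrt (real k)"
    have "norm (avg N a b x) \<le> norm (avg N a b x - x) + norm x"
      using norm_triangle_sub[of "avg N a b x" x] by simp
    moreover have "\<delta> * r \<le> 1 * r" using pos r by (intro mult_right_mono) auto
    ultimately have "norm (avg N a b x) \<le> 2 * r" using x(3) nx[OF x(1,2)] by (simp add: r_def)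
    then have "norm ((1 / r) *\<^sub>R avg N a b x) \<le> 2" using r by (simp add: pos_divide_le_eq)
    then show "cell' x \<in> Z" unfolding cell'_def ex[OF x(1)] by (rule inZ)
  next
    fix x y assume x: "supp k x" "lbd x 1" "norm (avg N a b x - x) \<le> \<delta> * sqrt (real k)"
      and y: "supp k y" "lbd y 1" "norm (avg N a b y - y) \<le> \<delta> * sqrt (real k)"
        and c: "cell' x = cell' y"
    have "norm ((1 / r) *\<^sub>R avg N a b x - (1 / r) *\<^sub>R avg N a b y) \<le> 2 * \<kappa> + \<theta>"
      unfolding ex[OF x(1)] ex[OF y(1)]
      by (rule same[OF c1[OF x(1,2)] c1[OF y(1,2)]]) (use c
        in \<open>simp only: cell'_def ex[OF x(1)] ex[OF y(1)]\<close>)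
    then have d: "norm (avg N a b x - avg N a b y) \<le> (2 * \<kappa> + \<theta>) * r"
      using r by (simp add: pos_divide_le_eq flip: scaleR_diff_right)
    have tri: "norm (p + q - s) \<le> norm p + norm q + norm s" for p q s :: fmat
      by (rule order_trans[OF norm_triangle_ineq4 add_right_mono[OF norm_triangle_ineq]])
    have "norm (x - y) = norm ((avg N a b x - avg N a b y) + (avg N a b y - y) - (avg N a b x - x))"
      by simp
    also have "\<dots> \<le> norm (avg N a b x - avg N a b y) + norm (avg N a b y - y)
      + norm (avg N a b x - x)" by (rule tri)
    also have "\<dots> \<le> (2 * \<kappa> + \<theta>) * r + \<delta> * r + \<delta> * r" using d x(3) y(3) by (simp add: r_def)
    finally show "norm (x - y) \<le> (2 * \<kappa> + \<theta> + 2 * \<delta>) * sqrt (real k)" by (simp add: r_def algebra_simps)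
  qed
qed

subsection \<open>Extending microstates\<close>

primrec esub :: "(nat \<Rightarrow> expr) \<Rightarrow> expr \<Rightarrow> expr" where
  "esub s (Var i) = s i"
| "esub s One = One"
| "esub s (Add e f) = Add (esub s e) (esub s f)"
| "esub s (Mul e f) = Mul (esub s e) (esub s f)"
| "esub s (Scal c e) = Scal c (esub s e)"
| "esub s (Adj e) = Adj (esub s e)"

lemma ev_sub: "ev st e1 X (esub s e) = ev st e1 (\<lambda>i. ev st e1 X (s i)) e"
  by (induction e) auto

lemma vars_sub: "(\<And>i. i \<in> vars e \<Longrightarrow> vars (s i) \<subseteq> A) \<Longrightarrow> vars (esub s e) \<subseteq> A"
  by (induction e) auto

lemma ev_cong: "(\<And>i. i \<in> vars e \<Longrightarrow> X i = Y i) \<Longrightarrow> ev st e1 X e = ev st e1 Y e"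
  by (induction e) auto

text \<open>
  If \<open>ys\<close> generates the algebra, elements \<open>X i\<close> of it are approximated by cut-off star
  polynomials in \<open>ys\<close>; evaluated at microstates of \<open>ys\<close> these extend them to joint
  microstates with an operator bound that does not depend on the required precision.
\<close>

lemma microstate_extension:
  fixes ys :: "'a::complex_hilbert bop list"
  assumes M: "von_neumann_algebra M" and tr: "tracial_state M \<tau>" and ys: "set ys \<subseteq> M"
    and sub: "M \<subseteq> weak_operator_topology closure_of polys (length ys) ((!) ys)"
    and X: "\<And>i. i < n \<Longrightarrow> X i \<in> M \<and> opb (X i) (1/8)"
    and E: "finite E" "\<And>e. e \<in> E \<Longrightarrow> vars e \<subseteq> {..<n + length ys}" and \<eta>: "0 < \<eta>"
  shows "\<exists>s m \<epsilon>. 0 < \<epsilon> \<and> (\<forall>k B. 0 < k \<longrightarrow> mstate \<tau> R ys m k \<epsilon> B \<longrightarrow>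
    (\<forall>i<n. supp k (evf k B (s i)) \<and> lbd (evf k B (s i)) 1) \<and>
    (\<forall>e\<in>E. cmod (trk k (evf k (\<lambda>i. if i < n then evf k B (s i) else B (i - n)) e)
      - \<tau> (evo (\<lambda>i. if i < n then X i else ys ! (i - n)) e)) < \<eta>))"
proof -
  let ?p = "length ys"
  let ?Y = "\<lambda>i. if i < n then X i else ys ! (i - n)"
  obtain K where K: "0 \<le> K" "\<And>i. i < ?p \<Longrightarrow> opb (ys ! i) K" using opb_common[of ?p "(!) ys"] by blast
  \<comment> \<open>One radius for both sides: the cutoff must be valid for \<open>ys\<close>, where
    it converges, and for the matrices \<open>B\<close>, where it yields the bound 1.\<close>
  define R' where "R' = max R K"
  have RK: "opb (ys ! i) R'" if "i < ?p" for i using K(2)[OF that] by (rule opb_mono) (simp add: R'_def)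
  have "\<exists>f. i < n \<longrightarrow> (\<forall>l. vars (fst (f l)) \<subseteq> {..<?p}) \<and>
    bsot approx_filter (\<lambda>l::'a set \<times> nat. evo ((!) ys) (cutoff R' (fst (f l)) (snd (f l)))) (X i)" for i
  proof (cases "i < n")
    case True
    have x: "X i \<in> M" "opb (X i) (1/8)" using X[OF True] by auto
    obtain t J where t: "\<And>l::'a set \<times> nat. vars (t l) \<subseteq> {..<?p}"
      and b: "bsot approx_filter (\<lambda>l. evo ((!) ys) (cutoff R' (t l) (J l))) (X i)"
      by (rule bsot_cut[OF M sub _ x, where R = R'], erule RK, rule that)
    show ?thesis by (rule exI[of _ "\<lambda>l. (t l, J l)"]) (use t b in simp)
  qed simp
  from choice[OF allI[OF this]] obtain f where f0: "\<forall>i. i < n \<longrightarrow> (\<forall>l. vars (fst (f i l)) \<subseteq> {..<?p}) \<and>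
    bsot approx_filter (\<lambda>l::'a set \<times> nat. evo ((!) ys) (cutoff R' (fst (f i l)) (snd (f i l)))) (X i)" ..
  then have f: "\<And>i l. i < n \<Longrightarrow> vars (fst (f i l)) \<subseteq> {..<?p}"
    "\<And>i. i < n \<Longrightarrow> bsot approx_filter (\<lambda>l. evo ((!) ys) (cutoff R' (fst (f i l)) (snd (f i l)))) (X i)" by blast+
  \<comment> \<open>All auxiliary elements use the same net index \<open>l\<close>; variables from
    \<open>n\<close> on stand for \<open>ys\<close> themselves.\<close>
  define s where "s l i = (if i < n then cutoff R' (fst (f i l)) (snd (f i l)) else Var (i
    - n))" for l i
  have vs: "vars (s l i) \<subseteq> {..<?p}" if "i < n + ?p" for l i
    using subset_trans[OF vars_cut f(1)] that by (auto simp: s_def)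
  have bs: "bsot approx_filter (\<lambda>l. evo ((!) ys) (s l i)) (?Y i)" for i
    by (cases "i < n") (simp_all add: s_def f(2) bsot_const)
  have ysM: "ys ! i \<in> M" if "i < ?p" for i using ys that by (auto intro!: nth_mem)
  have "((\<lambda>l. \<tau> (evo ((!) ys) (esub (s l) e))) \<longlongrightarrow> \<tau> (evo ?Y e)) approx_filter" if e: "e \<in> E" for e
  proof (rule tendsto_trace_bsot[OF tr])
    show "evo ((!) ys) (esub (s l) e) \<in> M" for l
      by (rule von_neumann_ev[OF M]) (use vars_sub[of e "s l" "{..<?p}"] vs E(2)[OF e] ysM in blast)
    show "evo ?Y e \<in> M"
      by (rule von_neumann_ev[OF M]) (use X ysM E(2)[OF e] in auto)
    show "bsot approx_filter (\<lambda>l. evo ((!) ys) (esub (s l) e)) (evo ?Y e)"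
      unfolding ev_sub by (rule bsot_ev) (rule bs)
  qed
  then have "\<forall>\<^sub>F l in approx_filter. cmod (\<tau> (evo ((!) ys) (esub (s l) e)) - \<tau> (evo ?Y e))
    < \<eta> / 2" if "e \<in> E" for e
    using that \<eta> unfolding tendsto_iff dist_norm by (meson half_gt_zero)
  then have "\<forall>\<^sub>F l in approx_filter. \<forall>e\<in>E. cmod (\<tau> (evo ((!) ys) (esub (s l) e)) - \<tau> (evo ?Y e))
    < \<eta> / 2"
    using E(1) by (simp add: eventually_ball_finite)
  from eventually_happens'[OF approx_filter_nonbot this]
  obtain l where l: "\<forall>e\<in>E. cmod (\<tau> (evo ((!) ys) (esub (s l) e)) - \<tau> (evo ?Y e)) < \<eta> / 2" ..
  have vE: "vars e \<subseteq> {..<?p}" if eE: "e \<in> esub (s l) ` E" for e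
  proof -
    obtain e' where e': "e = esub (s l) e'" "e' \<in> E" using eE by (rule imageE)
    show ?thesis unfolding e'(1) by (rule vars_sub, rule vs) (use E(2)[OF e'(2)] in auto)
  qed
  \<comment> \<open>With \<open>l\<close> fixed the substituted expressions are fixed polynomials in
    \<open>ys\<close>, so moments of microstates control them; the other half of
    \<open>\<eta>\<close> went into the choice of \<open>l\<close>.\<close>
  have "\<exists>m \<epsilon>. 0 < \<epsilon> \<and> (\<forall>k X R. 0 < k \<longrightarrow> mstate \<tau> R ys m k \<epsilon> X \<longrightarrow>
    (\<forall>e\<in>esub (s l) ` E. cmod (trk k (evf k X e) - \<tau> (evo ((!) ys) e)) < \<eta> / 2))"
    by (rule mstate_moments[OF M tr ys finite_imageI[OF E(1)] _ half_gt_zero[OF \<eta>]]) (rule vE)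
  then obtain m \<epsilon> where \<epsilon>: "0 < \<epsilon>" and mom: "\<forall>k X R. 0 < k \<longrightarrow> mstate \<tau> R ys m k \<epsilon> X \<longrightarrow>
    (\<forall>e\<in>esub (s l) ` E. cmod (trk k (evf k X e) - \<tau> (evo ((!) ys) e)) < \<eta> / 2)"
    by (elim exE conjE) (rule that)
  show ?thesis
  proof (intro exI[of _ "s l"] exI[of _ m] exI[of _ \<epsilon>] conjI \<epsilon> allI impI ballI)
    fix k :: nat and B assume k: "0 < k" and ms: "mstate \<tau> R ys m k \<epsilon> B"
    have B: "supp k (B i)" "lbd (B i) R" if "i < ?p" for i using ms that by (auto simp: mstate_def)
    { fix i assume i: "i < n"
      show "supp k (evf k B (s l i))" by (rule supp_evf) (use B(1) vs[of i l] i in auto)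
      have "lbd (evf k B (cutoff R' (fst (f i l)) (snd (f i l)))) 1"
        by (rule lbd_cut, rule lbd_mono[OF B(2)]) (use f(1)[OF i, of l] in \<open>auto simp: R'_def\<close>)
      then show "lbd (evf k B (s l i)) 1" using i by (simp add: s_def) }
    fix e assume e: "e \<in> E"
    have eq: "evf k (\<lambda>i. if i < n then evf k B (s l i) else B (i - n)) e = evf k B (esub (s l) e)"
      unfolding ev_sub by (rule arg_cong[of _ _ "\<lambda>X. evf k X e"]) (auto simp: s_def)
    have "cmod (trk k (evf k B (esub (s l) e)) - \<tau> (evo ((!) ys) (esub (s l) e))) < \<eta> / 2"
      using mom[rule_format, OF k ms] e by blast
    moreover have "cmod (\<tau> (evo ((!) ys) (esub (s l) e)) - \<tau> (evo ?Y e)) < \<eta> / 2" using l e by blast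
    ultimately have "cmod ((trk k (evf k B (esub (s l) e)) - \<tau> (evo ((!) ys) (esub (s l) e)))
      + (\<tau> (evo ((!) ys) (esub (s l) e)) - \<tau> (evo ?Y e))) < \<eta> / 2 + \<eta> / 2" by (rule norm_add_less)
    then show "cmod (trk k (evf k (\<lambda>i. if i < n then evf k B (s l i) else B (i - n)) e)
      - \<tau> (evo ?Y e)) < \<eta>"
      unfolding eq by simp
  qed
qed

subsection \<open>Averaging over powers of Haar unitaries\<close>

definition sqn :: "('a::complex_hilbert bop \<Rightarrow> complex) \<Rightarrow> 'a bop \<Rightarrow> real"
  where "sqn \<tau> a = Re (\<tau> (adj a * a))"

context
  fixes M :: "'a::complex_hilbert bop set" and \<tau> :: "'a bop \<Rightarrow> complex"
  assumes M: "von_neumann_algebra M" and tr: "tracial_state M \<tau>"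
begin

lemma closedM: "1 \<in> M" "0 \<in> M" "a \<in> M \<Longrightarrow> b \<in> M \<Longrightarrow> a + b \<in> M" "a \<in> M \<Longrightarrow> b \<in> M \<Longrightarrow> a * b \<in> M"
  "a \<in> M \<Longrightarrow> c *\<^sub>C a \<in> M" "a \<in> M \<Longrightarrow> adj a \<in> M" "a \<in> M \<Longrightarrow> - a \<in> M" "a \<in> M \<Longrightarrow> b \<in> M \<Longrightarrow> a - b \<in> M"
  "a \<in> M \<Longrightarrow> a ^ t \<in> M"
proof -
  show 1: "1 \<in> M" and p: "a \<in> M \<Longrightarrow> b \<in> M \<Longrightarrow> a + b \<in> M" and m: "a \<in> M \<Longrightarrow> b \<in> M \<Longrightarrow> a * b \<in> M"
    and c: "a \<in> M \<Longrightarrow> c *\<^sub>C a \<in> M" and "a \<in> M \<Longrightarrow> adj a \<in> M" for a b c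
    using M unfolding von_neumann_algebra_def by simp_all
  show "0 \<in> M" using c[OF 1, of 0] by simp
  show n: "a \<in> M \<Longrightarrow> - a \<in> M" for a using c[of a "-1"] by simp
  show "a \<in> M \<Longrightarrow> b \<in> M \<Longrightarrow> a - b \<in> M" for a b using p[OF _ n, of a b] by simp
  show "a ^ t \<in> M" if "a \<in> M" for t by (induction t) (simp_all add: 1 m that)
qed

lemma sqn_nonneg: "a \<in> M \<Longrightarrow> 0 \<le> sqn \<tau> a"
  using tr by (simp add: tracial_state_def sqn_def)

lemma tau_add: "a \<in> M \<Longrightarrow> b \<in> M \<Longrightarrow> \<tau> (a + b) = \<tau> a + \<tau> b"
  using tr by (simp add: tracial_state_def)

lemma tau_scale: "a \<in> M \<Longrightarrow> \<tau> (c *\<^sub>C a) = c * \<tau> a"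
  using tr by (simp add: tracial_state_def)

text \<open>The parallelogram identity with the difference term dropped. It stands in for the
  triangle inequality; the extra factors 2 are the origin of the powers of 4 and 8 below.\<close>

lemma sqn_add: assumes "a \<in> M" "b \<in> M" shows "sqn \<tau> (a + b) \<le> 2 * sqn \<tau> a + 2 * sqn \<tau> b"
proof -
  have "adj (a + b) * (a + b) + adj (a - b) * (a - b) = 2 *\<^sub>C (adj a * a) + 2 *\<^sub>C (adj b * b)"
    using scaleC_bop_distrib(2)[of 1 1 "adj a * a"] scaleC_bop_distrib(2)[of 1 1 "adj b * b"]
    by (simp add: algebra_simps)
  then have "\<tau> (adj (a + b) * (a + b)) + \<tau> (adj (a - b) * (a - b))
    = 2 * \<tau> (adj a * a) + 2 * \<tau> (adj b * b)"
    using assms by (metis tau_add tau_scale closedM(3,4,5,6,8))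
  then have "Re (\<tau> (adj (a + b) * (a + b)) + \<tau> (adj (a - b) * (a - b)))
    = Re (2 * \<tau> (adj a * a) + 2 * \<tau> (adj b * b))"
    by (rule arg_cong)
  then have "sqn \<tau> (a + b) + sqn \<tau> (a - b) = 2 * sqn \<tau> a + 2 * sqn \<tau> b"
    by (simp only: sqn_def plus_complex.sel) simp
  then show ?thesis using sqn_nonneg[OF closedM(8)[OF assms]] by linarith
qed

lemma sqn_unitary_left: "unitary v \<Longrightarrow> sqn \<tau> (v * a) = sqn \<tau> a"
proof -
  assume "unitary v"
  then have "adj (v * a) * (v * a) = adj a * a"
    by (simp add: unitary_def mult.assoc) (metis mult.assoc mult_1)
  then show ?thesis by (simp add: sqn_def)
qed

lemma sqn_unitary_right: assumes "unitary w" "w \<in> M" "a \<in> M" shows "sqn \<tau> (a * adj w) = sqn \<tau> a"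
proof -
  have "\<tau> (adj (a * adj w) * (a * adj w)) = \<tau> (w * (adj a * a * adj w))" by (simp add: mult.assoc)
  also have "\<dots> = \<tau> ((adj a * a * adj w) * w)"
    using tr assms closedM unfolding tracial_state_def by simp
  also have "(adj a * a * adj w) * w = adj a * a" using assms(1) by (simp add: unitary_def mult.assoc)
  finally show ?thesis by (simp add: sqn_def)
qed

lemma sqn_scale: "a \<in> M \<Longrightarrow> sqn \<tau> (c *\<^sub>C a) = (cmod c)\<^sup>2 * sqn \<tau> a"
proof -
  assume a: "a \<in> M"
  have "\<tau> (adj (c *\<^sub>C a) * (c *\<^sub>C a)) = (cnj c * c) * \<tau> (adj a * a)"
    using tau_scale[OF closedM(4)[OF closedM(6)[OF a] a]] by simp
  also have "cnj c * c = of_real ((cmod c)\<^sup>2)" by (simp only: complex_norm_square mult.commute)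
  finally show ?thesis unfolding sqn_def by (simp del: of_real_power)
qed

text \<open>The defect \<open>d\<close> satisfies d(t+1) = v d(t) adj(w) + (v u adj(w) - u), and
  multiplication by unitaries keeps \<open>sqn\<close>. The crude constant does no harm, because
  \<open>v\<close> and \<open>w\<close> are picked after \<open>N\<close>.\<close>

lemma averaging_defect:
  assumes u: "u \<in> M" and v: "v \<in> M" "unitary v" and w: "w \<in> M" "unitary w" and N: "0 < N"
  shows "sqn \<tau> (complex_of_real (1 / real N) *\<^sub>C (\<Sum>t<N. v ^ t * u * adj w ^ t) - u)
    \<le> 8 ^ N * sqn \<tau> (v * u - u * w)"
proof -
  define g where "g = sqn \<tau> (v * u - u * w)"
  define d where "d t = v ^ t * u * adj w ^ t - u" for t
  have g0: "0 \<le> g" unfolding g_def by (intro sqn_nonneg closedM u v w)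
  have dM: "d t \<in> M" for t unfolding d_def by (intro closedM u v w)
  have "v * u * adj w - u = (v * u - u * w) * adj w"
    using w(2) by (simp add: unitary_def algebra_simps)
  then have base: "sqn \<tau> (v * u * adj w - u) = g"
    unfolding g_def using sqn_unitary_right[OF w(2,1)] closedM u v w by simp
  \<comment> \<open>The recursion gives 2 * 4^t + 2, which is at most 4^(t+1).\<close>
  have dg: "sqn \<tau> (d t) \<le> 4 ^ t * g" for t
  proof (induction t)
    case 0
    show ?case using g0 by (simp add: d_def sqn_def) (metis tau_scale closedM(2) scaleC_bop_simps(2) mult_zero_left zero_complex.sel(1))
  next
    case (Suc t)
    have "d (Suc t) = v * d t * adj w + (v * u * adj w - u)"
      unfolding d_def by (simp add: algebra_simps power_Suc2[of "adj w"] del: power_Suc2)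
        (simp add: power_commutes mult.assoc)
    then have "sqn \<tau> (d (Suc t)) \<le> 2 * sqn \<tau> (v * d t * adj w) + 2 * sqn \<tau> (v * u * adj w - u)"
      by (metis sqn_add closedM(4,6,8) dM u v(1) w(1))
    also have "sqn \<tau> (v * d t * adj w) = sqn \<tau> (d t)"
      using sqn_unitary_right[OF w(2,1) closedM(4)[OF v(1) dM]] sqn_unitary_left[OF v(2)] by simp
    finally have "sqn \<tau> (d (Suc t)) \<le> 2 * (4 ^ t * g) + 2 * g" using Suc base by linarith
    also have "\<dots> \<le> 4 ^ Suc t * g"
    proof -
      have "1 * g \<le> 4 ^ t * g" using g0 by (intro mult_right_mono) auto
      then show ?thesis by (simp add: mult.commute[of g])
    qed
    finally show ?case .
  qed
  have SM: "(\<Sum>t<n. d t) \<in> M" for n by (induction n) (simp_all add: closedM dM)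
  have S: "sqn \<tau> (\<Sum>t<n. d t) \<le> 8 ^ n * g" for n
  proof (induction n)
    case 0
    show ?case using g0 by (simp add: sqn_def) (metis tau_scale closedM(2) scaleC_bop_simps(2) mult_zero_left zero_complex.sel(1))
  next
    case (Suc n)
    have "sqn \<tau> (\<Sum>t<Suc n. d t) \<le> 2 * sqn \<tau> (\<Sum>t<n. d t) + 2 * sqn \<tau> (d n)"
      using sqn_add[OF SM dM] by simp
    also have "\<dots> \<le> 2 * (8 ^ n * g) + 2 * (4 ^ n * g)" using Suc dg[of n] by linarith
    also have "\<dots> \<le> 2 * (8 ^ n * g) + 2 * (8 ^ n * g)"
      using g0 by (intro add_left_mono mult_left_mono mult_right_mono power_mono) auto
    also have "\<dots> \<le> 8 ^ Suc n * g" using g0 by simp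
    finally show ?case .
  qed
  have "u = complex_of_real (1 / real N) *\<^sub>C (\<Sum>t<N. u)"
  proof (rule bop_eqI)
    fix x
    have "app (\<Sum>t<n. u) x = real n *\<^sub>R app u x" for n
      by (induction n) (simp_all add: scaleR_add_left add.commute)
    then show "app u x = app (complex_of_real (1 / real N) *\<^sub>C (\<Sum>t<N. u)) x"
      using N by (simp add: scaleC_of_real del: of_real_divide)
  qed
  then have "complex_of_real (1 / real N) *\<^sub>C (\<Sum>t<N. v ^ t * u * adj w ^ t) - u
    = complex_of_real (1 / real N) *\<^sub>C (\<Sum>t<N. d t)"
    unfolding d_def sum_subtractf scaleC_bop_distrib by simp
  then have "sqn \<tau> (complex_of_real (1 / real N) *\<^sub>C (\<Sum>t<N. v ^ t * u * adj w ^ t) - u)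
    = (1 / real N)\<^sup>2 * sqn \<tau> (\<Sum>t<N. d t)"
    using sqn_scale[OF SM] by (simp add: norm_divide)
  also have "\<dots> \<le> 1 * sqn \<tau> (\<Sum>t<N. d t)"
    using N sqn_nonneg[OF SM] by (intro mult_right_mono power_le_one) auto
  finally show ?thesis using S[of N] by (simp add: g_def)
qed

lemma haar_power_orthogonal:
  assumes "haar_unitary \<tau> v"
  shows "\<tau> (adj (v ^ s) * v ^ t) = (if s = t then 1 else 0)"
    "\<tau> (adj (adj v ^ s) * adj v ^ t) = (if s = t then 1 else 0)"
proof -
  have u: "adj v * v = 1" "v * adj v = 1" using assms by (auto simp: haar_unitary_def unitary_def)
  have h: "\<tau> (unitary_power v m) = 0" if "m \<noteq> 0" for m using assms that by (simp add: haar_unitary_def)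
  have p: "\<tau> (v ^ m) = 0" "\<tau> (adj v ^ m) = 0" if "0 < m" for m
    using h[of "int m"] h[of "- int m"] that by (simp_all add: unitary_power_def)
  have ap: "adj (a ^ m) = adj a ^ m" for a :: "'a bop" and m
    by (induction m) (simp_all add: power_commutes)
  have canc1: "x ^ s * y ^ (s + m) = y ^ m" if xy: "x * y = 1" for x y :: "'a bop" and s m
  proof (induction s)
    case (Suc s)
    have "x ^ Suc s * y ^ (Suc s + m) = x ^ s * (x * y) * y ^ (s + m)"
      by (simp only: power_Suc2[of x] add_Suc power_Suc[of y] mult.assoc)
    then show ?case using Suc xy by simp
  qed simp
  have canc2: "x ^ (s + m) * y ^ s = x ^ m" if xy: "x * y = 1" for x y :: "'a bop" and s m
  proof (induction s)
    case (Suc s)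
    have "x ^ (Suc s + m) * y ^ Suc s = x ^ (s + m) * (x * y) * y ^ s"
      by (simp only: power_Suc2[of x] add_Suc power_Suc[of y] mult.assoc)
    then show ?case using Suc xy by simp
  qed simp
  have one: "\<tau> 1 = 1" using tr by (simp add: tracial_state_def)
  \<comment> \<open>Inverse powers cancel and leave a power of the longer side, of trace 0.
    Exchanging \<open>x\<close> and \<open>y\<close> treats \<open>v\<close> and its adjoint
    alike.\<close>
  have gen: "\<tau> (x ^ s * y ^ t) = (if s = t then 1 else 0)"
    if xy: "x * y = 1" and z: "\<And>m. 0 < m \<Longrightarrow> \<tau> (x ^ m) = 0" "\<And>m. 0 < m \<Longrightarrow>
      \<tau> (y ^ m) = 0" for x y :: "'a bop"
  proof (cases "s \<le> t")
    case True
    then show ?thesis using canc1[OF xy, of s "t - s"] z(2)[of "t - s"] one by auto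
  next
    case False
    then show ?thesis using canc2[OF xy, of t "s - t"] z(1)[of "s - t"] by auto
  qed
  show "\<tau> (adj (v ^ s) * v ^ t) = (if s = t then 1 else 0)" unfolding ap by (rule gen[OF u(1) p(2,1)])
  show "\<tau> (adj (adj v ^ s) * adj v ^ t) = (if s = t then 1 else 0)" unfolding ap adj_adj
    by (rule gen[OF u(2) p])
qed

end

section \<open>The averaging operator as an expression\<close>

primrec sumE :: "nat \<Rightarrow> (nat \<Rightarrow> expr) \<Rightarrow> expr" where
  "sumE 0 f = Scal 0 One"
| "sumE (Suc N) f = Add (sumE N f) (f N)"

definition avgE :: "nat \<Rightarrow> (nat \<Rightarrow> expr) \<Rightarrow> (nat \<Rightarrow> expr) \<Rightarrow> nat \<Rightarrow> expr"
  where "avgE N a b n = Add (Scal (of_real (1 / real N)) (sumE N (\<lambda>t. Mul (Mul (a t) (Var n)) (b t)))) (Scal (-1) (Var n))"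

lemma evo_sumE: "evo X (sumE N f) = (\<Sum>t<N. evo X (f t))"
  by (induction N) simp_all

lemma evf_sumE: "evf k X (sumE N f) = (\<Sum>t<N. evf k X (f t))"
  by (induction N) simp_all

lemma vars_sumE: "(\<And>t. t < N \<Longrightarrow> vars (f t) \<subseteq> A) \<Longrightarrow> vars (sumE N f) \<subseteq> A"
  by (induction N) auto

lemma vars_avgE: "(\<And>t. t < N \<Longrightarrow> vars (a t) \<subseteq> {..<n} \<and> vars (b t) \<subseteq> {..<n}) \<Longrightarrow>
  vars (avgE N a b n) \<subseteq> {..<Suc n}"
proof -
  assume ab: "\<And>t. t < N \<Longrightarrow> vars (a t) \<subseteq> {..<n} \<and> vars (b t) \<subseteq> {..<n}"
  have "vars (Mul (Mul (a t) (Var n)) (b t)) \<subseteq> {..<Suc n}" if "t < N" for t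
    using ab[OF that] by (auto simp: less_Suc_eq)
  then have "vars (sumE N (\<lambda>t. Mul (Mul (a t) (Var n)) (b t))) \<subseteq> {..<Suc n}" by (rule vars_sumE)
  then show ?thesis by (simp add: avgE_def)
qed

lemma evo_avgE: "evo X (avgE N a b n) = complex_of_real (1 / real N) *\<^sub>C (\<Sum>t<N. evo X (a t) * X n * evo X (b t)) - X n"
  unfolding avgE_def by (simp add: evo_sumE)

lemma evf_avgE: "evf k X (avgE N a b n) = avg N (\<lambda>t. evf k X (a t)) (\<lambda>t. evf k X (b t)) (X n) - X n"
proof -
  have "(-1) *\<^sub>C f = - f" for f :: fmat by (rule fmat_eqI) simp
  then show ?thesis unfolding avgE_def avg_def scaleR_fmat_def by (simp add: evf_sumE)
qed

lemma poly_sqn_approx: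
  fixes X :: "nat \<Rightarrow> 'a::complex_hilbert bop"
  assumes M: "von_neumann_algebra M" and tr: "tracial_state M \<tau>"
    and sub: "M \<subseteq> weak_operator_topology closure_of polys n X" and X: "\<And>i. i < n \<Longrightarrow> X i \<in> M"
    and x: "x \<in> M" and \<eta>: "0 < \<eta>"
  shows "\<exists>e. vars e \<subseteq> {..<n} \<and> sqn \<tau> (evo X e - x) < \<eta>"
proof -
  obtain f where f: "\<And>l::'a set \<times> nat. vars (f l) \<subseteq> {..<n}" "bsot approx_filter (\<lambda>l. evo X (f l)) x"
    by (rule bsot_poly[OF M sub x], rule that)
  have fM: "evo X (f l) \<in> M" for l by (rule von_neumann_ev[OF M]) (use f(1)[of l] X in auto)
  have "((\<lambda>l. \<tau> (adj (evo X (f l) - x) * (evo X (f l) - x))) \<longlongrightarrow> \<tau> (adj (x - x) * (x - x))) approx_filter"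
    by (rule tendsto_trace_bsot[OF tr]) (intro closedM[OF M tr] fM x bsot_mult bsot_adj bsot_diff bsot_const f(2))+
  then have "((\<lambda>l. sqn \<tau> (evo X (f l) - x)) \<longlongrightarrow> sqn \<tau> (x - x)) approx_filter"
    unfolding sqn_def by (rule tendsto_Re)
  moreover have "sqn \<tau> (x - x) = 0"
    using sqn_scale[OF M tr closedM(2)[OF M tr], of 0] by simp
  ultimately have "\<forall>\<^sub>F l in approx_filter. sqn \<tau> (evo X (f l) - x) < \<eta>"
    using \<eta> by (simp add: order_tendstoD(2))
  from eventually_happens'[OF approx_filter_nonbot this] show ?thesis using f(1) by blast
qed

text \<open>The powers of \<open>v\<close> and \<open>adj w\<close> lie in \<open>N\<close>, so they
  are approximated by polynomials in the first \<open>n\<close> variables only; their matrices are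
  then nearly determined by a microstate of the generators of \<open>N\<close>. The finitely many
  conditions hold eventually along one filter, so a single index meets them all.\<close>

lemma averaging_polys:
  fixes X :: "nat \<Rightarrow> 'a::complex_hilbert bop"
  assumes M: "von_neumann_algebra M" and tr: "tracial_state M \<tau>" and Nv: "von_neumann_algebra N"
    and NM: "N \<subseteq> M"
    and sub: "N \<subseteq> weak_operator_topology closure_of polys n X" and X: "\<And>i. i < n \<Longrightarrow> X i \<in> N"
    and u: "u \<in> M" and Xn: "X n = (1/8) *\<^sub>C u"
    and v: "v \<in> N" "haar_unitary \<tau> v" and w: "w \<in> N" "haar_unitary \<tau> w"
    and K: "0 < K" and \<mu>: "0 < \<mu>" and d: "8 ^ K * sqn \<tau> (v * u - u * w) < \<eta>"
  shows "\<exists>a b. (\<forall>t. vars (a t) \<subseteq> {..<n} \<and> vars (b t) \<subseteq> {..<n}) \<and>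
    (\<forall>s<K. \<forall>t<K. cmod (\<tau> (evo X (Mul (Adj (a s)) (a t))) - (if s = t then 1 else 0)) < \<mu> \<and>
      cmod (\<tau> (evo X (Mul (Adj (b s)) (b t))) - (if s = t then 1 else 0)) < \<mu>) \<and>
    sqn \<tau> (evo X (avgE K a b n)) < \<eta>"
proof -
  note cN = von_neumann_algebra_def
  have vN: "v ^ t \<in> N" and wN: "adj w ^ t \<in> N" for t
  proof -
    have m: "1 \<in> N" "\<And>a b. a \<in> N \<Longrightarrow> b \<in> N \<Longrightarrow> a * b \<in> N" "adj w \<in> N" using Nv w(1) unfolding cN by simp_all
    show "v ^ t \<in> N" by (induction t) (simp_all add: m v)
    show "adj w ^ t \<in> N" by (induction t) (simp_all add: m)
  qed
  have ch: "\<exists>f. (\<forall>l::'a set \<times> nat. vars (f l) \<subseteq> {..<n}) \<and>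
    bsot approx_filter (\<lambda>l. evo X (f l)) x" if "x \<in> N" for x
    by (rule bsot_poly[OF Nv sub that]) blast
  have "\<forall>t. \<exists>f. (\<forall>l::'a set \<times> nat. vars (f l) \<subseteq> {..<n}) \<and>
    bsot approx_filter (\<lambda>l. evo X (f l)) (v ^ t)" using ch[OF vN] by simp
  from choice[OF this] obtain a where "\<forall>t. (\<forall>l::'a set \<times> nat. vars (a t l) \<subseteq> {..<n}) \<and>
    bsot approx_filter (\<lambda>l. evo X (a t l)) (v ^ t)" ..
  then have a: "\<And>t l. vars (a t l) \<subseteq> {..<n}" "\<And>t. bsot approx_filter (\<lambda>l. evo X (a t l)) (v ^ t)"
    by blast+
  have "\<forall>t. \<exists>f. (\<forall>l::'a set \<times> nat. vars (f l) \<subseteq> {..<n}) \<and>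
    bsot approx_filter (\<lambda>l. evo X (f l)) (adj w ^ t)" using ch[OF wN] by simp
  from choice[OF this] obtain b where "\<forall>t. (\<forall>l::'a set \<times> nat. vars (b t l) \<subseteq> {..<n}) \<and>
    bsot approx_filter (\<lambda>l. evo X (b t l)) (adj w ^ t)" ..
  then have b: "\<And>t l. vars (b t l) \<subseteq> {..<n}" "\<And>t. bsot approx_filter (\<lambda>l. evo X (b t l)) (adj w ^ t)" by blast+
  have evN: "evo X e \<in> M" if "vars e \<subseteq> {..<n}" for e
    using von_neumann_ev[OF Nv, of e X] X that NM by blast
  have mom: "\<forall>\<^sub>F l in approx_filter. cmod (\<tau> (evo X (Mul (Adj (c s l)) (c t l))) - (if s
    = t then 1 else 0)) < \<mu>"
    if c: "\<And>t l::'a set \<times> nat. vars (c t l) \<subseteq> {..<n}"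
      and z: "\<And>t. bsot approx_filter (\<lambda>l. evo X (c t l)) (z t)"
      "\<And>t. z t \<in> N" and h: "\<And>s t. \<tau> (adj (z s) * z t) = (if s = t then 1 else 0)" for c z and s t :: nat
  proof -
    have zM: "z t \<in> M" for t using z(2) NM by blast
    have "((\<lambda>l. \<tau> (adj (evo X (c s l)) * evo X (c t l))) \<longlongrightarrow> \<tau> (adj (z s) * z t)) approx_filter"
      by (rule tendsto_trace_bsot[OF tr]) (intro closedM[OF M tr] evN c zM bsot_mult bsot_adj z(1))+
    then have "((\<lambda>l. \<tau> (evo X (Mul (Adj (c s l)) (c t l)))) \<longlongrightarrow> (if s = t then 1 else 0)) approx_filter"
      by (simp add: h)
    then show ?thesis using \<mu> unfolding tendsto_iff dist_norm by blast
  qed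
  have ma: "\<forall>\<^sub>F l in approx_filter. \<forall>s\<in>{..<K}. \<forall>t\<in>{..<K}. cmod (\<tau> (evo X (Mul (Adj (a s l)) (a t l))) - (if s = t then 1 else 0)) < \<mu>"
    by (intro eventually_ball_finite ballI finite_lessThan mom[OF a vN] haar_power_orthogonal[OF M tr v(2)])
  have mb: "\<forall>\<^sub>F l in approx_filter. \<forall>s\<in>{..<K}. \<forall>t\<in>{..<K}. cmod (\<tau> (evo X (Mul (Adj (b s l)) (b t l))) - (if s = t then 1 else 0)) < \<mu>"
    by (intro eventually_ball_finite ballI finite_lessThan mom[OF b wN] haar_power_orthogonal[OF M tr w(2)])
  have XnM: "X n \<in> M" unfolding Xn using closedM(5)[OF M tr u] .
  define z where "z = complex_of_real (1 / real K) *\<^sub>C (\<Sum>t<K. v ^ t * X n * adj w ^ t) - X n"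
  have bs: "bsot approx_filter (\<lambda>l. evo X (avgE K (\<lambda>t. a t l) (\<lambda>t. b t l) n)) z"
  proof -
    have "bsot approx_filter (\<lambda>l. \<Sum>t<m. evo X (a t l) * X n * evo X (b t l)) (\<Sum>t<m. v ^ t * X n * adj w ^ t)" for m
      by (induction m) (simp_all add: bsot_const bsot_add bsot_mult a b)
    then show ?thesis unfolding evo_avgE z_def by (intro bsot_diff bsot_scaleC bsot_const)
  qed
  have zM: "z \<in> M"
  proof -
    have "(\<Sum>t<m. v ^ t * X n * adj w ^ t) \<in> M" for m
      using vN wN NM by (induction m) (auto intro!: closedM(2,3,4)[OF M tr] XnM)
    then show ?thesis unfolding z_def by (intro closedM[OF M tr] XnM)
  qed
  have eM: "evo X (avgE K (\<lambda>t. a t l) (\<lambda>t. b t l) n) \<in> M" for l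
    by (rule von_neumann_ev[OF M]) (use vars_avgE[of K "\<lambda>t. a t l" n "\<lambda>t. b t l"] a(1) b(1) X NM XnM
      in \<open>auto simp: less_Suc_eq subset_iff\<close>)
  have "((\<lambda>l. \<tau> (adj (evo X (avgE K (\<lambda>t. a t l) (\<lambda>t. b t l) n)) * evo X (avgE K (\<lambda>t. a t l) (\<lambda>t. b t l) n))) \<longlongrightarrow> \<tau> (adj z * z)) approx_filter"
    by (rule tendsto_trace_bsot[OF tr]) (intro closedM[OF M tr] eM zM bsot_mult bsot_adj bs)+
  then have lim: "((\<lambda>l. sqn \<tau> (evo X (avgE K (\<lambda>t. a t l) (\<lambda>t. b t l) n))) \<longlongrightarrow> sqn \<tau> z) approx_filter"
    unfolding sqn_def by (rule tendsto_Re)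
  have "z = (1/8) *\<^sub>C (complex_of_real (1 / real K) *\<^sub>C (\<Sum>t<K. v ^ t * u * adj w ^ t) - u)"
  proof -
    have "(\<Sum>t<m. v ^ t * X n * adj w ^ t) = (1/8) *\<^sub>C (\<Sum>t<m. v ^ t * u * adj w ^ t)" for m
      unfolding Xn by (induction m) (simp_all add: scaleC_bop_distrib bop_eqI)
    then show ?thesis unfolding z_def Xn scaleC_bop_distrib by (simp add: mult.commute)
  qed
  moreover have "complex_of_real (1 / real K) *\<^sub>C (\<Sum>t<K. v ^ t * u * adj w ^ t) - u \<in> M" (is "?y \<in> M")
  proof -
    have "(\<Sum>t<m. v ^ t * u * adj w ^ t) \<in> M" for m
      using vN wN NM by (induction m) (auto intro!: closedM(2,3,4)[OF M tr] u)
    then show ?thesis by (intro closedM[OF M tr] u)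
  qed
  ultimately have "sqn \<tau> z = (cmod (1/8))\<^sup>2 * sqn \<tau> ?y" using sqn_scale[OF M tr] by simp
  also have "\<dots> \<le> sqn \<tau> ?y"
    using sqn_nonneg[OF M tr \<open>?y \<in> M\<close>] by (intro mult_left_le_one_le) (auto simp: power2_eq_square)
  also have "\<dots> \<le> 8 ^ K * sqn \<tau> (v * u - u * w)"
    using v(2) w(2) by (intro averaging_defect[OF M tr u subsetD[OF NM v(1)] _ subsetD[OF NM w(1)] _ K]) (simp_all add: haar_unitary_def)
  finally have "sqn \<tau> z < \<eta>" using d by simp
  with lim have "\<forall>\<^sub>F l in approx_filter. sqn \<tau> (evo X (avgE K (\<lambda>t. a t l) (\<lambda>t. b t l) n)) < \<eta>"
    by (simp add: order_tendstoD(2))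
  from eventually_happens'[OF approx_filter_nonbot eventually_conj[OF this eventually_conj[OF ma mb]]]
  obtain l where l: "sqn \<tau> (evo X (avgE K (\<lambda>t. a t l) (\<lambda>t. b t l) n)) < \<eta>"
    "\<forall>s\<in>{..<K}. \<forall>t\<in>{..<K}. cmod (\<tau> (evo X (Mul (Adj (a s l)) (a t l))) - (if s = t then 1 else 0)) < \<mu>"
    "\<forall>s\<in>{..<K}. \<forall>t\<in>{..<K}. cmod (\<tau> (evo X (Mul (Adj (b s l)) (b t l))) - (if s
      = t then 1 else 0)) < \<mu>" by (elim exE conjE)
  show ?thesis
    by (rule exI[of _ "\<lambda>t. a t l"], rule exI[of _ "\<lambda>t. b t l"]) (use l a(1) b(1) in auto)
qed

subsection \<open>Orbit coverings\<close>

text \<open>Finiteness comes from the cells of the trivial average with one term and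
  \<open>idm k\<close> on both sides, which fixes every matrix. The number of cells is irrelevant
  here, so nothing uniform in \<open>k\<close> is claimed.\<close>

lemma microstates_covering_attained:
  assumes k: "0 < k" and \<omega>: "0 < \<omega>" and ne: "microstates \<tau> 1 xs m k \<epsilon> \<noteq> {}"
  shows "\<exists>C. C \<subseteq> microstates \<tau> 1 xs m k \<epsilon> \<and> finite C \<and>
    card C = orbit_covering_number k (microstates \<tau> 1 xs m k \<epsilon>) \<omega> \<and>
    microstates \<tau> 1 xs m k \<epsilon> \<subseteq> (\<Union>B\<in>C. orbit_ball k B \<omega>)"
proof -
  let ?G = "microstates \<tau> 1 xs m k \<epsilon>" and ?n = "length xs"
  \<comment> \<open>Each matrix moves by at most 3 \<open>\<kappa>\<close>; over the tuple the
    squares stay below (3 \<omega> / 4)^2.\<close>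
  define \<kappa> where "\<kappa> = \<omega> / (4 * (real ?n + 1))"
  have \<kappa>: "0 < \<kappa>" using \<omega> by (simp add: \<kappa>_def)
  have av: "avg (Suc 0) (\<lambda>_. idm k) (\<lambda>_. idm k) x = x" if "supp k x" for x
    using that by (simp add: avg_def idm_mult)
  have h: "Re (\<Sum>t<Suc 0. \<Sum>s<Suc 0. trk k (fadj (idm k) * idm k) * trk k (fadj (idm k) * idm k))
    \<le> 2 * real (Suc 0)"
    using k by (simp add: idm_mult supp_idm trk_idm)
  from almost_fixed_cells[where a = "\<lambda>_. idm k" and b = "\<lambda>_. idm k"
    and \<delta> = 0, OF k zero_less_Suc supp_idm supp_idm h \<kappa> \<kappa> order_refl zero_le_one]
  obtain cell :: "fmat \<Rightarrow> fmat \<Rightarrow> int" and Z where Z: "finite Z"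
    and in0: "\<forall>x. supp k x \<longrightarrow> lbd x 1 \<longrightarrow> norm (avg (Suc 0) (\<lambda>_. idm k) (\<lambda>_. idm k) x - x)
      \<le> 0 * sqrt (real k) \<longrightarrow> cell x \<in> Z"
    and same0: "\<forall>x y. supp k x \<longrightarrow> lbd x 1 \<longrightarrow> norm (avg (Suc 0) (\<lambda>_. idm k) (\<lambda>_. idm k) x - x)
      \<le> 0 * sqrt (real k) \<longrightarrow>
      supp k y \<longrightarrow> lbd y 1 \<longrightarrow> norm (avg (Suc 0) (\<lambda>_. idm k) (\<lambda>_. idm k) y - y) \<le> 0 * sqrt (real k) \<longrightarrow>
        cell x = cell y \<longrightarrow>
      norm (x - y) \<le> (2 * \<kappa> + \<kappa> + 2 * 0) * sqrt (real k)"
    by (elim exE conjE) (rule that)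
  have inZ: "cell x \<in> Z" if "supp k x" "lbd x 1" for x using in0 that by (simp add: av)
  have same: "norm (x - y) \<le> 3 * \<kappa> * sqrt (real k)" if "supp k x" "lbd x 1" "supp k y" "lbd y 1"
    "cell x = cell y" for x y
    using same0[rule_format, of x y] that by (simp add: av)
  have G: "As \<in> mat_tuples k ?n" "\<And>i. i < ?n \<Longrightarrow>
    supp k (fm (As ! i)) \<and> lbd (fm (As ! i)) 1" if "As \<in> ?G" for As
    using that unfolding microstates_iff[OF zero_le_one] mstate_def by blast+
  define c where "c As = map (\<lambda>i. cell (fm (As ! i))) [0..<?n]" for As
  show ?thesis
  proof (rule covering_number_attained[where c = c, OF ne])
    have "c ` ?G \<subseteq> {l. set l \<subseteq> Z \<and> length l = ?n}"
    proof (rule image_subsetI)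
      fix As assume "As \<in> ?G"
      from G(2)[OF this] show "c As \<in> {l. set l \<subseteq> Z \<and> length l = ?n}"
        unfolding c_def using inZ by auto
    qed
    then show "finite (c ` ?G)" by (rule finite_subset) (rule finite_lists_length_eq[OF Z])
    fix A B assume A: "A \<in> ?G" and B: "B \<in> ?G" and cAB: "c A = c B"
    have uf: "uf k (idm k)" by (simp add: uf_def supp_idm idm_mult)
    show "A \<in> orbit_ball k B \<omega>"
    proof (rule orbit_ballI[OF G(1)[OF A] G(1)[OF B] k \<omega> uf uf])
      have "(norm (conjf (idm k) (fm (A ! j)) - conjf (idm k) (fm (B ! j))))\<^sup>2
        \<le> (3 * \<kappa>)\<^sup>2 * real k" if j: "j < ?n" for j
      proof -
        note a = G(2)[OF A j] and b = G(2)[OF B j]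
        have "cell (fm (A ! j)) = cell (fm (B ! j))"
          using cAB j unfolding c_def map_eq_conv by simp
        then have "norm (fm (A ! j) - fm (B ! j)) \<le> 3 * \<kappa> * sqrt (real k)" using a b
          by (intro same) auto
        then have "(norm (fm (A ! j) - fm (B ! j)))\<^sup>2 \<le> (3 * \<kappa> * sqrt (real k))\<^sup>2"
          by (rule power_mono) simp
        then show ?thesis using a b by (simp add: conjf_def idm_mult power_mult_distrib)
      qed
      then have "(\<Sum>j<?n. (norm (conjf (idm k) (fm (A ! j)) - conjf (idm k) (fm (B ! j))))\<^sup>2)
        \<le> (\<Sum>j<?n. (3 * \<kappa>)\<^sup>2 * real k)"
        by (intro sum_mono) auto
      also have "\<dots> = (real ?n * (3 * \<kappa>)\<^sup>2) * real k" by simp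
      also have "\<dots> < \<omega>\<^sup>2 * real k"
      proof (rule mult_strict_right_mono)
        have k4: "\<kappa> * (real ?n + 1) = \<omega> / 4" by (simp add: \<kappa>_def divide_simps)
        have "(3 * \<kappa>)\<^sup>2 * (real ?n + 1)\<^sup>2 = (3 * (\<kappa> * (real ?n + 1)))\<^sup>2"
          by (simp only: power_mult_distrib mult.assoc)
        then have e: "(3 * \<kappa>)\<^sup>2 * (real ?n + 1)\<^sup>2 = (3 * (\<omega> / 4))\<^sup>2" by (simp only: k4)
        have "real ?n * (3 * \<kappa>)\<^sup>2 \<le> (real ?n + 1)\<^sup>2 * (3 * \<kappa>)\<^sup>2"
          by (intro mult_right_mono) (auto simp: power2_eq_square algebra_simps)
        also have "\<dots> = (3 * (\<omega> / 4))\<^sup>2" using e by (simp add: mult.commute)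
        also have "\<dots> = 9/16 * \<omega>\<^sup>2" by (simp add: power2_eq_square)
        also have "\<dots> < \<omega>\<^sup>2" using \<omega> by simp
        finally show "real ?n * (3 * \<kappa>)\<^sup>2 < \<omega>\<^sup>2" .
      qed (use k in simp)
      finally show "(\<Sum>j<?n. (norm (conjf (idm k) (fm (A ! j)) - conjf (idm k) (fm (B ! j))))\<^sup>2)
        < \<omega>\<^sup>2 * real k" .
    qed
  qed
qed

text \<open>
  The counting step for one matrix size: a tuple \<open>B\<close> is classified by the center \<open>c\<close> of the
  covering to which its first \<open>n\<close> auxiliary matrices belong, and by the cell of the last
  auxiliary matrix with respect to the averaging operator formed at a representative of \<open>c\<close>.
\<close>

lemma covering_step:
  fixes FB :: "complex mat list \<Rightarrow> nat \<Rightarrow> fmat" and P :: "nat \<Rightarrow> expr"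
  assumes k: "0 < k" and N: "0 < N" and G: "G \<subseteq> mat_tuples k p" and C: "finite C"
    and FB: "\<And>B i. B \<in> G \<Longrightarrow> i < Suc n \<Longrightarrow> supp k (FB B i) \<and> lbd (FB B i) 1"
    and P: "\<And>j. j < p \<Longrightarrow> vars (P j) \<subseteq> {..<Suc n}" and ab: "\<And>t. vars (a t) \<subseteq> {..<n} \<and> vars (b t) \<subseteq> {..<n}"
    and PB: "\<And>B j. B \<in> G \<Longrightarrow> j < p \<Longrightarrow> norm (evf k (FB B) (P j) - fm (B ! j)) \<le> \<zeta> / 4 * sqrt (real k)"
    and EB: "\<And>B. B \<in> G \<Longrightarrow> norm (evf k (FB B) (avgE N a b n)) \<le> \<delta> / 4 * sqrt (real k)"
    and HB: "\<And>B. B \<in> G \<Longrightarrow> Re (\<Sum>t<N. \<Sum>s<N. trk k (evf k (FB B) (Mul (Adj (a s)) (a t))) *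
      trk k (evf k (FB B) (Mul (Adj (b s)) (b t)))) \<le> 2 * real N"
    and cov: "\<And>B. B \<in> G \<Longrightarrow> \<exists>c w. c \<in> C \<and> uf k w \<and>
      (\<forall>i<n. norm (conjf w (FB B i) - fm (c ! i)) \<le> \<rho> * sqrt (real k))"
    and La: "\<And>j. j < p \<Longrightarrow> \<exists>L\<le>La. hs_lipschitz 1 (P j) L" "0 \<le> La"
      and Lb: "hs_lipschitz 1 (avgE N a b n) Lb"
    and pos: "0 < \<kappa>" "0 < \<theta>" "0 \<le> \<delta>" "\<delta> \<le> 1" "0 < \<omega>" "0 \<le> \<zeta>" "0 \<le> \<rho>"
    and n1: "Lb * (real n * (2 * \<rho>)) \<le> 3/4 * \<delta>"
    and n2: "La * (real n * (2 * \<rho>) + (2 * \<kappa> + \<theta> + 2 * \<delta>)) \<le> \<zeta> / 2"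
    and n3: "real p * \<zeta>\<^sup>2 < \<omega>\<^sup>2"
  shows "real (orbit_covering_number k G \<omega>) \<le>
    max 1 (real (card C) * exp ((real k)\<^sup>2 * (4 / (real N * \<kappa>\<^sup>2) * (5 + 4 / \<theta>\<^sup>2))))"
proof -
  define r where "r = sqrt (real k)"
  have r: "0 < r" "r\<^sup>2 = real k" using k by (simp_all add: r_def)
  define bound where "bound = exp ((real k)\<^sup>2 * (4 / (real N * \<kappa>\<^sup>2) * (5 + 4 / \<theta>\<^sup>2)))"
  have "\<forall>B. \<exists>q. B \<in> G \<longrightarrow> fst q \<in> C \<and> uf k (snd q) \<and>
    (\<forall>i<n. norm (conjf (snd q) (FB B i) - fm (fst q ! i)) \<le> \<rho> * r)"
  proof
    fix B
    show "\<exists>q. B \<in> G \<longrightarrow> fst q \<in> C \<and> uf k (snd q) \<and>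
      (\<forall>i<n. norm (conjf (snd q) (FB B i) - fm (fst q ! i)) \<le> \<rho> * r)"
    proof (cases "B \<in> G")
      case True
      from cov[OF True] obtain c w where "c \<in> C" "uf k w"
        "\<forall>i<n. norm (conjf w (FB B i) - fm (c ! i)) \<le> \<rho> * sqrt (real k)"
        by (elim exE conjE)
      then show ?thesis by (intro exI[of _ "(c, w)"]) (simp add: r_def)
    qed simp
  qed
  from choice[OF this] obtain q where q: "\<forall>B. B \<in> G \<longrightarrow> fst (q B) \<in> C \<and> uf k (snd (q B)) \<and>
    (\<forall>i<n. norm (conjf (snd (q B)) (FB B i) - fm (fst (q B) ! i)) \<le> \<rho> * r)" ..
  define ctr where "ctr B = fst (q B)" for B
  define w where "w B = snd (q B)" for B
  have ctr: "ctr B \<in> C" and w: "uf k (w B)" and near: "i < n \<Longrightarrow>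
    norm (conjf (w B) (FB B i) - fm (ctr B ! i)) \<le> \<rho> * r"
    if "B \<in> G" for B i
    using q that by (simp_all add: ctr_def w_def)
  define X where "X B i = conjf (w B) (FB B i)" for B i
  have Xs: "supp k (X B i)" and Xl: "lbd (X B i) 1" if "B \<in> G" "i < Suc n" for B i
    using FB[OF that] w[OF that(1)] by (simp_all add: X_def supp_conjf lbd_conjf)
  have evX: "evf k (X B) e = conjf (w B) (evf k (FB B) e)" and evs: "supp k (evf k (FB B) e)"
    if "B \<in> G" "vars e \<subseteq> {..<Suc n}" for B e
  proof -
    have "supp k (FB B i)" if "i \<in> vars e" for i using FB[OF \<open>B \<in> G\<close>] that \<open>vars e \<subseteq> {..<Suc n}\<close> by auto
    then show "evf k (X B) e = conjf (w B) (evf k (FB B) e)" "supp k (evf k (FB B) e)"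
      unfolding X_def by (auto intro: evf_conjf[OF w[OF that(1)]] supp_evf)
  qed
  have close: "norm (X B i - X B' i) \<le> 2 * \<rho> * r" if B: "B \<in> G" "B' \<in> G" and c: "ctr B = ctr B'"
    and i: "i < n" for B B' i
  proof -
    have "norm (X B i - X B' i) = norm ((X B i - fm (ctr B ! i)) - (X B' i - fm (ctr B' ! i)))"
      using c by simp
    also have "\<dots> \<le> norm (X B i - fm (ctr B ! i)) + norm (X B' i - fm (ctr B' ! i))"
      by (rule norm_triangle_ineq4)
    also have "\<dots> \<le> \<rho> * r + \<rho> * r" unfolding X_def by (intro add_mono near B i)
    finally show ?thesis by simp
  qed
  \<comment> \<open>The averaging operator must be common to a class, and \<open>HB\<close> speaks
    about tuples of \<open>G\<close>, not about the centres; hence it is formed at a tuple of the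
    class.\<close>
  define rep where "rep c = (SOME B. B \<in> G \<and> ctr B = c)" for c
  have rep: "rep c \<in> G" "ctr (rep c) = c" if "c \<in> ctr ` G" for c
  proof -
    have "\<exists>B. B \<in> G \<and> ctr B = c" using that by blast
    then have "rep c \<in> G \<and> ctr (rep c) = c" unfolding rep_def by (rule someI_ex)
    then show "rep c \<in> G" "ctr (rep c) = c" by auto
  qed
  define A where "A c t = evf k (X (rep c)) (a t)" for c t
  define A' where "A' c t = evf k (X (rep c)) (b t)" for c t
  have vab: "vars (a t) \<subseteq> {..<Suc n}" "vars (b t) \<subseteq> {..<Suc n}" for t using ab[of t]
    by (auto simp: less_Suc_eq)
  define good where "good c x \<longleftrightarrow> supp k x \<and> lbd x 1 \<and> norm (avg N (A c) (A' c) x - x) \<le> \<delta> * r" for c x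
  have "\<exists>(cell :: fmat \<Rightarrow> fmat \<Rightarrow> int) Z. finite Z \<and> real (card Z) \<le> bound \<and> (\<forall>x. good c x \<longrightarrow> cell x \<in> Z) \<and>
    (\<forall>x y. good c x \<longrightarrow> good c y \<longrightarrow> cell x = cell y \<longrightarrow> norm (x - y) \<le> (2 * \<kappa> + \<theta> + 2 * \<delta>) * r)"
    if c: "c \<in> ctr ` G" for c
  proof -
    note R = rep(1)[OF c]
    have s: "supp k (A c t)" "supp k (A' c t)" for t
      unfolding A_def A'_def evX[OF R vab(1)] evX[OF R vab(2)] by (intro supp_conjf w R evs vab)+
    have t: "trk k (evf k (X (rep c)) e) = trk k (evf k (FB (rep c)) e)" if "vars e \<subseteq> {..<Suc n}" for e
      unfolding evX[OF R that] by (rule trk_conjf[OF w[OF R] evs[OF R that]])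
    have e: "fadj (A c s) * A c t = evf k (X (rep c)) (Mul (Adj (a s)) (a t))"
      "fadj (A' c s) * A' c t = evf k (X (rep c)) (Mul (Adj (b s)) (b t))" for s t
      by (simp_all add: A_def A'_def)
    have vv: "vars (Mul (Adj (a s)) (a t)) \<subseteq> {..<Suc n}"
      "vars (Mul (Adj (b s)) (b t)) \<subseteq> {..<Suc n}" for s t
      using vab by simp_all
    have h: "Re (\<Sum>t<N. \<Sum>s<N. trk k (fadj (A c s) * A c t) * trk k (fadj (A' c s) * A' c t))
      \<le> 2 * real N"
      unfolding e t[OF vv(1)] t[OF vv(2)] by (rule HB[OF R])
    from almost_fixed_cells[where a = "A c" and b = "A' c", OF k N s h pos(1-4)]
    obtain cell :: "fmat \<Rightarrow> fmat \<Rightarrow> int" and Z where Z: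
      "finite Z" "real (card Z) \<le> exp ((real k)\<^sup>2 * (4 / (real N * \<kappa>\<^sup>2) * (5 + 4 / \<theta>\<^sup>2)))"
      and 1: "\<forall>x. supp k x \<longrightarrow> lbd x 1 \<longrightarrow> norm (avg N (A c) (A' c) x - x) \<le> \<delta> * sqrt (real k) \<longrightarrow> cell x \<in> Z"
      and 2: "\<forall>x y. supp k x \<longrightarrow> lbd x 1 \<longrightarrow> norm (avg N (A c) (A' c) x - x) \<le> \<delta> * sqrt (real k) \<longrightarrow>
      supp k y \<longrightarrow> lbd y 1 \<longrightarrow> norm (avg N (A c) (A' c) y - y) \<le> \<delta> * sqrt (real k) \<longrightarrow> cell x = cell y \<longrightarrow>
      norm (x - y) \<le> (2 * \<kappa> + \<theta> + 2 * \<delta>) * sqrt (real k)"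
      by (elim exE conjE) (rule that)
    show ?thesis
      by (rule exI[of _ cell], rule exI[of _ Z]) (use Z 1 2 in \<open>simp add: good_def bound_def r_def\<close>)
  qed
  note cells = this
  have "\<forall>c. \<exists>z. c \<in> ctr ` G \<longrightarrow> finite (snd z) \<and> real (card (snd z)) \<le> bound \<and> (\<forall>x. good c x \<longrightarrow>
    (fst z :: fmat \<Rightarrow> fmat \<Rightarrow> int) x \<in> snd z) \<and>
    (\<forall>x y. good c x \<longrightarrow> good c y \<longrightarrow> fst z x = fst z y \<longrightarrow> norm (x - y) \<le> (2 * \<kappa> + \<theta> + 2 * \<delta>) * r)"
  proof
    fix c
    show "\<exists>z. c \<in> ctr ` G \<longrightarrow> finite (snd z) \<and> real (card (snd z)) \<le> bound \<and> (\<forall>x. good c x \<longrightarrow>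
      (fst z :: fmat \<Rightarrow> fmat \<Rightarrow> int) x \<in> snd z) \<and>
      (\<forall>x y. good c x \<longrightarrow> good c y \<longrightarrow> fst z x = fst z y \<longrightarrow> norm (x - y) \<le> (2 * \<kappa> + \<theta> + 2 * \<delta>) * r)"
    proof (cases "c \<in> ctr ` G")
      case True
      from cells[OF True] obtain cell :: "fmat \<Rightarrow> fmat \<Rightarrow> int"
        and Z where "finite Z" "real (card Z) \<le> bound"
        "\<forall>x. good c x \<longrightarrow> cell x \<in> Z"
        "\<forall>x y. good c x \<longrightarrow> good c y \<longrightarrow> cell x = cell y \<longrightarrow> norm (x - y) \<le> (2 * \<kappa> + \<theta> + 2 * \<delta>) * r"
        by (elim exE conjE) (rule that)
      then show ?thesis by (intro exI[of _ "(cell, Z)"]) simp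
    qed simp
  qed
  from choice[OF this] obtain z :: "complex mat list \<Rightarrow> (fmat \<Rightarrow> fmat \<Rightarrow> int) \<times> (fmat \<Rightarrow> int) set"
    where z: "\<forall>c. c \<in> ctr ` G \<longrightarrow> finite (snd (z c)) \<and> real (card (snd (z c))) \<le> bound \<and>
      (\<forall>x. good c x \<longrightarrow> fst (z c) x \<in> snd (z c)) \<and>
    (\<forall>x y. good c x \<longrightarrow> good c y \<longrightarrow> fst (z c) x = fst (z c) y \<longrightarrow> norm (x - y) \<le> (2 * \<kappa> + \<theta> + 2 * \<delta>) * r)" ..
  have goodX: "good (ctr B) (X B n)" if B: "B \<in> G" for B
  proof -
    have cB: "ctr B \<in> ctr ` G" using B by simp
    note R = rep(1)[OF cB]
    \<comment> \<open>The representative's first \<open>n\<close> matrices with the last matrix of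
      \<open>B\<close>: \<open>B\<close> nearly fixes its own average up to \<delta>/4, and
      \<open>n1\<close> allows 3/4 \<delta> for changing the coefficients.\<close>
    define Y where "Y i = (if i < n then X (rep (ctr B)) i else X B i)" for i
    have "evf k Y (a t) = A (ctr B) t" "evf k Y (b t) = A' (ctr B) t" for t
      unfolding A_def A'_def by (rule ev_cong, use ab[of t] in \<open>auto simp: Y_def\<close>)+
    then have eq: "avg N (A (ctr B)) (A' (ctr B)) (X B n) - X B n = evf k Y (avgE N a b n)"
      unfolding evf_avgE by (simp add: Y_def)
    have va: "vars (avgE N a b n) \<subseteq> {..<Suc n}" by (rule vars_avgE) (use ab in blast)
    have "\<forall>i<Suc n. lbd (Y i) 1 \<and> lbd (X B i) 1" using Xl[OF B] Xl[OF R] by (simp add: Y_def)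
    from hs_lipschitzD[OF Lb va this, of k]
    have "norm (evf k Y (avgE N a b n) - evf k (X B) (avgE N a b n))
      \<le> Lb * (\<Sum>i<Suc n. norm (Y i - X B i))" .
    also have "\<dots> = Lb * (\<Sum>i<n. norm (X (rep (ctr B)) i - X B i))" by (simp add: Y_def)
    also have "\<dots> \<le> Lb * (\<Sum>i<n. 2 * \<rho> * r)"
      using Lb by (intro mult_left_mono sum_mono close R B rep(2)[OF cB]) (auto simp: hs_lipschitz_def)
    also have "\<dots> = (Lb * (real n * (2 * \<rho>))) * r" by simp
    also have "\<dots> \<le> (3/4 * \<delta>) * r" by (rule mult_right_mono[OF n1]) (use r in simp)
    finally have 1: "norm (evf k Y (avgE N a b n) - evf k (X B) (avgE N a b n)) \<le> 3/4 * \<delta> * r" .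
    have "norm (evf k (X B) (avgE N a b n)) \<le> \<delta> / 4 * r"
      unfolding evX[OF B va] norm_conjf[OF w[OF B] evs[OF B va]] r_def by (rule EB[OF B])
    then have "norm (evf k Y (avgE N a b n)) \<le> \<delta> * r"
      using 1 norm_triangle_sub[of "evf k Y (avgE N a b n)" "evf k (X B) (avgE N a b n)"] by linarith
    then show ?thesis unfolding good_def eq using Xs[OF B] Xl[OF B] by simp
  qed
  define cls where "cls B = (ctr B, fst (z (ctr B)) (X B n))" for B
  define Z where "Z = (SIGMA c:ctr ` G. snd (z c))"
  have fC: "finite (ctr ` G)" "card (ctr ` G) \<le> card C"
    using C ctr by (auto intro: finite_subset card_mono)
  have fZ: "finite Z" unfolding Z_def using fC z by (intro finite_SigmaI) auto
  have "orbit_covering_number k G \<omega> \<le> max 1 (card Z)"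
  proof (rule covering_number_le[OF fZ, where c = cls])
    show "cls ` G \<subseteq> Z" unfolding cls_def Z_def using goodX z by auto
    fix B B' assume B: "B \<in> G" "B' \<in> G" and e: "cls B = cls B'"
    have c: "ctr B = ctr B'" and f: "fst (z (ctr B)) (X B n) = fst (z (ctr B)) (X B' n)" using e
      by (auto simp: cls_def)
    have cB: "ctr B \<in> ctr ` G" using B by simp
    have xn: "norm (X B n - X B' n) \<le> (2 * \<kappa> + \<theta> + 2 * \<delta>) * r"
      using z[rule_format, OF cB] goodX[OF B(1)] goodX[OF B(2)] c f by auto
    have sumX: "(\<Sum>i<Suc n. norm (X B i - X B' i)) \<le> (real n * (2 * \<rho>) + (2 * \<kappa> + \<theta> + 2 * \<delta>)) * r"
    proof -
      have "(\<Sum>i<n. norm (X B i - X B' i)) \<le> (\<Sum>i<n. 2 * \<rho> * r)" by (intro sum_mono close B c) simp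
      then show ?thesis using xn by (simp add: algebra_simps)
    qed
    \<comment> \<open>The budget is \<zeta>/2 for the difference of the polynomials and \<zeta>/4
      for each of the two approximations of \<open>ys\<close>.\<close>
    have main: "norm (conjf (w B) (fm (B ! j)) - conjf (w B') (fm (B' ! j))) \<le> \<zeta> * r" if j:
      "j < p" for j
    proof -
      obtain L where L: "L \<le> La" "hs_lipschitz 1 (P j) L" using La(1)[OF j] by blast
      have sB: "supp k (fm (B ! j))" "supp k (fm (B' ! j))" using G B j
        by (auto intro!: supp_fm mat_tuplesD)
      have d: "norm (evf k (X D) (P j) - conjf (w D) (fm (D ! j))) \<le> \<zeta> / 4 * r" if D: "D \<in> G" for D
      proof -
        have "supp k (fm (D ! j))" using G D j by (auto intro!: supp_fm mat_tuplesD)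
        then have "norm (evf k (X D) (P j) - conjf (w D) (fm (D ! j)))
          = norm (evf k (FB D) (P j) - fm (D ! j))"
          unfolding evX[OF D P[OF j]] conjf_diff[symmetric]
          by (rule norm_conjf[OF w[OF D] supp_diff[OF evs[OF D P[OF j]]]])
        then show ?thesis using PB[OF D j] by (simp add: r_def)
      qed
      have "\<forall>i<Suc n. lbd (X B i) 1 \<and> lbd (X B' i) 1" using Xl[OF B(1)] Xl[OF B(2)] by simp
      from hs_lipschitzD[OF L(2) P[OF j] this, of k]
      have "norm (evf k (X B) (P j) - evf k (X B') (P j)) \<le> L * (\<Sum>i<Suc n. norm (X B i - X B' i))" .
      also have "\<dots> \<le> La * ((real n * (2 * \<rho>) + (2 * \<kappa> + \<theta> + 2 * \<delta>)) * r)"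
        using L(1) La(2) by (intro mult_mono sumX sum_nonneg) auto
      also have "\<dots> \<le> \<zeta> / 2 * r" using mult_right_mono[OF n2, of r] r by (simp add: mult.assoc)
      finally have m: "norm (evf k (X B) (P j) - evf k (X B') (P j)) \<le> \<zeta> / 2 * r" .
      let ?f = "evf k (X B) (P j)" and ?f' = "evf k (X B') (P j)"
        and ?g = "conjf (w B) (fm (B ! j))" and ?g' = "conjf (w B') (fm (B' ! j))"
      have tri: "norm (p + q - s) \<le> norm p + norm q + norm s" for p q s :: fmat
        by (rule order_trans[OF norm_triangle_ineq4 add_right_mono[OF norm_triangle_ineq]])
      have "norm (?g - ?g') = norm ((?f - ?f') + (?f' - ?g') - (?f - ?g))" by simp
      also have "\<dots> \<le> norm (?f - ?f') + norm (?f' - ?g') + norm (?f - ?g)" by (rule tri)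
      also have "\<dots> \<le> \<zeta> / 2 * r + \<zeta> / 4 * r + \<zeta> / 4 * r" by (intro add_mono m d B)
      finally show ?thesis by (simp add: algebra_simps)
    qed
    show "B \<in> orbit_ball k B' \<omega>"
    proof (rule orbit_ballI[OF subsetD[OF G B(1)] subsetD[OF G B(2)] k pos(5) w[OF B(1)] w[OF B(2)]])
      have "(\<Sum>j<p. (norm (conjf (w B) (fm (B ! j)) - conjf (w B') (fm (B' ! j))))\<^sup>2)
        \<le> (\<Sum>j<p. (\<zeta> * r)\<^sup>2)"
        by (intro sum_mono power_mono main) auto
      also have "\<dots> = (real p * \<zeta>\<^sup>2) * real k" using r by (simp add: power_mult_distrib)
      also have "\<dots> < \<omega>\<^sup>2 * real k" using n3 k by (intro mult_strict_right_mono) auto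
      finally show "(\<Sum>j<p. (norm (conjf (w B) (fm (B ! j)) - conjf (w B') (fm (B' ! j))))\<^sup>2)
        < \<omega>\<^sup>2 * real k" .
    qed
  qed
  then have "real (orbit_covering_number k G \<omega>) \<le> max 1 (real (card Z))" by linarith
  also have "real (card Z) = (\<Sum>c\<in>ctr ` G. real (card (snd (z c))))"
    unfolding Z_def using fC z by (subst card_SigmaI) auto
  also have "max 1 (\<Sum>c\<in>ctr ` G. real (card (snd (z c)))) \<le> max 1 (real (card C) * bound)"
  proof (rule max.mono[OF order_refl])
    have "(\<Sum>c\<in>ctr ` G. real (card (snd (z c)))) \<le> (\<Sum>c\<in>ctr ` G. bound)" using z by (intro sum_mono) blast
    also have "\<dots> = real (card (ctr ` G)) * bound" by simp
    also have "\<dots> \<le> real (card C) * bound" using fC by (intro mult_right_mono) (auto simp: bound_def)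
    finally show "(\<Sum>c\<in>ctr ` G. real (card (snd (z c)))) \<le> real (card C) * bound" .
  qed
  finally show ?thesis unfolding bound_def .
qed

subsection \<open>The covering estimate\<close>

lemma polys_cong: "(\<And>i. i < n \<Longrightarrow> X i = Y i) \<Longrightarrow> polys n X = polys n Y"
proof -
  assume a: "\<And>i. i < n \<Longrightarrow> X i = Y i"
  have "evo X e = evo Y e" if "vars e \<subseteq> {..<n}" for e by (rule ev_cong) (use a that in blast)
  then show ?thesis unfolding polys_def by metis
qed

text \<open>Each product is within 3 \<open>\<nu>\<close> of the Kronecker symbol: the diagonal
  gives N and the N^2 errors together at most another N.\<close>

lemma near_diagonal_sum:
  assumes N: "0 < N" and \<nu>: "3 * \<nu> * real N \<le> 1"
    and d: "\<And>s t. s < N \<Longrightarrow> t < N \<Longrightarrow> cmod (\<alpha> s t - (if s = t then 1 else 0)) \<le> \<nu> \<and>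
      cmod (\<beta> s t - (if s = t then 1 else 0)) \<le> \<nu>"
  shows "Re (\<Sum>t<N. \<Sum>s<N. \<alpha> s t * \<beta> s t) \<le> 2 * real N"
proof -
  have "0 \<le> \<nu>" using d[OF N N] norm_ge_zero order_trans by blast
  then have "\<nu> * 1 \<le> \<nu> * (3 * real N)" using N by (intro mult_left_mono) auto
  then have \<nu>1: "\<nu> \<le> 1" using \<nu> by simp
  have "Re (\<alpha> s t * \<beta> s t) \<le> (if s = t then 1 else 0) + 3 * \<nu>" if st: "s < N" "t < N" for s t
  proof -
    define \<delta> :: complex where "\<delta> = (if s = t then 1 else 0)"
    have dd: "cmod (\<alpha> s t - \<delta>) \<le> \<nu>" "cmod (\<beta> s t - \<delta>) \<le> \<nu>" using d[OF st] by (simp_all add: \<delta>_def)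
    have "cmod (\<beta> s t) \<le> cmod \<delta> + cmod (\<beta> s t - \<delta>)" by (rule norm_triangle_sub)
    then have b: "cmod (\<beta> s t) \<le> 2" using dd(2) \<nu>1 by (auto simp: \<delta>_def split: if_splits)
    have "\<alpha> s t * \<beta> s t - \<delta> = (\<alpha> s t - \<delta>) * \<beta> s t + \<delta> * (\<beta> s t - \<delta>)" by (simp add: \<delta>_def algebra_simps)
    then have "cmod (\<alpha> s t * \<beta> s t - \<delta>) \<le> cmod (\<alpha> s t - \<delta>) * cmod (\<beta> s t) + cmod \<delta> * cmod (\<beta> s t - \<delta>)"
      using norm_triangle_ineq[of "(\<alpha> s t - \<delta>) * \<beta> s t" "\<delta> * (\<beta> s t - \<delta>)"] by (simp add: norm_mult)
    also have "\<dots> \<le> \<nu> * 2 + 1 * \<nu>" using dd b \<open>0 \<le> \<nu>\<close> by (intro add_mono mult_mono) (auto simp: \<delta>_def)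
    finally have "Re (\<alpha> s t * \<beta> s t - \<delta>) \<le> 3 * \<nu>" using complex_Re_le_cmod[of "\<alpha> s t * \<beta> s t - \<delta>"]
      by linarith
    then show ?thesis by (simp add: \<delta>_def split: if_splits)
  qed
  then have "Re (\<Sum>t<N. \<Sum>s<N. \<alpha> s t * \<beta> s t) \<le> (\<Sum>t<N. \<Sum>s<N. (if s = t then 1 else 0) + 3 * \<nu>)"
    unfolding Re_sum by (intro sum_mono) auto
  also have "\<dots> = real N + real N * (3 * \<nu> * real N)" by (simp add: sum.distrib algebra_simps)
  also have "\<dots> \<le> real N + real N * 1" using \<nu> by (intro add_left_mono mult_left_mono) auto
  finally show ?thesis by simp
qed

text \<open>The order of choices is the point. The target \<open>\<omega>\<close> fixes the
  polynomials \<open>P\<close> and the precisions \<open>\<kappa>\<close>, \<open>\<delta>\<close>;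
  these and \<open>D\<close> fix \<open>K\<close>; only then are \<open>v\<close> and
  \<open>w\<close> taken, so close to intertwining that 8^K does not matter. They give
  \<open>a\<close> and \<open>b\<close>, whose Lipschitz constant fixes the radius
  \<open>\<omega>1\<close> at which \<open>N\<close> is covered, and this the moments demanded of
  \<open>ys\<close>.\<close>

lemma orbit_covering_estimate:
  fixes xs ys :: "'a::complex_hilbert bop list"
  assumes M: "von_neumann_algebra M" and tr: "tracial_state M \<tau>" and Nv: "von_neumann_algebra N"
    and NM: "N \<subseteq> M"
    and xs: "\<And>x. x \<in> set xs \<Longrightarrow> x \<in> N \<and> opb x (1/8)"
    and subN: "N \<subseteq> weak_operator_topology closure_of polys (length xs) ((!) xs)"
    and u: "u \<in> M" "unitary u"
    and subM: "M \<subseteq> weak_operator_topology closure_of polys (Suc (length xs)) (\<lambda>i. if i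
      < length xs then xs ! i else (1/8) *\<^sub>C u)"
    and ys: "set ys \<subseteq> M" and subY: "M \<subseteq> weak_operator_topology closure_of polys (length ys) ((!) ys)"
    and K0: "\<And>\<omega> D. 0 < \<omega> \<Longrightarrow> \<omega> < 1 \<Longrightarrow> 0 < D \<Longrightarrow> \<exists>m \<epsilon>. 0 < \<epsilon> \<and> (\<forall>\<^sub>F k in sequentially.
      ln (real (orbit_covering_number k (microstates \<tau> 1 xs m k \<epsilon>) \<omega>)) \<le> D * (real k)\<^sup>2)"
    and vw: "\<And>\<eta>. 0 < \<eta> \<Longrightarrow> \<exists>v w. v \<in> N \<and> w \<in> N \<and> haar_unitary \<tau> v \<and> haar_unitary \<tau> w \<and>
      sqn \<tau> (v * u - u * w) < \<eta>"
    and \<omega>: "0 < \<omega>" and R: "0 < R" and D: "0 < D"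
  shows "\<exists>m \<epsilon>. 0 < \<epsilon> \<and> (\<forall>\<^sub>F k in sequentially.
      ln (real (orbit_covering_number k (microstates \<tau> R ys m k \<epsilon>) \<omega>)) \<le> D * (real k)\<^sup>2)"
proof -
  let ?n = "length xs" and ?p = "length ys"
  define X where "X i = (if i < ?n then xs ! i else (1/8) *\<^sub>C u)" for i
  define Y where "Y i = (if i < Suc ?n then X i else ys ! (i - Suc ?n))" for i
  have u8: "(1/8) *\<^sub>C u \<in> M" "opb ((1/8) *\<^sub>C u) (1/8)"
  proof -
    show "(1/8) *\<^sub>C u \<in> M" by (rule closedM(5)[OF M tr u(1)])
    have "opb u 1" by (simp add: opb_def unitary_norm[OF u(2)])
    from opb_scaleC[OF this, of "1/8"] show "opb ((1/8) *\<^sub>C u) (1/8)" by simp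
  qed
  have xsN: "xs ! i \<in> N" "opb (xs ! i) (1/8)" if "i < ?n" for i using xs[OF nth_mem[OF that]] by auto
  have XM: "X i \<in> M" "opb (X i) (1/8)" for i using xsN NM u8 by (auto simp: X_def)
  define \<zeta> where "\<zeta> = \<omega> / (real ?p + 1)"
  have \<zeta>: "0 < \<zeta>" using \<omega> by (simp add: \<zeta>_def)
  have n3: "real ?p * \<zeta>\<^sup>2 < \<omega>\<^sup>2"
  proof -
    have z: "\<zeta> * (real ?p + 1) = \<omega>" by (simp add: \<zeta>_def divide_simps)
    have "real ?p * \<zeta>\<^sup>2 < (real ?p + 1)\<^sup>2 * \<zeta>\<^sup>2"
      using \<zeta> by (intro mult_strict_right_mono) (auto simp: power2_eq_square algebra_simps add_pos_nonneg)
    also have "\<dots> = (\<zeta> * (real ?p + 1))\<^sup>2" by (simp only: power_mult_distrib mult.commute)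
    finally show ?thesis unfolding z .
  qed
  \<comment> \<open>The 32: half of (\<zeta>/4)^2 is spent here, the other half on the moment error
    \<open>\<eta>\<close>.\<close>
  have "\<forall>j. \<exists>e. j < ?p \<longrightarrow> vars e \<subseteq> {..<Suc ?n} \<and> sqn \<tau> (evo X e - ys ! j) < \<zeta>\<^sup>2 / 32"
  proof
    fix j
    show "\<exists>e. j < ?p \<longrightarrow> vars e \<subseteq> {..<Suc ?n} \<and> sqn \<tau> (evo X e - ys ! j) < \<zeta>\<^sup>2 / 32"
    proof (cases "j < ?p")
      case True
      have "ys ! j \<in> M" using ys nth_mem[OF True] by blast
      moreover have "M \<subseteq> weak_operator_topology closure_of polys (Suc ?n) X" using subM
        by (simp add: X_def[abs_def])
      moreover have "0 < \<zeta>\<^sup>2 / 32" using \<zeta> by simp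
      ultimately have "\<exists>e. vars e \<subseteq> {..<Suc ?n} \<and> sqn \<tau> (evo X e - ys ! j) < \<zeta>\<^sup>2 / 32"
        by (intro poly_sqn_approx[OF M tr]) (use XM in auto)
      then show ?thesis by simp
    qed simp
  qed
  from choice[OF this] obtain P where P: "\<forall>j. j < ?p \<longrightarrow>
    vars (P j) \<subseteq> {..<Suc ?n} \<and> sqn \<tau> (evo X (P j) - ys ! j) < \<zeta>\<^sup>2 / 32" ..
  have "\<forall>j. \<exists>L. hs_lipschitz 1 (P j) L" using evf_lipschitz[OF zero_le_one] by blast
  from choice[OF this] obtain Lp where Lp: "\<forall>j. hs_lipschitz 1 (P j) (Lp j)" ..
  have Lp0: "0 \<le> Lp j" for j using Lp by (simp add: hs_lipschitz_def)
  define L1 where "L1 = (\<Sum>j<?p. Lp j)"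
  have L1: "0 \<le> L1" "j < ?p \<Longrightarrow> Lp j \<le> L1" for j
    unfolding L1_def by (auto intro: sum_nonneg member_le_sum Lp0)
  \<comment> \<open>The total movement allowed to an auxiliary tuple: half of it for the first
    matrices, through \<open>n\<omega>\<close>, half for the last one.\<close>
  define \<sigma> where "\<sigma> = \<zeta> / (2 * (L1 + 1))"
  have \<sigma>: "0 < \<sigma>" "L1 * \<sigma> \<le> \<zeta> / 2" using \<zeta> L1(1) by (simp_all add: \<sigma>_def field_simps)
  \<comment> \<open>With \<open>\<theta>\<close> equal to \<open>\<kappa>\<close> the last matrix
    moves by 3 \<kappa> + 2 \<delta>, at most 5/12 of \<open>\<sigma>\<close>.\<close>
  define \<kappa> where "\<kappa> = \<sigma> / 12"
  define \<delta> where "\<delta> = min 1 (\<sigma> / 12)"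
  have \<kappa>: "0 < \<kappa>" and \<delta>: "0 < \<delta>" "\<delta> \<le> 1" "\<delta> \<le> \<sigma> / 12" using \<sigma> by (simp_all add: \<kappa>_def \<delta>_def)
  define c0 where "c0 = 4 / \<kappa>\<^sup>2 * (5 + 4 / \<kappa>\<^sup>2)"
  have c0: "0 < c0" using \<kappa> by (simp add: c0_def add_pos_pos)
  \<comment> \<open>The cells then cost at most D/2 in the exponent; the other D/2 is left for the
    covering of \<open>N\<close>.\<close>
  define K where "K = Suc (nat \<lceil>2 * c0 / D\<rceil>)"
  have K: "0 < K" "c0 / real K \<le> D / 2"
  proof -
    have "2 * c0 / D \<le> real K" unfolding K_def by linarith
    then show "c0 / real K \<le> D / 2" using D by (simp add: K_def field_simps)
  qed (simp add: K_def)
  \<comment> \<open>An error \<open>\<mu>\<close> arises in the algebra and another in the matrices,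
    so \<open>near_diagonal_sum\<close> is applied with 2 \<open>\<mu>\<close>.\<close>
  define \<mu> where "\<mu> = 1 / (6 * real K)"
  have \<mu>: "0 < \<mu>" "3 * (2 * \<mu>) * real K \<le> 1" using K by (simp_all add: \<mu>_def)
  have \<delta>2: "0 < \<delta>\<^sup>2 / 32" using \<delta> by simp
  have "0 < (\<delta>\<^sup>2 / 32) / 8 ^ K" using \<delta>2 by simp
  from vw[OF this] obtain v w where v: "v \<in> N" "haar_unitary \<tau> v" and w: "w \<in> N" "haar_unitary \<tau> w"
    and d: "sqn \<tau> (v * u - u * w) < (\<delta>\<^sup>2 / 32) / 8 ^ K" by (elim exE conjE) (rule that)
  have d8: "8 ^ K * sqn \<tau> (v * u - u * w) < \<delta>\<^sup>2 / 32"
    using mult_strict_left_mono[OF d, of "8 ^ K"] by simp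
  have subX: "N \<subseteq> weak_operator_topology closure_of polys ?n X"
    using subN polys_cong[of ?n "(!) xs" X] by (simp add: X_def)
  have XN: "X i \<in> N" if "i < ?n" for i using xsN(1)[OF that] that by (simp add: X_def)
  have Xn: "X ?n = (1/8) *\<^sub>C u" by (simp add: X_def)
  from averaging_polys[OF M tr Nv NM subX XN u(1) Xn v w K(1) \<mu>(1) d8]
  obtain a b where ab: "\<forall>t. vars (a t) \<subseteq> {..<?n} \<and> vars (b t) \<subseteq> {..<?n}"
    and mom: "\<forall>s<K. \<forall>t<K. cmod (\<tau> (evo X (Mul (Adj (a s)) (a t))) - (if s = t then 1 else 0)) < \<mu> \<and>
      cmod (\<tau> (evo X (Mul (Adj (b s)) (b t))) - (if s = t then 1 else 0)) < \<mu>"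
    and e0: "sqn \<tau> (evo X (avgE K a b ?n)) < \<delta>\<^sup>2 / 32"
    by - (drule meta_mp, assumption, elim exE conjE, rule that)
  have ve0: "vars (avgE K a b ?n) \<subseteq> {..<Suc ?n}" by (rule vars_avgE) (use ab in blast)
  obtain L2 where L2: "hs_lipschitz 1 (avgE K a b ?n) L2" using evf_lipschitz[OF zero_le_one] by blast
  have L20: "0 \<le> L2" using L2 by (simp add: hs_lipschitz_def)
  \<comment> \<open>The first bound keeps the radius below 1, the second serves \<open>n2\<close>,
    the third \<open>n1\<close>.\<close>
  define \<omega>1 where "\<omega>1 = min (1/2) (min (\<sigma> / (4 * (real ?n + 1))) (\<delta> / (4 * (real ?n + 1) * (L2 + 1))))"
  have \<omega>1: "0 < \<omega>1" "\<omega>1 < 1" using \<sigma> \<delta> L20 by (auto simp: \<omega>1_def min_less_iff_disj)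
  have n\<omega>: "real ?n * (2 * \<omega>1) \<le> \<sigma> / 2"
  proof -
    have "real ?n * (2 * \<omega>1) \<le> (real ?n + 1) * (2 * (\<sigma> / (4 * (real ?n + 1))))"
      using \<omega>1 by (intro mult_mono) (auto simp: \<omega>1_def)
    also have "\<dots> = \<sigma> / 2" by (simp add: divide_simps)
    finally show ?thesis .
  qed
  have n1: "L2 * (real ?n * (2 * \<omega>1)) \<le> 3/4 * \<delta>"
  proof -
    have "L2 * (real ?n * (2 * \<omega>1)) \<le> (L2 + 1) * ((real ?n + 1) * (2 * (\<delta> / (4 * (real ?n + 1) * (L2
      + 1)))))"
      using \<omega>1 L20 by (intro mult_mono) (auto simp: \<omega>1_def)
    also have "\<dots> = \<delta> / 2"
    proof -
      have "A * (B * (2 * (\<delta> / (4 * B * A)))) = \<delta> / 2" if "A \<noteq> 0" "B \<noteq> 0" for A B :: real using that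
        by simp
      moreover have "L2 + 1 \<noteq> 0" "real ?n + 1 \<noteq> 0" using L20 by linarith+
      ultimately show ?thesis by blast
    qed
    finally show ?thesis using \<delta> by simp
  qed
  have n2: "L1 * (real ?n * (2 * \<omega>1) + (2 * \<kappa> + \<kappa> + 2 * \<delta>)) \<le> \<zeta> / 2"
  proof -
    have "real ?n * (2 * \<omega>1) + (2 * \<kappa> + \<kappa> + 2 * \<delta>) \<le> \<sigma>" using n\<omega> \<delta>(3) \<sigma>(1) by (simp add: \<kappa>_def)
    then have "L1 * (real ?n * (2 * \<omega>1) + (2 * \<kappa> + \<kappa> + 2 * \<delta>)) \<le> L1 * \<sigma>"
      by (rule mult_left_mono) (rule L1)
    then show ?thesis using \<sigma>(2) by simp
  qed
  have "0 < D / 2" using D by simp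
  from K0[OF \<omega>1 this] obtain m0 \<epsilon>0 where \<epsilon>0: "0 < \<epsilon>0" and cov0: "\<forall>\<^sub>F k in sequentially.
      ln (real (orbit_covering_number k (microstates \<tau> 1 xs m0 k \<epsilon>0) \<omega>1)) \<le> D / 2 * (real k)\<^sup>2"
        by (elim exE conjE) (rule that)
  \<comment> \<open>The polynomial minus the generator it approximates; in the joint tuple
    \<open>ys ! j\<close> has index Suc n + j, with n the length of \<open>xs\<close>.\<close>
  define df where "df j = Add (P j) (Scal (-1) (Var (Suc ?n + j)))" for j
  define sq where "sq e = Mul (Adj e) e" for e
  define W where "W = {w :: (nat \<times> bool) list. set w \<subseteq> {..<?n} \<times> UNIV \<and> length w \<le> m0}"
  \<comment> \<open>Words make the first matrices a microstate of \<open>xs\<close>, squares bound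
    Hilbert-Schmidt norms, and the remaining products are the Gram entries for
    \<open>near_diagonal_sum\<close>.\<close>
  define E where "E = wexpr ` W \<union> (sq \<circ> df) ` {..<?p} \<union> {sq (avgE K a b ?n)} \<union>
    (\<lambda>st. Mul (Adj (a (fst st))) (a (snd st))) ` ({..<K} \<times> {..<K}) \<union>
    (\<lambda>st. Mul (Adj (b (fst st))) (b (snd st))) ` ({..<K} \<times> {..<K})"
  have fW: "finite W" unfolding W_def by (rule finite_lists_length_le) simp
  have fE: "finite E" unfolding E_def using fW by simp
  have vdf: "vars (df j) \<subseteq> {..<Suc ?n + ?p}" if "j < ?p" for j
    using P[rule_format, OF that] that by (auto simp: df_def)
  have vab: "vars (a t) \<subseteq> {..<Suc ?n + ?p}" "vars (b t) \<subseteq> {..<Suc ?n + ?p}" for t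
    using ab[rule_format, of t] by auto
  have vE: "vars e \<subseteq> {..<Suc ?n + ?p}" if "e \<in> E" for e
  proof -
    have W: "vars (wexpr w) \<subseteq> {..<Suc ?n + ?p}" if "w \<in> W" for w
    proof -
      have "fst ` set w \<subseteq> {..<?n}" using that unfolding W_def by auto
      then show ?thesis unfolding vars_wexpr by auto
    qed
    have sqv: "vars (sq e) = vars e" for e by (simp add: sq_def)
    have av: "vars (avgE K a b ?n) \<subseteq> {..<Suc ?n + ?p}" by (rule order_trans[OF ve0]) auto
    from that consider "e \<in> wexpr ` W" | "e \<in> (sq \<circ> df) ` {..<?p}" | "e = sq (avgE K a b ?n)"
      | "e \<in> (\<lambda>st. Mul (Adj (a (fst st))) (a (snd st))) ` ({..<K} \<times> {..<K})"
      | "e \<in> (\<lambda>st. Mul (Adj (b (fst st))) (b (snd st))) ` ({..<K} \<times> {..<K})"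
      unfolding E_def by blast
    then show ?thesis
    proof cases
      case 1 then show ?thesis using W by (elim imageE) (simp only:)
    next
      case 2 then show ?thesis using vdf by (elim imageE) (simp add: sqv)
    next
      case 3 then show ?thesis using av by (simp only: sqv)
    next
      case 4 then show ?thesis using vab(1) by (elim imageE) (simp only: vars.simps Un_least)
    next
      case 5 then show ?thesis using vab(2) by (elim imageE) (simp only: vars.simps Un_least)
    qed
  qed
  define \<eta> where "\<eta> = min (min \<epsilon>0 \<mu>) (min (\<zeta>\<^sup>2 / 32) (\<delta>\<^sup>2 / 32))"
  have \<eta>: "0 < \<eta>" "\<eta> \<le> \<epsilon>0" "\<eta> \<le> \<mu>" "\<eta> \<le> \<zeta>\<^sup>2 / 32" "\<eta> \<le> \<delta>\<^sup>2 / 32"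
    using \<epsilon>0 \<mu> \<zeta> \<delta> by (simp_all add: \<eta>_def)
  have "\<exists>s m \<epsilon>. 0 < \<epsilon> \<and> (\<forall>k B. 0 < k \<longrightarrow> mstate \<tau> R ys m k \<epsilon> B \<longrightarrow>
    (\<forall>i<Suc ?n. supp k (evf k B (s i)) \<and> lbd (evf k B (s i)) 1) \<and>
    (\<forall>e\<in>E. cmod (trk k (evf k (\<lambda>i. if i < Suc ?n then evf k B (s i) else B (i - Suc ?n)) e)
      - \<tau> (evo (\<lambda>i. if i < Suc ?n then X i else ys ! (i - Suc ?n)) e)) < \<eta>))"
    by (rule microstate_extension[OF M tr ys subY _ fE vE \<eta>(1)]) (use XM in auto)
  moreover have "(\<lambda>i. if i < Suc ?n then X i else ys ! (i - Suc ?n)) = Y"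
    by (simp add: Y_def fun_eq_iff)
  ultimately have "\<exists>s m \<epsilon>. 0 < \<epsilon> \<and> (\<forall>k B. 0 < k \<longrightarrow> mstate \<tau> R ys m k \<epsilon> B \<longrightarrow>
    (\<forall>i<Suc ?n. supp k (evf k B (s i)) \<and> lbd (evf k B (s i)) 1) \<and>
    (\<forall>e\<in>E. cmod (trk k (evf k (\<lambda>i. if i < Suc ?n then evf k B (s i) else B (i - Suc ?n)) e)
      - \<tau> (evo Y e)) < \<eta>))"
    by (simp only:)
  then obtain s m \<epsilon> where \<epsilon>: "0 < \<epsilon>" and ext: "\<forall>k B. 0 < k \<longrightarrow> mstate \<tau> R ys m k \<epsilon> B \<longrightarrow>
    (\<forall>i<Suc ?n. supp k (evf k B (s i)) \<and> lbd (evf k B (s i)) 1) \<and>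
    (\<forall>e\<in>E. cmod (trk k (evf k (\<lambda>i. if i < Suc ?n then evf k B (s i) else B (i - Suc ?n)) e)
      - \<tau> (evo Y e)) < \<eta>)"
    by (elim exE conjE) (rule that)
  have "ln (real (orbit_covering_number k (microstates \<tau> R ys m k \<epsilon>) \<omega>)) \<le> D * (real k)\<^sup>2"
    if k: "0 < k" and c1: "ln (real (orbit_covering_number k (microstates \<tau> 1 xs m0 k \<epsilon>0) \<omega>1))
      \<le> D / 2 * (real k)\<^sup>2" for k
  proof (cases "microstates \<tau> R ys m k \<epsilon> = {}")
    case True
    then show ?thesis using D by (simp add: orbit_covering_number_def)
  next
    case False
    let ?G = "microstates \<tau> R ys m k \<epsilon>" and ?G1 = "microstates \<tau> 1 xs m0 k \<epsilon>0"
    define FB where "FB B i = (if i < Suc ?n then evf k (\<lambda>i. fm (B ! i)) (s i) else fm (B ! (i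
      - Suc ?n)))" for B i
    have G: "B \<in> mat_tuples k ?p" "mstate \<tau> R ys m k \<epsilon> (\<lambda>i. fm (B ! i))" if "B \<in> ?G" for B
      using that R by (simp_all add: microstates_iff)
    have FB1: "supp k (FB B i)" "lbd (FB B i) 1" if "B \<in> ?G" "i < Suc ?n" for B i
      using ext[rule_format, OF k G(2)[OF that(1)]] that(2) unfolding FB_def by auto
    have FB2: "cmod (trk k (evf k (FB B) e) - \<tau> (evo Y e)) < \<eta>" if "B \<in> ?G" "e \<in> E" for B e
      using ext[rule_format, OF k G(2)[OF that(1)]] that(2) unfolding FB_def[abs_def] by auto
    have FBs: "supp k (FB B i)" if "B \<in> ?G" "i < Suc ?n + ?p" for B i
    proof (cases "i < Suc ?n")
      case False
      then have "supp k (fm (B ! (i - Suc ?n)))" using that(2)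
        by (intro supp_fm mat_tuplesD[OF G(1)[OF that(1)]]) auto
      then show ?thesis using False by (simp add: FB_def)
    qed (rule FB1[OF that(1)])
    have small: "norm (evf k (FB B) e) \<le> c / 4 * sqrt (real k)"
      if B: "B \<in> ?G" and e: "sq e \<in> E" and q: "sqn \<tau> (evo Y e) < c\<^sup>2 / 32" "\<eta> \<le> c\<^sup>2 / 32"
        and c: "0 \<le> c" for B e c
    proof -
      have "vars e \<subseteq> {..<Suc ?n + ?p}" using vE[OF e] by (simp add: sq_def)
      then have s: "supp k (evf k (FB B) e)" by (intro supp_evf FBs[OF B]) auto
      have "Re (trk k (evf k (FB B) (sq e)) - \<tau> (evo Y (sq e))) < \<eta>"
        using FB2[OF B e] complex_Re_le_cmod le_less_trans by blast
      moreover have "Re (\<tau> (evo Y (sq e))) = sqn \<tau> (evo Y e)" by (simp add: sq_def sqn_def)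
      ultimately have "Re (trk k (evf k (FB B) (sq e))) \<le> c\<^sup>2 / 16" using q by simp
      then have "(norm (evf k (FB B) e))\<^sup>2 \<le> real k * (c\<^sup>2 / 16)"
        unfolding norm_sq_trk[OF s] by (intro mult_left_mono) (simp_all add: sq_def)
      also have "\<dots> = (c / 4 * sqrt (real k))\<^sup>2" by (simp add: power_mult_distrib power_divide)
      finally show ?thesis by (rule power2_le_imp_le) (use c in simp)
    qed
    have YX: "evo Y e = evo X e" if "vars e \<subseteq> {..<Suc ?n}" for e
      by (rule ev_cong) (use that in \<open>auto simp: Y_def\<close>)
    have HB: "Re (\<Sum>t<K. \<Sum>s<K. trk k (evf k (FB B) (Mul (Adj (a s)) (a t))) * trk k (evf k (FB B) (Mul (Adj (b s)) (b t)))) \<le> 2 * real K"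
      if B: "B \<in> ?G" for B
    proof (rule near_diagonal_sum[OF K(1) \<mu>(2)])
      fix s t assume st: "s < K" "t < K"
      have E2: "Mul (Adj (a s)) (a t) \<in> E" "Mul (Adj (b s)) (b t) \<in> E" using st unfolding E_def
        by force+
      have v2: "vars (Mul (Adj (a s)) (a t)) \<subseteq> {..<Suc ?n}" "vars (Mul (Adj (b s)) (b t)) \<subseteq> {..<Suc ?n}"
        using ab[rule_format, of s] ab[rule_format, of t] by auto
      have tri: "cmod (x - z) \<le> 2 * \<mu>" if "cmod (x - y) < \<eta>" "cmod (y - z) < \<mu>" for x y z
        using norm_triangle_ineq[of "x - y" "y - z"] that \<eta>(3) by simp
      show "cmod (trk k (evf k (FB B) (Mul (Adj (a s)) (a t))) - (if s = t then 1 else 0)) \<le> 2 * \<mu> \<and>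
        cmod (trk k (evf k (FB B) (Mul (Adj (b s)) (b t))) - (if s = t then 1 else 0)) \<le> 2 * \<mu>"
        using tri[OF FB2[OF B E2(1)]] tri[OF FB2[OF B E2(2)]] mom[rule_format, OF st]
          unfolding YX[OF v2(1)] YX[OF v2(2)] by blast
    qed
    have EB: "norm (evf k (FB B) (avgE K a b ?n)) \<le> \<delta> / 4 * sqrt (real k)" if B: "B \<in> ?G" for B
      by (rule small[OF B]) (use e0 \<eta> \<delta> YX[OF ve0] in \<open>auto simp: E_def\<close>)
    have PB: "norm (evf k (FB B) (P j) - fm (B ! j)) \<le> \<zeta> / 4 * sqrt (real k)" if B: "B \<in> ?G"
      and j: "j < ?p" for B j
    proof -
      have m1: "(-1) *\<^sub>C f = - f" for f :: fmat by (rule fmat_eqI) simp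
      have "norm (evf k (FB B) (df j)) \<le> \<zeta> / 4 * sqrt (real k)"
      proof (rule small[OF B])
        show "sq (df j) \<in> E" using j unfolding E_def by force
        have "evo Y (df j) = evo X (P j) - ys ! j"
          using YX[of "P j"] P[rule_format, OF j] by (simp add: df_def Y_def)
        then show "sqn \<tau> (evo Y (df j)) < \<zeta>\<^sup>2 / 32" using P[rule_format, OF j] by simp
      qed (use \<eta> \<zeta> in auto)
      then show ?thesis by (simp add: df_def m1 FB_def)
    qed
    \<comment> \<open>The part for \<open>xs\<close>, returned to matrices: by \<open>QG\<close> it
      is a microstate of radius 1 whatever \<open>R\<close> is.\<close>
    define Q where "Q B = map (\<lambda>i. mk k (FB B i)) [0..<?n]" for B
    have Qi: "fm (Q B ! i) = FB B i" if "B \<in> ?G" "i < ?n" for B i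
      using that FB1(1)[of B i] by (simp add: Q_def fm_mk)
    have QG: "Q B \<in> ?G1" if B: "B \<in> ?G" for B
      unfolding microstates_iff[OF zero_le_one] mstate_def
    proof (intro conjI allI impI)
      show "Q B \<in> mat_tuples k ?n" by (auto simp: Q_def mat_tuples_def)
      show "supp k (fm (Q B ! i))" "lbd (fm (Q B ! i)) 1" if "i < ?n" for i
        using FB1[OF B, of i] that by (simp_all add: Qi[OF B])
      fix w :: "(nat \<times> bool) list" assume w: "1 \<le> length w \<and> length w \<le> m0 \<and> fst ` set w \<subseteq> {..<?n}"
      then have "w \<in> W" by (force simp: W_def)
      then have wE: "wexpr w \<in> E" unfolding E_def by blast
      have "evf k (\<lambda>i. fm (Q B ! i)) (wexpr w) = evf k (FB B) (wexpr w)"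
        by (rule ev_cong) (use w Qi[OF B] in \<open>auto simp: vars_wexpr\<close>)
      moreover have "evo Y (wexpr w) = evo ((!) xs) (wexpr w)"
        by (rule ev_cong) (use w in \<open>fastforce simp: vars_wexpr Y_def X_def\<close>)
      ultimately show "cmod (trk k (evf k (\<lambda>i. fm (Q B ! i)) (wexpr w))
        - \<tau> (evo ((!) xs) (wexpr w))) < \<epsilon>0"
        using FB2[OF B wE] \<eta>(2) by simp
    qed
    have ne1: "?G1 \<noteq> {}" using False QG by blast
    from microstates_covering_attained[OF k \<omega>1(1) ne1]
    obtain C where C: "C \<subseteq> ?G1" "finite C" "card C = orbit_covering_number k ?G1 \<omega>1"
      "?G1 \<subseteq> (\<Union>B\<in>C. orbit_ball k B \<omega>1)"
      by (elim exE conjE) (rule that)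
    have C0: "1 \<le> card C" using C(2,4) ne1 by (auto simp: Suc_le_eq card_gt_0_iff)
    have cov: "\<exists>c w. c \<in> C \<and> uf k w \<and> (\<forall>i<?n. norm (conjf w (FB B i) - fm (c ! i))
      \<le> \<omega>1 * sqrt (real k))" if B: "B \<in> ?G" for B
    proof -
      obtain c where c: "c \<in> C" "Q B \<in> orbit_ball k c \<omega>1" using C(4) QG[OF B] by blast
      have "c \<in> mat_tuples k ?n" using C(1) c(1) by (auto simp: microstates_def)
      from orbit_ballE[OF c(2) this k] obtain w
        where "uf k w" "\<forall>i<?n. norm (conjf w (fm (Q B ! i)) - fm (c ! i)) \<le> \<omega>1 * sqrt (real k)"
        by (elim exE conjE) (rule that)
      then show ?thesis using c(1) Qi[OF B] by (intro exI[of _ c] exI[of _ w]) auto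
    qed
    define cc where "cc = (real k)\<^sup>2 * (4 / (real K * \<kappa>\<^sup>2) * (5 + 4 / \<kappa>\<^sup>2))"
    have "real (orbit_covering_number k ?G \<omega>) \<le> max 1 (real (card C) * exp cc)"
      unfolding cc_def
    proof (rule covering_step[where FB = FB and P = P and a = a and b = b and n = ?n and p = ?p
      and \<zeta> = \<zeta> and \<delta> = \<delta> and \<rho> = \<omega>1 and La = L1 and Lb = L2])
      show "\<exists>L\<le>L1. hs_lipschitz 1 (P j) L" if "j < ?p" for j using L1(2)[OF that] Lp by blast
      show "vars (P j) \<subseteq> {..<Suc ?n}" if "j < ?p" for j using P that by blast
      show "vars (a t) \<subseteq> {..<?n} \<and> vars (b t) \<subseteq> {..<?n}" for t using ab by blast
      show "supp k (FB B i) \<and> lbd (FB B i) 1" if "B \<in> ?G" "i < Suc ?n" for B i using FB1[OF that]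
        by simp
      show "?G \<subseteq> mat_tuples k ?p" using G(1) by blast
    qed (use k K C cov PB EB HB L1 L2 \<kappa> \<delta> \<omega> \<zeta> \<omega>1 n1 n2 n3 in \<open>simp_all add: less_imp_le\<close>)
    also have "\<dots> = real (card C) * exp cc"
    proof -
      have "0 \<le> cc" unfolding cc_def by simp
      then have "1 * 1 \<le> real (card C) * exp cc" using C0 by (intro mult_mono) auto
      then show ?thesis by simp
    qed
    finally have le: "real (orbit_covering_number k ?G \<omega>) \<le> real (card C) * exp cc" .
    have "cc = (real k)\<^sup>2 * (c0 / real K)" by (simp add: cc_def c0_def)
    also have "\<dots> \<le> (real k)\<^sup>2 * (D / 2)" by (rule mult_left_mono[OF K(2)]) simp
    finally have ccD: "cc \<le> D / 2 * (real k)\<^sup>2" by (simp add: mult.commute)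
    show ?thesis
    \<comment> \<open>For the value 0 the convention \<open>ln 0 = 0\<close> settles the
      claim.\<close>
    proof (cases "orbit_covering_number k ?G \<omega> = 0")
      case False
      then have "ln (real (orbit_covering_number k ?G \<omega>)) \<le> ln (real (card C) * exp cc)"
        using le by (intro ln_mono) auto
      also have "\<dots> = ln (real (card C)) + cc" using C0 by (subst ln_mult) auto
      also have "\<dots> \<le> D / 2 * (real k)\<^sup>2 + D / 2 * (real k)\<^sup>2" using c1 C(3) ccD
        by (intro add_mono) simp_all
      finally show ?thesis by (simp add: field_simps)
    qed (use D in simp)
  qed
  then have "\<forall>\<^sub>F k in sequentially. ln (real (orbit_covering_number k (microstates \<tau> R ys m k \<epsilon>) \<omega>))
    \<le> D * (real k)\<^sup>2"
    using eventually_conj[OF eventually_gt_at_top[of 0] cov0] by (auto elim: eventually_mono)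
  then show ?thesis using \<epsilon> by blast
qed

section \<open>From covering bounds to the orbit dimension\<close>

lemma generated_subset_polys_closure:
  "set zs \<subseteq> weak_operator_topology closure_of polys n X \<Longrightarrow> vN_generated (set zs) = A \<Longrightarrow>
    A \<subseteq> weak_operator_topology closure_of polys n X"
  using vN_generated_least[OF polys_closure_von_neumann] by blast

text \<open>Dividing by a constant does not change the generated algebra, and brings the generators into
  the operator norm ball for which the estimates above are stated.\<close>

lemma small_generators:
  assumes N: "von_neumann_algebra N" and fg: "finitely_generated N"
  obtains xs where "xs \<noteq> []" "vN_generated (set xs) = N" "\<And>x. x \<in> set xs \<Longrightarrow> x \<in> N \<and> opb x (1/8)"
proof -
  obtain xs0 where xs0: "vN_generated (set xs0) = N" using fg unfolding finitely_generated_def by blast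
  obtain K where K: "0 \<le> K" "\<And>i. i < length (1 # xs0) \<Longrightarrow> opb ((1 # xs0) ! i) K"
    using opb_common[of "length (1 # xs0)" "(!) (1 # xs0)"] by blast
  define d where "d = 1 / (8 * (K + 1))"
  have d: "0 < d" "d * K \<le> 1/8" using K(1) by (simp_all add: d_def field_simps)
  define c :: complex where "c = of_real d"
  \<comment> \<open>The unit in front makes the list nonempty, as \<open>upper_orbit_dim\<close>
    demands, without changing the generated algebra.\<close>
  define xs where "xs = map (\<lambda>x. c *\<^sub>C x) (1 # xs0)"
  have c: "c \<noteq> 0" "cmod c * K \<le> 1/8" using d by (simp_all add: c_def)
  have gen: "set xs \<subseteq> A \<longleftrightarrow> set xs0 \<subseteq> A" if A: "von_neumann_algebra A" for A
  proof -
    have cl: "1 \<in> A" "\<And>d x. x \<in> A \<Longrightarrow> d *\<^sub>C x \<in> A" using A unfolding von_neumann_algebra_def by auto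
    have "(1 / c) *\<^sub>C c *\<^sub>C x = x" for x :: "'a bop"
      using c(1) by transfer (simp add: scaleC_scaleC scaleC_of_real[of 1, simplified])
    then have "c *\<^sub>C x \<in> A \<longleftrightarrow> x \<in> A" for x using cl(2) by metis
    then show ?thesis using cl(1) by (auto simp: xs_def)
  qed
  have "vN_generated (set xs) = vN_generated (set xs0)"
    unfolding vN_generated_def by (intro arg_cong[where f = Inter] Collect_cong) (use gen in blast)
  then have vx: "vN_generated (set xs) = N" using xs0 by simp
  show ?thesis
  proof (rule that[OF _ vx])
    fix x assume x: "x \<in> set xs"
    then obtain y where y: "y \<in> set (1 # xs0)" "x = c *\<^sub>C y" unfolding xs_def set_map by (elim imageE)
    obtain i where "i < length (1 # xs0)" "y = (1 # xs0) ! i" using y(1) by (metis in_set_conv_nth)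
    then have "opb y K" using K(2) by blast
    then have "opb x (cmod c * K)" unfolding y(2) by (rule opb_scaleC)
    then have "opb x (1/8)" using c(2) by (rule opb_mono)
    then show "x \<in> N \<and> opb x (1/8)" using x subset_vN_generated[of "set xs"] vx by blast
  qed (simp add: xs_def)
qed

lemma ln_nat_nonneg: "0 \<le> ln (real n)"
  by (cases "n = 0") simp_all

lemma orbit_dim_at_nonneg: "0 < \<omega> \<Longrightarrow> \<omega> < 1 \<Longrightarrow> 0 \<le> orbit_dim_at \<tau> xs \<omega> R"
  unfolding orbit_dim_at_def
proof (rule INF_greatest, clarify)
  fix m :: nat and \<epsilon> :: real assume \<omega>: "0 < \<omega>" "\<omega> < 1"
  have "0 \<le> ln (real (orbit_covering_number k (microstates \<tau> R xs m k \<epsilon>) \<omega>)) / (- ((real k)\<^sup>2 * ln \<omega>))" for k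
    using ln_nat_nonneg \<omega> by (intro divide_nonneg_nonneg) (auto simp: mult_nonneg_nonpos)
  then show "0 \<le> limsup (\<lambda>k. ereal (ln (real (orbit_covering_number k (microstates \<tau> R xs m k \<epsilon>) \<omega>)) / (- ((real k)\<^sup>2 * ln \<omega>))))"
    by (intro le_Limsup always_eventually allI) simp_all
qed

text \<open>An infimum below a positive number is undercut by a single pair (m, \<epsilon>). The
  threshold D / (- ln \<omega>) cancels the normalisation in the definition.\<close>

lemma covering_bound_if_orbit_dim_nonpos:
  assumes d: "orbit_dim_at \<tau> xs \<omega> R \<le> 0" and \<omega>: "0 < \<omega>" "\<omega> < 1" and D: "0 < D"
  shows "\<exists>m \<epsilon>. 0 < \<epsilon> \<and> (\<forall>\<^sub>F k in sequentially.
      ln (real (orbit_covering_number k (microstates \<tau> R xs m k \<epsilon>) \<omega>)) \<le> D * (real k)\<^sup>2)"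
proof -
  have ln: "0 < - ln \<omega>" using \<omega> by simp
  have "orbit_dim_at \<tau> xs \<omega> R < ereal (D / (- ln \<omega>))"
    using d D ln by (intro le_less_trans[OF d]) (simp add: divide_pos_neg divide_less_0_iff)
  then obtain q where q: "q \<in> UNIV \<times> {0<..}"
    "(case q of (m, \<epsilon>) \<Rightarrow> limsup (\<lambda>k. ereal (ln (real (orbit_covering_number k (microstates \<tau> R xs m k \<epsilon>) \<omega>))
        / (- ((real k)\<^sup>2 * ln \<omega>))))) < ereal (D / (- ln \<omega>))"
    unfolding orbit_dim_at_def INF_less_iff by (elim bexE)
  obtain m \<epsilon> where me: "q = (m, \<epsilon>)" by (cases q)
  have \<epsilon>: "0 < \<epsilon>" using q(1) me by simp
  have "\<forall>\<^sub>F k in sequentially. ereal (ln (real (orbit_covering_number k (microstates \<tau> R xs m k \<epsilon>) \<omega>))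
        / (- ((real k)\<^sup>2 * ln \<omega>))) < ereal (D / (- ln \<omega>))"
    by (rule Limsup_lessD) (use q(2) me in simp)
  then have "\<forall>\<^sub>F k in sequentially.
      ln (real (orbit_covering_number k (microstates \<tau> R xs m k \<epsilon>) \<omega>)) \<le> D * (real k)\<^sup>2"
    using eventually_gt_at_top[of 0]
  proof eventually_elim
    case (elim k)
    have "A \<le> D * K" if "A / (- (K * l)) < D / (- l)" "0 < K" "0 < - l" for A K l :: real
    proof -
      have p: "0 < - (K * l)" using mult_pos_pos[OF that(2,3)] by simp
      have "A < D / (- l) * (- (K * l))" using that(1) p by (simp only: pos_divide_less_eq)
      also have "\<dots> = D * K" using that by simp
      finally show ?thesis by simp
    qed
    from this[of _ "(real k)\<^sup>2" "ln \<omega>"] show ?case using elim ln by simp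
  qed
  then show ?thesis using \<epsilon> by blast
qed

lemma orbit_dim_nonpos_if_covering_bound:
  assumes \<omega>: "0 < \<omega>" "\<omega> < 1"
    and b: "\<And>D. 0 < D \<Longrightarrow> \<exists>m \<epsilon>. 0 < \<epsilon> \<and> (\<forall>\<^sub>F k in sequentially.
      ln (real (orbit_covering_number k (microstates \<tau> R xs m k \<epsilon>) \<omega>)) \<le> D * (real k)\<^sup>2)"
  shows "orbit_dim_at \<tau> xs \<omega> R \<le> 0"
proof (rule ereal_le_epsilon2)
  fix e :: real assume e: "0 < e"
  have ln: "0 < - ln \<omega>" using \<omega> by simp
  from b[OF mult_pos_pos[OF e ln]] obtain m \<epsilon> where \<epsilon>: "0 < \<epsilon>" and ev: "\<forall>\<^sub>F k in sequentially.
      ln (real (orbit_covering_number k (microstates \<tau> R xs m k \<epsilon>) \<omega>)) \<le> e * - ln \<omega> * (real k)\<^sup>2"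
    by (elim exE conjE) (rule that)
  have "\<forall>\<^sub>F k in sequentially. ereal (ln (real (orbit_covering_number k (microstates \<tau> R xs m k \<epsilon>) \<omega>))
        / (- ((real k)\<^sup>2 * ln \<omega>))) \<le> ereal e"
    using ev eventually_gt_at_top[of 0]
  proof eventually_elim
    case (elim k)
    have "A / (- (K * l)) \<le> e" if "A \<le> e * - l * K" "0 < K" "0 < - l" for A K l :: real
    proof -
      have p: "0 < - (K * l)" using mult_pos_pos[OF that(2,3)] by simp
      have "A \<le> e * (- (K * l))" using that(1) by (simp add: mult_ac)
      then show ?thesis using p by (simp only: pos_divide_le_eq)
    qed
    from this[of _ "ln \<omega>" "(real k)\<^sup>2"] show ?case using elim ln by simp
  qed
  then have "limsup (\<lambda>k. ereal (ln (real (orbit_covering_number k (microstates \<tau> R xs m k \<epsilon>) \<omega>))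
        / (- ((real k)\<^sup>2 * ln \<omega>)))) \<le> ereal e" by (rule Limsup_bounded)
  then show "orbit_dim_at \<tau> xs \<omega> R \<le> 0 + ereal e"
    unfolding orbit_dim_at_def by (intro INF_lower2[of "(m, \<epsilon>)"]) (use \<epsilon> in simp_all)
qed

theorem theorem4:
  fixes M N :: "'h::complex_hilbert bop set"
    and \<tau> :: "'h bop \<Rightarrow> complex"
    and u :: "'h bop"
  assumes "von_neumann_algebra M" and "tracial_state M \<tau>" and "diffuse M"
    and "von_neumann_algebra N" and "N \<subseteq> M" and "diffuse N"
    and "u \<in> M" and "unitary u"
    and "finitely_generated N" and "upper_orbit_dim N \<tau> = 0"
    and "vN_generated (insert u N) = M"
  shows "((\<exists>v w :: nat \<Rightarrow> 'h bop.
            (\<forall>n. v n \<in> N \<and> haar_unitary \<tau> (v n)) \<and>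
            (\<forall>n. w n \<in> N \<and> haar_unitary \<tau> (w n)) \<and>
            (\<lambda>n. norm2 \<tau> (v n * u - u * w n)) \<longlonglongrightarrow> 0)
          \<longrightarrow> upper_orbit_dim M \<tau> = 0) \<and>
         ((\<exists>v\<in>N. \<exists>w\<in>N. haar_unitary \<tau> v \<and> haar_unitary \<tau> w \<and> v * u = u * w)
          \<longrightarrow> upper_orbit_dim M \<tau> = 0)"
proof -
  note M = assms(1) and tr = assms(2) and Nv = assms(4) and NM = assms(5) and u = assms(7,8)
  obtain xs where xs: "xs \<noteq> []" "vN_generated (set xs) = N" "\<And>x. x \<in> set xs \<Longrightarrow> x \<in> N \<and> opb x (1/8)"
    by (rule small_generators[OF Nv assms(9)]) (rule that)
  define X where "X i = (if i < length xs then xs ! i else (1/8) *\<^sub>C u)" for i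
  let ?MC = "weak_operator_topology closure_of polys (Suc (length xs)) X"
  have MC: "von_neumann_algebra ?MC" by (rule polys_closure_von_neumann)
  have X: "X i \<in> ?MC" if "i < Suc (length xs)" for i
    by (rule vars_in_polys_closure[of i "Suc (length xs)" X, OF that])
  have NMC: "N \<subseteq> ?MC"
  proof (rule generated_subset_polys_closure[OF _ xs(2)], rule subsetI)
    fix x assume "x \<in> set xs"
    then obtain i where "i < length xs" "x = xs ! i" by (metis in_set_conv_nth)
    then show "x \<in> ?MC" using X[of i] by (simp add: X_def)
  qed
  have uMC: "u \<in> ?MC"
  proof -
    have "X (length xs) \<in> ?MC" by (rule X) simp
    then have "8 *\<^sub>C X (length xs) \<in> ?MC" using MC unfolding von_neumann_algebra_def by blast
    moreover have "8 *\<^sub>C (1/8) *\<^sub>C u = u"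
      by transfer (simp add: scaleC_scaleC scaleC_of_real[of 1, simplified])
    ultimately show ?thesis by (simp add: X_def)
  qed
  have subM: "M \<subseteq> weak_operator_topology closure_of polys (Suc (length xs)) (\<lambda>i. if i
    < length xs then xs ! i else (1/8) *\<^sub>C u)"
    using vN_generated_least[OF MC, of "insert u N"] uMC NMC assms(11) unfolding X_def[abs_def] by simp
  have list_sub: "A \<subseteq> weak_operator_topology closure_of polys (length zs) ((!) zs)" if "vN_generated (set zs) = A" for A and zs :: "'h bop list"
  proof (rule generated_subset_polys_closure[OF _ that], rule subsetI)
    fix x assume "x \<in> set zs"
    then obtain i where "i < length zs" "x = zs ! i" by (metis in_set_conv_nth)
    then show "x \<in> weak_operator_topology closure_of polys (length zs) ((!) zs)"
      using vars_in_polys_closure[of i "length zs" "(!) zs"] by simp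
  qed
  have K0: "\<exists>m \<epsilon>. 0 < \<epsilon> \<and> (\<forall>\<^sub>F k in sequentially.
      ln (real (orbit_covering_number k (microstates \<tau> 1 xs m k \<epsilon>) \<omega>)) \<le> D * (real k)\<^sup>2)"
    if "0 < \<omega>" "\<omega> < 1" "0 < D" for \<omega> D
  proof (rule covering_bound_if_orbit_dim_nonpos[OF _ that])
    have "orbit_dim_at \<tau> xs \<omega> 1 \<le> upper_orbit_dim_tuple \<tau> xs"
      unfolding upper_orbit_dim_tuple_def using that by (intro SUP_upper2[of \<omega>] SUP_upper2[of 1]) auto
    also have "\<dots> \<le> upper_orbit_dim N \<tau>" unfolding upper_orbit_dim_def
      by (rule SUP_upper) (use xs in simp)
    finally show "orbit_dim_at \<tau> xs \<omega> 1 \<le> 0" using assms(10) by simp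
  qed
  \<comment> \<open>A supremum over generating tuples is nonnegative only if there is such a tuple;
    \<open>xs @ [u]\<close> is one.\<close>
  have "0 \<le> upper_orbit_dim M \<tau>"
  proof -
    have "vN_generated (set (xs @ [u])) = M"
    proof
      have "set (xs @ [u]) \<subseteq> M" using xs(3) NM u by auto
      then show "vN_generated (set (xs @ [u])) \<subseteq> M" by (rule vN_generated_least[OF M])
      have "M \<subseteq> A" if A: "von_neumann_algebra A" "set (xs @ [u]) \<subseteq> A" for A
      proof -
        have "N \<subseteq> A" using vN_generated_least[OF A(1), of "set xs"] A(2) xs(2) by simp
        then show ?thesis using vN_generated_least[OF A(1), of "insert u N"] A(2) assms(11) by simp
      qed
      then show "M \<subseteq> vN_generated (set (xs @ [u]))" unfolding vN_generated_def by blast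
    qed
    then have "upper_orbit_dim_tuple \<tau> (xs @ [u]) \<le> upper_orbit_dim M \<tau>"
      unfolding upper_orbit_dim_def by (intro SUP_upper) simp
    moreover have "orbit_dim_at \<tau> (xs @ [u]) (1/2) 1 \<le> upper_orbit_dim_tuple \<tau> (xs @ [u])"
      unfolding upper_orbit_dim_tuple_def by (intro SUP_upper2[of "1/2"] SUP_upper2[of 1]) auto
    moreover have "0 \<le> orbit_dim_at \<tau> (xs @ [u]) (1/2) 1" by (rule orbit_dim_at_nonneg) simp_all
    ultimately show ?thesis by order
  qed
  moreover have "upper_orbit_dim M \<tau> \<le> 0"
    if vw: "\<And>\<eta>. 0 < \<eta> \<Longrightarrow> \<exists>v w. v \<in> N \<and> w \<in> N \<and> haar_unitary \<tau> v \<and> haar_unitary \<tau> w \<and>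
      sqn \<tau> (v * u - u * w) < \<eta>"
    unfolding upper_orbit_dim_def upper_orbit_dim_tuple_def
  proof (intro SUP_least)
    fix ys :: "'h bop list" and \<omega> R :: real
    assume "ys \<in> {ys. ys \<noteq> [] \<and> vN_generated (set ys) = M}" and \<omega>: "\<omega> \<in> {0<..<1}" and R: "R \<in> {0<..}"
    then have ys: "vN_generated (set ys) = M" by simp
    have ysM: "set ys \<subseteq> M" using subset_vN_generated[of "set ys"] ys by simp
    show "orbit_dim_at \<tau> ys \<omega> R \<le> 0"
    proof (rule orbit_dim_nonpos_if_covering_bound)
      fix D :: real assume D: "0 < D"
      show "\<exists>m \<epsilon>. 0 < \<epsilon> \<and> (\<forall>\<^sub>F k in sequentially.
          ln (real (orbit_covering_number k (microstates \<tau> R ys m k \<epsilon>) \<omega>)) \<le> D * (real k)\<^sup>2)"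
        by (rule orbit_covering_estimate[OF M tr Nv NM xs(3) list_sub[OF xs(2)] u subM ysM list_sub[OF ys] K0 vw _ _ D])
          (use \<omega> R in auto)
    qed (use \<omega> in auto)
  qed
  \<comment> \<open>Both claims reduce to this criterion: a sequence supplies the pairs for each
    precision, and an exact intertwining serves all precisions at once.\<close>
  ultimately have zero: "upper_orbit_dim M \<tau> = 0"
    if "\<And>\<eta>. 0 < \<eta> \<Longrightarrow> \<exists>v w. v \<in> N \<and> w \<in> N \<and> haar_unitary \<tau> v \<and> haar_unitary \<tau> w \<and>
      sqn \<tau> (v * u - u * w) < \<eta>"
    using that by (intro antisym) blast+
  have n2: "norm2 \<tau> x = sqrt (sqn \<tau> x)" for x by (simp add: norm2_def sqn_def)
  have "upper_orbit_dim M \<tau> = 0"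
    if vw: "\<And>n. v n \<in> N \<and> haar_unitary \<tau> (v n)" "\<And>n. w n \<in> N \<and> haar_unitary \<tau> (w n)"
      and lim: "(\<lambda>n. norm2 \<tau> (v n * u - u * w n)) \<longlonglongrightarrow> 0" for v w :: "nat \<Rightarrow> 'h bop"
  proof (rule zero)
    fix \<eta> :: real assume "0 < \<eta>"
    then have "\<forall>\<^sub>F n in sequentially. norm2 \<tau> (v n * u - u * w n) < sqrt \<eta>"
      by (intro order_tendstoD(2)[OF lim]) simp
    then obtain n where "norm2 \<tau> (v n * u - u * w n) < sqrt \<eta>" by (auto simp: eventually_sequentially)
    then have "sqn \<tau> (v n * u - u * w n) < \<eta>" by (simp add: n2)
    then show "\<exists>v w. v \<in> N \<and> w \<in> N \<and> haar_unitary \<tau> v \<and> haar_unitary \<tau> w \<and> sqn \<tau> (v * u - u * w) < \<eta>"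
      using vw by (intro exI[of _ "v n"] exI[of _ "w n"]) simp
  qed
  moreover have "upper_orbit_dim M \<tau> = 0"
    if vw: "v \<in> N" "w \<in> N" "haar_unitary \<tau> v" "haar_unitary \<tau> w" "v * u = u * w" for v w
  proof (rule zero)
    fix \<eta> :: real assume \<eta>: "0 < \<eta>"
    have "1 \<in> M" using M unfolding von_neumann_algebra_def by simp
    then have "\<tau> (0 *\<^sub>C 1) = 0 * \<tau> 1" using tr unfolding tracial_state_def by blast
    moreover have "0 *\<^sub>C (1 :: 'h bop) = 0" by transfer (simp add: scaleC_of_real[of 0, simplified])
    ultimately have "sqn \<tau> 0 = 0" by (simp add: sqn_def)
    then show "\<exists>v w. v \<in> N \<and> w \<in> N \<and> haar_unitary \<tau> v \<and> haar_unitary \<tau> w \<and> sqn \<tau> (v * u - u * w) < \<eta>"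
      using vw \<eta> by (intro exI[of _ v] exI[of _ w]) simp
  qed
  ultimately show ?thesis by blast
qed

end
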